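(* Let $R$ be a commutative ring with unit, $\mathcal{A}$ a homologically connective dg category over $R$, $\mathcal{B}$ a cofibrant dg category, and $F_0:\mathcal{B}\to\mathsf{H}_0(\mathcal{A})=\mathbb{P}_0(\mathcal{A})$ a dg functor. Starting from $F_0$, construct inductively dg functors $F_n:\mathcal{B}\to\mathbb{P}_n(\mathcal{A})$, where $F_{n+1}$ is a lift of $F_n$ along $\mathbb{P}_{n+1}(\mathcal{A})\to\mathbb{P}_n(\mathcal{A})$, the process stopping at stage $n$ only if $F_n$ admits no such lift. If at each stage of this process the obstruction class $\omega_n(F_n)$ vanishes (i.e. the family $\{\omega_n(F_n)\}_{n\geq 0}$ of obstruction classes vanishes), then there exists a lift $F:\mathcal{B}\to\mathcal{A}$ of $F_0$. Here, if $\mathcal{A}$ is positively graded, a lift of $F_0$ is a dg functor $F:\mathcal{B}\to\mathcal{A}$ whose composite with the projection $\tau_{\leq 0}:\mathcal{A}\to\mathsf{H}_0(\mathcal{A})$ equals $F_0$; for general homologically connective $\mathcal{A}$, it is a dg functor $F:\mathcal{B}\to\mathcal{A}$ that factors as $\mathcal{B}\stackrel{F'}{\to}\tau_{\geq 0}(\mathcal{A})\to\mathcal{A}$ with the composite of $F'$ and $\tau_{\leq 0}:\tau_{\geq 0}(\mathcal{A})\to\mathsf{H}_0(\mathcal{A})$ equal to $F_0$.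
   Context: Complexes are complexes of $R$-modules with homological grading; $Ch$ is their category. $\mathrm{dgcat}$ is the category of small dg categories over $R$, with the Quillen model structure whose weak equivalences are the quasi-equivalences (dg functors $F$ with all $F(x,y)$ quasi-isomorphisms and $\mathsf{H}_0(F)$ an equivalence of categories) and whose fibrations are the dg functors $F:\mathcal{A}\to\mathcal{B}$ such that (F1) all $F(x,y)$ are degreewise surjective and (F2) for every object $a_1\in\mathcal{A}$ and every morphism $v\in\mathcal{B}(F(a_1),b)$ that becomes invertible in $\mathsf{H}_0(\mathcal{B})$ there is a morphism $u\in\mathcal{A}(a_1,a_2)$ with $F(u)=v$ that becomes invertible in $\mathsf{H}_0(\mathcal{A})$. Cofibrant means cofibrant in this model structure. For $X\in\mathrm{dgcat}$, $\mathrm{dgcat}\downarrow X$ is the category of objects over $X$ with the induced model structure. $\mathcal{A}$ is homologically connective if $\mathsf{H}_i(\mathcal{A}(x,y))=0$ for all $x,y$ and $i<0$, and positively graded if $\mathcal{A}(x,y)_i=0$ for all $x,y$ and $i<0$. All constructions below are defined for positively graded $\mathcal{A}$; for a homologically connective $\mathcal{A}$ they are applied to $\tau_{\geq 0}(\mathcal{A})$, the positively graded dg category obtained by the intelligent truncation (degree $0$ cycles in degree $0$) of each complex of morphisms, which comes with a natural quasi-equivalence $\tau_{\geq 0}(\mathcal{A})\to\mathcal{A}$ that is the identity on objects. So let $\mathcal{A}$ be positively graded. Small Postnikov sections: $\mathbb{P}_n(\mathcal{A})=\tau_{\leq n}(\mathcal{A})$ has the same objects as $\mathcal{A}$ and each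 complex $M=\mathcal{A}(x,y)$ is replaced by $\tau_{\leq n}(M)$, equal to $M_i$ in degrees $i<n$, $M_n/\mathrm{Im}(M_{n+1})$ in degree $n$, and $0$ in degrees $>n$. In particular $\mathbb{P}_0(\mathcal{A})=\mathsf{H}_0(\mathcal{A})$. There are natural projections $\mathcal{A}\to\mathbb{P}_n(\mathcal{A})$ and $\mathbb{P}_{n+1}(\mathcal{A})\to\mathbb{P}_n(\mathcal{A})$. Big Postnikov sections: for $m\in\mathbb{Z}$ let $S_m$ be the complex $R$ concentrated in degree $m$, with $\mathbf{1}_m\in S_m$ the unit of $R$, and $D_{m+1}$ the mapping cone of the identity of $S_m$. $\mathcal{C}(m)$ is the dg category with objects $1,2$, $\mathcal{C}(m)(1,1)=\mathcal{C}(m)(2,2)=R$, $\mathcal{C}(m)(2,1)=0$, $\mathcal{C}(m)(1,2)=S_m$; $\mathcal{D}(m+1)$ is the dg category with objects $3,4$, endomorphisms $R$, $\mathcal{D}(m+1)(4,3)=0$, $\mathcal{D}(m+1)(3,4)=D_{m+1}$. $S(m):\mathcal{C}(m)\to\mathcal{D}(m+1)$ sends $1\mapsto 3$, $2\mapsto 4$ and $S_m\to D_{m+1}$ by the identity of $R$ in degree $m$. Set $P_n(\mathcal{A})^0=\mathcal{A}$, let $P_n(\mathcal{A})^{i+1}$ be the pushout of $P_n(\mathcal{A})^i$ along $\coprod_{m>n}\coprod_{T:\mathcal{C}(m)\to P_n(\mathcal{A})^i}S(m)$ (over all $m>n$ and all dg functors $T$), and $P_n(\mathcal{A})=\mathrm{colim}_i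 P_n(\mathcal{A})^i$. The dg functor $M_n:P_n(\mathcal{A})\to\mathbb{P}_n(\mathcal{A})$ is the identity on objects, is the natural projection on $\mathcal{A}$, and sends every freely adjoined bounding chain to $0$; it is a trivial fibration. Square zero extension: for a small dg category $\mathcal{D}$ and a $\mathcal{D}$-$\mathcal{D}$-bimodule $N$ (a dg functor $\mathcal{D}^{op}\otimes\mathcal{D}\to Ch$), $\mathcal{D}\ltimes N$ has the objects of $\mathcal{D}$, $(\mathcal{D}\ltimes N)(x,y)=\mathcal{D}(x,y)\oplus N(x,y)$, and composition given by that of $\mathcal{D}$, the bimodule structure, and zero on pairs of elements of $N$. There are the inclusion $\mathcal{D}\to\mathcal{D}\ltimes N$ and the projection $\mathcal{D}\ltimes N\to\mathcal{D}$. The $\mathbb{P}_n(\mathcal{A})$-bimodule $\mathsf{H}_{n+1}(\mathcal{A})[n+2]$ sends $(x,y)$ to the $R$-module $\mathsf{H}_{n+1}(\mathcal{A}(x,y))$ placed in degree $n+2$, with the natural $\mathsf{H}_0(\mathcal{A})$-bimodule structure restricted along $\mathbb{P}_n(\mathcal{A})\to\mathsf{H}_0(\mathcal{A})$. The dg functor $\gamma_n:P_n(\mathcal{A})\to\mathbb{P}_n(\mathcal{A})\ltimes\mathsf{H}_{n+1}(\mathcal{A})[n+2]$ is the colimit of dg functors $\gamma_n^i$ on $P_n(\mathcal{A})^i$, where $\gamma_n^0$ is $\mathcal{A}\to\mathbb{P}_n(\mathcal{A})$ followed by the inclusion, and $\gamma_n^{i+1}$ extends $\gamma_n^i$ as follows: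 for $T:\mathcal{C}(m)\to P_n(\mathcal{A})^i$, if $m>n+1$ the adjoined bounding chain of $T(\mathbf{1}_m)$ is sent to $0$; if $m=n+1$, then since $\mathcal{A}(T(1),T(2))_j\to P_n(\mathcal{A})^i(T(1),T(2))_j$ is an isomorphism for $j\leq n+1$, the cycle $T(\mathbf{1}_{n+1})$ is a cycle of $\mathcal{A}(T(1),T(2))$, and the adjoined bounding chain is sent to its homology class in $\mathsf{H}_{n+1}(\mathcal{A}(T(1),T(2)))$, in degree $n+2$. The composite of $\gamma_n$ with the projection to $\mathbb{P}_n(\mathcal{A})$ is $M_n$. Obstruction classes: for a dg functor $G:\mathcal{B}\to P_n(\mathcal{A})$, the obstruction class $\omega_n(G)$ is the image of $\gamma_n\circ G$ in $\mathsf{Ho}(\mathrm{dgcat}\downarrow\mathbb{P}_n(\mathcal{A}))$, where $\mathcal{B}$ is over $\mathbb{P}_n(\mathcal{A})$ via $M_n\circ G$ and the square zero extension via the projection. It vanishes if it factors (in $\mathsf{Ho}(\mathrm{dgcat}\downarrow\mathbb{P}_n(\mathcal{A}))$) through the canonical inclusion $\mathbb{P}_n(\mathcal{A})\to\mathbb{P}_n(\mathcal{A})\ltimes\mathsf{H}_{n+1}(\mathcal{A})[n+2]$. For a dg functor $F_n:\mathcal{B}\to\mathbb{P}_n(\mathcal{A})$ with $\mathcal{B}$ cofibrant, choose $\widetilde{F_n}:\mathcal{B}\to P_n(\mathcal{A})$ with $M_n\circ\widetilde{F_n}=F_n$ and set $\omega_n(F_n):=\omega_n(\widetilde{F_n})$;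 whether it vanishes does not depend on the choice of $\widetilde{F_n}$. *)

theory Defs
  imports "HOL-Algebra.Module" "HOL-Algebra.AbelCoset" "HOL-Library.Extended_Nat"
begin

section \<open>Smallness\<close>

text \<open>
  Isabelle/HOL has no quantification over types inside a formula, so ``small'' is rendered by a
  fixed universe type: the objects and the homogeneous morphisms of a dg category are elements
  of one type \<open>'u\<close>, and every notion that refers to all small dg categories (lifting properties,
  universal properties, the homotopy category) ranges over the dg categories on that type.
  The concrete universe below contains the scalars, an arbitrary supply \<open>'a\<close> of atoms and
  is closed under pairing.  Its cardinality is an infinite cardinal that is at least that of the
  carrier of \<open>R\<close>, so the usual small object arguments (cofibrant replacements, pushouts along
  small sets of cells, path objects) stay inside it, and since \<open>'a\<close> is arbitrary every small dg
  category over \<open>R\<close> has an isomorphic copy in such a universe.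
\<close>

datatype ('r, 'a) univ =
    Scal (unscal: 'r)
  | Atom 'a
  | Num nat
  | UPair (ufst: "('r, 'a) univ") (usnd: "('r, 'a) univ")


section \<open>Modules and complexes\<close>

definition linear_map ::
    "'r ring \<Rightarrow> ('r, 'u) module \<Rightarrow> ('r, 'v) module \<Rightarrow> ('u \<Rightarrow> 'v) \<Rightarrow> bool" where
  "linear_map R M N f \<longleftrightarrow>
     f \<in> carrier M \<rightarrow> carrier N \<and>
     (\<forall>x\<in>carrier M. \<forall>y\<in>carrier M. f (x \<oplus>\<^bsub>M\<^esub> y) = f x \<oplus>\<^bsub>N\<^esub> f y) \<and>
     (\<forall>r\<in>carrier R. \<forall>x\<in>carrier M. f (r \<odot>\<^bsub>M\<^esub> x) = r \<odot>\<^bsub>N\<^esub> f x)"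

definition zero_module :: "('r, 'u) module \<Rightarrow> ('r, 'u) module" where
  "zero_module M = M\<lparr>carrier := {\<zero>\<^bsub>M\<^esub>}\<rparr>"

text \<open>
  The quotient of \<open>M\<close> by a submodule \<open>N\<close>.  In order to stay in the same type, a coset is
  represented by a chosen element of it; \<open>quot_class M N x\<close> is the element that
  represents the coset of \<open>x\<close>, and it depends on that coset only.
\<close>

definition quot_class :: "('r, 'u) module \<Rightarrow> 'u set \<Rightarrow> 'u \<Rightarrow> 'u" where
  "quot_class M N x = (SOME y. y \<in> N +>\<^bsub>M\<^esub> x)"

definition quot_module :: "('r, 'u) module \<Rightarrow> 'u set \<Rightarrow> ('r, 'u) module" where
  "quot_module M N = M\<lparr>carrier := quot_class M N ` carrier M,
     zero := quot_class M N \<zero>\<^bsub>M\<^esub>,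
     add := (\<lambda>x y. quot_class M N (x \<oplus>\<^bsub>M\<^esub> y)),
     smult := (\<lambda>r x. quot_class M N (r \<odot>\<^bsub>M\<^esub> x))\<rparr>"

text \<open>Homological grading: \<open>Dif M i\<close> goes from degree \<open>i\<close> to degree \<open>i - 1\<close>.\<close>

record ('r, 'u) complex =
  Gr :: "int \<Rightarrow> ('r, 'u) module"
  Dif :: "int \<Rightarrow> 'u \<Rightarrow> 'u"

definition chain_complex :: "'r ring \<Rightarrow> ('r, 'u) complex \<Rightarrow> bool" where
  "chain_complex R M \<longleftrightarrow>
     (\<forall>i. Module.module R (Gr M i)) \<and>
     (\<forall>i. linear_map R (Gr M i) (Gr M (i - 1)) (Dif M i)) \<and>
     (\<forall>i. \<forall>x\<in>carrier (Gr M i). Dif M (i - 1) (Dif M i x) = \<zero>\<^bsub>Gr M (i - 2)\<^esub>)"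

definition cycles :: "('r, 'u) complex \<Rightarrow> int \<Rightarrow> 'u set" where
  "cycles M i = {z \<in> carrier (Gr M i). Dif M i z = \<zero>\<^bsub>Gr M (i - 1)\<^esub>}"

definition boundaries :: "('r, 'u) complex \<Rightarrow> int \<Rightarrow> 'u set" where
  "boundaries M i = Dif M (i + 1) ` carrier (Gr M (i + 1))"

definition hclass :: "('r, 'u) complex \<Rightarrow> int \<Rightarrow> 'u \<Rightarrow> 'u" where
  "hclass M i = quot_class (Gr M i) (boundaries M i)"

definition homology :: "('r, 'u) complex \<Rightarrow> int \<Rightarrow> ('r, 'u) module" where
  "homology M i = quot_module ((Gr M i)\<lparr>carrier := cycles M i\<rparr>) (boundaries M i)"

text \<open>The map \<open>f\<close> is given degreewise; elements of \<open>homology M i\<close> are chosen cycles of \<open>M\<close>.\<close>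

definition quasi_isomorphism ::
    "('r, 'u) complex \<Rightarrow> ('r, 'u) complex \<Rightarrow> (int \<Rightarrow> 'u \<Rightarrow> 'u) \<Rightarrow> bool" where
  "quasi_isomorphism M N f \<longleftrightarrow>
     (\<forall>i. bij_betw (\<lambda>z. hclass N i (f i z)) (carrier (homology M i)) (carrier (homology N i)))"

text \<open>
  The intelligent truncations.  \<open>trunc_le_map n M\<close> is the projection of \<open>M\<close>, and also that of
  \<open>trunc_le (Suc n) M\<close>, onto \<open>trunc_le n M\<close>.
\<close>

definition trunc_le_map :: "nat \<Rightarrow> ('r, 'u) complex \<Rightarrow> int \<Rightarrow> 'u \<Rightarrow> 'u" where
  "trunc_le_map n M i x =
     (if i < int n then x
      else if i = int n then hclass M i x
      else \<zero>\<^bsub>Gr M i\<^esub>)"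

definition trunc_le :: "nat \<Rightarrow> ('r, 'u) complex \<Rightarrow> ('r, 'u) complex" where
  "trunc_le n M =
     \<lparr>Gr = (\<lambda>i. if i < int n then Gr M i
                else if i = int n then quot_module (Gr M i) (boundaries M i)
                else zero_module (Gr M i)),
      Dif = (\<lambda>i x. trunc_le_map n M (i - 1) (Dif M i x))\<rparr>"

definition trunc_ge0 :: "('r, 'u) complex \<Rightarrow> ('r, 'u) complex" where
  "trunc_ge0 M =
     \<lparr>Gr = (\<lambda>i. if i < 0 then zero_module (Gr M i)
                else if i = 0 then (Gr M 0)\<lparr>carrier := cycles M 0\<rparr>
                else Gr M i),
      Dif = Dif M\<rparr>"


section \<open>Categories\<close>

record 'u category =
  CObj :: "'u set"
  CHom :: "'u \<Rightarrow> 'u \<Rightarrow> 'u set"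
  CComp :: "'u \<Rightarrow> 'u \<Rightarrow> 'u \<Rightarrow> 'u \<Rightarrow> 'u \<Rightarrow> 'u"
  CId :: "'u \<Rightarrow> 'u"

text \<open>
  \<open>CComp C x y z g f\<close> is the composite of \<open>f\<close> from \<open>x\<close> to \<open>y\<close> with \<open>g\<close> from \<open>y\<close> to \<open>z\<close>.
\<close>

definition invertible_in :: "'u category \<Rightarrow> 'u \<Rightarrow> 'u \<Rightarrow> 'u \<Rightarrow> bool" where
  "invertible_in C x y f \<longleftrightarrow>
     f \<in> CHom C x y \<and>
     (\<exists>g\<in>CHom C y x. CComp C x y x g f = CId C x \<and> CComp C y x y f g = CId C y)"

definition is_functor ::
    "'u category \<Rightarrow> 'u category \<Rightarrow> ('u \<Rightarrow> 'u) \<Rightarrow> ('u \<Rightarrow> 'u \<Rightarrow> 'u \<Rightarrow> 'u) \<Rightarrow> bool" where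
  "is_functor C D Fo Fm \<longleftrightarrow>
     (\<forall>x\<in>CObj C. Fo x \<in> CObj D) \<and>
     (\<forall>x\<in>CObj C. \<forall>y\<in>CObj C. \<forall>f\<in>CHom C x y. Fm x y f \<in> CHom D (Fo x) (Fo y)) \<and>
     (\<forall>x\<in>CObj C. Fm x x (CId C x) = CId D (Fo x)) \<and>
     (\<forall>x\<in>CObj C. \<forall>y\<in>CObj C. \<forall>z\<in>CObj C. \<forall>f\<in>CHom C x y. \<forall>g\<in>CHom C y z.
        Fm x z (CComp C x y z g f) = CComp D (Fo x) (Fo y) (Fo z) (Fm y z g) (Fm x y f))"

definition natural_iso ::
    "'u category \<Rightarrow> 'u category \<Rightarrow> ('u \<Rightarrow> 'u) \<Rightarrow> ('u \<Rightarrow> 'u \<Rightarrow> 'u \<Rightarrow> 'u) \<Rightarrow>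
     ('u \<Rightarrow> 'u) \<Rightarrow> ('u \<Rightarrow> 'u \<Rightarrow> 'u \<Rightarrow> 'u) \<Rightarrow> ('u \<Rightarrow> 'u) \<Rightarrow> bool" where
  "natural_iso C D Fo Fm Go Gm \<eta> \<longleftrightarrow>
     (\<forall>x\<in>CObj C. invertible_in D (Fo x) (Go x) (\<eta> x)) \<and>
     (\<forall>x\<in>CObj C. \<forall>y\<in>CObj C. \<forall>f\<in>CHom C x y.
        CComp D (Fo x) (Fo y) (Go y) (\<eta> y) (Fm x y f) =
        CComp D (Fo x) (Go x) (Go y) (Gm x y f) (\<eta> x))"

definition is_equivalence ::
    "'u category \<Rightarrow> 'u category \<Rightarrow> ('u \<Rightarrow> 'u) \<Rightarrow> ('u \<Rightarrow> 'u \<Rightarrow> 'u \<Rightarrow> 'u) \<Rightarrow> bool" where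
  "is_equivalence C D Fo Fm \<longleftrightarrow>
     is_functor C D Fo Fm \<and>
     (\<exists>Go Gm. is_functor D C Go Gm \<and>
        (\<exists>\<eta>. natural_iso C C (\<lambda>x. x) (\<lambda>x y f. f)
                (\<lambda>x. Go (Fo x)) (\<lambda>x y f. Gm (Fo x) (Fo y) (Fm x y f)) \<eta>) \<and>
        (\<exists>\<epsilon>. natural_iso D D (\<lambda>x. Fo (Go x)) (\<lambda>x y f. Fm (Go x) (Go y) (Gm x y f))
                (\<lambda>x. x) (\<lambda>x y f. f) \<epsilon>))"


section \<open>dg categories and dg functors\<close>

text \<open>
  \<open>Comp A x y z i j g f\<close> is the composite of \<open>f\<close>, of degree \<open>j\<close> from \<open>x\<close> to \<open>y\<close>, with \<open>g\<close>,
  of degree \<open>i\<close> from \<open>y\<close> to \<open>z\<close>.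
\<close>

record ('r, 'u) dgcat =
  Obj :: "'u set"
  Hom :: "'u \<Rightarrow> 'u \<Rightarrow> ('r, 'u) complex"
  Comp :: "'u \<Rightarrow> 'u \<Rightarrow> 'u \<Rightarrow> int \<Rightarrow> int \<Rightarrow> 'u \<Rightarrow> 'u \<Rightarrow> 'u"
  Ident :: "'u \<Rightarrow> 'u"

abbreviation HomGr :: "('r, 'u) dgcat \<Rightarrow> 'u \<Rightarrow> 'u \<Rightarrow> int \<Rightarrow> ('r, 'u) module" where
  "HomGr A x y i \<equiv> Gr (Hom A x y) i"

abbreviation Mor :: "('r, 'u) dgcat \<Rightarrow> 'u \<Rightarrow> 'u \<Rightarrow> int \<Rightarrow> 'u set" where
  "Mor A x y i \<equiv> carrier (HomGr A x y i)"

abbreviation koszul :: "('r, 'u) module \<Rightarrow> int \<Rightarrow> 'u \<Rightarrow> 'u" where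
  "koszul M i x \<equiv> (if even i then x else \<ominus>\<^bsub>M\<^esub> x)"

locale dg_category =
  fixes R :: "'r ring" and A :: "('r, 'u) dgcat"
  assumes cring: "cring R"
    and hom_complex: "\<lbrakk>x \<in> Obj A; y \<in> Obj A\<rbrakk> \<Longrightarrow> chain_complex R (Hom A x y)"
    and comp_linear_right: "\<lbrakk>x \<in> Obj A; y \<in> Obj A; z \<in> Obj A; g \<in> Mor A y z i\<rbrakk> \<Longrightarrow>
      linear_map R (HomGr A x y j) (HomGr A x z (i + j)) (\<lambda>f. Comp A x y z i j g f)"
    and comp_linear_left: "\<lbrakk>x \<in> Obj A; y \<in> Obj A; z \<in> Obj A; f \<in> Mor A x y j\<rbrakk> \<Longrightarrow>
      linear_map R (HomGr A y z i) (HomGr A x z (i + j)) (\<lambda>g. Comp A x y z i j g f)"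
    and comp_assoc: "\<lbrakk>w \<in> Obj A; x \<in> Obj A; y \<in> Obj A; z \<in> Obj A;
        h \<in> Mor A y z i; g \<in> Mor A x y j; f \<in> Mor A w x k\<rbrakk> \<Longrightarrow>
      Comp A w y z i (j + k) h (Comp A w x y j k g f) =
      Comp A w x z (i + j) k (Comp A x y z i j h g) f"
    and leibniz: "\<lbrakk>x \<in> Obj A; y \<in> Obj A; z \<in> Obj A; g \<in> Mor A y z i; f \<in> Mor A x y j\<rbrakk> \<Longrightarrow>
      Dif (Hom A x z) (i + j) (Comp A x y z i j g f) =
      Comp A x y z (i - 1) j (Dif (Hom A y z) i g) f \<oplus>\<^bsub>HomGr A x z (i + j - 1)\<^esub>
      koszul (HomGr A x z (i + j - 1)) i (Comp A x y z i (j - 1) g (Dif (Hom A x y) j f))"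
    and ident_cycle: "x \<in> Obj A \<Longrightarrow> Ident A x \<in> cycles (Hom A x x) 0"
    and ident_left: "\<lbrakk>x \<in> Obj A; y \<in> Obj A; f \<in> Mor A x y j\<rbrakk> \<Longrightarrow>
      Comp A x y y 0 j (Ident A y) f = f"
    and ident_right: "\<lbrakk>x \<in> Obj A; y \<in> Obj A; f \<in> Mor A x y j\<rbrakk> \<Longrightarrow>
      Comp A x x y j 0 f (Ident A x) = f"

text \<open>
  dg functors carry their domain and codomain and are \<^const>\<open>undefined\<close> outside the objects and
  morphisms of the domain, so that equality of dg functors is equality of records.
\<close>

record ('r, 'u) dgfun =
  Dom :: "('r, 'u) dgcat"
  Cod :: "('r, 'u) dgcat"
  ob :: "'u \<Rightarrow> 'u"
  mor :: "'u \<Rightarrow> 'u \<Rightarrow> int \<Rightarrow> 'u \<Rightarrow> 'u"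

definition mk_dgfun :: "('r, 'u) dgcat \<Rightarrow> ('r, 'u) dgcat \<Rightarrow> ('u \<Rightarrow> 'u) \<Rightarrow>
    ('u \<Rightarrow> 'u \<Rightarrow> int \<Rightarrow> 'u \<Rightarrow> 'u) \<Rightarrow> ('r, 'u) dgfun" where
  "mk_dgfun A B Fo Fm =
     \<lparr>Dom = A, Cod = B, ob = restrict Fo (Obj A),
      mor = (\<lambda>x y i. restrict (Fm x y i)
               (if x \<in> Obj A \<and> y \<in> Obj A then Mor A x y i else {}))\<rparr>"

definition dg_functor :: "'r ring \<Rightarrow> ('r, 'u) dgfun \<Rightarrow> bool" where
  "dg_functor R F \<longleftrightarrow>
     dg_category R (Dom F) \<and> dg_category R (Cod F) \<and>
     F = mk_dgfun (Dom F) (Cod F) (ob F) (mor F) \<and>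
     (\<forall>x\<in>Obj (Dom F). ob F x \<in> Obj (Cod F)) \<and>
     (\<forall>x\<in>Obj (Dom F). \<forall>y\<in>Obj (Dom F). \<forall>i.
        linear_map R (HomGr (Dom F) x y i) (HomGr (Cod F) (ob F x) (ob F y) i) (mor F x y i)) \<and>
     (\<forall>x\<in>Obj (Dom F). \<forall>y\<in>Obj (Dom F). \<forall>i. \<forall>f\<in>Mor (Dom F) x y i.
        mor F x y (i - 1) (Dif (Hom (Dom F) x y) i f) =
        Dif (Hom (Cod F) (ob F x) (ob F y)) i (mor F x y i f)) \<and>
     (\<forall>x\<in>Obj (Dom F). mor F x x 0 (Ident (Dom F) x) = Ident (Cod F) (ob F x)) \<and>
     (\<forall>x\<in>Obj (Dom F). \<forall>y\<in>Obj (Dom F). \<forall>z\<in>Obj (Dom F). \<forall>i j.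
        \<forall>g\<in>Mor (Dom F) y z i. \<forall>f\<in>Mor (Dom F) x y j.
          mor F x z (i + j) (Comp (Dom F) x y z i j g f) =
          Comp (Cod F) (ob F x) (ob F y) (ob F z) i j (mor F y z i g) (mor F x y j f))"

definition dg_hom ::
    "'r ring \<Rightarrow> ('r, 'u) dgcat \<Rightarrow> ('r, 'u) dgcat \<Rightarrow> ('r, 'u) dgfun set" where
  "dg_hom R A B = {F. dg_functor R F \<and> Dom F = A \<and> Cod F = B}"

definition dg_id :: "('r, 'u) dgcat \<Rightarrow> ('r, 'u) dgfun" where
  "dg_id A = mk_dgfun A A (\<lambda>x. x) (\<lambda>x y i f. f)"

definition dg_comp :: "('r, 'u) dgfun \<Rightarrow> ('r, 'u) dgfun \<Rightarrow> ('r, 'u) dgfun" (infixl \<open>\<circ>\<^sub>d\<close> 55) where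
  "G \<circ>\<^sub>d F = mk_dgfun (Dom F) (Cod G) (\<lambda>x. ob G (ob F x))
     (\<lambda>x y i f. mor G (ob F x) (ob F y) i (mor F x y i f))"


section \<open>The model structure\<close>

definition H0 :: "('r, 'u) dgcat \<Rightarrow> 'u category" where
  "H0 A =
     \<lparr>CObj = Obj A,
      CHom = (\<lambda>x y. carrier (homology (Hom A x y) 0)),
      CComp = (\<lambda>x y z g f. hclass (Hom A x z) 0 (Comp A x y z 0 0 g f)),
      CId = (\<lambda>x. hclass (Hom A x x) 0 (Ident A x))\<rparr>"

definition H0_mor :: "('r, 'u) dgfun \<Rightarrow> 'u \<Rightarrow> 'u \<Rightarrow> 'u \<Rightarrow> 'u" where
  "H0_mor F x y f = hclass (Hom (Cod F) (ob F x) (ob F y)) 0 (mor F x y 0 f)"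

definition quasi_equivalence :: "'r ring \<Rightarrow> ('r, 'u) dgfun \<Rightarrow> bool" where
  "quasi_equivalence R F \<longleftrightarrow>
     dg_functor R F \<and>
     (\<forall>x\<in>Obj (Dom F). \<forall>y\<in>Obj (Dom F).
        quasi_isomorphism (Hom (Dom F) x y) (Hom (Cod F) (ob F x) (ob F y)) (mor F x y)) \<and>
     is_equivalence (H0 (Dom F)) (H0 (Cod F)) (ob F) (H0_mor F)"

definition homotopy_invertible :: "('r, 'u) dgcat \<Rightarrow> 'u \<Rightarrow> 'u \<Rightarrow> 'u \<Rightarrow> bool" where
  "homotopy_invertible A x y f \<longleftrightarrow>
     f \<in> cycles (Hom A x y) 0 \<and> invertible_in (H0 A) x y (hclass (Hom A x y) 0 f)"

definition fibration :: "'r ring \<Rightarrow> ('r, 'u) dgfun \<Rightarrow> bool" where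
  "fibration R F \<longleftrightarrow>
     dg_functor R F \<and>
     (\<forall>x\<in>Obj (Dom F). \<forall>y\<in>Obj (Dom F). \<forall>i.
        mor F x y i ` Mor (Dom F) x y i = Mor (Cod F) (ob F x) (ob F y) i) \<and>
     (\<forall>a1\<in>Obj (Dom F). \<forall>b\<in>Obj (Cod F). \<forall>v. homotopy_invertible (Cod F) (ob F a1) b v \<longrightarrow>
        (\<exists>a2\<in>Obj (Dom F). \<exists>u. ob F a2 = b \<and> homotopy_invertible (Dom F) a1 a2 u \<and>
           mor F a1 a2 0 u = v))"

definition trivial_fibration :: "'r ring \<Rightarrow> ('r, 'u) dgfun \<Rightarrow> bool" where
  "trivial_fibration R F \<longleftrightarrow> fibration R F \<and> quasi_equivalence R F"

text \<open>
  The cofibrations of the model structure are the dg functors with the left lifting property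
  against the trivial fibrations, and the initial dg category is empty; hence a dg category \<open>B\<close>
  is cofibrant iff dg functors out of \<open>B\<close> lift along trivial fibrations.
\<close>

definition cofibrant :: "'r ring \<Rightarrow> ('r, 'u) dgcat \<Rightarrow> bool" where
  "cofibrant R B \<longleftrightarrow>
     dg_category R B \<and>
     (\<forall>P F. trivial_fibration R P \<and> F \<in> dg_hom R B (Cod P) \<longrightarrow>
        (\<exists>L\<in>dg_hom R B (Dom P). P \<circ>\<^sub>d L = F))"


section \<open>The homotopy category of dg categories over \<open>X\<close>\<close>

text \<open>
  An object over \<open>X\<close> is a dg functor with codomain \<open>X\<close>.  In the induced model structure the weak
  equivalences are the morphisms over \<open>X\<close> whose underlying dg functor is a quasi-equivalence,
  and the homotopy category is the localization at them: its morphisms are zigzags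
  modulo the congruence generated by the relations below.  A step \<open>Fwd p F q\<close> leads from \<open>p\<close>
  to \<open>q\<close> along \<open>F\<close>; a step \<open>Bwd p W q\<close> is the formal inverse of a weak
  equivalence \<open>W\<close> from \<open>p\<close> to \<open>q\<close> and leads from \<open>q\<close> to \<open>p\<close>.
\<close>

definition over_hom ::
    "'r ring \<Rightarrow> ('r, 'u) dgcat \<Rightarrow> ('r, 'u) dgfun \<Rightarrow> ('r, 'u) dgfun \<Rightarrow> ('r, 'u) dgfun set" where
  "over_hom R X p q =
     {F. dg_functor R p \<and> Cod p = X \<and> dg_functor R q \<and> Cod q = X \<and>
         F \<in> dg_hom R (Dom p) (Dom q) \<and> q \<circ>\<^sub>d F = p}"

datatype ('r, 'u) zstep =
    Fwd "('r, 'u) dgfun" "('r, 'u) dgfun" "('r, 'u) dgfun"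
  | Bwd "('r, 'u) dgfun" "('r, 'u) dgfun" "('r, 'u) dgfun"

inductive zigzag ::
    "'r ring \<Rightarrow> ('r, 'u) dgcat \<Rightarrow> ('r, 'u) dgfun \<Rightarrow> ('r, 'u) zstep list \<Rightarrow> ('r, 'u) dgfun \<Rightarrow> bool"
  for R X where
  zz_nil: "dg_functor R p \<Longrightarrow> Cod p = X \<Longrightarrow> zigzag R X p [] p"
| zz_fwd: "F \<in> over_hom R X p q \<Longrightarrow> zigzag R X q s r \<Longrightarrow> zigzag R X p (Fwd p F q # s) r"
| zz_bwd: "W \<in> over_hom R X q p \<Longrightarrow> quasi_equivalence R W \<Longrightarrow> zigzag R X q s r \<Longrightarrow>
    zigzag R X p (Bwd q W p # s) r"

inductive zz_equiv ::
    "'r ring \<Rightarrow> ('r, 'u) dgcat \<Rightarrow> ('r, 'u) dgfun \<Rightarrow> ('r, 'u) dgfun \<Rightarrow>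
     ('r, 'u) zstep list \<Rightarrow> ('r, 'u) zstep list \<Rightarrow> bool"
  for R X where
  refl: "zigzag R X p s q \<Longrightarrow> zz_equiv R X p q s s"
| sym: "zz_equiv R X p q s t \<Longrightarrow> zz_equiv R X p q t s"
| trans: "zz_equiv R X p q s t \<Longrightarrow> zz_equiv R X p q t u \<Longrightarrow> zz_equiv R X p q s u"
| append: "zz_equiv R X p q s s' \<Longrightarrow> zz_equiv R X q r t t' \<Longrightarrow> zz_equiv R X p r (s @ t) (s' @ t')"
| ident: "dg_functor R p \<Longrightarrow> Cod p = X \<Longrightarrow> zz_equiv R X p p [Fwd p (dg_id (Dom p)) p] []"
| comp: "F \<in> over_hom R X p q \<Longrightarrow> G \<in> over_hom R X q r \<Longrightarrow>
    zz_equiv R X p r [Fwd p F q, Fwd q G r] [Fwd p (G \<circ>\<^sub>d F) r]"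
| inv_right: "W \<in> over_hom R X p q \<Longrightarrow> quasi_equivalence R W \<Longrightarrow>
    zz_equiv R X p p [Fwd p W q, Bwd p W q] []"
| inv_left: "W \<in> over_hom R X p q \<Longrightarrow> quasi_equivalence R W \<Longrightarrow>
    zz_equiv R X q q [Bwd p W q, Fwd p W q] []"

definition ho_class ::
    "'r ring \<Rightarrow> ('r, 'u) dgcat \<Rightarrow> ('r, 'u) dgfun \<Rightarrow> ('r, 'u) dgfun \<Rightarrow> ('r, 'u) zstep list \<Rightarrow>
     ('r, 'u) zstep list set" where
  "ho_class R X p q s = {t. zz_equiv R X p q s t}"

definition ho_hom ::
    "'r ring \<Rightarrow> ('r, 'u) dgcat \<Rightarrow> ('r, 'u) dgfun \<Rightarrow> ('r, 'u) dgfun \<Rightarrow>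
     ('r, 'u) zstep list set set" where
  "ho_hom R X p q = {ho_class R X p q s | s. zigzag R X p s q}"

definition ho_comp ::
    "'r ring \<Rightarrow> ('r, 'u) dgcat \<Rightarrow> ('r, 'u) dgfun \<Rightarrow> ('r, 'u) dgfun \<Rightarrow>
     ('r, 'u) zstep list set \<Rightarrow> ('r, 'u) zstep list set \<Rightarrow> ('r, 'u) zstep list set" where
  "ho_comp R X p r \<beta> \<alpha> = (\<Union>s\<in>\<alpha>. \<Union>t\<in>\<beta>. ho_class R X p r (s @ t))"

text \<open>The image of a morphism over \<open>X\<close> under the localization functor.\<close>

definition ho_of ::
    "'r ring \<Rightarrow> ('r, 'u) dgcat \<Rightarrow> ('r, 'u) dgfun \<Rightarrow> ('r, 'u) dgfun \<Rightarrow> ('r, 'u) dgfun \<Rightarrow>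
     ('r, 'u) zstep list set" where
  "ho_of R X p q F = ho_class R X p q [Fwd p F q]"


section \<open>Connectivity and small Postnikov sections\<close>

definition homologically_connective :: "('r, 'u) dgcat \<Rightarrow> bool" where
  "homologically_connective A \<longleftrightarrow>
     (\<forall>x\<in>Obj A. \<forall>y\<in>Obj A. \<forall>i<0.
        carrier (homology (Hom A x y) i) = {\<zero>\<^bsub>homology (Hom A x y) i\<^esub>})"

definition positively_graded :: "('r, 'u) dgcat \<Rightarrow> bool" where
  "positively_graded A \<longleftrightarrow>
     (\<forall>x\<in>Obj A. \<forall>y\<in>Obj A. \<forall>i<0. Mor A x y i = {\<zero>\<^bsub>HomGr A x y i\<^esub>})"

definition tau_ge0 :: "('r, 'u) dgcat \<Rightarrow> ('r, 'u) dgcat" where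
  "tau_ge0 A = A\<lparr>Hom := \<lambda>x y. trunc_ge0 (Hom A x y)\<rparr>"

definition tau_ge0_incl :: "('r, 'u) dgcat \<Rightarrow> ('r, 'u) dgfun" where
  "tau_ge0_incl A = mk_dgfun (tau_ge0 A) A (\<lambda>x. x) (\<lambda>x y i f. f)"

text \<open>The dg category to which the constructions are applied.\<close>

definition positive_model :: "('r, 'u) dgcat \<Rightarrow> ('r, 'u) dgcat" where
  "positive_model A = (if positively_graded A then A else tau_ge0 A)"

definition small_postnikov :: "nat \<Rightarrow> ('r, 'u) dgcat \<Rightarrow> ('r, 'u) dgcat" where
  "small_postnikov n A =
     \<lparr>Obj = Obj A,
      Hom = (\<lambda>x y. trunc_le n (Hom A x y)),
      Comp = (\<lambda>x y z i j g f. trunc_le_map n (Hom A x z) (i + j) (Comp A x y z i j g f)),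
      Ident = (\<lambda>x. trunc_le_map n (Hom A x x) 0 (Ident A x))\<rparr>"

definition postnikov_proj :: "nat \<Rightarrow> ('r, 'u) dgcat \<Rightarrow> ('r, 'u) dgfun" where
  "postnikov_proj n A = mk_dgfun A (small_postnikov n A) (\<lambda>x. x)
     (\<lambda>x y i f. trunc_le_map n (Hom A x y) i f)"

definition postnikov_step :: "nat \<Rightarrow> ('r, 'u) dgcat \<Rightarrow> ('r, 'u) dgfun" where
  "postnikov_step n A = mk_dgfun (small_postnikov (Suc n) A) (small_postnikov n A) (\<lambda>x. x)
     (\<lambda>x y i f. trunc_le_map n (Hom A x y) i f)"


section \<open>Colimits of dg categories\<close>

text \<open>
  Colimits are characterized by their universal property; they are determined up
  to unique isomorphism.
\<close>

definition is_coproduct ::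
    "'r ring \<Rightarrow> 'i set \<Rightarrow> ('i \<Rightarrow> ('r, 'u) dgcat) \<Rightarrow> ('i \<Rightarrow> ('r, 'u) dgfun) \<Rightarrow> ('r, 'u) dgcat \<Rightarrow> bool"
  where
  "is_coproduct R I C inc K \<longleftrightarrow>
     dg_category R K \<and>
     (\<forall>c\<in>I. inc c \<in> dg_hom R (C c) K) \<and>
     (\<forall>Z F. dg_category R Z \<and> (\<forall>c\<in>I. F c \<in> dg_hom R (C c) Z) \<longrightarrow>
        (\<exists>!H. H \<in> dg_hom R K Z \<and> (\<forall>c\<in>I. H \<circ>\<^sub>d inc c = F c)))"

definition is_pushout ::
    "'r ring \<Rightarrow> ('r, 'u) dgfun \<Rightarrow> ('r, 'u) dgfun \<Rightarrow> ('r, 'u) dgfun \<Rightarrow> ('r, 'u) dgfun \<Rightarrow> bool"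
  where
  "is_pushout R f g u v \<longleftrightarrow>
     dg_functor R f \<and> dg_functor R g \<and> Dom f = Dom g \<and>
     dg_functor R u \<and> Dom u = Cod f \<and> dg_functor R v \<and> Dom v = Cod g \<and> Cod u = Cod v \<and>
     u \<circ>\<^sub>d f = v \<circ>\<^sub>d g \<and>
     (\<forall>Z a b. a \<in> dg_hom R (Cod f) Z \<and> b \<in> dg_hom R (Cod g) Z \<and> a \<circ>\<^sub>d f = b \<circ>\<^sub>d g \<longrightarrow>
        (\<exists>!H. H \<in> dg_hom R (Cod v) Z \<and> H \<circ>\<^sub>d u = a \<and> H \<circ>\<^sub>d v = b))"

definition is_sequential_colimit ::
    "'r ring \<Rightarrow> (nat \<Rightarrow> ('r, 'u) dgcat) \<Rightarrow> (nat \<Rightarrow> ('r, 'u) dgfun) \<Rightarrow> (nat \<Rightarrow> ('r, 'u) dgfun) \<Rightarrow>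
     ('r, 'u) dgcat \<Rightarrow> bool" where
  "is_sequential_colimit R P st leg K \<longleftrightarrow>
     dg_category R K \<and>
     (\<forall>i. st i \<in> dg_hom R (P i) (P (Suc i))) \<and>
     (\<forall>i. leg i \<in> dg_hom R (P i) K) \<and>
     (\<forall>i. leg (Suc i) \<circ>\<^sub>d st i = leg i) \<and>
     (\<forall>Z F. (\<forall>i. F i \<in> dg_hom R (P i) Z) \<and> (\<forall>i. F (Suc i) \<circ>\<^sub>d st i = F i) \<longrightarrow>
        (\<exists>!H. H \<in> dg_hom R K Z \<and> (\<forall>i. H \<circ>\<^sub>d leg i = F i)))"


section \<open>Big Postnikov sections\<close>

text \<open>The module \<open>R\<close>.  (The multiplicative part of the record is irrelevant.)\<close>

definition scalar_module :: "'r ring \<Rightarrow> ('r, ('r, 'a) univ) module" where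
  "scalar_module R =
     \<lparr>carrier = Scal ` carrier R,
      monoid.mult = (\<lambda>x y. Scal (unscal x \<otimes>\<^bsub>R\<^esub> unscal y)),
      one = Scal \<one>\<^bsub>R\<^esub>,
      zero = Scal \<zero>\<^bsub>R\<^esub>,
      add = (\<lambda>x y. Scal (unscal x \<oplus>\<^bsub>R\<^esub> unscal y)),
      smult = (\<lambda>r x. Scal (r \<otimes>\<^bsub>R\<^esub> unscal x))\<rparr>"

definition zero_complex :: "'r ring \<Rightarrow> ('r, ('r, 'a) univ) complex" where
  "zero_complex R = \<lparr>Gr = (\<lambda>i. zero_module (scalar_module R)), Dif = (\<lambda>i x. Scal \<zero>\<^bsub>R\<^esub>)\<rparr>"

definition sphere_complex :: "'r ring \<Rightarrow> int \<Rightarrow> ('r, ('r, 'a) univ) complex" where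
  "sphere_complex R m =
     \<lparr>Gr = (\<lambda>i. if i = m then scalar_module R else zero_module (scalar_module R)),
      Dif = (\<lambda>i x. Scal \<zero>\<^bsub>R\<^esub>)\<rparr>"

text \<open>
  \<open>disk_complex R (m + 1)\<close> is the mapping cone of the identity of \<open>sphere_complex R m\<close>: a copy
  of \<open>R\<close> in degree \<open>m\<close>, one in degree \<open>m + 1\<close>, and the identity as differential between them.
\<close>

definition disk_complex :: "'r ring \<Rightarrow> int \<Rightarrow> ('r, ('r, 'a) univ) complex" where
  "disk_complex R k =
     \<lparr>Gr = (\<lambda>i. if i = k \<or> i = k - 1 then scalar_module R else zero_module (scalar_module R)),
      Dif = (\<lambda>i x. if i = k then x else Scal \<zero>\<^bsub>R\<^esub>)\<rparr>"

definition arrow_dgcat :: "'r ring \<Rightarrow> ('r, 'a) univ \<Rightarrow> ('r, 'a) univ \<Rightarrow>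
    ('r, ('r, 'a) univ) complex \<Rightarrow> ('r, ('r, 'a) univ) dgcat" where
  "arrow_dgcat R a b K =
     \<lparr>Obj = {a, b},
      Hom = (\<lambda>x y. if x = y then sphere_complex R 0
                   else if x = a \<and> y = b then K else zero_complex R),
      Comp = (\<lambda>x y z i j g f. Scal (unscal g \<otimes>\<^bsub>R\<^esub> unscal f)),
      Ident = (\<lambda>x. Scal \<one>\<^bsub>R\<^esub>)\<rparr>"

definition C_cat :: "'r ring \<Rightarrow> int \<Rightarrow> ('r, ('r, 'a) univ) dgcat" where
  "C_cat R m = arrow_dgcat R (Num 1) (Num 2) (sphere_complex R m)"

text \<open>\<open>D_cat R (m + 1)\<close> has the morphism complex \<open>disk_complex R (m + 1)\<close>.\<close>

definition D_cat :: "'r ring \<Rightarrow> int \<Rightarrow> ('r, ('r, 'a) univ) dgcat" where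
  "D_cat R k = arrow_dgcat R (Num 3) (Num 4) (disk_complex R k)"

definition S_fun :: "'r ring \<Rightarrow> int \<Rightarrow> ('r, ('r, 'a) univ) dgfun" where
  "S_fun R m = mk_dgfun (C_cat R m) (D_cat R (m + 1))
     (\<lambda>x. if x = Num 1 then Num 3 else Num 4) (\<lambda>x y i f. f)"

type_synonym ('r, 'a) cell = "int \<times> ('r, ('r, 'a) univ) dgfun"

definition cells ::
    "'r ring \<Rightarrow> nat \<Rightarrow> ('r, ('r, 'a) univ) dgcat \<Rightarrow> ('r, 'a) cell set" where
  "cells R n Q = {(m, T). int n < m \<and> T \<in> dg_hom R (C_cat R m) Q}"

text \<open>
  \<open>st\<close> is the canonical dg functor from \<open>Q\<close> to the pushout of \<open>Q\<close> along the coproduct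
  of the \<open>S(m)\<close>, taken over all cells \<open>(m, T)\<close>, and \<open>att (m, T)\<close> is the canonical dg functor
  from \<open>D(m + 1)\<close> to that pushout.
\<close>

definition attaches_cells ::
    "'r ring \<Rightarrow> nat \<Rightarrow> ('r, ('r, 'a) univ) dgfun \<Rightarrow>
     (('r, 'a) cell \<Rightarrow> ('r, ('r, 'a) univ) dgfun) \<Rightarrow> bool" where
  "attaches_cells R n st att \<longleftrightarrow>
     (\<exists>K L incK incL s t u.
        is_coproduct R (cells R n (Dom st)) (\<lambda>(m, T). C_cat R m) incK K \<and>
        is_coproduct R (cells R n (Dom st)) (\<lambda>(m, T). D_cat R (m + 1)) incL L \<and>
        s \<in> dg_hom R K L \<and>
        (\<forall>(m, T)\<in>cells R n (Dom st). s \<circ>\<^sub>d incK (m, T) = incL (m, T) \<circ>\<^sub>d S_fun R m) \<and>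
        t \<in> dg_hom R K (Dom st) \<and>
        (\<forall>(m, T)\<in>cells R n (Dom st). t \<circ>\<^sub>d incK (m, T) = T) \<and>
        is_pushout R s t u st \<and>
        (\<forall>c\<in>cells R n (Dom st). att c = u \<circ>\<^sub>d incL c))"

record ('r, 'a) postnikov_tower =
  Stage :: "nat \<Rightarrow> ('r, ('r, 'a) univ) dgcat"
  StageMap :: "nat \<Rightarrow> ('r, ('r, 'a) univ) dgfun"
  Attach :: "nat \<Rightarrow> ('r, 'a) cell \<Rightarrow> ('r, ('r, 'a) univ) dgfun"
  Colim :: "('r, ('r, 'a) univ) dgcat"
  Leg :: "nat \<Rightarrow> ('r, ('r, 'a) univ) dgfun"

text \<open>
  \<open>big_postnikov R n A t\<close>: the tower \<open>t\<close> consists of \<open>Stage t i\<close> \<open>= P_n(A)^i\<close> and its colimit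
  \<open>Colim t\<close> \<open>= P_n(A)\<close>, together with the structure maps.
\<close>

definition big_postnikov ::
    "'r ring \<Rightarrow> nat \<Rightarrow> ('r, ('r, 'a) univ) dgcat \<Rightarrow> ('r, 'a) postnikov_tower \<Rightarrow> bool" where
  "big_postnikov R n A t \<longleftrightarrow>
     Stage t 0 = A \<and>
     (\<forall>i. StageMap t i \<in> dg_hom R (Stage t i) (Stage t (Suc i)) \<and>
          attaches_cells R n (StageMap t i) (Attach t i)) \<and>
     is_sequential_colimit R (Stage t) (StageMap t) (Leg t) (Colim t)"

primrec from_base ::
    "('r, 'a) postnikov_tower \<Rightarrow> nat \<Rightarrow> ('r, ('r, 'a) univ) dgfun" where
  "from_base t 0 = dg_id (Stage t 0)"
| "from_base t (Suc i) = StageMap t i \<circ>\<^sub>d from_base t i"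

text \<open>
  The dg functor from \<open>D(m + 1)\<close> to \<open>P_n(A)\<close> that classifies the bounding chain adjoined in
  \<open>P_n(A)^(i+1)\<close> for the cell \<open>(m, T)\<close>.  The chain itself is the image of the unit of \<open>R\<close>
  in degree \<open>m + 1\<close>.
\<close>

definition cell_map ::
    "('r, 'a) postnikov_tower \<Rightarrow> nat \<Rightarrow> ('r, 'a) cell \<Rightarrow> ('r, ('r, 'a) univ) dgfun" where
  "cell_map t i c = Leg t (Suc i) \<circ>\<^sub>d Attach t i c"

definition bounding_chain_value ::
    "'r ring \<Rightarrow> ('r, 'a) postnikov_tower \<Rightarrow> ('r, ('r, 'a) univ) dgfun \<Rightarrow> nat \<Rightarrow> ('r, 'a) cell \<Rightarrow>
     ('r, 'a) univ" where
  "bounding_chain_value R t F i c =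
     mor (F \<circ>\<^sub>d cell_map t i c) (Num 3) (Num 4) (fst c + 1) (Scal \<one>\<^bsub>R\<^esub>)"

definition zero_at ::
    "('r, ('r, 'a) univ) dgfun \<Rightarrow> ('r, 'a) postnikov_tower \<Rightarrow> nat \<Rightarrow> ('r, 'a) cell \<Rightarrow> ('r, 'a) univ"
  where
  "zero_at F t i c =
     \<zero>\<^bsub>HomGr (Cod F) (ob (F \<circ>\<^sub>d cell_map t i c) (Num 3)) (ob (F \<circ>\<^sub>d cell_map t i c) (Num 4))
        (fst c + 1)\<^esub>"

text \<open>
  The dg functor \<open>M_n\<close>.  The objects of \<open>P_n(A)\<close> are those of \<open>A\<close> via \<open>Leg t 0\<close>, so that the
  first condition on \<open>M\<close> includes that it is the identity on objects.
\<close>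

definition is_M ::
    "'r ring \<Rightarrow> nat \<Rightarrow> ('r, ('r, 'a) univ) dgcat \<Rightarrow> ('r, 'a) postnikov_tower \<Rightarrow>
     ('r, ('r, 'a) univ) dgfun \<Rightarrow> bool" where
  "is_M R n A t M \<longleftrightarrow>
     M \<in> dg_hom R (Colim t) (small_postnikov n A) \<and>
     M \<circ>\<^sub>d Leg t 0 = postnikov_proj n A \<and>
     (\<forall>i. \<forall>c\<in>cells R n (Stage t i). bounding_chain_value R t M i c = zero_at M t i c)"


section \<open>Square zero extensions\<close>

text \<open>
  \<open>LAct N x y z i j g v\<close> is \<open>g v\<close> for \<open>g\<close> of degree \<open>i\<close> from \<open>y\<close> to \<open>z\<close> and \<open>v\<close> of degree \<open>j\<close> in
  \<open>N(x, y)\<close>; \<open>RAct N x y z i j v f\<close> is \<open>v f\<close> for \<open>v\<close> of degree \<open>i\<close> in \<open>N(y, z)\<close>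
  and \<open>f\<close> of degree \<open>j\<close> from \<open>x\<close> to \<open>y\<close>.
\<close>

record ('r, 'u) dgbimodule =
  BHom :: "'u \<Rightarrow> 'u \<Rightarrow> ('r, 'u) complex"
  LAct :: "'u \<Rightarrow> 'u \<Rightarrow> 'u \<Rightarrow> int \<Rightarrow> int \<Rightarrow> 'u \<Rightarrow> 'u \<Rightarrow> 'u"
  RAct :: "'u \<Rightarrow> 'u \<Rightarrow> 'u \<Rightarrow> int \<Rightarrow> int \<Rightarrow> 'u \<Rightarrow> 'u \<Rightarrow> 'u"

definition direct_sum_module ::
    "('r, ('r, 'a) univ) module \<Rightarrow> ('r, ('r, 'a) univ) module \<Rightarrow> ('r, ('r, 'a) univ) module" where
  "direct_sum_module M N =
     \<lparr>carrier = {UPair x v | x v. x \<in> carrier M \<and> v \<in> carrier N},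
      monoid.mult = (\<lambda>p q. UPair (ufst p \<otimes>\<^bsub>M\<^esub> ufst q) (usnd p \<otimes>\<^bsub>N\<^esub> usnd q)),
      one = UPair \<one>\<^bsub>M\<^esub> \<one>\<^bsub>N\<^esub>,
      zero = UPair \<zero>\<^bsub>M\<^esub> \<zero>\<^bsub>N\<^esub>,
      add = (\<lambda>p q. UPair (ufst p \<oplus>\<^bsub>M\<^esub> ufst q) (usnd p \<oplus>\<^bsub>N\<^esub> usnd q)),
      smult = (\<lambda>r p. UPair (r \<odot>\<^bsub>M\<^esub> ufst p) (r \<odot>\<^bsub>N\<^esub> usnd p))\<rparr>"

definition direct_sum_complex ::
    "('r, ('r, 'a) univ) complex \<Rightarrow> ('r, ('r, 'a) univ) complex \<Rightarrow> ('r, ('r, 'a) univ) complex" where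
  "direct_sum_complex M N =
     \<lparr>Gr = (\<lambda>i. direct_sum_module (Gr M i) (Gr N i)),
      Dif = (\<lambda>i p. UPair (Dif M i (ufst p)) (Dif N i (usnd p)))\<rparr>"

definition square_zero_extension ::
    "('r, ('r, 'a) univ) dgcat \<Rightarrow> ('r, ('r, 'a) univ) dgbimodule \<Rightarrow> ('r, ('r, 'a) univ) dgcat"
    (infixl \<open>\<ltimes>\<close> 65) where
  "D \<ltimes> N =
     \<lparr>Obj = Obj D,
      Hom = (\<lambda>x y. direct_sum_complex (Hom D x y) (BHom N x y)),
      Comp = (\<lambda>x y z i j p q.
        UPair (Comp D x y z i j (ufst p) (ufst q))
              (LAct N x y z i j (ufst p) (usnd q) \<oplus>\<^bsub>Gr (BHom N x z) (i + j)\<^esub>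
               RAct N x y z i j (usnd p) (ufst q))),
      Ident = (\<lambda>x. UPair (Ident D x) \<zero>\<^bsub>Gr (BHom N x x) 0\<^esub>)\<rparr>"

definition sqz_incl ::
    "('r, ('r, 'a) univ) dgcat \<Rightarrow> ('r, ('r, 'a) univ) dgbimodule \<Rightarrow> ('r, ('r, 'a) univ) dgfun" where
  "sqz_incl D N = mk_dgfun D (D \<ltimes> N) (\<lambda>x. x) (\<lambda>x y i f. UPair f \<zero>\<^bsub>Gr (BHom N x y) i\<^esub>)"

definition sqz_proj ::
    "('r, ('r, 'a) univ) dgcat \<Rightarrow> ('r, ('r, 'a) univ) dgbimodule \<Rightarrow> ('r, ('r, 'a) univ) dgfun" where
  "sqz_proj D N = mk_dgfun (D \<ltimes> N) D (\<lambda>x. x) (\<lambda>x y i p. ufst p)"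

text \<open>
  The bimodule \<open>H_(n+1)(A)[n+2]\<close> over \<open>small_postnikov n A\<close>, for \<open>A\<close> positively graded: a morphism
  of degree 0 acts through its class in \<open>H_0(A)\<close>, which it represents; morphisms of
  positive degree act by zero.
\<close>

definition homology_bimodule :: "nat \<Rightarrow> ('r, 'u) dgcat \<Rightarrow> ('r, 'u) dgbimodule" where
  "homology_bimodule n A =
     (let H = (\<lambda>x y. homology (Hom A x y) (int n + 1)) in
      \<lparr>BHom = (\<lambda>x y. \<lparr>Gr = (\<lambda>i. if i = int n + 2 then H x y else zero_module (H x y)),
                      Dif = (\<lambda>i v. \<zero>\<^bsub>H x y\<^esub>)\<rparr>),
       LAct = (\<lambda>x y z i j g v.
         if i = 0 \<and> j = int n + 2
         then hclass (Hom A x z) (int n + 1) (Comp A x y z 0 (int n + 1) g v)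
         else \<zero>\<^bsub>H x z\<^esub>),
       RAct = (\<lambda>x y z i j v f.
         if i = int n + 2 \<and> j = 0
         then hclass (Hom A x z) (int n + 1) (Comp A x y z (int n + 1) 0 v f)
         else \<zero>\<^bsub>H x z\<^esub>)\<rparr>)"

abbreviation kinv_target ::
    "nat \<Rightarrow> ('r, ('r, 'a) univ) dgcat \<Rightarrow> ('r, ('r, 'a) univ) dgcat" where
  "kinv_target n A \<equiv> small_postnikov n A \<ltimes> homology_bimodule n A"

abbreviation kinv_incl ::
    "nat \<Rightarrow> ('r, ('r, 'a) univ) dgcat \<Rightarrow> ('r, ('r, 'a) univ) dgfun" where
  "kinv_incl n A \<equiv> sqz_incl (small_postnikov n A) (homology_bimodule n A)"

abbreviation kinv_proj ::
    "nat \<Rightarrow> ('r, ('r, 'a) univ) dgcat \<Rightarrow> ('r, ('r, 'a) univ) dgfun" where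
  "kinv_proj n A \<equiv> sqz_proj (small_postnikov n A) (homology_bimodule n A)"

text \<open>
  The dg functor \<open>gamma_n\<close>; its composite with \<open>Leg t i\<close> is \<open>gamma_n^i\<close>.  For a cell \<open>(n + 1, T)\<close>
  the cycle \<open>z\<close> below is the one of \<open>A\<close> that corresponds to \<open>T(1_(n+1))\<close>
  under the isomorphism from \<open>A\<close> to \<open>P_n(A)^i\<close> in degree \<open>n + 1\<close>.
\<close>

definition is_gamma ::
    "'r ring \<Rightarrow> nat \<Rightarrow> ('r, ('r, 'a) univ) dgcat \<Rightarrow> ('r, 'a) postnikov_tower \<Rightarrow>
     ('r, ('r, 'a) univ) dgfun \<Rightarrow> bool" where
  "is_gamma R n A t \<gamma> \<longleftrightarrow>
     \<gamma> \<in> dg_hom R (Colim t) (kinv_target n A) \<and>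
     \<gamma> \<circ>\<^sub>d Leg t 0 = kinv_incl n A \<circ>\<^sub>d postnikov_proj n A \<and>
     (\<forall>i. \<forall>(m, T)\<in>cells R n (Stage t i). m > int n + 1 \<longrightarrow>
        bounding_chain_value R t \<gamma> i (m, T) = zero_at \<gamma> t i (m, T)) \<and>
     (\<forall>i. \<forall>(m, T)\<in>cells R n (Stage t i). m = int n + 1 \<longrightarrow>
        (\<exists>a\<in>Obj A. \<exists>b\<in>Obj A. \<exists>z\<in>cycles (Hom A a b) (int n + 1).
           ob (from_base t i) a = ob T (Num 1) \<and>
           ob (from_base t i) b = ob T (Num 2) \<and>
           mor (from_base t i) a b (int n + 1) z = mor T (Num 1) (Num 2) m (Scal \<one>\<^bsub>R\<^esub>) \<and>
           bounding_chain_value R t \<gamma> i (m, T) =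
             UPair \<zero>\<^bsub>HomGr (small_postnikov n A) a b (int n + 2)\<^esub>
                   (hclass (Hom A a b) (int n + 1) z)))"


section \<open>Obstruction classes and lifts\<close>

text \<open>
  \<open>\<omega>_n(G)\<close>, a morphism in the homotopy category over \<open>small_postnikov n A\<close> from \<open>M \<circ>\<^sub>d G\<close> to the
  square zero extension.
\<close>

definition obstruction_class ::
    "'r ring \<Rightarrow> nat \<Rightarrow> ('r, ('r, 'a) univ) dgcat \<Rightarrow> ('r, ('r, 'a) univ) dgfun \<Rightarrow>
     ('r, ('r, 'a) univ) dgfun \<Rightarrow> ('r, ('r, 'a) univ) dgfun \<Rightarrow>
     ('r, ('r, 'a) univ) zstep list set" where
  "obstruction_class R n A M \<gamma> G =
     ho_of R (small_postnikov n A) (M \<circ>\<^sub>d G) (kinv_proj n A) (\<gamma> \<circ>\<^sub>d G)"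

text \<open>Factorization of \<open>\<omega>\<close>, with source \<open>p\<close>, through the canonical inclusion.\<close>

definition class_vanishes ::
    "'r ring \<Rightarrow> nat \<Rightarrow> ('r, ('r, 'a) univ) dgcat \<Rightarrow> ('r, ('r, 'a) univ) dgfun \<Rightarrow>
     ('r, ('r, 'a) univ) zstep list set \<Rightarrow> bool" where
  "class_vanishes R n A p \<omega> \<longleftrightarrow>
     (let X = small_postnikov n A in
      \<exists>h\<in>ho_hom R X p (dg_id X).
        \<omega> = ho_comp R X p (kinv_proj n A)
              (ho_of R X (dg_id X) (kinv_proj n A) (kinv_incl n A)) h)"

text \<open>
  Vanishing of \<open>\<omega>_n(F)\<close>, where \<open>F\<close> is a dg functor to \<open>small_postnikov n A\<close>.  The quantifier covers
  all choices involved: that of the colimits defining \<open>P_n(A)\<close> (which determine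
  \<open>M\<close> and \<open>\<gamma>\<close>) and that of \<open>G\<close> with \<open>M \<circ>\<^sub>d G = F\<close>.
\<close>

definition obstruction_vanishes ::
    "'r ring \<Rightarrow> nat \<Rightarrow> ('r, ('r, 'a) univ) dgcat \<Rightarrow> ('r, ('r, 'a) univ) dgfun \<Rightarrow> bool" where
  "obstruction_vanishes R n A F \<longleftrightarrow>
     (\<exists>t M \<gamma> G. big_postnikov R n A t \<and> is_M R n A t M \<and> is_gamma R n A t \<gamma> \<and>
        G \<in> dg_hom R (Dom F) (Colim t) \<and> M \<circ>\<^sub>d G = F \<and>
        class_vanishes R n A F (obstruction_class R n A M \<gamma> G))"

text \<open>
  A run of the inductive construction, for \<open>A\<close> positively graded: \<open>F n\<close> is constructed for \<open>n < N\<close>,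
  where \<open>N\<close> may be \<open>\<infinity>\<close>, and if the process stops, then because the last one has no lift.
\<close>

definition lifting_process ::
    "'r ring \<Rightarrow> ('r, 'u) dgcat \<Rightarrow> ('r, 'u) dgcat \<Rightarrow> ('r, 'u) dgfun \<Rightarrow>
     enat \<Rightarrow> (nat \<Rightarrow> ('r, 'u) dgfun) \<Rightarrow> bool" where
  "lifting_process R A B F0 N F \<longleftrightarrow>
     0 < N \<and> F 0 = F0 \<and>
     (\<forall>n. enat n < N \<longrightarrow> F n \<in> dg_hom R B (small_postnikov n A)) \<and>
     (\<forall>n. enat (Suc n) < N \<longrightarrow> postnikov_step n A \<circ>\<^sub>d F (Suc n) = F n) \<and>
     (\<forall>n. N = enat (Suc n) \<longrightarrow>
        \<not> (\<exists>L\<in>dg_hom R B (small_postnikov (Suc n) A). postnikov_step n A \<circ>\<^sub>d L = F n))"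

definition is_lift ::
    "'r ring \<Rightarrow> ('r, 'u) dgcat \<Rightarrow> ('r, 'u) dgcat \<Rightarrow> ('r, 'u) dgfun \<Rightarrow> ('r, 'u) dgfun \<Rightarrow> bool" where
  "is_lift R A B F0 F \<longleftrightarrow>
     F \<in> dg_hom R B A \<and>
     (if positively_graded A then postnikov_proj 0 A \<circ>\<^sub>d F = F0
      else (\<exists>F'\<in>dg_hom R B (tau_ge0 A).
              tau_ge0_incl A \<circ>\<^sub>d F' = F \<and> postnikov_proj 0 (tau_ge0 A) \<circ>\<^sub>d F' = F0))"

end

theory Submission imports Defs begin

text \<open>
  Let \<open>X\<close> be the small Postnikov section \<open>\<tau>\<^sub>\<le>\<^sub>n A\<close> of a positively graded \<open>A\<close>, \<open>E = X \<ltimes> H\<^bsub>n+1\<^esub>(A)[n+2]\<close> and \<open>Z\<close> the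
  coskeleton of \<open>A\<close> in which every cycle of degree greater than \<open>n\<close> bounds uniquely.  By the latter
  property \<open>A \<rightarrow> Z\<close> extends to \<open>\<Gamma> : P\<^sub>n(A) \<rightarrow> Z\<close>, and \<open>\<gamma>\<^sub>n\<close> is the composite of \<open>\<Gamma>\<close> with an explicit
  fibration \<open>\<kappa> : Z \<rightarrow> E\<close>.  Zigzags over \<open>X\<close> act on homotopy classes of dg functors out of the cofibrant
  \<open>B\<close>, homotopies being dg functors to path categories; so, if the obstruction class of \<open>F\<^sub>n\<close> vanishes,
  \<open>\<gamma>\<^sub>n G = \<kappa> \<Gamma> G\<close> is homotopic to \<open>i f\<close> for some \<open>f : B \<rightarrow> X\<close>, where \<open>i : X \<rightarrow> E\<close> is the inclusion, and
  projecting to \<open>X\<close> shows that \<open>f\<close> is homotopic to \<open>F\<^sub>n\<close>.  Homotopy lifting along \<open>\<kappa>\<close> gives \<open>g : B \<rightarrow> Z\<close> with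
  \<open>\<kappa> g = i f\<close>.  This equation says that \<open>g\<close> sends degree \<open>n + 2\<close> to boundaries of \<open>A\<close>, so that \<open>g\<close> induces
  a lift of \<open>f\<close> to \<open>\<tau>\<^bsub>\<le>n+1\<^esub> A\<close>, and homotopy lifting along the fibration from there to \<open>X\<close> makes it a lift of
  \<open>F\<^sub>n\<close>.  Hence the process never stops.  In each degree the \<open>F\<^sub>n\<close> are eventually constant, and their
  limit is the required dg functor.
\<close>

section \<open>Modules and complexes\<close>

text \<open>\<open>P\<^sub>n(A)\<close> is given by a universal property, so nothing is computed
  inside it: dg functors out of it are built and compared cell by cell. \<open>Z\<close> serves as
  its rigid model, with the homology of \<open>A\<close> up to degree \<open>n\<close> and none
  above. In the pullback of \<open>\<kappa>\<close> along \<open>i\<close>, degree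
  \<open>n + 2\<close> consists of the boundaries among the cycles of degree \<open>n + 1\<close>;
  it therefore projects onto the small section of level \<open>n + 1\<close>. This is why a strict
  equation \<open>\<kappa> g = i f\<close> yields a lift, and why vanishing up to homotopy must be
  made strict by a fibration.

  The second obstacle is that equality in the homotopy category is a generated congruence of
  zigzags. It becomes usable only through an invariant, here the action on homotopy classes. That
  the generating relations preserve it amounts to bijectivity of quasi-equivalences on these
  classes; three surjective equivalences involving homotopy pullbacks supply this as well as
  homotopy lifting.

  The dg category axioms for the cells, for \<open>E\<close> and for the truncation of
  \<open>A\<close> are read off from dg functors that the given data contain.\<close>

lemma (in abelian_group) a_inv_zero [simp]: "\<ominus> \<zero> = \<zero>"
  by (rule minus_equality) simp_all

lemma (in abelian_group) diff_zero [simp]: "x \<in> carrier G \<Longrightarrow> x \<ominus> \<zero> = x"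
  by (simp add: minus_eq)

lemma (in abelian_group) diff_self [simp]: "x \<in> carrier G \<Longrightarrow> x \<ominus> x = \<zero>"
  by (simp add: minus_eq r_neg)

text \<open>
  Cancellation of opposite summands at a distance: the term order of \<open>algebra\<close> puts all negated
  summands last, so that they are in general not adjacent to their opposites.
\<close>

lemma (in abelian_group) distant_neg:
  assumes "x \<in> carrier G" "a \<in> carrier G" "b \<in> carrier G" "c \<in> carrier G" "d \<in> carrier G" "y \<in> carrier G"
  shows "x \<oplus> (a \<oplus> (\<ominus> x \<oplus> y)) = a \<oplus> y" "x \<oplus> (a \<oplus> \<ominus> x) = a"
    "x \<oplus> (a \<oplus> (b \<oplus> (\<ominus> x \<oplus> y))) = a \<oplus> (b \<oplus> y)" "x \<oplus> (a \<oplus> (b \<oplus> \<ominus> x)) = a \<oplus> b"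
    "x \<oplus> (a \<oplus> (b \<oplus> (c \<oplus> (\<ominus> x \<oplus> y)))) = a \<oplus> (b \<oplus> (c \<oplus> y))"
    "x \<oplus> (a \<oplus> (b \<oplus> (c \<oplus> \<ominus> x))) = a \<oplus> (b \<oplus> c)"
    "x \<oplus> (a \<oplus> (b \<oplus> (c \<oplus> (d \<oplus> (\<ominus> x \<oplus> y))))) = a \<oplus> (b \<oplus> (c \<oplus> (d \<oplus> y)))"
    "x \<oplus> (a \<oplus> (b \<oplus> (c \<oplus> (d \<oplus> \<ominus> x)))) = a \<oplus> (b \<oplus> (c \<oplus> d))"
proof -
  have 1: "x \<oplus> (a \<oplus> (\<ominus> x \<oplus> y)) = a \<oplus> y" if "a \<in> carrier G" "y \<in> carrier G" for a y
    using that assms(1) by (simp add: a_lcomm[of x a] r_neg2)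
  have 2: "x \<oplus> (a \<oplus> \<ominus> x) = a" if "a \<in> carrier G" for a
    using that assms(1) by (simp add: a_lcomm[of x a] r_neg)
  show "x \<oplus> (a \<oplus> (\<ominus> x \<oplus> y)) = a \<oplus> y" "x \<oplus> (a \<oplus> \<ominus> x) = a" using 1 2 assms by auto
  have 3: "x \<oplus> (a \<oplus> (b \<oplus> (\<ominus> x \<oplus> y))) = a \<oplus> (b \<oplus> y)" if "a \<in> carrier G" "b \<in> carrier G" "y \<in> carrier G" for a b y
    using that assms(1) 1[of "a \<oplus> b" y] by (simp add: a_assoc)
  have 4: "x \<oplus> (a \<oplus> (b \<oplus> \<ominus> x)) = a \<oplus> b" if "a \<in> carrier G" "b \<in> carrier G" for a b
    using that assms(1) 2[of "a \<oplus> b"] by (simp add: a_assoc)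
  show "x \<oplus> (a \<oplus> (b \<oplus> (\<ominus> x \<oplus> y))) = a \<oplus> (b \<oplus> y)" "x \<oplus> (a \<oplus> (b \<oplus> \<ominus> x)) = a \<oplus> b"
    using 3 4 assms by auto
  show "x \<oplus> (a \<oplus> (b \<oplus> (c \<oplus> (\<ominus> x \<oplus> y)))) = a \<oplus> (b \<oplus> (c \<oplus> y))"
    "x \<oplus> (a \<oplus> (b \<oplus> (c \<oplus> \<ominus> x))) = a \<oplus> (b \<oplus> c)"
    "x \<oplus> (a \<oplus> (b \<oplus> (c \<oplus> (d \<oplus> (\<ominus> x \<oplus> y))))) = a \<oplus> (b \<oplus> (c \<oplus> (d \<oplus> y)))"
    "x \<oplus> (a \<oplus> (b \<oplus> (c \<oplus> (d \<oplus> \<ominus> x)))) = a \<oplus> (b \<oplus> (c \<oplus> d))"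
    using 3[of "a \<oplus> b" c y] 4[of "a \<oplus> b" c] 3[of "a \<oplus> b" "c \<oplus> d" y] 4[of "a \<oplus> b" "c \<oplus> d"] assms
    by (simp_all add: a_assoc)
qed

text \<open>With these rules \<open>algebra\<close> proves equations between signed sums of
  morphisms of one degree, where no multiplication is available.\<close>

lemmas (in abelian_group) abelian_group_simprules
  [algebra add: abelian_group "zero G" "add G" "a_inv G" "a_minus G"] =
  a_closed zero_closed a_inv_closed minus_closed a_assoc l_zero l_neg a_comm minus_eq
  r_zero r_neg r_neg2 r_neg1 minus_add minus_minus a_inv_zero a_lcomm distant_neg

lemma (in abelian_group) minus_zero_iff:
  "x \<in> carrier G \<Longrightarrow> y \<in> carrier G \<Longrightarrow> x \<ominus> y = \<zero> \<longleftrightarrow> x = y"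
  by (metis a_inv_closed minus_equality minus_minus minus_eq r_neg)

lemma module_abelian_group: "Module.module R M \<Longrightarrow> abelian_group M"
  by (rule Module.module.axioms)

lemma module_cring: "Module.module R M \<Longrightarrow> cring R"
  by (rule Module.module.axioms)

lemma linear_mapI:
  assumes "\<And>x. x \<in> carrier M \<Longrightarrow> f x \<in> carrier N"
    and "\<And>x y. x \<in> carrier M \<Longrightarrow> y \<in> carrier M \<Longrightarrow> f (x \<oplus>\<^bsub>M\<^esub> y) = f x \<oplus>\<^bsub>N\<^esub> f y"
    and "\<And>r x. r \<in> carrier R \<Longrightarrow> x \<in> carrier M \<Longrightarrow> f (r \<odot>\<^bsub>M\<^esub> x) = r \<odot>\<^bsub>N\<^esub> f x"
  shows "linear_map R M N f"
  using assms by (auto simp: linear_map_def)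

lemma linear_map_closed: "linear_map R M N f \<Longrightarrow> x \<in> carrier M \<Longrightarrow> f x \<in> carrier N"
  by (auto simp: linear_map_def)

lemma linear_map_add:
  "linear_map R M N f \<Longrightarrow> x \<in> carrier M \<Longrightarrow> y \<in> carrier M \<Longrightarrow> f (x \<oplus>\<^bsub>M\<^esub> y) = f x \<oplus>\<^bsub>N\<^esub> f y"
  by (auto simp: linear_map_def)

lemma linear_map_smult:
  "linear_map R M N f \<Longrightarrow> r \<in> carrier R \<Longrightarrow> x \<in> carrier M \<Longrightarrow> f (r \<odot>\<^bsub>M\<^esub> x) = r \<odot>\<^bsub>N\<^esub> f x"
  by (auto simp: linear_map_def)

lemma linear_map_zero:
  assumes "Module.module R M" "Module.module R N" "linear_map R M N f"
  shows "f \<zero>\<^bsub>M\<^esub> = \<zero>\<^bsub>N\<^esub>"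
proof -
  interpret M: abelian_group M using assms(1) by (rule module_abelian_group)
  interpret N: abelian_group N using assms(2) by (rule module_abelian_group)
  have c: "f \<zero>\<^bsub>M\<^esub> \<in> carrier N" using assms(3) by (rule linear_map_closed) simp
  have "f \<zero>\<^bsub>M\<^esub> \<oplus>\<^bsub>N\<^esub> f \<zero>\<^bsub>M\<^esub> = f (\<zero>\<^bsub>M\<^esub> \<oplus>\<^bsub>M\<^esub> \<zero>\<^bsub>M\<^esub>)"
    by (rule linear_map_add[OF assms(3), symmetric]) auto
  then have "f \<zero>\<^bsub>M\<^esub> \<oplus>\<^bsub>N\<^esub> f \<zero>\<^bsub>M\<^esub> = f \<zero>\<^bsub>M\<^esub>" by simp
  then show ?thesis using c N.add.l_cancel_one' by metis
qed

lemma linear_map_inv: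
  assumes "Module.module R M" "Module.module R N" "linear_map R M N f" "x \<in> carrier M"
  shows "f (\<ominus>\<^bsub>M\<^esub> x) = \<ominus>\<^bsub>N\<^esub> f x"
proof -
  interpret M: abelian_group M using assms(1) by (rule module_abelian_group)
  interpret N: abelian_group N using assms(2) by (rule module_abelian_group)
  have "f (\<ominus>\<^bsub>M\<^esub> x) \<oplus>\<^bsub>N\<^esub> f x = f (\<ominus>\<^bsub>M\<^esub> x \<oplus>\<^bsub>M\<^esub> x)"
    by (rule linear_map_add[OF assms(3), symmetric]) (use assms in auto)
  also have "\<dots> = \<zero>\<^bsub>N\<^esub>" using assms by (simp add: M.l_neg linear_map_zero)
  finally show ?thesis
    using linear_map_closed[OF assms(3)] assms(4) by (metis M.a_inv_closed N.minus_equality)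
qed

lemma linear_map_minus:
  assumes "Module.module R M" "Module.module R N" "linear_map R M N f"
    "x \<in> carrier M" "y \<in> carrier M"
  shows "f (x \<ominus>\<^bsub>M\<^esub> y) = f x \<ominus>\<^bsub>N\<^esub> f y"
proof -
  interpret M: abelian_group M using assms(1) by (rule module_abelian_group)
  show ?thesis using assms
    by (simp add: a_minus_def linear_map_add[OF assms(3)] linear_map_inv[OF assms(1-3)])
qed

lemma linear_map_id: "linear_map R M M (\<lambda>x. x)"
  by (simp add: linear_map_def)

lemma linear_map_compose:
  "linear_map R M N f \<Longrightarrow> linear_map R N L g \<Longrightarrow> linear_map R M L (\<lambda>x. g (f x))"
  by (auto simp: linear_map_def Pi_iff)

lemma linear_map_cong:
  assumes "linear_map R M N f" "\<And>x. x \<in> carrier M \<Longrightarrow> f x = g x" "Module.module R M"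
  shows "linear_map R M N g"
proof -
  interpret M: Module.module R M by fact
  show ?thesis using assms(1,2) by (auto simp: linear_map_def Pi_iff)
qed

lemma linear_map_const_zero:
  assumes "Module.module R N" shows "linear_map R M N (\<lambda>x. \<zero>\<^bsub>N\<^esub>)"
proof -
  interpret N: Module.module R N by fact
  show ?thesis by (rule linear_mapI) (auto simp: N.smult_r_null)
qed

lemma linear_map_sum:
  assumes "Module.module R N" "linear_map R M N f" "linear_map R M N g"
  shows "linear_map R M N (\<lambda>x. f x \<oplus>\<^bsub>N\<^esub> g x)"
proof -
  interpret N: Module.module R N by fact
  note c = linear_map_closed[OF assms(2)] linear_map_closed[OF assms(3)]
  show ?thesis
    by (rule linear_mapI)
      (simp_all add: c linear_map_add[OF assms(2)] linear_map_add[OF assms(3)] N.a_ac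
        linear_map_smult[OF assms(2)] linear_map_smult[OF assms(3)] N.smult_r_distr)
qed

lemma linear_map_uminus:
  assumes "Module.module R N" "linear_map R M N f"
  shows "linear_map R M N (\<lambda>x. \<ominus>\<^bsub>N\<^esub> f x)"
proof -
  interpret N: Module.module R N by fact
  note c = linear_map_closed[OF assms(2)]
  show ?thesis
    by (rule linear_mapI)
      (simp_all add: c linear_map_add[OF assms(2)] N.minus_add
        linear_map_smult[OF assms(2)] N.smult_r_minus)
qed

lemma linear_map_diff:
  assumes "Module.module R N" "linear_map R M N f" "linear_map R M N g"
  shows "linear_map R M N (\<lambda>x. f x \<ominus>\<^bsub>N\<^esub> g x)"
  unfolding a_minus_def by (intro linear_map_sum linear_map_uminus assms)

lemma linear_map_koszul:
  assumes "Module.module R N" "linear_map R M N f"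
  shows "linear_map R M N (\<lambda>x. koszul N i (f x))"
  using assms linear_map_uminus[OF assms] by (cases "even i") simp_all

text \<open>The module axioms are equations and pass along a surjection that respects the
  operations. The zero has to be matched separately because \<open>N\<close> is not yet known to be
  a group. This provides the module structure on quotients whose elements are chosen
  representatives.\<close>

lemma module_transport:
  assumes M: "Module.module R M" and lin: "linear_map R M N f"
    and surj: "f ` carrier M = carrier N" and zero: "f \<zero>\<^bsub>M\<^esub> = \<zero>\<^bsub>N\<^esub>"
  shows "Module.module R N"
proof -
  interpret M: Module.module R M by fact
  note add = linear_map_add[OF lin, symmetric] and smult = linear_map_smult[OF lin, symmetric]
  have ex: "\<exists>x\<in>carrier M. y = f x" if "y \<in> carrier N" for y using surj that by blast
  have cl: "f x \<in> carrier N" if "x \<in> carrier M" for x using surj that by blast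
  show ?thesis
  proof (rule moduleI)
    show "cring R" using M by (rule module_cring)
    show "abelian_group N"
    proof (rule abelian_groupI)
      fix x y assume xy: "x \<in> carrier N" "y \<in> carrier N"
      obtain a b where ab: "a \<in> carrier M" "b \<in> carrier M" "x = f a" "y = f b"
        using xy ex by metis
      show "x \<oplus>\<^bsub>N\<^esub> y \<in> carrier N" using ab cl by (simp add: add)
      show "x \<oplus>\<^bsub>N\<^esub> y = y \<oplus>\<^bsub>N\<^esub> x" using ab by (simp add: add M.a_comm)
      show "\<zero>\<^bsub>N\<^esub> \<oplus>\<^bsub>N\<^esub> x = x" using ab by (simp add: add zero[symmetric])
      show "\<exists>y\<in>carrier N. y \<oplus>\<^bsub>N\<^esub> x = \<zero>\<^bsub>N\<^esub>"
        by (rule bexI[of _ "f (\<ominus>\<^bsub>M\<^esub> a)"]) (use ab cl in \<open>simp_all add: add M.l_neg zero\<close>)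
    next
      fix x y z assume xyz: "x \<in> carrier N" "y \<in> carrier N" "z \<in> carrier N"
      obtain a b c where "a \<in> carrier M" "b \<in> carrier M" "c \<in> carrier M" "x = f a" "y = f b" "z = f c"
        using xyz ex by metis
      then show "x \<oplus>\<^bsub>N\<^esub> y \<oplus>\<^bsub>N\<^esub> z = x \<oplus>\<^bsub>N\<^esub> (y \<oplus>\<^bsub>N\<^esub> z)" by (simp add: add M.a_assoc)
    next
      show "\<zero>\<^bsub>N\<^esub> \<in> carrier N" using cl by (metis zero M.zero_closed)
    qed
  next
    fix x assume "x \<in> carrier N"
    then show "\<one>\<^bsub>R\<^esub> \<odot>\<^bsub>N\<^esub> x = x" using ex[of x] by (auto simp: smult)
  next
    fix r x assume rx: "r \<in> carrier R" "x \<in> carrier N"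
    obtain a where a: "a \<in> carrier M" "x = f a" using rx ex by metis
    show "r \<odot>\<^bsub>N\<^esub> x \<in> carrier N" using a rx cl by (simp add: smult)
    { fix s assume s: "s \<in> carrier R"
      show "(r \<oplus>\<^bsub>R\<^esub> s) \<odot>\<^bsub>N\<^esub> x = r \<odot>\<^bsub>N\<^esub> x \<oplus>\<^bsub>N\<^esub> s \<odot>\<^bsub>N\<^esub> x"
        using a rx s by (simp add: smult add M.smult_l_distr)
      show "(r \<otimes>\<^bsub>R\<^esub> s) \<odot>\<^bsub>N\<^esub> x = r \<odot>\<^bsub>N\<^esub> (s \<odot>\<^bsub>N\<^esub> x)"
        using a rx s by (simp add: smult M.smult_assoc1) }
    { fix y assume "y \<in> carrier N"
      then obtain b where b: "b \<in> carrier M" "y = f b" using ex by metis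
      show "r \<odot>\<^bsub>N\<^esub> (x \<oplus>\<^bsub>N\<^esub> y) = r \<odot>\<^bsub>N\<^esub> x \<oplus>\<^bsub>N\<^esub> r \<odot>\<^bsub>N\<^esub> y"
        using a b rx by (simp add: smult add M.smult_r_distr) }
  qed
qed

lemma module_subset:
  assumes M: "Module.module R M" and S: "S \<subseteq> carrier M" "\<zero>\<^bsub>M\<^esub> \<in> S"
    and add: "\<And>x y. x \<in> S \<Longrightarrow> y \<in> S \<Longrightarrow> x \<oplus>\<^bsub>M\<^esub> y \<in> S"
    and inv: "\<And>x. x \<in> S \<Longrightarrow> \<ominus>\<^bsub>M\<^esub> x \<in> S"
    and smult: "\<And>r x. r \<in> carrier R \<Longrightarrow> x \<in> S \<Longrightarrow> r \<odot>\<^bsub>M\<^esub> x \<in> S"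
  shows "Module.module R (M\<lparr>carrier := S\<rparr>)"
proof -
  interpret M: Module.module R M by fact
  have c: "x \<in> carrier M" if "x \<in> S" for x using that S by blast
  show ?thesis
  proof (rule moduleI)
    show "cring R" using M by (rule module_cring)
    show "abelian_group (M\<lparr>carrier := S\<rparr>)"
      by (rule abelian_groupI)
        (use S c add inv in \<open>auto simp: M.a_ac intro!: bexI[of _ "\<ominus>\<^bsub>M\<^esub> _"] M.r_neg\<close>)
  qed (use c smult in \<open>auto simp: M.smult_l_distr M.smult_r_distr M.smult_assoc1\<close>)
qed

lemma module_zero_module:
  assumes "Module.module R M" shows "Module.module R (zero_module M)"
proof -
  interpret M: Module.module R M by fact
  show ?thesis unfolding zero_module_def
    by (rule module_subset[OF assms]) (auto simp: M.smult_r_null)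
qed

lemma zero_module_simps [simp]:
  "carrier (zero_module M) = {\<zero>\<^bsub>M\<^esub>}" "\<zero>\<^bsub>zero_module M\<^esub> = \<zero>\<^bsub>M\<^esub>"
  "x \<oplus>\<^bsub>zero_module M\<^esub> y = x \<oplus>\<^bsub>M\<^esub> y" "r \<odot>\<^bsub>zero_module M\<^esub> x = r \<odot>\<^bsub>M\<^esub> x"
  by (simp_all add: zero_module_def)

lemma direct_sum_module_simps [simp]:
  "UPair x v \<in> carrier (direct_sum_module M N) \<longleftrightarrow> x \<in> carrier M \<and> v \<in> carrier N"
  "\<zero>\<^bsub>direct_sum_module M N\<^esub> = UPair \<zero>\<^bsub>M\<^esub> \<zero>\<^bsub>N\<^esub>"
  "p \<oplus>\<^bsub>direct_sum_module M N\<^esub> q = UPair (ufst p \<oplus>\<^bsub>M\<^esub> ufst q) (usnd p \<oplus>\<^bsub>N\<^esub> usnd q)"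
  "r \<odot>\<^bsub>direct_sum_module M N\<^esub> p = UPair (r \<odot>\<^bsub>M\<^esub> ufst p) (r \<odot>\<^bsub>N\<^esub> usnd p)"
  by (simp_all add: direct_sum_module_def)

lemma direct_sum_moduleE:
  assumes "p \<in> carrier (direct_sum_module M N)"
  obtains x v where "p = UPair x v" "x \<in> carrier M" "v \<in> carrier N"
  using assms by (auto simp: direct_sum_module_def)

lemma module_direct_sum:
  assumes "Module.module R M" "Module.module R N"
  shows "Module.module R (direct_sum_module M N)"
proof -
  interpret M: Module.module R M by fact
  interpret N: Module.module R N by fact
  show ?thesis
  proof (rule moduleI)
    show "cring R" using assms(1) by (rule module_cring)
    show "abelian_group (direct_sum_module M N)"
    proof (rule abelian_groupI)
      fix x assume "x \<in> carrier (direct_sum_module M N)"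
      then obtain a b where "x = UPair a b" "a \<in> carrier M" "b \<in> carrier N"
        by (rule direct_sum_moduleE)
      then show "\<exists>y\<in>carrier (direct_sum_module M N). y \<oplus>\<^bsub>direct_sum_module M N\<^esub> x = \<zero>\<^bsub>direct_sum_module M N\<^esub>"
        by (intro bexI[of _ "UPair (\<ominus>\<^bsub>M\<^esub> a) (\<ominus>\<^bsub>N\<^esub> b)"]) (auto simp: M.l_neg N.l_neg)
    qed (auto elim!: direct_sum_moduleE simp: M.a_ac N.a_ac)
  qed (auto elim!: direct_sum_moduleE simp: M.smult_l_distr M.smult_r_distr M.smult_assoc1
        N.smult_l_distr N.smult_r_distr N.smult_assoc1)
qed

lemma direct_sum_inv:
  assumes "Module.module R M" "Module.module R N" "x \<in> carrier M" "v \<in> carrier N"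
  shows "\<ominus>\<^bsub>direct_sum_module M N\<^esub> UPair x v = UPair (\<ominus>\<^bsub>M\<^esub> x) (\<ominus>\<^bsub>N\<^esub> v)"
proof -
  interpret M: Module.module R M by fact
  interpret N: Module.module R N by fact
  interpret S: Module.module R "direct_sum_module M N" by (rule module_direct_sum) fact+
  show ?thesis using assms(3,4)
    by (intro S.minus_equality) (auto simp: M.l_neg N.l_neg)
qed

lemma linear_map_pair:
  assumes "linear_map R L M f" "linear_map R L N g"
  shows "linear_map R L (direct_sum_module M N) (\<lambda>x. UPair (f x) (g x))"
  using assms by (auto simp: linear_map_def Pi_iff)

lemma linear_map_ufst: "linear_map R (direct_sum_module M N) M ufst"
  by (auto simp: linear_map_def elim!: direct_sum_moduleE)

lemma linear_map_usnd: "linear_map R (direct_sum_module M N) N usnd"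
  by (auto simp: linear_map_def elim!: direct_sum_moduleE)

section \<open>Chain complexes, boundaries and chosen homology classes\<close>

lemma complex_module: "chain_complex R M \<Longrightarrow> Module.module R (Gr M i)"
  by (simp add: chain_complex_def)

lemma complex_linear: "chain_complex R M \<Longrightarrow> linear_map R (Gr M i) (Gr M (i - 1)) (Dif M i)"
  by (simp add: chain_complex_def)

lemma complex_dif_dif:
  "chain_complex R M \<Longrightarrow> x \<in> carrier (Gr M i) \<Longrightarrow> j = i - 1 \<Longrightarrow> k = i - 2 \<Longrightarrow>
   Dif M j (Dif M i x) = \<zero>\<^bsub>Gr M k\<^esub>"
  by (simp add: chain_complex_def)

lemma chain_complexI:
  assumes "\<And>i. Module.module R (Gr M i)"
    and "\<And>i. linear_map R (Gr M i) (Gr M (i - 1)) (Dif M i)"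
    and "\<And>i x. x \<in> carrier (Gr M i) \<Longrightarrow> Dif M (i - 1) (Dif M i x) = \<zero>\<^bsub>Gr M (i - 2)\<^esub>"
  shows "chain_complex R M"
  using assms by (simp add: chain_complex_def)

text \<open>The relation behind \<open>hclass\<close>: quotients consist of chosen representatives,
  and statements about classes are reduced to this relation by \<open>hclass_eq_iff\<close>.\<close>

definition homologous :: "('r, 'u) complex \<Rightarrow> int \<Rightarrow> 'u \<Rightarrow> 'u \<Rightarrow> bool" where
  "homologous M i x y \<longleftrightarrow> (\<exists>w\<in>carrier (Gr M (i + 1)). x \<ominus>\<^bsub>Gr M i\<^esub> y = Dif M (i + 1) w)"

lemma quot_class_cong: "N +>\<^bsub>M\<^esub> x = N +>\<^bsub>M\<^esub> y \<Longrightarrow> quot_class M N x = quot_class M N y"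
  by (simp add: quot_class_def)

context
  fixes R :: "'r ring" and M :: "('r, 'u) complex" and i :: int
  assumes M: "chain_complex R M"
begin

interpretation Mi: Module.module R "Gr M i" by (rule complex_module[OF M])
interpretation Ms: Module.module R "Gr M (i + 1)" by (rule complex_module[OF M])

lemma boundary_linear: "linear_map R (Gr M (i + 1)) (Gr M i) (Dif M (i + 1))"
  using complex_linear[OF M, of "i + 1"] by simp

lemma boundaries_subset: "boundaries M i \<subseteq> carrier (Gr M i)"
  using linear_map_closed[OF boundary_linear] by (auto simp: boundaries_def)

lemma boundaries_zero: "\<zero>\<^bsub>Gr M i\<^esub> \<in> boundaries M i"
  unfolding boundaries_def
  by (rule image_eqI[of _ _ "\<zero>\<^bsub>Gr M (i+1)\<^esub>"])
    (simp_all add: linear_map_zero[OF Ms.module_axioms Mi.module_axioms boundary_linear])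

lemma boundaries_add:
  "x \<in> boundaries M i \<Longrightarrow> y \<in> boundaries M i \<Longrightarrow> x \<oplus>\<^bsub>Gr M i\<^esub> y \<in> boundaries M i"
  unfolding boundaries_def
  by (auto simp: linear_map_add[OF boundary_linear, symmetric])

lemma boundaries_inv: "x \<in> boundaries M i \<Longrightarrow> \<ominus>\<^bsub>Gr M i\<^esub> x \<in> boundaries M i"
  unfolding boundaries_def
  by (auto simp: linear_map_inv[OF Ms.module_axioms Mi.module_axioms boundary_linear, symmetric])

lemma boundaries_smult:
  "r \<in> carrier R \<Longrightarrow> x \<in> boundaries M i \<Longrightarrow> r \<odot>\<^bsub>Gr M i\<^esub> x \<in> boundaries M i"
  unfolding boundaries_def
  by (auto simp: linear_map_smult[OF boundary_linear, symmetric])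

lemma boundaries_cycles: "boundaries M i \<subseteq> cycles M i"
  using boundaries_subset complex_dif_dif[OF M, of _ "i + 1" i "i - 1"]
  by (auto simp: boundaries_def cycles_def)

lemma homologous_boundaries: "homologous M i x y \<longleftrightarrow> x \<ominus>\<^bsub>Gr M i\<^esub> y \<in> boundaries M i"
  by (auto simp: homologous_def boundaries_def)

lemma homologous_refl: "x \<in> carrier (Gr M i) \<Longrightarrow> homologous M i x x"
  using boundaries_zero by (simp add: homologous_boundaries Mi.r_neg a_minus_def)

lemma homologous_sym:
  "x \<in> carrier (Gr M i) \<Longrightarrow> y \<in> carrier (Gr M i) \<Longrightarrow> homologous M i x y \<Longrightarrow> homologous M i y x"
proof -
  assume a: "x \<in> carrier (Gr M i)" "y \<in> carrier (Gr M i)" "homologous M i x y"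
  have "y \<ominus>\<^bsub>Gr M i\<^esub> x = \<ominus>\<^bsub>Gr M i\<^esub> (x \<ominus>\<^bsub>Gr M i\<^esub> y)" using a by algebra
  with a boundaries_inv show ?thesis by (simp add: homologous_boundaries)
qed

lemma homologous_trans:
  "x \<in> carrier (Gr M i) \<Longrightarrow> y \<in> carrier (Gr M i) \<Longrightarrow> z \<in> carrier (Gr M i) \<Longrightarrow>
   homologous M i x y \<Longrightarrow> homologous M i y z \<Longrightarrow> homologous M i x z"
proof -
  assume a: "x \<in> carrier (Gr M i)" "y \<in> carrier (Gr M i)" "z \<in> carrier (Gr M i)"
    "homologous M i x y" "homologous M i y z"
  have "x \<ominus>\<^bsub>Gr M i\<^esub> z = (x \<ominus>\<^bsub>Gr M i\<^esub> y) \<oplus>\<^bsub>Gr M i\<^esub> (y \<ominus>\<^bsub>Gr M i\<^esub> z)"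
    using a(1-3) by algebra
  with a boundaries_add show ?thesis by (simp add: homologous_boundaries)
qed

lemma coset_boundaries:
  "y \<in> boundaries M i +>\<^bsub>Gr M i\<^esub> x \<longleftrightarrow> y \<in> carrier (Gr M i) \<and> homologous M i y x"
  if "x \<in> carrier (Gr M i)"
proof
  assume "y \<in> boundaries M i +>\<^bsub>Gr M i\<^esub> x"
  then obtain h where h: "h \<in> boundaries M i" "y = h \<oplus>\<^bsub>Gr M i\<^esub> x"
    by (auto simp: a_r_coset_def r_coset_def)
  then have hc: "h \<in> carrier (Gr M i)" using boundaries_subset by blast
  have "h \<oplus>\<^bsub>Gr M i\<^esub> x \<ominus>\<^bsub>Gr M i\<^esub> x = h" using that hc by algebra
  then show "y \<in> carrier (Gr M i) \<and> homologous M i y x"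
    using h hc that by (simp add: homologous_boundaries)
next
  assume y: "y \<in> carrier (Gr M i) \<and> homologous M i y x"
  then have "y \<in> carrier (Gr M i)" by simp
  with that have "y = (y \<ominus>\<^bsub>Gr M i\<^esub> x) \<oplus>\<^bsub>Gr M i\<^esub> x" by algebra
  with y show "y \<in> boundaries M i +>\<^bsub>Gr M i\<^esub> x"
    by (auto simp: a_r_coset_def r_coset_def homologous_boundaries)
qed

lemma hclass_homologous:
  assumes "x \<in> carrier (Gr M i)"
  shows "hclass M i x \<in> carrier (Gr M i)" "homologous M i (hclass M i x) x"
proof -
  have "x \<in> boundaries M i +>\<^bsub>Gr M i\<^esub> x"
    using assms coset_boundaries homologous_refl by blast
  then have "hclass M i x \<in> boundaries M i +>\<^bsub>Gr M i\<^esub> x"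
    unfolding hclass_def quot_class_def by (rule someI)
  then show "hclass M i x \<in> carrier (Gr M i)" "homologous M i (hclass M i x) x"
    using coset_boundaries[OF assms] by auto
qed

text \<open>The chosen element lies in the coset, and equal cosets lead to equal choices.\<close>

lemma hclass_eq_iff:
  assumes "x \<in> carrier (Gr M i)" "y \<in> carrier (Gr M i)"
  shows "hclass M i x = hclass M i y \<longleftrightarrow> homologous M i x y"
proof
  assume "hclass M i x = hclass M i y"
  then show "homologous M i x y"
    using hclass_homologous assms homologous_sym homologous_trans by metis
next
  assume "homologous M i x y"
  then have "z \<in> boundaries M i +>\<^bsub>Gr M i\<^esub> x \<longleftrightarrow> z \<in> boundaries M i +>\<^bsub>Gr M i\<^esub> y" for z
    using coset_boundaries[OF assms(1), of z] coset_boundaries[OF assms(2), of z]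
      homologous_sym[OF assms] homologous_trans[OF _ assms, of z]
      homologous_trans[OF _ assms(2) assms(1), of z] by blast
  then have "boundaries M i +>\<^bsub>Gr M i\<^esub> x = boundaries M i +>\<^bsub>Gr M i\<^esub> y" by blast
  then show "hclass M i x = hclass M i y"
    unfolding hclass_def by (rule quot_class_cong)
qed

lemma hclass_idem: "x \<in> carrier (Gr M i) \<Longrightarrow> hclass M i (hclass M i x) = hclass M i x"
  using hclass_homologous hclass_eq_iff by metis

text \<open>The zero of a quotient is the representative chosen in the coset of zero, which may
  differ from zero; hence the comparison with the class of zero.\<close>

lemma hclass_boundary_iff:
  "x \<in> carrier (Gr M i) \<Longrightarrow> hclass M i x = hclass M i \<zero>\<^bsub>Gr M i\<^esub> \<longleftrightarrow> x \<in> boundaries M i"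
  by (simp add: hclass_eq_iff homologous_boundaries)

lemma homologous_cycle:
  assumes "x \<in> carrier (Gr M i)" "y \<in> cycles M i" "homologous M i x y"
  shows "x \<in> cycles M i"
proof -
  interpret Mp: Module.module R "Gr M (i - 1)" by (rule complex_module[OF M])
  have y: "y \<in> carrier (Gr M i)" using assms by (simp add: cycles_def)
  have "x \<ominus>\<^bsub>Gr M i\<^esub> y \<in> cycles M i"
    using assms boundaries_cycles homologous_boundaries by blast
  then have "Dif M i x \<ominus>\<^bsub>Gr M (i - 1)\<^esub> Dif M i y = \<zero>\<^bsub>Gr M (i - 1)\<^esub>"
    using linear_map_minus[OF Mi.module_axioms Mp.module_axioms complex_linear[OF M]] assms(1) y
    by (simp add: cycles_def)
  then show ?thesis
    using assms linear_map_closed[OF complex_linear[OF M]]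
    by (simp add: cycles_def)
qed

lemma hclass_cycle: "x \<in> cycles M i \<Longrightarrow> hclass M i x \<in> cycles M i"
  using homologous_cycle hclass_homologous by (simp add: cycles_def)

lemma homology_carrier: "carrier (homology M i) = hclass M i ` cycles M i"
proof -
  \<comment> \<open>A coset is formed with the addition alone, so restricting the carrier to the
    cycles does not affect the choice.\<close>
  have "quot_class (Gr M i\<lparr>carrier := S\<rparr>) = quot_class (Gr M i)" for S and N :: "'u set"
    by (intro ext) (simp add: quot_class_def a_r_coset_def r_coset_def)
  then show ?thesis by (simp add: homology_def quot_module_def hclass_def)
qed

lemma homology_rep: "z \<in> carrier (homology M i) \<longleftrightarrow> z \<in> cycles M i \<and> hclass M i z = z"
  unfolding homology_carrier using hclass_cycle hclass_idem by (auto simp: cycles_def image_iff)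

end

section \<open>Calculus in dg categories\<close>

context dg_category
begin

lemma hom_module: "x \<in> Obj A \<Longrightarrow> y \<in> Obj A \<Longrightarrow> Module.module R (HomGr A x y i)"
  using hom_complex by (rule complex_module)

lemma hom_group: "x \<in> Obj A \<Longrightarrow> y \<in> Obj A \<Longrightarrow> abelian_group (HomGr A x y i)"
  using hom_module by (rule module_abelian_group)

lemma dif_linear: "x \<in> Obj A \<Longrightarrow> y \<in> Obj A \<Longrightarrow>
    linear_map R (HomGr A x y i) (HomGr A x y (i - 1)) (Dif (Hom A x y) i)"
  using hom_complex by (rule complex_linear)

lemma mor_zero: "x \<in> Obj A \<Longrightarrow> y \<in> Obj A \<Longrightarrow> \<zero>\<^bsub>HomGr A x y i\<^esub> \<in> Mor A x y i"
  using abelian_group.a_inv_closed hom_group abelian_groupE(2) by metis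

lemma mor_add: "x \<in> Obj A \<Longrightarrow> y \<in> Obj A \<Longrightarrow> f \<in> Mor A x y i \<Longrightarrow> g \<in> Mor A x y i \<Longrightarrow>
    f \<oplus>\<^bsub>HomGr A x y i\<^esub> g \<in> Mor A x y i"
  using hom_group abelian_groupE(1) by metis

lemma mor_inv: "x \<in> Obj A \<Longrightarrow> y \<in> Obj A \<Longrightarrow> f \<in> Mor A x y i \<Longrightarrow> \<ominus>\<^bsub>HomGr A x y i\<^esub> f \<in> Mor A x y i"
  using hom_group abelian_group.a_inv_closed by metis

lemma mor_minus: "x \<in> Obj A \<Longrightarrow> y \<in> Obj A \<Longrightarrow> f \<in> Mor A x y i \<Longrightarrow> g \<in> Mor A x y i \<Longrightarrow>
    f \<ominus>\<^bsub>HomGr A x y i\<^esub> g \<in> Mor A x y i"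
  by (simp add: a_minus_def mor_inv mor_add)

lemma mor_smult: "x \<in> Obj A \<Longrightarrow> y \<in> Obj A \<Longrightarrow> f \<in> Mor A x y i \<Longrightarrow> r \<in> carrier R \<Longrightarrow>
    r \<odot>\<^bsub>HomGr A x y i\<^esub> f \<in> Mor A x y i"
  using hom_module Module.module.smult_closed by metis

lemma dif_closed: "x \<in> Obj A \<Longrightarrow> y \<in> Obj A \<Longrightarrow> f \<in> Mor A x y i \<Longrightarrow> k = i - 1 \<Longrightarrow>
    Dif (Hom A x y) i f \<in> Mor A x y k"
  using linear_map_closed[OF dif_linear] by blast

lemma comp_closed: "x \<in> Obj A \<Longrightarrow> y \<in> Obj A \<Longrightarrow> z \<in> Obj A \<Longrightarrow> g \<in> Mor A y z i \<Longrightarrow>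
    f \<in> Mor A x y j \<Longrightarrow> k = i + j \<Longrightarrow> Comp A x y z i j g f \<in> Mor A x z k"
  using linear_map_closed[OF comp_linear_right] by blast

lemma ident_closed: "x \<in> Obj A \<Longrightarrow> Ident A x \<in> Mor A x x 0"
  using ident_cycle by (simp add: cycles_def)

lemma dif_ident: "x \<in> Obj A \<Longrightarrow> Dif (Hom A x x) 0 (Ident A x) = \<zero>\<^bsub>HomGr A x x (-1)\<^esub>"
  using ident_cycle[of x] by (simp add: cycles_def)

lemma cycle_closed: "f \<in> cycles (Hom A x y) i \<Longrightarrow> f \<in> Mor A x y i"
  by (simp add: cycles_def)

lemmas mor_closed = mor_zero mor_add mor_inv mor_minus mor_smult dif_closed comp_closed ident_closed

lemma dif_dif: "x \<in> Obj A \<Longrightarrow> y \<in> Obj A \<Longrightarrow> f \<in> Mor A x y i \<Longrightarrow> j = i - 1 \<Longrightarrow>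
    Dif (Hom A x y) j (Dif (Hom A x y) i f) = \<zero>\<^bsub>HomGr A x y (i - 2)\<^esub>"
  using complex_dif_dif[OF hom_complex] by blast

lemma dif_cycle: "x \<in> Obj A \<Longrightarrow> y \<in> Obj A \<Longrightarrow> f \<in> Mor A x y i \<Longrightarrow> j = i - 1 \<Longrightarrow>
    Dif (Hom A x y) i f \<in> cycles (Hom A x y) j"
  by (auto simp: cycles_def dif_dif intro: dif_closed)

lemma dif_zero: "x \<in> Obj A \<Longrightarrow> y \<in> Obj A \<Longrightarrow>
    Dif (Hom A x y) i \<zero>\<^bsub>HomGr A x y i\<^esub> = \<zero>\<^bsub>HomGr A x y (i - 1)\<^esub>"
  by (rule linear_map_zero[OF hom_module hom_module dif_linear])

lemma dif_add: "x \<in> Obj A \<Longrightarrow> y \<in> Obj A \<Longrightarrow> f \<in> Mor A x y i \<Longrightarrow> g \<in> Mor A x y i \<Longrightarrow>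
    Dif (Hom A x y) i (f \<oplus>\<^bsub>HomGr A x y i\<^esub> g) =
    Dif (Hom A x y) i f \<oplus>\<^bsub>HomGr A x y (i - 1)\<^esub> Dif (Hom A x y) i g"
  using dif_linear by (rule linear_map_add)

lemma dif_inv: "x \<in> Obj A \<Longrightarrow> y \<in> Obj A \<Longrightarrow> f \<in> Mor A x y i \<Longrightarrow>
    Dif (Hom A x y) i (\<ominus>\<^bsub>HomGr A x y i\<^esub> f) = \<ominus>\<^bsub>HomGr A x y (i - 1)\<^esub> Dif (Hom A x y) i f"
  by (rule linear_map_inv[OF hom_module hom_module dif_linear])

lemma dif_minus: "x \<in> Obj A \<Longrightarrow> y \<in> Obj A \<Longrightarrow> f \<in> Mor A x y i \<Longrightarrow> g \<in> Mor A x y i \<Longrightarrow>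
    Dif (Hom A x y) i (f \<ominus>\<^bsub>HomGr A x y i\<^esub> g) =
    Dif (Hom A x y) i f \<ominus>\<^bsub>HomGr A x y (i - 1)\<^esub> Dif (Hom A x y) i g"
  by (rule linear_map_minus[OF hom_module hom_module dif_linear])

context
  fixes x y z :: 'u and i j :: int
  assumes obj: "x \<in> Obj A" "y \<in> Obj A" "z \<in> Obj A"
begin

lemma comp_zero_right: "g \<in> Mor A y z i \<Longrightarrow>
    Comp A x y z i j g \<zero>\<^bsub>HomGr A x y j\<^esub> = \<zero>\<^bsub>HomGr A x z (i + j)\<^esub>"
  by (rule linear_map_zero[OF hom_module hom_module comp_linear_right]) (use obj in auto)

lemma comp_zero_left: "f \<in> Mor A x y j \<Longrightarrow>
    Comp A x y z i j \<zero>\<^bsub>HomGr A y z i\<^esub> f = \<zero>\<^bsub>HomGr A x z (i + j)\<^esub>"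
  by (rule linear_map_zero[OF hom_module hom_module comp_linear_left]) (use obj in auto)

lemma comp_add_right: "g \<in> Mor A y z i \<Longrightarrow> f \<in> Mor A x y j \<Longrightarrow> f' \<in> Mor A x y j \<Longrightarrow>
    Comp A x y z i j g (f \<oplus>\<^bsub>HomGr A x y j\<^esub> f') =
    Comp A x y z i j g f \<oplus>\<^bsub>HomGr A x z (i + j)\<^esub> Comp A x y z i j g f'"
  using comp_linear_right obj by (intro linear_map_add) auto

lemma comp_add_left: "f \<in> Mor A x y j \<Longrightarrow> g \<in> Mor A y z i \<Longrightarrow> g' \<in> Mor A y z i \<Longrightarrow>
    Comp A x y z i j (g \<oplus>\<^bsub>HomGr A y z i\<^esub> g') f =
    Comp A x y z i j g f \<oplus>\<^bsub>HomGr A x z (i + j)\<^esub> Comp A x y z i j g' f"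
  by (rule linear_map_add[OF comp_linear_left]) (use obj in auto)

lemma comp_inv_right: "g \<in> Mor A y z i \<Longrightarrow> f \<in> Mor A x y j \<Longrightarrow>
    Comp A x y z i j g (\<ominus>\<^bsub>HomGr A x y j\<^esub> f) = \<ominus>\<^bsub>HomGr A x z (i + j)\<^esub> Comp A x y z i j g f"
  by (rule linear_map_inv[OF hom_module hom_module comp_linear_right]) (use obj in auto)

lemma comp_inv_left: "f \<in> Mor A x y j \<Longrightarrow> g \<in> Mor A y z i \<Longrightarrow>
    Comp A x y z i j (\<ominus>\<^bsub>HomGr A y z i\<^esub> g) f = \<ominus>\<^bsub>HomGr A x z (i + j)\<^esub> Comp A x y z i j g f"
  by (rule linear_map_inv[OF hom_module hom_module comp_linear_left]) (use obj in auto)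

lemma comp_minus_right: "g \<in> Mor A y z i \<Longrightarrow> f \<in> Mor A x y j \<Longrightarrow> f' \<in> Mor A x y j \<Longrightarrow>
    Comp A x y z i j g (f \<ominus>\<^bsub>HomGr A x y j\<^esub> f') =
    Comp A x y z i j g f \<ominus>\<^bsub>HomGr A x z (i + j)\<^esub> Comp A x y z i j g f'"
  by (rule linear_map_minus[OF hom_module hom_module comp_linear_right]) (use obj in auto)

lemma comp_minus_left: "f \<in> Mor A x y j \<Longrightarrow> g \<in> Mor A y z i \<Longrightarrow> g' \<in> Mor A y z i \<Longrightarrow>
    Comp A x y z i j (g \<ominus>\<^bsub>HomGr A y z i\<^esub> g') f =
    Comp A x y z i j g f \<ominus>\<^bsub>HomGr A x z (i + j)\<^esub> Comp A x y z i j g' f"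
  by (rule linear_map_minus[OF hom_module hom_module comp_linear_left]) (use obj in auto)

lemma comp_smult_right: "g \<in> Mor A y z i \<Longrightarrow> f \<in> Mor A x y j \<Longrightarrow> r \<in> carrier R \<Longrightarrow>
    Comp A x y z i j g (r \<odot>\<^bsub>HomGr A x y j\<^esub> f) = r \<odot>\<^bsub>HomGr A x z (i + j)\<^esub> Comp A x y z i j g f"
  using linear_map_smult[OF comp_linear_right] obj by blast

lemma comp_smult_left: "f \<in> Mor A x y j \<Longrightarrow> g \<in> Mor A y z i \<Longrightarrow> r \<in> carrier R \<Longrightarrow>
    Comp A x y z i j (r \<odot>\<^bsub>HomGr A y z i\<^esub> g) f = r \<odot>\<^bsub>HomGr A x z (i + j)\<^esub> Comp A x y z i j g f"
  using linear_map_smult[OF comp_linear_left] obj by blast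

end

section \<open>Products of cycles and boundaries\<close>

lemma dif_comp_cycle_left:
  assumes obj: "x \<in> Obj A" "y \<in> Obj A" "z \<in> Obj A"
    and "g \<in> cycles (Hom A y z) i" "f \<in> Mor A x y j"
  shows "Dif (Hom A x z) (i + j) (Comp A x y z i j g f) =
    koszul (HomGr A x z (i + j - 1)) i (Comp A x y z i (j - 1) g (Dif (Hom A x y) j f))"
proof -
  interpret M: abelian_group "HomGr A x z (i + j - 1)" using obj hom_group by blast
  interpret y: Module.module R "HomGr A y z (i - 1)" using obj hom_module by blast
  have g: "g \<in> Mor A y z i" "Dif (Hom A y z) i g = \<zero>\<^bsub>HomGr A y z (i - 1)\<^esub>"
    using assms by (simp_all add: cycles_def)
  have "Comp A x y z (i - 1) j (Dif (Hom A y z) i g) f = \<zero>\<^bsub>HomGr A x z (i + j - 1)\<^esub>"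
    using g comp_zero_left[OF obj assms(5), of "i - 1"] by (simp add: algebra_simps)
  moreover have "Comp A x y z i (j - 1) g (Dif (Hom A x y) j f) \<in> Mor A x z (i + j - 1)"
    using obj g assms by (intro comp_closed dif_closed) auto
  ultimately show ?thesis using leibniz[OF obj g(1) assms(5)] by auto
qed

lemma dif_comp_cycle_right:
  assumes obj: "x \<in> Obj A" "y \<in> Obj A" "z \<in> Obj A"
    and "f \<in> cycles (Hom A x y) j" "g \<in> Mor A y z i"
  shows "Dif (Hom A x z) (i + j) (Comp A x y z i j g f) =
    Comp A x y z (i - 1) j (Dif (Hom A y z) i g) f"
proof -
  interpret M: abelian_group "HomGr A x z (i + j - 1)" using obj hom_group by blast
  have f: "f \<in> Mor A x y j" "Dif (Hom A x y) j f = \<zero>\<^bsub>HomGr A x y (j - 1)\<^esub>"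
    using assms by (simp_all add: cycles_def)
  have "Comp A x y z i (j - 1) g (Dif (Hom A x y) j f) = \<zero>\<^bsub>HomGr A x z (i + j - 1)\<^esub>"
    using f comp_zero_right[OF obj assms(5), of "j - 1"] by (simp add: algebra_simps)
  moreover have "Comp A x y z (i - 1) j (Dif (Hom A y z) i g) f \<in> Mor A x z (i + j - 1)"
    using obj f assms by (intro comp_closed dif_closed) auto
  ultimately show ?thesis using leibniz[OF obj assms(5) f(1)] by auto
qed

lemma comp_cycle:
  assumes obj: "x \<in> Obj A" "y \<in> Obj A" "z \<in> Obj A"
    and "g \<in> cycles (Hom A y z) i" "f \<in> cycles (Hom A x y) j" "k = i + j"
  shows "Comp A x y z i j g f \<in> cycles (Hom A x z) k"
proof -
  have g: "g \<in> Mor A y z i" "Dif (Hom A y z) i g = \<zero>\<^bsub>HomGr A y z (i - 1)\<^esub>"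
    and f: "f \<in> Mor A x y j" using assms by (simp_all add: cycles_def)
  have "Comp A x y z (i - 1) j \<zero>\<^bsub>HomGr A y z (i - 1)\<^esub> f = \<zero>\<^bsub>HomGr A x z (i + j - 1)\<^esub>"
    using comp_zero_left[OF obj f, of "i - 1"] by (simp add: algebra_simps)
  then show ?thesis
    using dif_comp_cycle_right[OF obj assms(5) g(1)] g(2) comp_closed[OF obj g(1) f] assms(6)
    by (simp add: cycles_def)
qed

text \<open>For a cycle \<open>g\<close>, the Leibniz rule turns \<open>g (d w)\<close> into
  \<open>d (g w)\<close> up to the Koszul sign, and boundaries are closed under negation.\<close>

lemma comp_boundary_right:
  assumes obj: "x \<in> Obj A" "y \<in> Obj A" "z \<in> Obj A"
    and g: "g \<in> cycles (Hom A y z) i" and f: "f \<in> boundaries (Hom A x y) j" and k: "k = i + j"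
  shows "Comp A x y z i j g f \<in> boundaries (Hom A x z) k"
proof -
  interpret M: abelian_group "HomGr A x z k" using obj hom_group by blast
  obtain w where w: "w \<in> Mor A x y (j + 1)" "f = Dif (Hom A x y) (j + 1) w"
    using f by (auto simp: boundaries_def)
  let ?gw = "Comp A x y z i (j + 1) g w"
  have gw: "?gw \<in> Mor A x z (k + 1)" using obj w cycle_closed[OF g] by (intro comp_closed) (auto simp: k)
  have gf: "Comp A x y z i j g f \<in> Mor A x z k"
    using obj w cycle_closed[OF g] by (intro comp_closed) (auto simp: k intro: dif_closed)
  have "Dif (Hom A x z) (k + 1) ?gw = koszul (HomGr A x z k) i (Comp A x y z i j g f)"
    using dif_comp_cycle_left[OF obj g w(1)] w(2) by (simp add: k algebra_simps)
  then have "Comp A x y z i j g f = koszul (HomGr A x z k) i (Dif (Hom A x z) (k + 1) ?gw)"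
    using gf by auto
  moreover have "Dif (Hom A x z) (k + 1) ?gw \<in> boundaries (Hom A x z) k"
    using gw by (simp add: boundaries_def)
  ultimately show ?thesis using boundaries_inv[OF hom_complex] obj by auto
qed

lemma comp_boundary_left:
  assumes obj: "x \<in> Obj A" "y \<in> Obj A" "z \<in> Obj A"
    and g: "g \<in> boundaries (Hom A y z) i" and f: "f \<in> cycles (Hom A x y) j" and k: "k = i + j"
  shows "Comp A x y z i j g f \<in> boundaries (Hom A x z) k"
proof -
  obtain w where w: "w \<in> Mor A y z (i + 1)" "g = Dif (Hom A y z) (i + 1) w"
    using g by (auto simp: boundaries_def)
  let ?wf = "Comp A x y z (i + 1) j w f"
  have wf: "?wf \<in> Mor A x z (k + 1)" using obj w cycle_closed[OF f] by (intro comp_closed) (auto simp: k)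
  have "Dif (Hom A x z) (k + 1) ?wf = Comp A x y z i j g f"
    using dif_comp_cycle_right[OF obj f w(1)] w(2) by (simp add: k algebra_simps)
  then show ?thesis using wf unfolding boundaries_def by (metis image_eqI)
qed

lemma comp_homologous:
  assumes obj: "x \<in> Obj A" "y \<in> Obj A" "z \<in> Obj A"
    and g: "g \<in> cycles (Hom A y z) i" "g' \<in> cycles (Hom A y z) i" "homologous (Hom A y z) i g g'"
    and f: "f \<in> cycles (Hom A x y) j" "f' \<in> cycles (Hom A x y) j" "homologous (Hom A x y) j f f'"
    and k: "k = i + j"
  shows "homologous (Hom A x z) k (Comp A x y z i j g f) (Comp A x y z i j g' f')"
proof -
  note c = cycle_closed[OF g(1)] cycle_closed[OF g(2)] cycle_closed[OF f(1)] cycle_closed[OF f(2)]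
  have "Comp A x y z i j g (f \<ominus>\<^bsub>HomGr A x y j\<^esub> f') \<in> boundaries (Hom A x z) k"
    using obj g f by (intro comp_boundary_right) (auto simp: k homologous_boundaries[OF hom_complex])
  then have 1: "homologous (Hom A x z) k (Comp A x y z i j g f) (Comp A x y z i j g f')"
    using c obj by (simp add: homologous_boundaries[OF hom_complex] comp_minus_right k)
  have "Comp A x y z i j (g \<ominus>\<^bsub>HomGr A y z i\<^esub> g') f' \<in> boundaries (Hom A x z) k"
    using obj g f by (intro comp_boundary_left) (auto simp: k homologous_boundaries[OF hom_complex])
  then have 2: "homologous (Hom A x z) k (Comp A x y z i j g f') (Comp A x y z i j g' f')"
    using c obj by (simp add: homologous_boundaries[OF hom_complex] comp_minus_left k)
  show ?thesis
    using obj c by (intro homologous_trans[OF hom_complex _ _ _ 1 2]) (auto simp: k intro: comp_closed)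
qed

section \<open>The category of degree zero homology\<close>

lemma H0_simps [simp]:
  "CObj (H0 A) = Obj A" "CHom (H0 A) x y = carrier (homology (Hom A x y) 0)"
  "CComp (H0 A) x y z g f = hclass (Hom A x z) 0 (Comp A x y z 0 0 g f)"
  "CId (H0 A) x = hclass (Hom A x x) 0 (Ident A x)"
  by (simp_all add: H0_def)

lemma H0_hom: "x \<in> Obj A \<Longrightarrow> y \<in> Obj A \<Longrightarrow>
    f \<in> carrier (homology (Hom A x y) 0) \<longleftrightarrow> f \<in> cycles (Hom A x y) 0 \<and> hclass (Hom A x y) 0 f = f"
  using hom_complex by (rule homology_rep)

text \<open>Composites in \<open>H0\<close> may be computed with any cycles in place of the chosen
  ones.\<close>

lemma hclass_comp:
  assumes obj: "x \<in> Obj A" "y \<in> Obj A" "z \<in> Obj A"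
    and g: "g \<in> cycles (Hom A y z) 0" and f: "f \<in> cycles (Hom A x y) 0"
  shows "hclass (Hom A x z) 0 (Comp A x y z 0 0 (hclass (Hom A y z) 0 g) (hclass (Hom A x y) 0 f)) =
    hclass (Hom A x z) 0 (Comp A x y z 0 0 g f)"
proof -
  note G = hclass_homologous[OF hom_complex cycle_closed[OF g]] hclass_cycle[OF hom_complex g]
  note F = hclass_homologous[OF hom_complex cycle_closed[OF f]] hclass_cycle[OF hom_complex f]
  show ?thesis using obj g f G F
    by (subst hclass_eq_iff[OF hom_complex]) (auto intro!: comp_homologous comp_closed dest: cycle_closed)
qed

text \<open>Removes the chosen representatives from invertibility in \<open>H0\<close>, leaving a
  cycle \<open>e'\<close> and two homologies, which is the form that computations use.\<close>

lemma homotopy_invertible_iff: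
  assumes obj: "x \<in> Obj A" "y \<in> Obj A"
  shows "homotopy_invertible A x y e \<longleftrightarrow> e \<in> cycles (Hom A x y) 0 \<and>
    (\<exists>e'\<in>cycles (Hom A y x) 0.
      homologous (Hom A x x) 0 (Comp A x y x 0 0 e' e) (Ident A x) \<and>
      homologous (Hom A y y) 0 (Comp A y x y 0 0 e e') (Ident A y))" (is "?L \<longleftrightarrow> ?R")
proof
  assume L: ?L
  then have e: "e \<in> cycles (Hom A x y) 0" by (simp add: homotopy_invertible_def)
  obtain e' where e': "e' \<in> cycles (Hom A y x) 0" "hclass (Hom A y x) 0 e' = e'"
    "hclass (Hom A x x) 0 (Comp A x y x 0 0 e' (hclass (Hom A x y) 0 e)) = hclass (Hom A x x) 0 (Ident A x)"
    "hclass (Hom A y y) 0 (Comp A y x y 0 0 (hclass (Hom A x y) 0 e) e') = hclass (Hom A y y) 0 (Ident A y)"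
    using L obj by (auto simp: homotopy_invertible_def invertible_in_def H0_hom)
  have "hclass (Hom A x x) 0 (Comp A x y x 0 0 e' e) = hclass (Hom A x x) 0 (Ident A x)"
    using hclass_comp[of x y x e' e] e e' obj by simp
  moreover have "hclass (Hom A y y) 0 (Comp A y x y 0 0 e e') = hclass (Hom A y y) 0 (Ident A y)"
    using hclass_comp[of y x y e e'] e e' obj by simp
  moreover have "Comp A x y x 0 0 e' e \<in> Mor A x x 0" "Comp A y x y 0 0 e e' \<in> Mor A y y 0"
    using obj e e' by (auto intro!: comp_closed dest: cycle_closed)
  ultimately show ?R using e e'(1) obj
    by (auto simp: hclass_eq_iff[OF hom_complex] ident_closed)
next
  assume R: ?R
  then obtain e' where e: "e \<in> cycles (Hom A x y) 0" and e': "e' \<in> cycles (Hom A y x) 0"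
    "homologous (Hom A x x) 0 (Comp A x y x 0 0 e' e) (Ident A x)"
    "homologous (Hom A y y) 0 (Comp A y x y 0 0 e e') (Ident A y)" by blast
  have "Comp A x y x 0 0 e' e \<in> Mor A x x 0" "Comp A y x y 0 0 e e' \<in> Mor A y y 0"
    using obj e e' by (auto intro!: comp_closed dest: cycle_closed)
  then have "hclass (Hom A x x) 0 (Comp A x y x 0 0 e' e) = hclass (Hom A x x) 0 (Ident A x)"
    "hclass (Hom A y y) 0 (Comp A y x y 0 0 e e') = hclass (Hom A y y) 0 (Ident A y)"
    using e' obj by (auto simp: hclass_eq_iff[OF hom_complex] ident_closed)
  then show ?L using e e'(1) obj hclass_comp[of x y x e' e] hclass_comp[of y x y e e']
    hclass_cycle[OF hom_complex] hclass_idem[OF hom_complex]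
    by (auto simp: homotopy_invertible_def invertible_in_def H0_hom cycle_closed
      intro!: bexI[of _ "hclass (Hom A y x) 0 e'"])
qed

end

section \<open>dg functors\<close>

lemma mk_dgfun_simps [simp]:
  "Dom (mk_dgfun A B Fo Fm) = A" "Cod (mk_dgfun A B Fo Fm) = B"
  "x \<in> Obj A \<Longrightarrow> ob (mk_dgfun A B Fo Fm) x = Fo x"
  "x \<in> Obj A \<Longrightarrow> y \<in> Obj A \<Longrightarrow> f \<in> Mor A x y i \<Longrightarrow> mor (mk_dgfun A B Fo Fm) x y i f = Fm x y i f"
  by (simp_all add: mk_dgfun_def)

lemma mk_dgfun_cong:
  assumes "\<And>x. x \<in> Obj A \<Longrightarrow> Fo x = Fo' x"
    "\<And>x y i f. x \<in> Obj A \<Longrightarrow> y \<in> Obj A \<Longrightarrow> f \<in> Mor A x y i \<Longrightarrow> Fm x y i f = Fm' x y i f"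
  shows "mk_dgfun A B Fo Fm = mk_dgfun A B Fo' Fm'"
  using assms by (auto simp: mk_dgfun_def restrict_def fun_eq_iff)

lemma mk_dgfun_idem [simp]:
  "mk_dgfun A B (ob (mk_dgfun A B Fo Fm)) (mor (mk_dgfun A B Fo Fm)) = mk_dgfun A B Fo Fm"
  by (rule mk_dgfun_cong) auto

lemma mk_dgfun_dg_hom:
  assumes "dg_category R A" "dg_category R B"
    and "\<And>x. x \<in> Obj A \<Longrightarrow> Fo x \<in> Obj B"
    and lin: "\<And>x y i. x \<in> Obj A \<Longrightarrow> y \<in> Obj A \<Longrightarrow>
      linear_map R (HomGr A x y i) (HomGr B (Fo x) (Fo y) i) (Fm x y i)"
    and dif: "\<And>x y i f. x \<in> Obj A \<Longrightarrow> y \<in> Obj A \<Longrightarrow> f \<in> Mor A x y i \<Longrightarrow>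
      Fm x y (i - 1) (Dif (Hom A x y) i f) = Dif (Hom B (Fo x) (Fo y)) i (Fm x y i f)"
    and id: "\<And>x. x \<in> Obj A \<Longrightarrow> Fm x x 0 (Ident A x) = Ident B (Fo x)"
    and comp: "\<And>x y z i j g f. x \<in> Obj A \<Longrightarrow> y \<in> Obj A \<Longrightarrow> z \<in> Obj A \<Longrightarrow>
      g \<in> Mor A y z i \<Longrightarrow> f \<in> Mor A x y j \<Longrightarrow>
      Fm x z (i + j) (Comp A x y z i j g f) = Comp B (Fo x) (Fo y) (Fo z) i j (Fm y z i g) (Fm x y j f)"
  shows "mk_dgfun A B Fo Fm \<in> dg_hom R A B"
proof -
  interpret A: dg_category R A by fact
  have lin': "linear_map R (HomGr A x y i) (HomGr B (Fo x) (Fo y) i) (mor (mk_dgfun A B Fo Fm) x y i)"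
    if "x \<in> Obj A" "y \<in> Obj A" for x y i
    using that by (intro linear_map_cong[OF lin _ A.hom_module]) auto
  show ?thesis
    unfolding dg_hom_def dg_functor_def
    using assms(1-3) dif id comp lin' by (simp add: A.mor_closed)
qed

locale dgf =
  fixes R :: "'r ring" and F :: "('r, 'u) dgfun"
  assumes is_functor: "dg_functor R F"
begin

sublocale D: dg_category R "Dom F" using is_functor by (simp add: dg_functor_def)
sublocale C: dg_category R "Cod F" using is_functor by (simp add: dg_functor_def)

lemma ob_closed: "x \<in> Obj (Dom F) \<Longrightarrow> ob F x \<in> Obj (Cod F)"
  using is_functor by (simp add: dg_functor_def)

lemma mor_linear: "x \<in> Obj (Dom F) \<Longrightarrow> y \<in> Obj (Dom F) \<Longrightarrow>
   linear_map R (HomGr (Dom F) x y i) (HomGr (Cod F) (ob F x) (ob F y) i) (mor F x y i)"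
  using is_functor by (simp add: dg_functor_def)

lemma mor_dif: "x \<in> Obj (Dom F) \<Longrightarrow> y \<in> Obj (Dom F) \<Longrightarrow> f \<in> Mor (Dom F) x y i \<Longrightarrow> k = i - 1 \<Longrightarrow>
   mor F x y k (Dif (Hom (Dom F) x y) i f) = Dif (Hom (Cod F) (ob F x) (ob F y)) i (mor F x y i f)"
  using is_functor by (simp add: dg_functor_def)

lemma mor_ident: "x \<in> Obj (Dom F) \<Longrightarrow> mor F x x 0 (Ident (Dom F) x) = Ident (Cod F) (ob F x)"
  using is_functor by (simp add: dg_functor_def)

lemma mor_comp: "x \<in> Obj (Dom F) \<Longrightarrow> y \<in> Obj (Dom F) \<Longrightarrow> z \<in> Obj (Dom F) \<Longrightarrow>
   g \<in> Mor (Dom F) y z i \<Longrightarrow> f \<in> Mor (Dom F) x y j \<Longrightarrow> k = i + j \<Longrightarrow>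
   mor F x z k (Comp (Dom F) x y z i j g f) =
     Comp (Cod F) (ob F x) (ob F y) (ob F z) i j (mor F y z i g) (mor F x y j f)"
  using is_functor by (simp add: dg_functor_def)

lemma mor_mor: "x \<in> Obj (Dom F) \<Longrightarrow> y \<in> Obj (Dom F) \<Longrightarrow> f \<in> Mor (Dom F) x y i \<Longrightarrow>
   mor F x y i f \<in> Mor (Cod F) (ob F x) (ob F y) i"
  using mor_linear by (rule linear_map_closed)

lemma mor_add: "x \<in> Obj (Dom F) \<Longrightarrow> y \<in> Obj (Dom F) \<Longrightarrow> f \<in> Mor (Dom F) x y i \<Longrightarrow> g \<in> Mor (Dom F) x y i \<Longrightarrow>
   mor F x y i (f \<oplus>\<^bsub>HomGr (Dom F) x y i\<^esub> g) =
   mor F x y i f \<oplus>\<^bsub>HomGr (Cod F) (ob F x) (ob F y) i\<^esub> mor F x y i g"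
  using mor_linear by (rule linear_map_add)

lemma mor_smult: "x \<in> Obj (Dom F) \<Longrightarrow> y \<in> Obj (Dom F) \<Longrightarrow> f \<in> Mor (Dom F) x y i \<Longrightarrow> r \<in> carrier R \<Longrightarrow>
   mor F x y i (r \<odot>\<^bsub>HomGr (Dom F) x y i\<^esub> f) = r \<odot>\<^bsub>HomGr (Cod F) (ob F x) (ob F y) i\<^esub> mor F x y i f"
  using linear_map_smult[OF mor_linear] by blast

lemma mor_zero: "x \<in> Obj (Dom F) \<Longrightarrow> y \<in> Obj (Dom F) \<Longrightarrow>
   mor F x y i \<zero>\<^bsub>HomGr (Dom F) x y i\<^esub> = \<zero>\<^bsub>HomGr (Cod F) (ob F x) (ob F y) i\<^esub>"
  by (rule linear_map_zero[OF D.hom_module C.hom_module mor_linear]) (auto simp: ob_closed)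

lemma mor_inv: "x \<in> Obj (Dom F) \<Longrightarrow> y \<in> Obj (Dom F) \<Longrightarrow> f \<in> Mor (Dom F) x y i \<Longrightarrow>
   mor F x y i (\<ominus>\<^bsub>HomGr (Dom F) x y i\<^esub> f) = \<ominus>\<^bsub>HomGr (Cod F) (ob F x) (ob F y) i\<^esub> mor F x y i f"
  by (rule linear_map_inv[OF D.hom_module C.hom_module mor_linear]) (auto simp: ob_closed)

lemma mor_minus: "x \<in> Obj (Dom F) \<Longrightarrow> y \<in> Obj (Dom F) \<Longrightarrow> f \<in> Mor (Dom F) x y i \<Longrightarrow> g \<in> Mor (Dom F) x y i \<Longrightarrow>
   mor F x y i (f \<ominus>\<^bsub>HomGr (Dom F) x y i\<^esub> g) =
   mor F x y i f \<ominus>\<^bsub>HomGr (Cod F) (ob F x) (ob F y) i\<^esub> mor F x y i g"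
  by (rule linear_map_minus[OF D.hom_module C.hom_module mor_linear]) (auto simp: ob_closed)

lemma mor_cycle: "x \<in> Obj (Dom F) \<Longrightarrow> y \<in> Obj (Dom F) \<Longrightarrow> f \<in> cycles (Hom (Dom F) x y) i \<Longrightarrow>
   mor F x y i f \<in> cycles (Hom (Cod F) (ob F x) (ob F y)) i"
  using mor_dif[of x y f i "i - 1"] mor_zero[of x y "i - 1"]
  by (auto simp: cycles_def mor_mor ob_closed)

lemma mor_homologous: "x \<in> Obj (Dom F) \<Longrightarrow> y \<in> Obj (Dom F) \<Longrightarrow>
   f \<in> Mor (Dom F) x y i \<Longrightarrow> g \<in> Mor (Dom F) x y i \<Longrightarrow> homologous (Hom (Dom F) x y) i f g \<Longrightarrow>
   homologous (Hom (Cod F) (ob F x) (ob F y)) i (mor F x y i f) (mor F x y i g)"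
  unfolding homologous_def
  by (auto simp: mor_minus[symmetric] mor_dif intro!: bexI[of _ "mor F x y (i+1) _"] mor_mor)

lemma mor_homotopy_invertible:
  assumes obj: "x \<in> Obj (Dom F)" "y \<in> Obj (Dom F)" and e: "homotopy_invertible (Dom F) x y e"
  shows "homotopy_invertible (Cod F) (ob F x) (ob F y) (mor F x y 0 e)"
proof -
  obtain e' where e: "e \<in> cycles (Hom (Dom F) x y) 0" and e': "e' \<in> cycles (Hom (Dom F) y x) 0"
    "homologous (Hom (Dom F) x x) 0 (Comp (Dom F) x y x 0 0 e' e) (Ident (Dom F) x)"
    "homologous (Hom (Dom F) y y) 0 (Comp (Dom F) y x y 0 0 e e') (Ident (Dom F) y)"
    using e obj by (auto simp: D.homotopy_invertible_iff)
  note c = D.cycle_closed[OF e] D.cycle_closed[OF e'(1)]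
  have "homologous (Hom (Cod F) (ob F x) (ob F x)) 0 (mor F x x 0 (Comp (Dom F) x y x 0 0 e' e)) (mor F x x 0 (Ident (Dom F) x))"
    "homologous (Hom (Cod F) (ob F y) (ob F y)) 0 (mor F y y 0 (Comp (Dom F) y x y 0 0 e e')) (mor F y y 0 (Ident (Dom F) y))"
    using obj c e' by (auto intro!: mor_homologous D.mor_closed)
  then have "homologous (Hom (Cod F) (ob F x) (ob F x)) 0
      (Comp (Cod F) (ob F x) (ob F y) (ob F x) 0 0 (mor F y x 0 e') (mor F x y 0 e)) (Ident (Cod F) (ob F x))"
    "homologous (Hom (Cod F) (ob F y) (ob F y)) 0
      (Comp (Cod F) (ob F y) (ob F x) (ob F y) 0 0 (mor F x y 0 e) (mor F y x 0 e')) (Ident (Cod F) (ob F y))"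
    using obj c by (simp_all add: mor_comp mor_ident)
  then show ?thesis using e e'(1) obj
    by (auto simp: C.homotopy_invertible_iff ob_closed intro!: mor_cycle)
qed

end

lemma dg_homD:
  assumes "F \<in> dg_hom R A B"
  shows "dg_functor R F" "Dom F = A" "Cod F = B" "dg_category R A" "dg_category R B"
  using assms by (auto simp: dg_hom_def dg_functor_def)

lemma dg_hom_mk: "F \<in> dg_hom R A B \<Longrightarrow> F = mk_dgfun A B (ob F) (mor F)"
  by (auto simp: dg_hom_def dg_functor_def)

lemma dg_hom_ext:
  assumes "F \<in> dg_hom R A B" "G \<in> dg_hom R A B"
    and "\<And>x. x \<in> Obj A \<Longrightarrow> ob F x = ob G x"
    and "\<And>x y i f. x \<in> Obj A \<Longrightarrow> y \<in> Obj A \<Longrightarrow> f \<in> Mor A x y i \<Longrightarrow> mor F x y i f = mor G x y i f"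
  shows "F = G"
proof -
  have "F = mk_dgfun A B (ob F) (mor F)" using assms(1) by (rule dg_hom_mk)
  also have "\<dots> = mk_dgfun A B (ob G) (mor G)" using assms(3,4) by (rule mk_dgfun_cong)
  also have "\<dots> = G" using dg_hom_mk[OF assms(2)] by simp
  finally show ?thesis .
qed

lemma dg_id_hom: "dg_category R A \<Longrightarrow> dg_id A \<in> dg_hom R A A"
  unfolding dg_id_def by (rule mk_dgfun_dg_hom) (auto simp: linear_map_id)

lemma dg_id_simps [simp]:
  "Dom (dg_id A) = A" "Cod (dg_id A) = A" "x \<in> Obj A \<Longrightarrow> ob (dg_id A) x = x"
  "x \<in> Obj A \<Longrightarrow> y \<in> Obj A \<Longrightarrow> f \<in> Mor A x y i \<Longrightarrow> mor (dg_id A) x y i f = f"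
  by (simp_all add: dg_id_def)

lemma dg_comp_simps [simp]:
  "Dom (G \<circ>\<^sub>d F) = Dom F" "Cod (G \<circ>\<^sub>d F) = Cod G"
  "x \<in> Obj (Dom F) \<Longrightarrow> ob (G \<circ>\<^sub>d F) x = ob G (ob F x)"
  "x \<in> Obj (Dom F) \<Longrightarrow> y \<in> Obj (Dom F) \<Longrightarrow> f \<in> Mor (Dom F) x y i \<Longrightarrow>
   mor (G \<circ>\<^sub>d F) x y i f = mor G (ob F x) (ob F y) i (mor F x y i f)"
  by (simp_all add: dg_comp_def)

lemma dg_comp_hom:
  assumes "F \<in> dg_hom R A B" "G \<in> dg_hom R B C"
  shows "G \<circ>\<^sub>d F \<in> dg_hom R A C"
proof -
  note F = dg_homD[OF assms(1)] and G = dg_homD[OF assms(2)]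
  interpret F: dgf R F by standard (rule F)
  interpret G: dgf R G by standard (rule G)
  note [simp] = F(2,3) G(2,3)
  note c = F.ob_closed[simplified] F.mor_mor[simplified] G.ob_closed[simplified] G.mor_mor[simplified]
  show ?thesis unfolding dg_comp_def F(2) G(3)
    by (rule mk_dgfun_dg_hom)
      (use F(4) G(5) c in \<open>auto simp: F.mor_dif[simplified] G.mor_dif[simplified] F.mor_ident[simplified]
        G.mor_ident[simplified] F.mor_comp[simplified] G.mor_comp[simplified]
        intro!: linear_map_compose[OF F.mor_linear[simplified] G.mor_linear[simplified]]\<close>)
qed

lemma dg_comp_assoc:
  assumes "F \<in> dg_hom R A B" "G \<in> dg_hom R B C" "H \<in> dg_hom R C D"
  shows "H \<circ>\<^sub>d (G \<circ>\<^sub>d F) = H \<circ>\<^sub>d G \<circ>\<^sub>d F"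
proof -
  interpret F: dgf R F by standard (rule dg_homD[OF assms(1)])
  note [simp] = dg_homD(2,3)[OF assms(1)] dg_homD(2,3)[OF assms(2)]
  show ?thesis
    by (rule dg_hom_ext[of _ R A D])
      (use assms F.ob_closed F.mor_mor in \<open>auto intro: dg_comp_hom\<close>)
qed

lemma dg_comp_id_left:
  assumes "F \<in> dg_hom R A B" shows "dg_id B \<circ>\<^sub>d F = F"
proof -
  interpret F: dgf R F by standard (rule dg_homD[OF assms(1)])
  note [simp] = dg_homD(2,3)[OF assms(1)]
  show ?thesis
    by (rule dg_hom_ext[of _ R A B])
      (use assms F.ob_closed F.mor_mor dg_homD(5)[OF assms] in \<open>auto intro: dg_comp_hom dg_id_hom\<close>)
qed

lemma dg_comp_id_right:
  assumes "F \<in> dg_hom R A B" shows "F \<circ>\<^sub>d dg_id A = F"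
  by (rule dg_hom_ext[of _ R A B]) (use assms dg_homD(4)[OF assms] in \<open>auto intro: dg_comp_hom dg_id_hom\<close>)

section \<open>Surjective equivalences\<close>

text \<open>Surjectivity on objects gives a section \<open>Go\<close>, and the inverse bijections on
  morphisms make it a functor, every equation being checked after applying \<open>Fm\<close>. Going
  to \<open>C\<close> and back is the identity of \<open>D\<close>, so the counit consists of
  identities; the unit at \<open>x\<close> is the preimage of the identity of
  \<open>Fo x\<close>.\<close>

lemma is_equivalence_if_bij:
  assumes F: "is_functor C D Fo Fm"
    and surj: "\<And>y. y \<in> CObj D \<Longrightarrow> \<exists>x\<in>CObj C. Fo x = y"
    and bij: "\<And>x y. x \<in> CObj C \<Longrightarrow> y \<in> CObj C \<Longrightarrow>
      bij_betw (Fm x y) (CHom C x y) (CHom D (Fo x) (Fo y))"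
    and idC: "\<And>x. x \<in> CObj C \<Longrightarrow> CId C x \<in> CHom C x x"
    and compC: "\<And>x y z f g. x \<in> CObj C \<Longrightarrow> y \<in> CObj C \<Longrightarrow> z \<in> CObj C \<Longrightarrow> f \<in> CHom C x y \<Longrightarrow>
      g \<in> CHom C y z \<Longrightarrow> CComp C x y z g f \<in> CHom C x z"
    and idD: "\<And>x. x \<in> CObj D \<Longrightarrow> CId D x \<in> CHom D x x"
    and unitD: "\<And>x y f. x \<in> CObj D \<Longrightarrow> y \<in> CObj D \<Longrightarrow> f \<in> CHom D x y \<Longrightarrow> CComp D x x y f (CId D x) = f"
      "\<And>x y f. x \<in> CObj D \<Longrightarrow> y \<in> CObj D \<Longrightarrow> f \<in> CHom D x y \<Longrightarrow> CComp D x y y (CId D y) f = f"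
  shows "is_equivalence C D Fo Fm"
proof -
  have Fo: "Fo x \<in> CObj D" if "x \<in> CObj C" for x using F that by (simp add: is_functor_def)
  have Fid: "Fm x x (CId C x) = CId D (Fo x)" if "x \<in> CObj C" for x
    using F that by (simp add: is_functor_def)
  have Fcomp: "Fm x z (CComp C x y z g f) = CComp D (Fo x) (Fo y) (Fo z) (Fm y z g) (Fm x y f)"
    if "x \<in> CObj C" "y \<in> CObj C" "z \<in> CObj C" "f \<in> CHom C x y" "g \<in> CHom C y z" for x y z f g
    using F that by (simp add: is_functor_def)
  define J where "J x y = inv_into (CHom C x y) (Fm x y)" for x y
  have J: "J x y g \<in> CHom C x y" "Fm x y (J x y g) = g"
    if "x \<in> CObj C" "y \<in> CObj C" "g \<in> CHom D (Fo x) (Fo y)" for x y g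
    using bij[OF that(1,2)] that(3)
    by (auto simp: J_def bij_betw_def f_inv_into_f intro: inv_into_into)
  have inj: "f = g" if "x \<in> CObj C" "y \<in> CObj C" "f \<in> CHom C x y" "g \<in> CHom C x y" "Fm x y f = Fm x y g" for x y f g
    using bij[OF that(1,2)] that by (auto simp: bij_betw_def inj_on_def)
  define Go where "Go y = (SOME x. x \<in> CObj C \<and> Fo x = y)" for y
  have Go: "Go y \<in> CObj C" "Fo (Go y) = y" if "y \<in> CObj D" for y
    using someI_ex[of "\<lambda>x. x \<in> CObj C \<and> Fo x = y"] surj[OF that] by (auto simp: Go_def)
  define Gm where "Gm y z = J (Go y) (Go z)" for y z
  have Gm: "Gm y z g \<in> CHom C (Go y) (Go z)" "Fm (Go y) (Go z) (Gm y z g) = g"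
    if "y \<in> CObj D" "z \<in> CObj D" "g \<in> CHom D y z" for y z g
    using J[OF Go(1)[OF that(1)] Go(1)[OF that(2)], of g] that(3)
    by (simp_all add: Gm_def Go(2)[OF that(1)] Go(2)[OF that(2)])
  have "Gm x z (CComp D x y z g f) = CComp C (Go x) (Go y) (Go z) (Gm y z g) (Gm x y f)"
    if "x \<in> CObj D" "y \<in> CObj D" "z \<in> CObj D" "f \<in> CHom D x y" "g \<in> CHom D y z" for x y z f g
  proof -
    let ?c = "CComp C (Go x) (Go y) (Go z) (Gm y z g) (Gm x y f)"
    have c: "?c \<in> CHom C (Go x) (Go z)"
      by (rule compC[OF Go(1) Go(1) Go(1) Gm(1) Gm(1)]) (fact that)+
    have Fc: "Fm (Go x) (Go z) ?c = CComp D x y z g f"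
      by (simp add: Fcomp[OF Go(1) Go(1) Go(1) Gm(1) Gm(1)] that Gm(2) Go(2))
    moreover have "Fm (Go x) (Go z) ?c \<in> CHom D (Fo (Go x)) (Fo (Go z))"
      using bij_betwE[OF bij[OF Go(1)[OF that(1)] Go(1)[OF that(3)]]] c by blast
    ultimately have m: "CComp D x y z g f \<in> CHom D x z" using that by (simp add: Go(2))
    show ?thesis
      by (rule inj[OF Go(1)[OF that(1)] Go(1)[OF that(3)]])
        (simp_all add: c Fc Gm[OF that(1,3) m])
  qed
  moreover have "Gm x x (CId D x) = CId C (Go x)" if "x \<in> CObj D" for x
    by (rule inj[OF Go(1)[OF that] Go(1)[OF that]])
      (simp_all add: Gm[OF that that idD[OF that]] idC Fid Go[OF that])
  ultimately have G: "is_functor D C Go Gm"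
    unfolding is_functor_def by (intro conjI ballI) (simp_all add: Go Gm)
  have "natural_iso C C (\<lambda>x. x) (\<lambda>x y f. f) (\<lambda>x. Go (Fo x)) (\<lambda>x y f. Gm (Fo x) (Fo y) (Fm x y f))
      (\<lambda>x. J x (Go (Fo x)) (CId D (Fo x)))"
    unfolding natural_iso_def
  proof safe
    fix x assume x: "x \<in> CObj C"
    let ?y = "Go (Fo x)" and ?i = "CId D (Fo x)"
    have y: "?y \<in> CObj C" "Fo ?y = Fo x" using Go Fo x by auto
    have i: "?i \<in> CHom D (Fo x) (Fo x)" using idD Fo x by auto
    have j: "J x ?y ?i \<in> CHom C x ?y" "Fm x ?y (J x ?y ?i) = ?i" using J[of x ?y ?i] x y i by auto
    have k: "J ?y x ?i \<in> CHom C ?y x" "Fm ?y x (J ?y x ?i) = ?i" using J[of ?y x ?i] x y i by auto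
    have "CComp C x ?y x (J ?y x ?i) (J x ?y ?i) = CId C x"
      by (rule inj[OF x x])
        (simp_all add: x y i j k idC Fcomp Fid unitD Fo compC[of x ?y x])
    moreover have "CComp C ?y x ?y (J x ?y ?i) (J ?y x ?i) = CId C ?y"
      by (rule inj[OF y(1) y(1)])
        (simp_all add: x y i j k idC Fcomp Fid unitD Fo compC[of ?y x ?y])
    ultimately show "invertible_in C x ?y (J x ?y ?i)"
      unfolding invertible_in_def using j k by blast
  next
    fix x y f assume x: "x \<in> CObj C" and y: "y \<in> CObj C" and f: "f \<in> CHom C x y"
    let ?x = "Go (Fo x)" and ?i = "CId D (Fo x)" and ?y = "Go (Fo y)" and ?j = "CId D (Fo y)"
    have xy: "?x \<in> CObj C" "Fo ?x = Fo x" "?y \<in> CObj C" "Fo ?y = Fo y" using Go Fo x y by auto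
    have Ff: "Fm x y f \<in> CHom D (Fo x) (Fo y)" using bij_betwE[OF bij[OF x y]] f by blast
    have i: "?i \<in> CHom D (Fo x) (Fo x)" "?j \<in> CHom D (Fo y) (Fo y)" using idD Fo x y by auto
    have j: "J x ?x ?i \<in> CHom C x ?x" "Fm x ?x (J x ?x ?i) = ?i" using J[of x ?x ?i] x xy i by auto
    have k: "J y ?y ?j \<in> CHom C y ?y" "Fm y ?y (J y ?y ?j) = ?j" using J[of y ?y ?j] y xy i by auto
    have g: "Gm (Fo x) (Fo y) (Fm x y f) \<in> CHom C ?x ?y"
      "Fm ?x ?y (Gm (Fo x) (Fo y) (Fm x y f)) = Fm x y f"
      using Gm[of "Fo x" "Fo y" "Fm x y f"] Ff x y Fo by auto
    show "CComp C x y ?y (J y ?y ?j) f = CComp C x ?x ?y (Gm (Fo x) (Fo y) (Fm x y f)) (J x ?x ?i)"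
      by (rule inj[of x ?y]) (simp_all add: x y xy f i j k g Ff Fcomp unitD Fo compC[of x y ?y] compC[of x ?x ?y])
  qed
  moreover have "natural_iso D D (\<lambda>x. Fo (Go x)) (\<lambda>x y f. Fm (Go x) (Go y) (Gm x y f)) (\<lambda>x. x) (\<lambda>x y f. f) (CId D)"
    unfolding natural_iso_def
  proof (intro conjI ballI)
    fix y assume y: "y \<in> CObj D"
    show "invertible_in D (Fo (Go y)) y (CId D y)"
      unfolding invertible_in_def
      using idD[OF y] unitD(1)[OF y y idD[OF y]] by (auto simp: Go[OF y])
  next
    fix y z f assume yz: "y \<in> CObj D" "z \<in> CObj D" and f: "f \<in> CHom D y z"
    show "CComp D (Fo (Go y)) (Fo (Go z)) z (CId D z) (Fm (Go y) (Go z) (Gm y z f)) =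
      CComp D (Fo (Go y)) y z f (CId D y)"
      using unitD[OF yz f] by (simp add: Go[OF yz(1)] Go[OF yz(2)] Gm[OF yz f])
  qed
  ultimately show ?thesis unfolding is_equivalence_def using F G by blast
qed

section \<open>Unit laws in \<open>H0\<close> and cancellation of homotopy equivalences\<close>

context dg_category
begin

lemma H0_comp_closed:
  assumes "x \<in> Obj A" "y \<in> Obj A" "z \<in> Obj A"
    and "f \<in> CHom (H0 A) x y" "g \<in> CHom (H0 A) y z"
  shows "CComp (H0 A) x y z g f \<in> CHom (H0 A) x z"
  using assms comp_cycle[OF assms(1-3), of g 0 f 0 0]
  by (auto simp: H0_hom intro!: hclass_cycle[OF hom_complex] hclass_idem[OF hom_complex] cycle_closed)

lemma H0_ident_closed: "x \<in> Obj A \<Longrightarrow> CId (H0 A) x \<in> CHom (H0 A) x x"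
  using ident_cycle[of x]
  by (auto simp: H0_hom intro!: hclass_cycle[OF hom_complex] hclass_idem[OF hom_complex] cycle_closed)

lemma H0_unit:
  assumes "x \<in> Obj A" "y \<in> Obj A" "f \<in> CHom (H0 A) x y"
  shows "CComp (H0 A) x x y f (CId (H0 A) x) = f" "CComp (H0 A) x y y (CId (H0 A) y) f = f"
  using assms hclass_comp[of x x y f "Ident A x"] hclass_comp[of x y y "Ident A y" f]
    ident_cycle[of x] ident_cycle[of y]
  by (auto simp: H0_hom ident_left ident_right cycle_closed)

text \<open>From \<open>e e' = 1 + d w\<close> follows \<open>r = (r e) e' - r (d w)\<close>. Since
  \<open>r e = d s\<close>, the first summand is the boundary of \<open>s e'\<close>; the second is
  that of \<open>r w\<close> up to the sign from moving \<open>d\<close> past \<open>r\<close>. The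
  explicit chain matters: it stays in any kernel that contains \<open>r\<close> and
  \<open>s\<close>.\<close>

lemma comp_precomp_boundary:
  assumes obj: "x \<in> Obj A" "y \<in> Obj A" "z \<in> Obj A"
    and e: "e \<in> cycles (Hom A x y) 0" "e' \<in> cycles (Hom A y x) 0"
    and w: "w \<in> Mor A y y 1" "Comp A y x y 0 0 e e' \<ominus>\<^bsub>HomGr A y y 0\<^esub> Ident A y = Dif (Hom A y y) 1 w"
    and r: "r \<in> cycles (Hom A y z) i" and s: "s \<in> Mor A x z (i + 1)"
    and eq: "Comp A x y z i 0 r e = Dif (Hom A x z) (i + 1) s"
  shows "r = Dif (Hom A y z) (i + 1) (Comp A y x z (i + 1) 0 s e' \<ominus>\<^bsub>HomGr A y z (i + 1)\<^esub>
    koszul (HomGr A y z (i + 1)) i (Comp A y y z i 1 r w))"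
proof -
  note c = cycle_closed[OF e(1)] cycle_closed[OF e(2)] cycle_closed[OF r]
  interpret M: abelian_group "HomGr A y z i" using obj hom_group by blast
  have a: "Comp A y x z (i + 1) 0 s e' \<in> Mor A y z (i + 1)" "Comp A y y z i 1 r w \<in> Mor A y z (i + 1)"
    using obj c s w by (auto intro!: comp_closed)
  have dw: "Dif (Hom A y y) 1 w \<in> Mor A y y 0" using w obj by (auto intro: dif_closed)
  have rdw: "Comp A y y z i 0 r (Dif (Hom A y y) 1 w) \<in> Mor A y z i"
    using obj c dw by (auto intro!: comp_closed)
  have ee: "Comp A y x y 0 0 e e' \<in> Mor A y y 0" using obj c by (auto intro!: comp_closed)
  have "Dif (Hom A y z) (i + 1) (Comp A y x z (i + 1) 0 s e') = Comp A y x z i 0 (Dif (Hom A x z) (i + 1) s) e'"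
    using dif_comp_cycle_right[OF obj(2,1,3) e(2) s] by simp
  also have "\<dots> = Comp A y y z i 0 r (Comp A y x y 0 0 e e')"
    using comp_assoc[OF obj(2,1,2,3) c(3,1,2)] eq by simp
  also have "Comp A y x y 0 0 e e' = Ident A y \<oplus>\<^bsub>HomGr A y y 0\<^esub> Dif (Hom A y y) 1 w"
  proof -
    interpret N: abelian_group "HomGr A y y 0" using obj hom_group by blast
    show ?thesis unfolding w(2)[symmetric] using ee ident_closed[OF obj(2)] by algebra
  qed
  also have "Comp A y y z i 0 r \<dots> = r \<oplus>\<^bsub>HomGr A y z i\<^esub> Comp A y y z i 0 r (Dif (Hom A y y) 1 w)"
    using obj c dw by (simp add: comp_add_right ident_closed ident_right)
  finally have 1: "Dif (Hom A y z) (i + 1) (Comp A y x z (i + 1) 0 s e') = \<dots>" .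
  have "Dif (Hom A y z) (i + 1) (Comp A y y z i 1 r w) =
      koszul (HomGr A y z i) i (Comp A y y z i 0 r (Dif (Hom A y y) 1 w))"
    using dif_comp_cycle_left[OF obj(2,2,3) r w(1)] by simp
  then have 2: "Dif (Hom A y z) (i + 1) (koszul (HomGr A y z (i + 1)) i (Comp A y y z i 1 r w)) =
      Comp A y y z i 0 r (Dif (Hom A y y) 1 w)"
    using obj a rdw by (auto simp: dif_inv)
  have "koszul (HomGr A y z (i + 1)) i (Comp A y y z i 1 r w) \<in> Mor A y z (i + 1)"
    using obj a by (auto intro: mor_inv)
  then have "Dif (Hom A y z) (i + 1) (Comp A y x z (i + 1) 0 s e' \<ominus>\<^bsub>HomGr A y z (i + 1)\<^esub>
      koszul (HomGr A y z (i + 1)) i (Comp A y y z i 1 r w)) =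
    (r \<oplus>\<^bsub>HomGr A y z i\<^esub> Comp A y y z i 0 r (Dif (Hom A y y) 1 w)) \<ominus>\<^bsub>HomGr A y z i\<^esub>
      Comp A y y z i 0 r (Dif (Hom A y y) 1 w)"
    using obj a(1) dif_minus[of y z _ "i + 1"] 1 2 by simp
  also have "\<dots> = r" using c rdw by algebra
  finally show ?thesis by simp
qed

text \<open>With \<open>e' e = 1 + d w\<close> the cycle \<open>t\<close> equals
  \<open>(t e') e - t (d w)\<close>: up to a boundary, every cycle factors through the homotopy
  equivalence \<open>e\<close>.\<close>

lemma cycle_precomp:
  assumes obj: "x \<in> Obj A" "y \<in> Obj A" "z \<in> Obj A"
    and e: "e \<in> cycles (Hom A x y) 0" "e' \<in> cycles (Hom A y x) 0"
    and w: "w \<in> Mor A x x 1" "Comp A x y x 0 0 e' e \<ominus>\<^bsub>HomGr A x x 0\<^esub> Ident A x = Dif (Hom A x x) 1 w"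
    and t: "t \<in> cycles (Hom A x z) i"
  shows "t = Comp A x y z i 0 (Comp A y x z i 0 t e') e \<ominus>\<^bsub>HomGr A x z i\<^esub>
    Dif (Hom A x z) (i + 1) (koszul (HomGr A x z (i + 1)) i (Comp A x x z i 1 t w))"
proof -
  note c = cycle_closed[OF e(1)] cycle_closed[OF e(2)] cycle_closed[OF t]
  interpret M: abelian_group "HomGr A x z i" using obj hom_group by blast
  have a: "Comp A x x z i 1 t w \<in> Mor A x z (i + 1)"
    using obj c w by (auto intro!: comp_closed)
  have dw: "Dif (Hom A x x) 1 w \<in> Mor A x x 0" using w obj by (auto intro: dif_closed)
  have tdw: "Comp A x x z i 0 t (Dif (Hom A x x) 1 w) \<in> Mor A x z i"
    using obj c dw by (auto intro!: comp_closed)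
  have ee: "Comp A x y x 0 0 e' e \<in> Mor A x x 0" using obj c by (auto intro!: comp_closed)
  have "Comp A x y z i 0 (Comp A y x z i 0 t e') e = Comp A x x z i 0 t (Comp A x y x 0 0 e' e)"
    using comp_assoc[OF obj(1,2,1,3) c(3,2,1)] by simp
  also have "Comp A x y x 0 0 e' e = Ident A x \<oplus>\<^bsub>HomGr A x x 0\<^esub> Dif (Hom A x x) 1 w"
  proof -
    interpret N: abelian_group "HomGr A x x 0" using obj hom_group by blast
    show ?thesis unfolding w(2)[symmetric] using ee ident_closed[OF obj(1)] by algebra
  qed
  also have "Comp A x x z i 0 t \<dots> = t \<oplus>\<^bsub>HomGr A x z i\<^esub> Comp A x x z i 0 t (Dif (Hom A x x) 1 w)"
    using obj c dw by (simp add: comp_add_right ident_closed ident_right)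
  finally have 1: "Comp A x y z i 0 (Comp A y x z i 0 t e') e = \<dots>" .
  have "Dif (Hom A x z) (i + 1) (Comp A x x z i 1 t w) =
      koszul (HomGr A x z i) i (Comp A x x z i 0 t (Dif (Hom A x x) 1 w))"
    using dif_comp_cycle_left[OF obj(1,1,3) t w(1)] by simp
  then have 2: "Dif (Hom A x z) (i + 1) (koszul (HomGr A x z (i + 1)) i (Comp A x x z i 1 t w)) =
      Comp A x x z i 0 t (Dif (Hom A x x) 1 w)"
    using obj a tdw by (auto simp: dif_inv)
  show ?thesis unfolding 1 2 using c tdw by algebra
qed

text \<open>Cancellation on the other side: \<open>r = e' (e r) - (d w) r\<close>. No sign occurs,
  because \<open>d\<close> meets the left factor \<open>w\<close> first and \<open>r\<close> is a
  cycle.\<close>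

lemma comp_postcomp_boundary:
  assumes obj: "x \<in> Obj A" "y \<in> Obj A" "z \<in> Obj A"
    and e: "e \<in> cycles (Hom A y z) 0" "e' \<in> cycles (Hom A z y) 0"
    and w: "w \<in> Mor A y y 1" "Comp A y z y 0 0 e' e \<ominus>\<^bsub>HomGr A y y 0\<^esub> Ident A y = Dif (Hom A y y) 1 w"
    and r: "r \<in> cycles (Hom A x y) i" and s: "s \<in> Mor A x z (i + 1)"
    and eq: "Comp A x y z 0 i e r = Dif (Hom A x z) (i + 1) s"
  shows "r = Dif (Hom A x y) (i + 1) (Comp A x z y 0 (i + 1) e' s \<ominus>\<^bsub>HomGr A x y (i + 1)\<^esub>
    Comp A x y y 1 i w r)"
proof -
  note c = cycle_closed[OF e(1)] cycle_closed[OF e(2)] cycle_closed[OF r]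
  interpret M: abelian_group "HomGr A x y i" using obj hom_group by blast
  have a: "Comp A x z y 0 (i + 1) e' s \<in> Mor A x y (i + 1)" "Comp A x y y 1 i w r \<in> Mor A x y (i + 1)"
    using obj c s w by (auto intro!: comp_closed)
  have dw: "Dif (Hom A y y) 1 w \<in> Mor A y y 0" using w obj by (auto intro: dif_closed)
  have dwr: "Comp A x y y 0 i (Dif (Hom A y y) 1 w) r \<in> Mor A x y i"
    using obj c dw by (auto intro!: comp_closed)
  have ee: "Comp A y z y 0 0 e' e \<in> Mor A y y 0" using obj c by (auto intro!: comp_closed)
  have "Dif (Hom A x y) (i + 1) (Comp A x z y 0 (i + 1) e' s) = Comp A x z y 0 i e' (Dif (Hom A x z) (i + 1) s)"
    using dif_comp_cycle_left[OF obj(1,3,2) e(2) s] by simp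
  also have "\<dots> = Comp A x y y 0 i (Comp A y z y 0 0 e' e) r"
    using comp_assoc[OF obj(1,2,3,2) c(2,1,3)] eq by simp
  also have "Comp A y z y 0 0 e' e = Ident A y \<oplus>\<^bsub>HomGr A y y 0\<^esub> Dif (Hom A y y) 1 w"
  proof -
    interpret N: abelian_group "HomGr A y y 0" using obj hom_group by blast
    show ?thesis unfolding w(2)[symmetric] using ee ident_closed[OF obj(2)] by algebra
  qed
  also have "Comp A x y y 0 i \<dots> r = r \<oplus>\<^bsub>HomGr A x y i\<^esub> Comp A x y y 0 i (Dif (Hom A y y) 1 w) r"
    using obj c dw by (simp add: comp_add_left ident_closed ident_left)
  finally have 1: "Dif (Hom A x y) (i + 1) (Comp A x z y 0 (i + 1) e' s) = \<dots>" .
  have 2: "Dif (Hom A x y) (i + 1) (Comp A x y y 1 i w r) = Comp A x y y 0 i (Dif (Hom A y y) 1 w) r"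
    using dif_comp_cycle_right[OF obj(1,2,2) r w(1)] by (simp add: add.commute)
  have "Dif (Hom A x y) (i + 1) (Comp A x z y 0 (i + 1) e' s \<ominus>\<^bsub>HomGr A x y (i + 1)\<^esub> Comp A x y y 1 i w r) =
    (r \<oplus>\<^bsub>HomGr A x y i\<^esub> Comp A x y y 0 i (Dif (Hom A y y) 1 w) r) \<ominus>\<^bsub>HomGr A x y i\<^esub>
      Comp A x y y 0 i (Dif (Hom A y y) 1 w) r"
    using obj a dif_minus[of x y _ "i + 1"] 1 2 by simp
  also have "\<dots> = r" using c dwr by algebra
  finally show ?thesis by simp
qed

text \<open>\<open>t = e (e' t) - (d w) t\<close>, as \<open>e e' = 1 + d w\<close> and
  \<open>t\<close> is a cycle.\<close>

lemma cycle_postcomp: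
  assumes obj: "x \<in> Obj A" "y \<in> Obj A" "z \<in> Obj A"
    and e: "e \<in> cycles (Hom A y z) 0" "e' \<in> cycles (Hom A z y) 0"
    and w: "w \<in> Mor A z z 1" "Comp A z y z 0 0 e e' \<ominus>\<^bsub>HomGr A z z 0\<^esub> Ident A z = Dif (Hom A z z) 1 w"
    and t: "t \<in> cycles (Hom A x z) i"
  shows "t = Comp A x y z 0 i e (Comp A x z y 0 i e' t) \<ominus>\<^bsub>HomGr A x z i\<^esub>
    Dif (Hom A x z) (i + 1) (Comp A x z z 1 i w t)"
proof -
  note c = cycle_closed[OF e(1)] cycle_closed[OF e(2)] cycle_closed[OF t]
  interpret M: abelian_group "HomGr A x z i" using obj hom_group by blast
  have dw: "Dif (Hom A z z) 1 w \<in> Mor A z z 0" using w obj by (auto intro: dif_closed)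
  have dwt: "Comp A x z z 0 i (Dif (Hom A z z) 1 w) t \<in> Mor A x z i"
    using obj c dw by (auto intro!: comp_closed)
  have ee: "Comp A z y z 0 0 e e' \<in> Mor A z z 0" using obj c by (auto intro!: comp_closed)
  have "Comp A x y z 0 i e (Comp A x z y 0 i e' t) = Comp A x z z 0 i (Comp A z y z 0 0 e e') t"
    using comp_assoc[OF obj(1,3,2,3) c(1,2,3)] by simp
  also have "Comp A z y z 0 0 e e' = Ident A z \<oplus>\<^bsub>HomGr A z z 0\<^esub> Dif (Hom A z z) 1 w"
  proof -
    interpret N: abelian_group "HomGr A z z 0" using obj hom_group by blast
    show ?thesis unfolding w(2)[symmetric] using ee ident_closed[OF obj(3)] by algebra
  qed
  also have "Comp A x z z 0 i \<dots> t = t \<oplus>\<^bsub>HomGr A x z i\<^esub> Comp A x z z 0 i (Dif (Hom A z z) 1 w) t"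
    using obj c dw by (simp add: comp_add_left ident_closed ident_left)
  finally have 1: "Comp A x y z 0 i e (Comp A x z y 0 i e' t) = \<dots>" .
  have 2: "Dif (Hom A x z) (i + 1) (Comp A x z z 1 i w t) = Comp A x z z 0 i (Dif (Hom A z z) 1 w) t"
    using dif_comp_cycle_right[OF obj(1,3,3) t w(1)] by (simp add: add.commute)
  show ?thesis unfolding 1 2 using c dwt by algebra
qed

lemma homotopy_invertibleE:
  assumes "homotopy_invertible A x y e" "x \<in> Obj A" "y \<in> Obj A"
  obtains e' w w' where "e \<in> cycles (Hom A x y) 0" "e' \<in> cycles (Hom A y x) 0"
    "w \<in> Mor A x x 1" "Comp A x y x 0 0 e' e \<ominus>\<^bsub>HomGr A x x 0\<^esub> Ident A x = Dif (Hom A x x) 1 w"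
    "w' \<in> Mor A y y 1" "Comp A y x y 0 0 e e' \<ominus>\<^bsub>HomGr A y y 0\<^esub> Ident A y = Dif (Hom A y y) 1 w'"
  using assms by (auto simp: homotopy_invertible_iff homologous_def)

lemma homotopy_invertible_ident: "x \<in> Obj A \<Longrightarrow> homotopy_invertible A x x (Ident A x)"
  using ident_cycle[of x] ident_closed[of x]
  by (auto simp: homotopy_invertible_iff ident_left intro!: bexI[of _ "Ident A x"] homologous_refl[OF hom_complex])

end

context dgf
begin

lemma H0_functor: "is_functor (H0 (Dom F)) (H0 (Cod F)) (ob F) (H0_mor F)"
  unfolding is_functor_def
proof (intro conjI ballI)
  fix x y f assume x: "x \<in> CObj (H0 (Dom F))" "y \<in> CObj (H0 (Dom F))" and f: "f \<in> CHom (H0 (Dom F)) x y"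
  then show "H0_mor F x y f \<in> CHom (H0 (Cod F)) (ob F x) (ob F y)"
    by (auto simp: H0_mor_def C.H0_hom D.H0_hom ob_closed C.cycle_closed mor_cycle
      intro!: hclass_cycle[OF C.hom_complex] hclass_idem[OF C.hom_complex])
next
  fix x assume x: "x \<in> CObj (H0 (Dom F))"
  then have o: "x \<in> Obj (Dom F)" by simp
  note i = D.ident_cycle[OF o] D.cycle_closed[OF D.ident_cycle[OF o]]
  note h = hclass_homologous[OF D.hom_complex[OF o o] i(2)]
  show "H0_mor F x x (CId (H0 (Dom F)) x) = CId (H0 (Cod F)) (ob F x)"
    using o i h mor_homologous[OF o o h(1) i(2) h(2)]
    by (simp add: H0_mor_def hclass_eq_iff[OF C.hom_complex] ob_closed mor_mor C.ident_closed mor_ident)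
next
  fix x y z f g
  assume "x \<in> CObj (H0 (Dom F))" "y \<in> CObj (H0 (Dom F))" "z \<in> CObj (H0 (Dom F))"
    and fg: "f \<in> CHom (H0 (Dom F)) x y" "g \<in> CHom (H0 (Dom F)) y z"
  then have o: "x \<in> Obj (Dom F)" "y \<in> Obj (Dom F)" "z \<in> Obj (Dom F)" by simp_all
  have f: "f \<in> cycles (Hom (Dom F) x y) 0" and g: "g \<in> cycles (Hom (Dom F) y z) 0"
    using fg o by (auto simp: D.H0_hom)
  let ?c = "Comp (Dom F) x y z 0 0 g f"
  have c: "?c \<in> Mor (Dom F) x z 0" using o f g by (auto intro!: D.comp_closed dest: D.cycle_closed)
  note h = hclass_homologous[OF D.hom_complex[OF o(1,3)] c]
  have "hclass (Hom (Cod F) (ob F x) (ob F z)) 0 (mor F x z 0 (hclass (Hom (Dom F) x z) 0 ?c)) =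
    hclass (Hom (Cod F) (ob F x) (ob F z)) 0 (mor F x z 0 ?c)"
    using o mor_homologous[OF o(1,3) h(1) c h(2)] c h
    by (simp add: hclass_eq_iff[OF C.hom_complex] ob_closed mor_mor)
  then show "H0_mor F x z (CComp (H0 (Dom F)) x y z g f) =
      CComp (H0 (Cod F)) (ob F x) (ob F y) (ob F z) (H0_mor F y z g) (H0_mor F x y f)"
    using o f g
    by (simp add: H0_mor_def C.hclass_comp ob_closed mor_cycle mor_comp D.cycle_closed)
qed (simp add: ob_closed)

end

text \<open>
  The right lifting property against the inclusions of a sphere in a disk; it characterizes
  the degreewise surjective quasi-isomorphisms.
\<close>

definition acyclic_surjection ::
    "('r, 'u) complex \<Rightarrow> ('r, 'u) complex \<Rightarrow> (int \<Rightarrow> 'u \<Rightarrow> 'u) \<Rightarrow> bool" where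
  "acyclic_surjection M N f \<longleftrightarrow>
     (\<forall>i. \<forall>m\<in>cycles M i. \<forall>n\<in>carrier (Gr N (i + 1)). Dif N (i + 1) n = f i m \<longrightarrow>
        (\<exists>l\<in>carrier (Gr M (i + 1)). Dif M (i + 1) l = m \<and> f (i + 1) l = n))"

definition surjective_equivalence :: "'r ring \<Rightarrow> ('r, 'u) dgfun \<Rightarrow> bool" where
  "surjective_equivalence R F \<longleftrightarrow>
     dg_functor R F \<and> (\<forall>y\<in>Obj (Cod F). \<exists>x\<in>Obj (Dom F). ob F x = y) \<and>
     (\<forall>x\<in>Obj (Dom F). \<forall>y\<in>Obj (Dom F).
        acyclic_surjection (Hom (Dom F) x y) (Hom (Cod F) (ob F x) (ob F y)) (mor F x y))"

locale surj_equiv =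
  fixes R :: "'r ring" and F :: "('r, 'u) dgfun"
  assumes surj_equiv: "surjective_equivalence R F"
begin

sublocale dgf R F using surj_equiv by unfold_locales (simp add: surjective_equivalence_def)

lemma ob_surj: "y \<in> Obj (Cod F) \<Longrightarrow> \<exists>x\<in>Obj (Dom F). ob F x = y"
  using surj_equiv by (simp add: surjective_equivalence_def)

lemma lift_boundary:
  assumes "x \<in> Obj (Dom F)" "y \<in> Obj (Dom F)" "m \<in> cycles (Hom (Dom F) x y) i"
    "n \<in> Mor (Cod F) (ob F x) (ob F y) j" "Dif (Hom (Cod F) (ob F x) (ob F y)) j n = mor F x y i m"
    "j = i + 1"
  shows "\<exists>l\<in>Mor (Dom F) x y j. Dif (Hom (Dom F) x y) j l = m \<and> mor F x y j l = n"
  using surj_equiv assms unfolding surjective_equivalence_def acyclic_surjection_def by blast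

lemma lift_cycle:
  assumes "x \<in> Obj (Dom F)" "y \<in> Obj (Dom F)" "n \<in> cycles (Hom (Cod F) (ob F x) (ob F y)) j"
  shows "\<exists>m\<in>cycles (Hom (Dom F) x y) j. mor F x y j m = n"
proof -
  \<comment> \<open>A cycle is a chain with boundary zero, so this is the lifting problem whose
    prescribed boundary upstairs is zero.\<close>
  have "\<zero>\<^bsub>HomGr (Dom F) x y (j - 1)\<^esub> \<in> cycles (Hom (Dom F) x y) (j - 1)"
    using D.dif_zero[OF assms(1,2)] D.mor_zero[OF assms(1,2)] by (simp add: cycles_def)
  then obtain l where "l\<in>Mor (Dom F) x y j"
    "Dif (Hom (Dom F) x y) j l = \<zero>\<^bsub>HomGr (Dom F) x y (j - 1)\<^esub>" "mor F x y j l = n"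
    using lift_boundary[OF assms(1,2), of "\<zero>\<^bsub>HomGr (Dom F) x y (j - 1)\<^esub>" "j - 1" n j] assms
    by (auto simp: cycles_def mor_zero)
  then show ?thesis by (auto simp: cycles_def)
qed

text \<open>The boundary of \<open>n\<close> is a cycle and lifts as such; then \<open>n\<close>
  lifts as a chain with that boundary.\<close>

lemma lift_mor:
  assumes "x \<in> Obj (Dom F)" "y \<in> Obj (Dom F)" "n \<in> Mor (Cod F) (ob F x) (ob F y) j"
  shows "\<exists>m\<in>Mor (Dom F) x y j. mor F x y j m = n"
proof -
  have "Dif (Hom (Cod F) (ob F x) (ob F y)) j n \<in> cycles (Hom (Cod F) (ob F x) (ob F y)) (j - 1)"
    using assms by (intro C.dif_cycle) (auto simp: ob_closed)
  from lift_cycle[OF assms(1,2) this] obtain m where "m \<in> cycles (Hom (Dom F) x y) (j - 1)"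
    "mor F x y (j - 1) m = Dif (Hom (Cod F) (ob F x) (ob F y)) j n" by blast
  from lift_boundary[OF assms(1,2) this(1) assms(3)] this(2) show ?thesis by auto
qed

text \<open>The difference of the two cycles is a cycle whose image bounds; lifting the bounding
  chain gives the homology upstairs.\<close>

lemma lift_homologous:
  assumes "x \<in> Obj (Dom F)" "y \<in> Obj (Dom F)" "f \<in> cycles (Hom (Dom F) x y) i" "g \<in> cycles (Hom (Dom F) x y) i"
    and "homologous (Hom (Cod F) (ob F x) (ob F y)) i (mor F x y i f) (mor F x y i g)"
  shows "homologous (Hom (Dom F) x y) i f g"
proof -
  note c = D.cycle_closed[OF assms(3)] D.cycle_closed[OF assms(4)]
  interpret N: abelian_group "HomGr (Dom F) x y (i - 1)" using D.hom_group assms by blast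
  have "f \<ominus>\<^bsub>HomGr (Dom F) x y i\<^esub> g \<in> cycles (Hom (Dom F) x y) i"
    using c assms by (simp add: cycles_def D.dif_minus D.mor_minus)
  moreover obtain w where "w \<in> Mor (Cod F) (ob F x) (ob F y) (i + 1)"
    "Dif (Hom (Cod F) (ob F x) (ob F y)) (i + 1) w = mor F x y i (f \<ominus>\<^bsub>HomGr (Dom F) x y i\<^esub> g)"
    using assms c by (auto simp: homologous_def mor_minus)
  ultimately show ?thesis
    using lift_boundary[OF assms(1,2), of _ i w "i + 1"] unfolding homologous_def by metis
qed

lemma quasi_iso:
  assumes o: "x \<in> Obj (Dom F)" "y \<in> Obj (Dom F)"
  shows "quasi_isomorphism (Hom (Dom F) x y) (Hom (Cod F) (ob F x) (ob F y)) (mor F x y)"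
  unfolding quasi_isomorphism_def
proof
  fix i
  note oF = ob_closed[OF o(1)] ob_closed[OF o(2)]
  note DM = D.hom_complex[OF o] and CM = C.hom_complex[OF oF]
  let ?h = "hclass (Hom (Dom F) x y) i" and ?k = "hclass (Hom (Cod F) (ob F x) (ob F y)) i"
  show "bij_betw (\<lambda>z. ?k (mor F x y i z)) (carrier (homology (Hom (Dom F) x y) i))
     (carrier (homology (Hom (Cod F) (ob F x) (ob F y)) i))"
  proof (rule bij_betwI')
    fix a b
    assume a: "a \<in> carrier (homology (Hom (Dom F) x y) i)" and b: "b \<in> carrier (homology (Hom (Dom F) x y) i)"
    have ab: "a \<in> cycles (Hom (Dom F) x y) i" "b \<in> cycles (Hom (Dom F) x y) i" "?h a = a" "?h b = b"
      using a b by (auto simp: homology_rep[OF DM])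
    note c = D.cycle_closed[OF ab(1)] D.cycle_closed[OF ab(2)]
    show "(?k (mor F x y i a) = ?k (mor F x y i b)) = (a = b)"
      using lift_homologous[OF o ab(1,2)] hclass_eq_iff[OF DM c] ab c
      by (auto simp: hclass_eq_iff[OF CM] mor_mor o intro!: homologous_refl[OF CM])
  next
    fix a assume a: "a \<in> carrier (homology (Hom (Dom F) x y) i)"
    then show "?k (mor F x y i a) \<in> carrier (homology (Hom (Cod F) (ob F x) (ob F y)) i)"
      by (auto simp: homology_rep[OF DM] homology_carrier[OF CM] mor_cycle o)
  next
    fix n assume n: "n \<in> carrier (homology (Hom (Cod F) (ob F x) (ob F y)) i)"
    then have n': "n \<in> cycles (Hom (Cod F) (ob F x) (ob F y)) i" "?k n = n" by (auto simp: homology_rep[OF CM])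
    then obtain m where m: "m \<in> cycles (Hom (Dom F) x y) i" "mor F x y i m = n"
      using lift_cycle[OF o] by blast
    note c = D.cycle_closed[OF m(1)]
    note h = hclass_homologous[OF DM c]
    have "?k (mor F x y i (?h m)) = ?k (mor F x y i m)"
      using mor_homologous[OF o h(1) c h(2)] c h by (simp add: hclass_eq_iff[OF CM] mor_mor o)
    then show "\<exists>a\<in>carrier (homology (Hom (Dom F) x y) i). n = ?k (mor F x y i a)"
      using m n' by (auto simp: homology_carrier[OF DM] intro!: bexI[of _ m])
  qed
qed

lemma lift_homotopy_invertible:
  assumes o: "x \<in> Obj (Dom F)" "y \<in> Obj (Dom F)"
    and v: "homotopy_invertible (Cod F) (ob F x) (ob F y) v"
  shows "\<exists>u. homotopy_invertible (Dom F) x y u \<and> mor F x y 0 u = v"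
proof -
  note oF = ob_closed[OF o(1)] ob_closed[OF o(2)]
  obtain v' where v: "v \<in> cycles (Hom (Cod F) (ob F x) (ob F y)) 0"
    and v': "v' \<in> cycles (Hom (Cod F) (ob F y) (ob F x)) 0"
      "homologous (Hom (Cod F) (ob F x) (ob F x)) 0 (Comp (Cod F) (ob F x) (ob F y) (ob F x) 0 0 v' v) (Ident (Cod F) (ob F x))"
      "homologous (Hom (Cod F) (ob F y) (ob F y)) 0 (Comp (Cod F) (ob F y) (ob F x) (ob F y) 0 0 v v') (Ident (Cod F) (ob F y))"
    using v oF by (auto simp: C.homotopy_invertible_iff)
  obtain u where u: "u \<in> cycles (Hom (Dom F) x y) 0" "mor F x y 0 u = v" using lift_cycle[OF o v] by blast
  obtain u' where u': "u' \<in> cycles (Hom (Dom F) y x) 0" "mor F y x 0 u' = v'" using lift_cycle[OF o(2,1) v'(1)] by blast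
  note c = D.cycle_closed[OF u(1)] D.cycle_closed[OF u'(1)]
  have "homologous (Hom (Dom F) x x) 0 (Comp (Dom F) x y x 0 0 u' u) (Ident (Dom F) x)"
    "homologous (Hom (Dom F) y y) 0 (Comp (Dom F) y x y 0 0 u u') (Ident (Dom F) y)"
    using o u u' v' c by (auto intro!: lift_homologous D.comp_cycle D.ident_cycle simp: mor_comp mor_ident)
  then have "homotopy_invertible (Dom F) x y u"
    using u(1) u'(1) o by (auto simp: D.homotopy_invertible_iff)
  then show ?thesis using u(2) by blast
qed

lemma equivalence: "quasi_equivalence R F"
  unfolding quasi_equivalence_def
proof (intro conjI ballI)
  show "is_equivalence (H0 (Dom F)) (H0 (Cod F)) (ob F) (H0_mor F)"
  proof (rule is_equivalence_if_bij)
    fix x y assume "x \<in> CObj (H0 (Dom F))" "y \<in> CObj (H0 (Dom F))"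
    then show "bij_betw (H0_mor F x y) (CHom (H0 (Dom F)) x y) (CHom (H0 (Cod F)) (ob F x) (ob F y))"
      using quasi_iso[of x y] by (simp add: quasi_isomorphism_def H0_mor_def[abs_def])
  qed (use ob_surj H0_functor D.H0_comp_closed D.H0_ident_closed C.H0_ident_closed C.H0_unit in \<open>simp_all\<close>)
qed (use quasi_iso is_functor in auto)

text \<open>For (F2) any preimage of the target object will do, because homotopy equivalences lift
  between fixed objects together with their inverses.\<close>

lemma trivial_fib: "trivial_fibration R F"
  unfolding trivial_fibration_def fibration_def
proof (intro conjI ballI allI impI)
  fix x y i assume "x \<in> Obj (Dom F)" "y \<in> Obj (Dom F)"
  then show "mor F x y i ` Mor (Dom F) x y i = Mor (Cod F) (ob F x) (ob F y) i"
    using mor_mor lift_mor by blast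
next
  fix x b v assume x: "x \<in> Obj (Dom F)" and b: "b \<in> Obj (Cod F)" and v: "homotopy_invertible (Cod F) (ob F x) b v"
  obtain y where "y \<in> Obj (Dom F)" "ob F y = b" using ob_surj[OF b] by blast
  with lift_homotopy_invertible[OF x this(1)] v
  show "\<exists>a2\<in>Obj (Dom F). \<exists>u. ob F a2 = b \<and> homotopy_invertible (Dom F) x a2 u \<and> mor F x a2 0 u = v"
    by blast
qed (use equivalence is_functor in auto)

end

lemma cofibrant_lift:
  assumes "cofibrant R B" "surjective_equivalence R P" "F \<in> dg_hom R B (Cod P)"
  shows "\<exists>L\<in>dg_hom R B (Dom P). P \<circ>\<^sub>d L = F"
  using assms surj_equiv.trivial_fib[of R P] unfolding cofibrant_def surj_equiv_def by blast

section \<open>Quasi-equivalences in terms of cycles and boundaries\<close>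

locale quasi_equiv =
  fixes R :: "'r ring" and F :: "('r, 'u) dgfun"
  assumes quasi_equiv: "quasi_equivalence R F"
begin

sublocale dgf R F using quasi_equiv by unfold_locales (simp add: quasi_equivalence_def)

context
  fixes x y :: 'u and i :: int
  assumes o: "x \<in> Obj (Dom F)" "y \<in> Obj (Dom F)"
begin

lemma homology_bij:
  "bij_betw (\<lambda>z. hclass (Hom (Cod F) (ob F x) (ob F y)) i (mor F x y i z))
    (carrier (homology (Hom (Dom F) x y) i)) (carrier (homology (Hom (Cod F) (ob F x) (ob F y)) i))"
  using quasi_equiv o by (simp add: quasi_equivalence_def quasi_isomorphism_def)

lemma reflects_boundary:
  assumes m: "m \<in> cycles (Hom (Dom F) x y) i"
    and n: "mor F x y i m \<in> boundaries (Hom (Cod F) (ob F x) (ob F y)) i"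
  shows "m \<in> boundaries (Hom (Dom F) x y) i"
proof -
  note oF = ob_closed[OF o(1)] ob_closed[OF o(2)]
  note DM = D.hom_complex[OF o] and CM = C.hom_complex[OF oF]
  let ?h = "hclass (Hom (Dom F) x y) i" and ?k = "hclass (Hom (Cod F) (ob F x) (ob F y)) i"
  let ?O = "\<zero>\<^bsub>HomGr (Dom F) x y i\<^esub>"
  have O: "?O \<in> cycles (Hom (Dom F) x y) i" using o by (simp add: cycles_def D.dif_zero D.mor_zero)
  note c = D.cycle_closed[OF m] D.cycle_closed[OF O]
  \<comment> \<open>The map on homology is applied to chosen cycles; passing from \<open>z\<close>
    to its chosen cycle leaves the class of the image unchanged.\<close>
  have k: "?k (mor F x y i (?h z)) = ?k (mor F x y i z)" if "z \<in> Mor (Dom F) x y i" for z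
    using hclass_homologous[OF DM that] that o by (simp add: hclass_eq_iff[OF CM] mor_mor mor_homologous)
  have "?k (mor F x y i m) = ?k (mor F x y i ?O)"
    using n hclass_boundary_iff[OF CM mor_mor[OF o c(1)]] by (simp add: mor_zero o)
  then have "?k (mor F x y i (?h m)) = ?k (mor F x y i (?h ?O))" using k c by simp
  then have "?h m = ?h ?O"
    using homology_bij homology_carrier[OF DM] m O by (auto simp: bij_betw_def inj_on_def)
  then show ?thesis using hclass_boundary_iff[OF DM c(1)] by simp
qed

lemma lift_cycle_homologous:
  assumes n: "n \<in> cycles (Hom (Cod F) (ob F x) (ob F y)) i"
  shows "\<exists>m\<in>cycles (Hom (Dom F) x y) i. homologous (Hom (Cod F) (ob F x) (ob F y)) i n (mor F x y i m)"
proof -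
  note oF = ob_closed[OF o(1)] ob_closed[OF o(2)]
  note DM = D.hom_complex[OF o] and CM = C.hom_complex[OF oF]
  let ?k = "hclass (Hom (Cod F) (ob F x) (ob F y)) i"
  have "?k n \<in> carrier (homology (Hom (Cod F) (ob F x) (ob F y)) i)"
    using n homology_carrier[OF CM] by auto
  then obtain m where m: "m \<in> carrier (homology (Hom (Dom F) x y) i)" "?k n = ?k (mor F x y i m)"
    using homology_bij by (auto simp: bij_betw_def)
  then have "m \<in> cycles (Hom (Dom F) x y) i" by (simp add: homology_rep[OF DM])
  then show ?thesis
    using m(2) hclass_eq_iff[OF CM C.cycle_closed[OF n] mor_mor[OF o]] D.cycle_closed by blast
qed

end

lemma essentially_surj:
  assumes "z \<in> Obj (Cod F)"
  shows "\<exists>x\<in>Obj (Dom F). \<exists>e. homotopy_invertible (Cod F) (ob F x) z e"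
proof -
  obtain Go Gm \<epsilon> where G: "is_functor (H0 (Cod F)) (H0 (Dom F)) Go Gm"
    and e: "natural_iso (H0 (Cod F)) (H0 (Cod F)) (\<lambda>x. ob F (Go x))
      (\<lambda>x y f. H0_mor F (Go x) (Go y) (Gm x y f)) (\<lambda>x. x) (\<lambda>x y f. f) \<epsilon>"
    using quasi_equiv unfolding quasi_equivalence_def is_equivalence_def by blast
  have Go: "Go z \<in> Obj (Dom F)" using G assms by (simp add: is_functor_def)
  have "invertible_in (H0 (Cod F)) (ob F (Go z)) z (\<epsilon> z)" using e assms by (simp add: natural_iso_def)
  \<comment> \<open>A morphism of \<open>H0\<close> is a chosen cycle and represents itself, so the
    counit at \<open>z\<close> is already the required homotopy equivalence.\<close>
  then have "homotopy_invertible (Cod F) (ob F (Go z)) z (\<epsilon> z)"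
    using Go assms by (auto simp: homotopy_invertible_def invertible_in_def C.H0_hom ob_closed)
  then show ?thesis using Go by blast
qed

end

section \<open>Homotopy pullbacks and path categories\<close>

text \<open>
  The objects of \<open>hpb p q\<close> are the triples of \<open>u\<close>, \<open>v\<close> and a homotopy equivalence \<open>e\<close> from \<open>p u\<close>
  to \<open>q v\<close>; a morphism of degree \<open>i\<close> is a triple \<open>(a, b, h)\<close> in which \<open>h\<close> has degree \<open>i + 1\<close> and
  bounds the defect of commutativity of the square formed by \<open>p a\<close> and \<open>q b\<close>.
\<close>

definition hpb :: "('r, ('r, 'a) univ) dgfun \<Rightarrow> ('r, ('r, 'a) univ) dgfun \<Rightarrow>
    ('r, ('r, 'a) univ) dgcat" where
  "hpb p q =
     \<lparr>Obj = {UPair u (UPair v e) | u v e. u \<in> Obj (Dom p) \<and> v \<in> Obj (Dom q) \<and>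
               homotopy_invertible (Cod p) (ob p u) (ob q v) e},
      Hom = (\<lambda>s t.
        \<lparr>Gr = (\<lambda>i. direct_sum_module (HomGr (Dom p) (ufst s) (ufst t) i)
            (direct_sum_module (HomGr (Dom q) (ufst (usnd s)) (ufst (usnd t)) i)
              (HomGr (Cod p) (ob p (ufst s)) (ob q (ufst (usnd t))) (i + 1)))),
         Dif = (\<lambda>i m. UPair (Dif (Hom (Dom p) (ufst s) (ufst t)) i (ufst m))
            (UPair (Dif (Hom (Dom q) (ufst (usnd s)) (ufst (usnd t))) i (ufst (usnd m)))
              ((Comp (Cod p) (ob p (ufst s)) (ob q (ufst (usnd s))) (ob q (ufst (usnd t))) i 0
                  (mor q (ufst (usnd s)) (ufst (usnd t)) i (ufst (usnd m))) (usnd (usnd s))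
                \<ominus>\<^bsub>HomGr (Cod p) (ob p (ufst s)) (ob q (ufst (usnd t))) i\<^esub>
                Comp (Cod p) (ob p (ufst s)) (ob p (ufst t)) (ob q (ufst (usnd t))) 0 i
                  (usnd (usnd t)) (mor p (ufst s) (ufst t) i (ufst m)))
               \<ominus>\<^bsub>HomGr (Cod p) (ob p (ufst s)) (ob q (ufst (usnd t))) i\<^esub>
               Dif (Hom (Cod p) (ob p (ufst s)) (ob q (ufst (usnd t)))) (i + 1) (usnd (usnd m)))))\<rparr>),
      Comp = (\<lambda>s t r i j g f.
        UPair (Comp (Dom p) (ufst s) (ufst t) (ufst r) i j (ufst g) (ufst f))
          (UPair (Comp (Dom q) (ufst (usnd s)) (ufst (usnd t)) (ufst (usnd r)) i j
                    (ufst (usnd g)) (ufst (usnd f)))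
            (Comp (Cod p) (ob p (ufst s)) (ob p (ufst t)) (ob q (ufst (usnd r))) (i + 1) j
                (usnd (usnd g)) (mor p (ufst s) (ufst t) j (ufst f))
             \<oplus>\<^bsub>HomGr (Cod p) (ob p (ufst s)) (ob q (ufst (usnd r))) (i + j + 1)\<^esub>
             koszul (HomGr (Cod p) (ob p (ufst s)) (ob q (ufst (usnd r))) (i + j + 1)) i
              (Comp (Cod p) (ob p (ufst s)) (ob q (ufst (usnd t))) (ob q (ufst (usnd r))) i (j + 1)
                (mor q (ufst (usnd t)) (ufst (usnd r)) i (ufst (usnd g))) (usnd (usnd f)))))),
      Ident = (\<lambda>s. UPair (Ident (Dom p) (ufst s)) (UPair (Ident (Dom q) (ufst (usnd s)))
        \<zero>\<^bsub>HomGr (Cod p) (ob p (ufst s)) (ob q (ufst (usnd s))) 1\<^esub>))\<rparr>"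

lemma hpb_Obj [simp]:
  "UPair u (UPair v e) \<in> Obj (hpb p q) \<longleftrightarrow> u \<in> Obj (Dom p) \<and> v \<in> Obj (Dom q) \<and>
     homotopy_invertible (Cod p) (ob p u) (ob q v) e"
  by (simp add: hpb_def)

lemma hpb_ObjE:
  assumes "s \<in> Obj (hpb p q)"
  obtains u v e where "s = UPair u (UPair v e)" "u \<in> Obj (Dom p)" "v \<in> Obj (Dom q)"
    "homotopy_invertible (Cod p) (ob p u) (ob q v) e"
  using assms by (auto simp: hpb_def)

lemma hpb_HomGr [simp]:
  "HomGr (hpb p q) (UPair u (UPair v e)) (UPair u' (UPair v' e')) i =
    direct_sum_module (HomGr (Dom p) u u' i)
      (direct_sum_module (HomGr (Dom q) v v' i) (HomGr (Cod p) (ob p u) (ob q v') (i + 1)))"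
  by (simp add: hpb_def)

lemma hpb_Dif [simp]:
  "Dif (Hom (hpb p q) (UPair u (UPair v e)) (UPair u' (UPair v' e'))) i (UPair a (UPair b h)) =
    UPair (Dif (Hom (Dom p) u u') i a) (UPair (Dif (Hom (Dom q) v v') i b)
      ((Comp (Cod p) (ob p u) (ob q v) (ob q v') i 0 (mor q v v' i b) e
        \<ominus>\<^bsub>HomGr (Cod p) (ob p u) (ob q v') i\<^esub>
        Comp (Cod p) (ob p u) (ob p u') (ob q v') 0 i e' (mor p u u' i a))
       \<ominus>\<^bsub>HomGr (Cod p) (ob p u) (ob q v') i\<^esub> Dif (Hom (Cod p) (ob p u) (ob q v')) (i + 1) h))"
  by (simp add: hpb_def)

lemma hpb_Comp [simp]:
  "Comp (hpb p q) (UPair u (UPair v e)) (UPair u' (UPair v' e')) (UPair u'' (UPair v'' e'')) i j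
      (UPair a' (UPair b' h')) (UPair a (UPair b h)) =
    UPair (Comp (Dom p) u u' u'' i j a' a) (UPair (Comp (Dom q) v v' v'' i j b' b)
      (Comp (Cod p) (ob p u) (ob p u') (ob q v'') (i + 1) j h' (mor p u u' j a)
       \<oplus>\<^bsub>HomGr (Cod p) (ob p u) (ob q v'') (i + j + 1)\<^esub>
       koszul (HomGr (Cod p) (ob p u) (ob q v'') (i + j + 1)) i
         (Comp (Cod p) (ob p u) (ob q v') (ob q v'') i (j + 1) (mor q v' v'' i b') h)))"
  by (simp add: hpb_def)

lemma hpb_Ident [simp]:
  "Ident (hpb p q) (UPair u (UPair v e)) =
    UPair (Ident (Dom p) u) (UPair (Ident (Dom q) v) \<zero>\<^bsub>HomGr (Cod p) (ob p u) (ob q v) 1\<^esub>)"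
  by (simp add: hpb_def)

lemma triple_sumE:
  assumes "m \<in> carrier (direct_sum_module M (direct_sum_module N L))"
  obtains a b h where "m = UPair a (UPair b h)" "a \<in> carrier M" "b \<in> carrier N" "h \<in> carrier L"
  using assms by (auto simp: direct_sum_module_def)

lemma linear_map_triple:
  assumes "linear_map R K M f" "linear_map R K N g" "linear_map R K L h"
  shows "linear_map R K (direct_sum_module M (direct_sum_module N L)) (\<lambda>x. UPair (f x) (UPair (g x) (h x)))"
  by (intro linear_map_pair assms)

lemma linear_map_proj:
  "linear_map R (direct_sum_module M (direct_sum_module N L)) M ufst"
  "linear_map R (direct_sum_module M (direct_sum_module N L)) N (\<lambda>m. ufst (usnd m))"
  "linear_map R (direct_sum_module M (direct_sum_module N L)) L (\<lambda>m. usnd (usnd m))"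
  using linear_map_ufst linear_map_compose[OF linear_map_usnd linear_map_ufst]
    linear_map_compose[OF linear_map_usnd linear_map_usnd] by blast+

locale cospan = p: dgf R p + q: dgf R q
  for R :: "'r ring" and p q :: "('r, ('r, 'a) univ) dgfun" +
  assumes cod: "Cod q = Cod p"
begin

abbreviation "U \<equiv> Dom p"
abbreviation "V \<equiv> Dom q"
abbreviation "Y \<equiv> Cod p"
abbreviation "P \<equiv> ob p"
abbreviation "Q \<equiv> ob q"

lemmas q_ob = q.ob_closed[unfolded cod]
lemmas q_mor = q.mor_mor[unfolded cod]
lemmas q_dif = q.mor_dif[unfolded cod]
lemmas q_comp = q.mor_comp[unfolded cod]
lemmas q_ident = q.mor_ident[unfolded cod]
lemmas q_linear = q.mor_linear[unfolded cod]
lemmas obs = p.ob_closed q_ob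
lemmas mors = p.mor_mor q_mor

lemma inv_cycle: "homotopy_invertible Y x y e \<Longrightarrow> e \<in> cycles (Hom Y x y) 0"
  by (simp add: homotopy_invertible_def)

lemma hpb_module:
  assumes "s \<in> Obj (hpb p q)" "t \<in> Obj (hpb p q)"
  shows "Module.module R (HomGr (hpb p q) s t i)"
  using assms
  by (elim hpb_ObjE) (simp add: module_direct_sum p.D.hom_module q.D.hom_module p.C.hom_module obs)

lemma hpb_dif_linear:
  assumes "s \<in> Obj (hpb p q)" "t \<in> Obj (hpb p q)"
  shows "linear_map R (HomGr (hpb p q) s t i) (HomGr (hpb p q) s t (i - 1)) (Dif (Hom (hpb p q) s t) i)"
proof -
  obtain u v e where s: "s = UPair u (UPair v e)" "u \<in> Obj U" "v \<in> Obj V"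
    "homotopy_invertible Y (P u) (Q v) e" using assms(1) by (rule hpb_ObjE)
  obtain u' v' e' where t: "t = UPair u' (UPair v' e')" "u' \<in> Obj U" "v' \<in> Obj V"
    "homotopy_invertible Y (P u') (Q v') e'" using assms(2) by (rule hpb_ObjE)
  note e = p.C.cycle_closed[OF inv_cycle[OF s(4)]] p.C.cycle_closed[OF inv_cycle[OF t(4)]]
  let ?D = "direct_sum_module (HomGr U u u' i) (direct_sum_module (HomGr V v v' i) (HomGr Y (P u) (Q v') (i + 1)))"
  have 1: "linear_map R ?D (HomGr Y (P u) (Q v') i)
      (\<lambda>m. Comp Y (P u) (Q v) (Q v') i 0 (mor q v v' i (ufst (usnd m))) e)"
    using p.C.comp_linear_left[of "P u" "Q v" "Q v'" e 0 i] s t e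
    by (intro linear_map_compose[OF linear_map_compose[OF linear_map_proj(2) q_linear]]) (simp_all add: obs)
  have 2: "linear_map R ?D (HomGr Y (P u) (Q v') i)
      (\<lambda>m. Comp Y (P u) (P u') (Q v') 0 i e' (mor p u u' i (ufst m)))"
    using p.C.comp_linear_right[of "P u" "P u'" "Q v'" e' 0 i] s t e
    by (intro linear_map_compose[OF linear_map_compose[OF linear_map_proj(1) p.mor_linear]]) (simp_all add: obs)
  have 3: "linear_map R ?D (HomGr Y (P u) (Q v') i)
      (\<lambda>m. Dif (Hom Y (P u) (Q v')) (i + 1) (usnd (usnd m)))"
    using p.C.dif_linear[of "P u" "Q v'" "i + 1"] s t
    by (intro linear_map_compose[OF linear_map_proj(3)]) (simp add: obs)
  have 4: "linear_map R ?D (HomGr U u u' (i - 1)) (\<lambda>m. Dif (Hom U u u') i (ufst m))"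
    by (rule linear_map_compose[OF linear_map_proj(1) p.D.dif_linear]) (simp_all add: s t)
  have 5: "linear_map R ?D (HomGr V v v' (i - 1)) (\<lambda>m. Dif (Hom V v v') i (ufst (usnd m)))"
    by (rule linear_map_compose[OF linear_map_proj(2) q.D.dif_linear]) (simp_all add: s t)
  have M: "Module.module R (HomGr Y (P u) (Q v') i)" using s t by (simp add: p.C.hom_module obs)
  note L = linear_map_triple[OF 4 5 linear_map_diff[OF M linear_map_diff[OF M 1 2] 3]]
  show ?thesis using L by (simp add: s t hpb_def)
qed

text \<open>In the third component, \<open>d (b e - e' a - d h)\<close> equals
  \<open>(d b) e - e' (d a)\<close>, since \<open>e\<close> and \<open>e'\<close> are cycles. This
  cancels against the terms that \<open>d b\<close> and \<open>d a\<close> contribute, because the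
  differential of the third component enters with a minus sign.\<close>

lemma hpb_dif_dif:
  assumes "s \<in> Obj (hpb p q)" "t \<in> Obj (hpb p q)" and m: "m \<in> Mor (hpb p q) s t i"
  shows "Dif (Hom (hpb p q) s t) (i - 1) (Dif (Hom (hpb p q) s t) i m) = \<zero>\<^bsub>HomGr (hpb p q) s t (i - 2)\<^esub>"
proof -
  obtain u v e where s: "s = UPair u (UPair v e)" "u \<in> Obj U" "v \<in> Obj V"
    "homotopy_invertible Y (P u) (Q v) e" using assms(1) by (rule hpb_ObjE)
  obtain u' v' e' where t: "t = UPair u' (UPair v' e')" "u' \<in> Obj U" "v' \<in> Obj V"
    "homotopy_invertible Y (P u') (Q v') e'" using assms(2) by (rule hpb_ObjE)
  note ec = inv_cycle[OF s(4)] inv_cycle[OF t(4)]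
  note e = p.C.cycle_closed[OF ec(1)] p.C.cycle_closed[OF ec(2)]
  obtain a b h where m: "m = UPair a (UPair b h)" "a \<in> Mor U u u' i" "b \<in> Mor V v v' i"
    "h \<in> Mor Y (P u) (Q v') (i + 1)" using m by (auto simp: s t elim!: triple_sumE)
  note o = s(2,3) t(2,3) p.ob_closed[OF s(2)] q_ob[OF s(3)] p.ob_closed[OF t(2)] q_ob[OF t(3)]
  interpret N: abelian_group "HomGr Y (P u) (Q v') (i - 1)" using o p.C.hom_group by simp
  let ?b = "mor q v v' i b" and ?a = "mor p u u' i a"
  have ab: "?a \<in> Mor Y (P u) (P u') i" "?b \<in> Mor Y (Q v) (Q v') i" using m o by (simp_all add: mors)
  have be: "Comp Y (P u) (Q v) (Q v') i 0 ?b e \<in> Mor Y (P u) (Q v') i"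
    and ea: "Comp Y (P u) (P u') (Q v') 0 i e' ?a \<in> Mor Y (P u) (Q v') i"
    and dh: "Dif (Hom Y (P u) (Q v')) (i + 1) h \<in> Mor Y (P u) (Q v') i"
    using ab e o m by (auto intro!: p.C.mor_closed)
  define B where "B = Comp Y (P u) (Q v) (Q v') (i - 1) 0 (Dif (Hom Y (Q v) (Q v')) i ?b) e"
  define A where "A = Comp Y (P u) (P u') (Q v') 0 (i - 1) e' (Dif (Hom Y (P u) (P u')) i ?a)"
  have BA: "B \<in> Mor Y (P u) (Q v') (i - 1)" "A \<in> Mor Y (P u) (Q v') (i - 1)"
    using ab e o unfolding A_def B_def by (auto intro!: p.C.mor_closed)
  have 1: "Dif (Hom Y (P u) (Q v')) i (Comp Y (P u) (Q v) (Q v') i 0 ?b e) = B"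
    using p.C.dif_comp_cycle_right[OF _ _ _ ec(1) ab(2)] o by (simp add: B_def)
  have 2: "Dif (Hom Y (P u) (Q v')) i (Comp Y (P u) (P u') (Q v') 0 i e' ?a) = A"
    using p.C.dif_comp_cycle_left[OF _ _ _ ec(2) ab(1)] o by (simp add: A_def)
  have 3: "Dif (Hom Y (P u) (Q v')) i (Dif (Hom Y (P u) (Q v')) (i + 1) h) = \<zero>\<^bsub>HomGr Y (P u) (Q v') (i - 1)\<^esub>"
    using p.C.dif_dif[OF o(5,8) m(4), of i] by simp
  have "Dif (Hom Y (P u) (Q v')) i ((Comp Y (P u) (Q v) (Q v') i 0 ?b e
      \<ominus>\<^bsub>HomGr Y (P u) (Q v') i\<^esub> Comp Y (P u) (P u') (Q v') 0 i e' ?a)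
      \<ominus>\<^bsub>HomGr Y (P u) (Q v') i\<^esub> Dif (Hom Y (P u) (Q v')) (i + 1) h) =
    (B \<ominus>\<^bsub>HomGr Y (P u) (Q v') (i - 1)\<^esub> A) \<ominus>\<^bsub>HomGr Y (P u) (Q v') (i - 1)\<^esub>
     \<zero>\<^bsub>HomGr Y (P u) (Q v') (i - 1)\<^esub>"
    using o be ea dh by (simp add: p.C.dif_minus 1 2 3 p.C.mor_minus)
  moreover have "(B \<ominus>\<^bsub>HomGr Y (P u) (Q v') (i - 1)\<^esub> A) \<ominus>\<^bsub>HomGr Y (P u) (Q v') (i - 1)\<^esub>
    ((B \<ominus>\<^bsub>HomGr Y (P u) (Q v') (i - 1)\<^esub> A) \<ominus>\<^bsub>HomGr Y (P u) (Q v') (i - 1)\<^esub>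
     \<zero>\<^bsub>HomGr Y (P u) (Q v') (i - 1)\<^esub>) = \<zero>\<^bsub>HomGr Y (P u) (Q v') (i - 1)\<^esub>"
    using BA by algebra
  ultimately show ?thesis
    using m o by (simp add: s t p.D.dif_dif q.D.dif_dif p.mor_dif q_dif flip: A_def B_def)
qed

lemma hpb_comp_linear_right:
  assumes "s \<in> Obj (hpb p q)" "t \<in> Obj (hpb p q)" "r \<in> Obj (hpb p q)" and g: "g \<in> Mor (hpb p q) t r i"
  shows "linear_map R (HomGr (hpb p q) s t j) (HomGr (hpb p q) s r (i + j)) (\<lambda>f. Comp (hpb p q) s t r i j g f)"
proof -
  obtain u v e where s: "s = UPair u (UPair v e)" "u \<in> Obj U" "v \<in> Obj V" using assms(1) by (rule hpb_ObjE)
  obtain u' v' e' where t: "t = UPair u' (UPair v' e')" "u' \<in> Obj U" "v' \<in> Obj V" using assms(2) by (rule hpb_ObjE)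
  obtain u'' v'' e'' where r: "r = UPair u'' (UPair v'' e'')" "u'' \<in> Obj U" "v'' \<in> Obj V" using assms(3) by (rule hpb_ObjE)
  obtain a' b' h' where g: "g = UPair a' (UPair b' h')" "a' \<in> Mor U u' u'' i" "b' \<in> Mor V v' v'' i"
    "h' \<in> Mor Y (P u') (Q v'') (i + 1)" using g by (auto simp: t r elim!: triple_sumE)
  note o = s(2,3) t(2,3) r(2,3) p.ob_closed[OF s(2)] q_ob[OF s(3)] p.ob_closed[OF t(2)] q_ob[OF t(3)] p.ob_closed[OF r(2)] q_ob[OF r(3)]
  let ?D = "direct_sum_module (HomGr U u u' j) (direct_sum_module (HomGr V v v' j) (HomGr Y (P u) (Q v') (j + 1)))"
  have M: "Module.module R (HomGr Y (P u) (Q v'') (i + j + 1))" using o by (simp add: p.C.hom_module)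
  have "linear_map R (HomGr Y (P u) (P u') j) (HomGr Y (P u) (Q v'') (i + j + 1))
      (\<lambda>f. Comp Y (P u) (P u') (Q v'') (i + 1) j h' f)"
    using p.C.comp_linear_right[of "P u" "P u'" "Q v''" h' "i + 1" j] o g by (simp add: algebra_simps)
  then have 1: "linear_map R ?D (HomGr Y (P u) (Q v'') (i + j + 1))
      (\<lambda>m. Comp Y (P u) (P u') (Q v'') (i + 1) j h' (mor p u u' j (ufst m)))"
    by (rule linear_map_compose[OF linear_map_compose[OF linear_map_proj(1) p.mor_linear], rotated 2])
      (use o in auto)
  have "linear_map R (HomGr Y (P u) (Q v') (j + 1)) (HomGr Y (P u) (Q v'') (i + j + 1))
      (\<lambda>f. Comp Y (P u) (Q v') (Q v'') i (j + 1) (mor q v' v'' i b') f)"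
    using p.C.comp_linear_right[of "P u" "Q v'" "Q v''" "mor q v' v'' i b'" i "j + 1"] o g
    by (simp add: algebra_simps mors)
  then have 2: "linear_map R ?D (HomGr Y (P u) (Q v'') (i + j + 1))
      (\<lambda>m. Comp Y (P u) (Q v') (Q v'') i (j + 1) (mor q v' v'' i b') (usnd (usnd m)))"
    by (rule linear_map_compose[OF linear_map_proj(3)])
  have 4: "linear_map R ?D (HomGr U u u'' (i + j)) (\<lambda>m. Comp U u u' u'' i j a' (ufst m))"
    by (rule linear_map_compose[OF linear_map_proj(1) p.D.comp_linear_right]) (simp_all add: o g)
  have 5: "linear_map R ?D (HomGr V v v'' (i + j)) (\<lambda>m. Comp V v v' v'' i j b' (ufst (usnd m)))"
    by (rule linear_map_compose[OF linear_map_proj(2) q.D.comp_linear_right]) (simp_all add: o g)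
  note L = linear_map_triple[OF 4 5 linear_map_sum[OF M 1 linear_map_koszul[OF M 2, of i]]]
  show ?thesis using L by (cases "even i") (simp_all add: s t r g hpb_def)
qed

lemma hpb_comp_linear_left:
  assumes "s \<in> Obj (hpb p q)" "t \<in> Obj (hpb p q)" "r \<in> Obj (hpb p q)" and f: "f \<in> Mor (hpb p q) s t j"
  shows "linear_map R (HomGr (hpb p q) t r i) (HomGr (hpb p q) s r (i + j)) (\<lambda>g. Comp (hpb p q) s t r i j g f)"
proof -
  obtain u v e where s: "s = UPair u (UPair v e)" "u \<in> Obj U" "v \<in> Obj V" using assms(1) by (rule hpb_ObjE)
  obtain u' v' e' where t: "t = UPair u' (UPair v' e')" "u' \<in> Obj U" "v' \<in> Obj V" using assms(2) by (rule hpb_ObjE)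
  obtain u'' v'' e'' where r: "r = UPair u'' (UPair v'' e'')" "u'' \<in> Obj U" "v'' \<in> Obj V" using assms(3) by (rule hpb_ObjE)
  obtain a b h where f: "f = UPair a (UPair b h)" "a \<in> Mor U u u' j" "b \<in> Mor V v v' j"
    "h \<in> Mor Y (P u) (Q v') (j + 1)" using f by (auto simp: t s elim!: triple_sumE)
  note o = s(2,3) t(2,3) r(2,3) p.ob_closed[OF s(2)] q_ob[OF s(3)] p.ob_closed[OF t(2)] q_ob[OF t(3)] p.ob_closed[OF r(2)] q_ob[OF r(3)]
  let ?D = "direct_sum_module (HomGr U u' u'' i) (direct_sum_module (HomGr V v' v'' i) (HomGr Y (P u') (Q v'') (i + 1)))"
  have M: "Module.module R (HomGr Y (P u) (Q v'') (i + j + 1))" using o by (simp add: p.C.hom_module)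
  have "linear_map R (HomGr Y (P u') (Q v'') (i + 1)) (HomGr Y (P u) (Q v'') (i + j + 1))
      (\<lambda>h'. Comp Y (P u) (P u') (Q v'') (i + 1) j h' (mor p u u' j a))"
    using p.C.comp_linear_left[of "P u" "P u'" "Q v''" "mor p u u' j a" j "i + 1"] o f
    by (simp add: algebra_simps mors)
  then have 1: "linear_map R ?D (HomGr Y (P u) (Q v'') (i + j + 1))
      (\<lambda>m. Comp Y (P u) (P u') (Q v'') (i + 1) j (usnd (usnd m)) (mor p u u' j a))"
    by (rule linear_map_compose[OF linear_map_proj(3)])
  have "linear_map R (HomGr Y (Q v') (Q v'') i) (HomGr Y (P u) (Q v'') (i + j + 1))
      (\<lambda>b'. Comp Y (P u) (Q v') (Q v'') i (j + 1) b' h)"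
    using p.C.comp_linear_left[of "P u" "Q v'" "Q v''" h "j + 1" i] o f
    by (simp add: algebra_simps mors)
  then have 2: "linear_map R ?D (HomGr Y (P u) (Q v'') (i + j + 1))
      (\<lambda>m. Comp Y (P u) (Q v') (Q v'') i (j + 1) (mor q v' v'' i (ufst (usnd m))) h)"
    by (rule linear_map_compose[OF linear_map_compose[OF linear_map_proj(2) q_linear], rotated 2])
      (use o in auto)
  have 4: "linear_map R ?D (HomGr U u u'' (i + j)) (\<lambda>m. Comp U u u' u'' i j (ufst m) a)"
    by (rule linear_map_compose[OF linear_map_proj(1) p.D.comp_linear_left]) (simp_all add: o f)
  have 5: "linear_map R ?D (HomGr V v v'' (i + j)) (\<lambda>m. Comp V v v' v'' i j (ufst (usnd m)) b)"
    by (rule linear_map_compose[OF linear_map_proj(2) q.D.comp_linear_left]) (simp_all add: o f)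
  note L = linear_map_triple[OF 4 5 linear_map_sum[OF M 1 linear_map_koszul[OF M 2, of i]]]
  show ?thesis using L by (cases "even i") (simp_all add: s t r f hpb_def)
qed

lemma hpb_assoc:
  assumes "s \<in> Obj (hpb p q)" "t \<in> Obj (hpb p q)" "r \<in> Obj (hpb p q)" "z \<in> Obj (hpb p q)"
    and m3: "m3 \<in> Mor (hpb p q) r z i" and m2: "m2 \<in> Mor (hpb p q) t r j" and m1: "m1 \<in> Mor (hpb p q) s t k"
  shows "Comp (hpb p q) s r z i (j + k) m3 (Comp (hpb p q) s t r j k m2 m1) =
    Comp (hpb p q) s t z (i + j) k (Comp (hpb p q) t r z i j m3 m2) m1"
proof -
  obtain u0 v0 e0 where s: "s = UPair u0 (UPair v0 e0)" "u0 \<in> Obj U" "v0 \<in> Obj V" using assms(1) by (rule hpb_ObjE)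
  obtain u1 v1 e1 where t: "t = UPair u1 (UPair v1 e1)" "u1 \<in> Obj U" "v1 \<in> Obj V" using assms(2) by (rule hpb_ObjE)
  obtain u2 v2 e2 where r: "r = UPair u2 (UPair v2 e2)" "u2 \<in> Obj U" "v2 \<in> Obj V" using assms(3) by (rule hpb_ObjE)
  obtain u3 v3 e3 where z: "z = UPair u3 (UPair v3 e3)" "u3 \<in> Obj U" "v3 \<in> Obj V" using assms(4) by (rule hpb_ObjE)
  obtain a1 b1 h1 where m1: "m1 = UPair a1 (UPair b1 h1)" "a1 \<in> Mor U u0 u1 k" "b1 \<in> Mor V v0 v1 k"
    "h1 \<in> Mor Y (P u0) (Q v1) (k + 1)" using m1 by (auto simp: s t elim!: triple_sumE)
  obtain a2 b2 h2 where m2: "m2 = UPair a2 (UPair b2 h2)" "a2 \<in> Mor U u1 u2 j" "b2 \<in> Mor V v1 v2 j"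
    "h2 \<in> Mor Y (P u1) (Q v2) (j + 1)" using m2 by (auto simp: r t elim!: triple_sumE)
  obtain a3 b3 h3 where m3: "m3 = UPair a3 (UPair b3 h3)" "a3 \<in> Mor U u2 u3 i" "b3 \<in> Mor V v2 v3 i"
    "h3 \<in> Mor Y (P u2) (Q v3) (i + 1)" using m3 by (auto simp: r z elim!: triple_sumE)
  note o = s(2,3) t(2,3) r(2,3) z(2,3) p.ob_closed[OF s(2)] q_ob[OF s(3)] p.ob_closed[OF t(2)] q_ob[OF t(3)]
    p.ob_closed[OF r(2)] q_ob[OF r(3)] p.ob_closed[OF z(2)] q_ob[OF z(3)]
  let ?a1 = "mor p u0 u1 k a1" and ?a2 = "mor p u1 u2 j a2"
  let ?b2 = "mor q v1 v2 j b2" and ?b3 = "mor q v2 v3 i b3"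
  have c: "?a1 \<in> Mor Y (P u0) (P u1) k" "?a2 \<in> Mor Y (P u1) (P u2) j"
    "?b2 \<in> Mor Y (Q v1) (Q v2) j" "?b3 \<in> Mor Y (Q v2) (Q v3) i"
    using m1 m2 m3 o by (simp_all add: mors)
  let ?M = "HomGr Y (P u0) (Q v3) (i + j + k + 1)"
  interpret M: abelian_group ?M using o p.C.hom_group by simp
  \<comment> \<open>The homotopy component of a triple composite has one term for each position of
    the homotopy: \<open>X1 = h3 a2 a1\<close>, \<open>X2 = b3 h2 a1\<close> and
    \<open>X3 = b3 b2 h1\<close>. Both bracketings give \<open>X1\<close>, then \<open>X2\<close>
    with the sign of \<open>i\<close>, then \<open>X3\<close> with the sign of
    \<open>i + j\<close>.\<close>
  define X1 where "X1 = Comp Y (P u0) (P u1) (Q v3) (i + j + 1) k (Comp Y (P u1) (P u2) (Q v3) (i + 1) j h3 ?a2) ?a1"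
  define X2 where "X2 = Comp Y (P u0) (P u1) (Q v3) (i + j + 1) k (Comp Y (P u1) (Q v2) (Q v3) i (j + 1) ?b3 h2) ?a1"
  define X3 where "X3 = Comp Y (P u0) (Q v1) (Q v3) (i + j) (k + 1) (Comp Y (Q v1) (Q v2) (Q v3) i j ?b3 ?b2) h1"
  have X: "X1 \<in> carrier ?M" "X2 \<in> carrier ?M" "X3 \<in> carrier ?M"
    unfolding X1_def X2_def X3_def using c o m1 m2 m3 by (auto intro!: p.C.comp_closed)
  have 1: "Comp Y (P u0) (P u2) (Q v3) (i + 1) (j + k) h3 (mor p u0 u2 (j + k) (Comp U u0 u1 u2 j k a2 a1)) = X1"
    using p.C.comp_assoc[of "P u0" "P u1" "P u2" "Q v3" h3 "i + 1" ?a2 j ?a1 k] o c m1 m2 m3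
    by (simp add: X1_def p.mor_comp algebra_simps)
  have A: "Comp Y (P u0) (P u1) (Q v2) (j + 1) k h2 ?a1 \<in> Mor Y (P u0) (Q v2) (j + k + 1)"
    "Comp Y (P u0) (Q v1) (Q v2) j (k + 1) ?b2 h1 \<in> Mor Y (P u0) (Q v2) (j + k + 1)"
    "Comp Y (P u1) (P u2) (Q v3) (i + 1) j h3 ?a2 \<in> Mor Y (P u1) (Q v3) (i + j + 1)"
    "Comp Y (P u1) (Q v2) (Q v3) i (j + 1) ?b3 h2 \<in> Mor Y (P u1) (Q v3) (i + j + 1)"
    using c o m1 m2 m3 by (auto intro!: p.C.comp_closed)
  have 2: "Comp Y (P u0) (Q v2) (Q v3) i (j + k + 1) ?b3 (Comp Y (P u0) (P u1) (Q v2) (j + 1) k h2 ?a1) = X2"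
    using p.C.comp_assoc[of "P u0" "P u1" "Q v2" "Q v3" ?b3 i h2 "j + 1" ?a1 k] o c m1 m2 m3
    by (simp add: X2_def algebra_simps)
  have 3: "Comp Y (P u0) (Q v2) (Q v3) i (j + k + 1) ?b3 (Comp Y (P u0) (Q v1) (Q v2) j (k + 1) ?b2 h1) = X3"
    using p.C.comp_assoc[of "P u0" "Q v1" "Q v2" "Q v3" ?b3 i ?b2 j h1 "k + 1"] o c m1 m2 m3
    by (simp add: X3_def algebra_simps)
  have L: "Comp Y (P u0) (Q v2) (Q v3) i (j + k + 1) ?b3
      (Comp Y (P u0) (P u1) (Q v2) (j + 1) k h2 ?a1 \<oplus>\<^bsub>HomGr Y (P u0) (Q v2) (j + k + 1)\<^esub>
        koszul (HomGr Y (P u0) (Q v2) (j + k + 1)) j (Comp Y (P u0) (Q v1) (Q v2) j (k + 1) ?b2 h1)) =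
    X2 \<oplus>\<^bsub>?M\<^esub> koszul ?M j X3"
    using p.C.comp_add_right[of "P u0" "Q v2" "Q v3" ?b3 i _ "j + k + 1"]
      p.C.comp_inv_right[of "P u0" "Q v2" "Q v3" ?b3 i _ "j + k + 1"] c o A
    by (simp add: 2[symmetric] 3[symmetric] p.C.mor_inv add.assoc[symmetric])
  have R: "Comp Y (P u0) (P u1) (Q v3) (i + j + 1) k
      (Comp Y (P u1) (P u2) (Q v3) (i + 1) j h3 ?a2 \<oplus>\<^bsub>HomGr Y (P u1) (Q v3) (i + j + 1)\<^esub>
        koszul (HomGr Y (P u1) (Q v3) (i + j + 1)) i (Comp Y (P u1) (Q v2) (Q v3) i (j + 1) ?b3 h2)) ?a1 =
    X1 \<oplus>\<^bsub>?M\<^esub> koszul ?M i X2"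
    using p.C.comp_add_left[of "P u0" "P u1" "Q v3" ?a1 k _ "i + j + 1"]
      p.C.comp_inv_left[of "P u0" "P u1" "Q v3" ?a1 k _ "i + j + 1"] c o A
    by (simp add: X1_def X2_def p.C.mor_inv ac_simps)
  have eqM: "i + (j + k) + 1 = i + j + k + 1" by simp
  have K: "X1 \<oplus>\<^bsub>?M\<^esub> koszul ?M i (X2 \<oplus>\<^bsub>?M\<^esub> koszul ?M j X3) =
     (X1 \<oplus>\<^bsub>?M\<^esub> koszul ?M i X2) \<oplus>\<^bsub>?M\<^esub> koszul ?M (i + j) X3"
  proof -
    have "X1 \<oplus>\<^bsub>?M\<^esub> (X2 \<oplus>\<^bsub>?M\<^esub> X3) = (X1 \<oplus>\<^bsub>?M\<^esub> X2) \<oplus>\<^bsub>?M\<^esub> X3"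
      "X1 \<oplus>\<^bsub>?M\<^esub> (X2 \<oplus>\<^bsub>?M\<^esub> (\<ominus>\<^bsub>?M\<^esub> X3)) = (X1 \<oplus>\<^bsub>?M\<^esub> X2) \<oplus>\<^bsub>?M\<^esub> (\<ominus>\<^bsub>?M\<^esub> X3)"
      "X1 \<oplus>\<^bsub>?M\<^esub> (\<ominus>\<^bsub>?M\<^esub> (X2 \<oplus>\<^bsub>?M\<^esub> X3)) = (X1 \<oplus>\<^bsub>?M\<^esub> (\<ominus>\<^bsub>?M\<^esub> X2)) \<oplus>\<^bsub>?M\<^esub> (\<ominus>\<^bsub>?M\<^esub> X3)"
      "X1 \<oplus>\<^bsub>?M\<^esub> (\<ominus>\<^bsub>?M\<^esub> (X2 \<oplus>\<^bsub>?M\<^esub> (\<ominus>\<^bsub>?M\<^esub> X3))) = (X1 \<oplus>\<^bsub>?M\<^esub> (\<ominus>\<^bsub>?M\<^esub> X2)) \<oplus>\<^bsub>?M\<^esub> X3"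
      using X by algebra+
    then show ?thesis by auto
  qed
  have q32: "mor q v1 v3 (i + j) (Comp V v1 v2 v3 i j b3 b2) = Comp Y (Q v1) (Q v2) (Q v3) i j ?b3 ?b2"
    using o m2 m3 by (simp add: q_comp)
  show ?thesis
    unfolding s t r z m1 m2 m3 hpb_Comp 1 L R q32 X3_def[symmetric] eqM K
    using o m1 m2 m3 by (simp add: p.D.comp_assoc q.D.comp_assoc)
qed

lemma hpb_leibniz:
  assumes "s \<in> Obj (hpb p q)" "t \<in> Obj (hpb p q)" "r \<in> Obj (hpb p q)"
    and g: "g \<in> Mor (hpb p q) t r i" and f: "f \<in> Mor (hpb p q) s t j"
  shows "Dif (Hom (hpb p q) s r) (i + j) (Comp (hpb p q) s t r i j g f) =
    Comp (hpb p q) s t r (i - 1) j (Dif (Hom (hpb p q) t r) i g) f \<oplus>\<^bsub>HomGr (hpb p q) s r (i + j - 1)\<^esub>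
    koszul (HomGr (hpb p q) s r (i + j - 1)) i (Comp (hpb p q) s t r i (j - 1) g (Dif (Hom (hpb p q) s t) j f))"
proof -
  obtain u v e where s: "s = UPair u (UPair v e)" "u \<in> Obj U" "v \<in> Obj V"
    "homotopy_invertible Y (P u) (Q v) e" using assms(1) by (rule hpb_ObjE)
  obtain u' v' e' where t: "t = UPair u' (UPair v' e')" "u' \<in> Obj U" "v' \<in> Obj V"
    "homotopy_invertible Y (P u') (Q v') e'" using assms(2) by (rule hpb_ObjE)
  obtain u'' v'' e'' where r: "r = UPair u'' (UPair v'' e'')" "u'' \<in> Obj U" "v'' \<in> Obj V"
    "homotopy_invertible Y (P u'') (Q v'') e''" using assms(3) by (rule hpb_ObjE)
  note e = p.C.cycle_closed[OF inv_cycle[OF s(4)]] p.C.cycle_closed[OF inv_cycle[OF t(4)]]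
    p.C.cycle_closed[OF inv_cycle[OF r(4)]]
  obtain a b h where f: "f = UPair a (UPair b h)" "a \<in> Mor U u u' j" "b \<in> Mor V v v' j"
    "h \<in> Mor Y (P u) (Q v') (j + 1)" using f by (auto simp: t s elim!: triple_sumE)
  obtain a' b' h' where g: "g = UPair a' (UPair b' h')" "a' \<in> Mor U u' u'' i" "b' \<in> Mor V v' v'' i"
    "h' \<in> Mor Y (P u') (Q v'') (i + 1)" using g by (auto simp: t r elim!: triple_sumE)
  note o = s(2,3) t(2,3) r(2,3) p.ob_closed[OF s(2)] q_ob[OF s(3)] p.ob_closed[OF t(2)] q_ob[OF t(3)]
    p.ob_closed[OF r(2)] q_ob[OF r(3)]
  let ?a = "mor p u u' j a" and ?a' = "mor p u' u'' i a'"
  let ?b = "mor q v v' j b" and ?b' = "mor q v' v'' i b'"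
  have c: "?a \<in> Mor Y (P u) (P u') j" "?a' \<in> Mor Y (P u') (P u'') i"
    "?b \<in> Mor Y (Q v) (Q v') j" "?b' \<in> Mor Y (Q v') (Q v'') i"
    using f g o by (simp_all add: mors)
  let ?M = "HomGr Y (P u) (Q v'') (i + j)"
  interpret M: abelian_group ?M using o p.C.hom_group by simp
  \<comment> \<open>\<open>X1 = b' b e\<close> and \<open>X2 = e'' a' a\<close> belong to the outer
    objects, \<open>X3\<close> to \<open>X6\<close> come from differentiating \<open>h' a\<close>
    and \<open>b' h\<close>, and \<open>X7 = b' e' a\<close> belongs to the middle object.\<close>
  define X1 where "X1 = Comp Y (P u) (Q v) (Q v'') (i + j) 0 (Comp Y (Q v) (Q v') (Q v'') i j ?b' ?b) e"
  define X2 where "X2 = Comp Y (P u) (P u'') (Q v'') 0 (i + j) e'' (Comp Y (P u) (P u') (P u'') i j ?a' ?a)"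
  define X3 where "X3 = Comp Y (P u) (P u') (Q v'') i j (Dif (Hom Y (P u') (Q v'')) (i + 1) h') ?a"
  define X4 where "X4 = Comp Y (P u) (P u') (Q v'') (i + 1) (j - 1) h' (Dif (Hom Y (P u) (P u')) j ?a)"
  define X5 where "X5 = Comp Y (P u) (Q v') (Q v'') (i - 1) (j + 1) (Dif (Hom Y (Q v') (Q v'')) i ?b') h"
  define X6 where "X6 = Comp Y (P u) (Q v') (Q v'') i j ?b' (Dif (Hom Y (P u) (Q v')) (j + 1) h)"
  define X7 where "X7 = Comp Y (P u) (P u') (Q v'') i j (Comp Y (P u') (Q v') (Q v'') i 0 ?b' e') ?a"
  have X: "X1 \<in> carrier ?M" "X2 \<in> carrier ?M" "X3 \<in> carrier ?M" "X4 \<in> carrier ?M"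
    "X5 \<in> carrier ?M" "X6 \<in> carrier ?M" "X7 \<in> carrier ?M"
    unfolding X1_def X2_def X3_def X4_def X5_def X6_def X7_def
    using c o f g e by (auto intro!: p.C.comp_closed p.C.dif_closed)
  define H1 where "H1 = Comp Y (P u) (P u') (Q v'') (i + 1) j h' ?a"
  define H2 where "H2 = Comp Y (P u) (Q v') (Q v'') i (j + 1) ?b' h"
  have H: "H1 \<in> Mor Y (P u) (Q v'') (i + j + 1)" "H2 \<in> Mor Y (P u) (Q v'') (i + j + 1)"
    unfolding H1_def H2_def using c o f g e by (auto intro!: p.C.comp_closed)
  have dH1: "Dif (Hom Y (P u) (Q v'')) (i + j + 1) H1 = X3 \<oplus>\<^bsub>?M\<^esub> koszul ?M (i + 1) X4"
    using p.C.leibniz[of "P u" "P u'" "Q v''" h' "i + 1" ?a j] c o f g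
    by (simp add: H1_def X3_def X4_def algebra_simps)
  have dH2: "Dif (Hom Y (P u) (Q v'')) (i + j + 1) H2 = X5 \<oplus>\<^bsub>?M\<^esub> koszul ?M i X6"
    using p.C.leibniz[of "P u" "Q v'" "Q v''" ?b' i h "j + 1"] c o f g
    by (simp add: H2_def X5_def X6_def add.assoc[symmetric])
  have dH: "Dif (Hom Y (P u) (Q v'')) (i + j + 1)
      (H1 \<oplus>\<^bsub>HomGr Y (P u) (Q v'') (i + j + 1)\<^esub> koszul (HomGr Y (P u) (Q v'') (i + j + 1)) i H2) =
    (X3 \<oplus>\<^bsub>?M\<^esub> koszul ?M (i + 1) X4) \<oplus>\<^bsub>?M\<^esub> koszul ?M i (X5 \<oplus>\<^bsub>?M\<^esub> koszul ?M i X6)"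
    using H o by (simp add: p.C.dif_add p.C.dif_inv p.C.mor_inv dH1 dH2)
  have b'be: "Comp Y (P u) (Q v') (Q v'') i j ?b' (Comp Y (P u) (Q v) (Q v') j 0 ?b e) = X1"
    using p.C.comp_assoc[of "P u" "Q v" "Q v'" "Q v''" ?b' i ?b j e 0] c o e by (simp add: X1_def)
  have b'e'a: "Comp Y (P u) (Q v') (Q v'') i j ?b' (Comp Y (P u) (P u') (Q v') 0 j e' ?a) = X7"
    using p.C.comp_assoc[of "P u" "P u'" "Q v'" "Q v''" ?b' i e' 0 ?a j] c o e by (simp add: X7_def)
  have e''a'a: "Comp Y (P u) (P u') (Q v'') i j (Comp Y (P u') (P u'') (Q v'') 0 i e'' ?a') ?a = X2"
    using p.C.comp_assoc[of "P u" "P u'" "P u''" "Q v''" e'' 0 ?a' i ?a j] c o e by (simp add: X2_def)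
  have parts: "Comp Y (P u) (Q v) (Q v') j 0 ?b e \<in> Mor Y (P u) (Q v') j"
    "Comp Y (P u) (P u') (Q v') 0 j e' ?a \<in> Mor Y (P u) (Q v') j"
    "Dif (Hom Y (P u) (Q v')) (j + 1) h \<in> Mor Y (P u) (Q v') j"
    "Comp Y (P u') (Q v') (Q v'') i 0 ?b' e' \<in> Mor Y (P u') (Q v'') i"
    "Comp Y (P u') (P u'') (Q v'') 0 i e'' ?a' \<in> Mor Y (P u') (Q v'') i"
    "Dif (Hom Y (P u') (Q v'')) (i + 1) h' \<in> Mor Y (P u') (Q v'') i"
    using c o f g e by (auto intro!: p.C.comp_closed p.C.dif_closed)
  have df: "Comp Y (P u) (Q v') (Q v'') i j ?b' ((Comp Y (P u) (Q v) (Q v') j 0 ?b e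
      \<ominus>\<^bsub>HomGr Y (P u) (Q v') j\<^esub> Comp Y (P u) (P u') (Q v') 0 j e' ?a)
      \<ominus>\<^bsub>HomGr Y (P u) (Q v') j\<^esub> Dif (Hom Y (P u) (Q v')) (j + 1) h) =
    X1 \<ominus>\<^bsub>?M\<^esub> X7 \<ominus>\<^bsub>?M\<^esub> X6"
    using parts c o by (simp add: p.C.comp_minus_right p.C.mor_minus b'be b'e'a flip: X6_def)
  have dg: "Comp Y (P u) (P u') (Q v'') i j ((Comp Y (P u') (Q v') (Q v'') i 0 ?b' e'
      \<ominus>\<^bsub>HomGr Y (P u') (Q v'') i\<^esub> Comp Y (P u') (P u'') (Q v'') 0 i e'' ?a')
      \<ominus>\<^bsub>HomGr Y (P u') (Q v'') i\<^esub> Dif (Hom Y (P u') (Q v'')) (i + 1) h') ?a =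
    X7 \<ominus>\<^bsub>?M\<^esub> X2 \<ominus>\<^bsub>?M\<^esub> X3"
    using parts c o by (simp add: p.C.comp_minus_left p.C.mor_minus e''a'a flip: X3_def X7_def)
  \<comment> \<open>The differentials of \<open>g\<close> and of \<open>f\<close> each contribute
    \<open>X7\<close>, with opposite signs, so it cancels; the other terms agree one by one in
    either parity.\<close>
  have K: "X1 \<ominus>\<^bsub>?M\<^esub> X2 \<ominus>\<^bsub>?M\<^esub> ((X3 \<oplus>\<^bsub>?M\<^esub> koszul ?M (i + 1) X4) \<oplus>\<^bsub>?M\<^esub>
      koszul ?M i (X5 \<oplus>\<^bsub>?M\<^esub> koszul ?M i X6)) =
    ((X7 \<ominus>\<^bsub>?M\<^esub> X2 \<ominus>\<^bsub>?M\<^esub> X3) \<oplus>\<^bsub>?M\<^esub> koszul ?M (i - 1) X5) \<oplus>\<^bsub>?M\<^esub>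
      koszul ?M i (X4 \<oplus>\<^bsub>?M\<^esub> koszul ?M i (X1 \<ominus>\<^bsub>?M\<^esub> X7 \<ominus>\<^bsub>?M\<^esub> X6))"
  proof (cases "even i")
    case True
    have "X1 \<ominus>\<^bsub>?M\<^esub> X2 \<ominus>\<^bsub>?M\<^esub> ((X3 \<oplus>\<^bsub>?M\<^esub> (\<ominus>\<^bsub>?M\<^esub> X4)) \<oplus>\<^bsub>?M\<^esub> (X5 \<oplus>\<^bsub>?M\<^esub> X6)) =
      ((X7 \<ominus>\<^bsub>?M\<^esub> X2 \<ominus>\<^bsub>?M\<^esub> X3) \<oplus>\<^bsub>?M\<^esub> (\<ominus>\<^bsub>?M\<^esub> X5)) \<oplus>\<^bsub>?M\<^esub>
        (X4 \<oplus>\<^bsub>?M\<^esub> (X1 \<ominus>\<^bsub>?M\<^esub> X7 \<ominus>\<^bsub>?M\<^esub> X6))"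
      using X by algebra
    then show ?thesis using True by simp
  next
    case False
    have "X1 \<ominus>\<^bsub>?M\<^esub> X2 \<ominus>\<^bsub>?M\<^esub> ((X3 \<oplus>\<^bsub>?M\<^esub> X4) \<oplus>\<^bsub>?M\<^esub> (\<ominus>\<^bsub>?M\<^esub> (X5 \<oplus>\<^bsub>?M\<^esub> (\<ominus>\<^bsub>?M\<^esub> X6)))) =
      ((X7 \<ominus>\<^bsub>?M\<^esub> X2 \<ominus>\<^bsub>?M\<^esub> X3) \<oplus>\<^bsub>?M\<^esub> X5) \<oplus>\<^bsub>?M\<^esub>
        (\<ominus>\<^bsub>?M\<^esub> (X4 \<oplus>\<^bsub>?M\<^esub> (\<ominus>\<^bsub>?M\<^esub> (X1 \<ominus>\<^bsub>?M\<^esub> X7 \<ominus>\<^bsub>?M\<^esub> X6))))"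
      using X by algebra
    then show ?thesis using False by simp
  qed
  have LHS3: "Dif (Hom (hpb p q) s r) (i + j) (Comp (hpb p q) s t r i j g f) =
    UPair (Dif (Hom U u u'') (i + j) (Comp U u u' u'' i j a' a))
      (UPair (Dif (Hom V v v'') (i + j) (Comp V v v' v'' i j b' b))
        (X1 \<ominus>\<^bsub>?M\<^esub> X2 \<ominus>\<^bsub>?M\<^esub> ((X3 \<oplus>\<^bsub>?M\<^esub> koszul ?M (i + 1) X4) \<oplus>\<^bsub>?M\<^esub>
          koszul ?M i (X5 \<oplus>\<^bsub>?M\<^esub> koszul ?M i X6))))"
    unfolding s t r f g hpb_Comp hpb_Dif H1_def[symmetric] H2_def[symmetric] dH
    using o f(2,3) g(2,3) by (simp add: p.mor_comp q_comp flip: X1_def X2_def)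
  have G1: "Comp (hpb p q) s t r (i - 1) j (Dif (Hom (hpb p q) t r) i g) f =
    UPair (Comp U u u' u'' (i - 1) j (Dif (Hom U u' u'') i a') a)
      (UPair (Comp V v v' v'' (i - 1) j (Dif (Hom V v' v'') i b') b)
        ((X7 \<ominus>\<^bsub>?M\<^esub> X2 \<ominus>\<^bsub>?M\<^esub> X3) \<oplus>\<^bsub>?M\<^esub> koszul ?M (i - 1) X5))"
    unfolding s t r f g hpb_Comp hpb_Dif
    using o g dg by (simp add: q_dif X5_def)
  have G2: "Comp (hpb p q) s t r i (j - 1) g (Dif (Hom (hpb p q) s t) j f) =
    UPair (Comp U u u' u'' i (j - 1) a' (Dif (Hom U u u') j a))
      (UPair (Comp V v v' v'' i (j - 1) b' (Dif (Hom V v v') j b))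
        (X4 \<oplus>\<^bsub>?M\<^esub> koszul ?M i (X1 \<ominus>\<^bsub>?M\<^esub> X7 \<ominus>\<^bsub>?M\<^esub> X6)))"
    unfolding s t r f g hpb_Comp hpb_Dif
    using o f df by (simp add: p.mor_dif X4_def)
  have m: "Comp U u u' u'' i (j - 1) a' (Dif (Hom U u u') j a) \<in> Mor U u u'' (i + j - 1)"
    "Comp V v v' v'' i (j - 1) b' (Dif (Hom V v v') j b) \<in> Mor V v v'' (i + j - 1)"
    using o f g by (auto intro!: p.D.comp_closed q.D.comp_closed p.D.dif_closed q.D.dif_closed)
  have m3: "X4 \<oplus>\<^bsub>?M\<^esub> koszul ?M i (X1 \<ominus>\<^bsub>?M\<^esub> X7 \<ominus>\<^bsub>?M\<^esub> X6) \<in> carrier ?M"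
    using X by simp
  have KS: "koszul (HomGr (hpb p q) s r (i + j - 1)) i (UPair x (UPair y z)) =
      UPair (koszul (HomGr U u u'' (i + j - 1)) i x) (UPair (koszul (HomGr V v v'' (i + j - 1)) i y) (koszul ?M i z))"
    if "x \<in> Mor U u u'' (i + j - 1)" "y \<in> Mor V v v'' (i + j - 1)" "z \<in> carrier ?M" for x y z
    using that o direct_sum_inv[of R "HomGr U u u'' (i + j - 1)"
        "direct_sum_module (HomGr V v v'' (i + j - 1)) ?M" x "UPair y z"]
      direct_sum_inv[of R "HomGr V v v'' (i + j - 1)" ?M y z]
    by (cases "even i")
      (simp_all add: s r p.D.hom_module q.D.hom_module p.C.hom_module module_direct_sum)
  show ?thesis
    unfolding LHS3 G1 G2 KS[OF m m3] K
    using p.D.leibniz[OF o(1,3,5) g(2) f(2)] q.D.leibniz[OF o(2,4,6) g(3) f(3)]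
    by (simp add: s r)
qed

lemma dg_category_hpb: "dg_category R (hpb p q)"
proof (rule dg_category.intro)
  fix s t assume st: "s \<in> Obj (hpb p q)" "t \<in> Obj (hpb p q)"
  show "chain_complex R (Hom (hpb p q) s t)"
    by (rule chain_complexI) (fact hpb_module[OF st] hpb_dif_linear[OF st] hpb_dif_dif[OF st])+
next
  fix s assume "s \<in> Obj (hpb p q)"
  then obtain u v e where s: "s = UPair u (UPair v e)" "u \<in> Obj U" "v \<in> Obj V"
    "homotopy_invertible Y (P u) (Q v) e" by (rule hpb_ObjE)
  note o = s(2,3) p.ob_closed[OF s(2)] q_ob[OF s(3)]
  note e = p.C.cycle_closed[OF inv_cycle[OF s(4)]]
  interpret M: abelian_group "HomGr Y (P u) (Q v) 0" using o p.C.hom_group by simp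
  show "Ident (hpb p q) s \<in> cycles (Hom (hpb p q) s s) 0"
    using o e p.C.dif_zero[OF o(3,4), of 1]
    by (simp add: s cycles_def p.D.ident_closed q.D.ident_closed p.C.mor_zero p.D.dif_ident q.D.dif_ident
      p.mor_ident q_ident p.C.ident_left p.C.ident_right M.minus_zero_iff)
  fix t f j assume "t \<in> Obj (hpb p q)" and f: "f \<in> Mor (hpb p q) s t j"
  then obtain u' v' e' where t: "t = UPair u' (UPair v' e')" "u' \<in> Obj U" "v' \<in> Obj V"
    by (auto elim: hpb_ObjE)
  note o = o t(2,3) p.ob_closed[OF t(2)] q_ob[OF t(3)]
  obtain a b h where f: "f = UPair a (UPair b h)" "a \<in> Mor U u u' j" "b \<in> Mor V v v' j"
    "h \<in> Mor Y (P u) (Q v') (j + 1)" using f by (auto simp: t s elim!: triple_sumE)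
  interpret N: abelian_group "HomGr Y (P u) (Q v') (j + 1)" using o p.C.hom_group by simp
  have "Comp Y (P u) (P u') (Q v') 1 j \<zero>\<^bsub>HomGr Y (P u') (Q v') 1\<^esub> (mor p u u' j a) =
      \<zero>\<^bsub>HomGr Y (P u) (Q v') (j + 1)\<^esub>"
    using o f p.C.comp_zero_left[of "P u" "P u'" "Q v'" "mor p u u' j a" j 1] by (simp add: mors add.commute)
  then show "Comp (hpb p q) s t t 0 j (Ident (hpb p q) t) f = f"
    using o f by (simp add: s t p.D.ident_left q.D.ident_left q_ident p.C.ident_left mors)
  show "Comp (hpb p q) s s t j 0 f (Ident (hpb p q) s) = f"
    using o f p.C.comp_zero_right[of "P u" "Q v" "Q v'" "mor q v v' j b" j 1]
    by (simp add: s t p.D.ident_right q.D.ident_right p.mor_ident p.C.ident_right mors)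
qed (simp_all add: p.D.cring hpb_comp_linear_right hpb_comp_linear_left hpb_assoc hpb_leibniz)

end

section \<open>Projections, induced maps, constant homotopies and pairing\<close>

definition hpb_fst :: "('r, ('r, 'a) univ) dgfun \<Rightarrow> ('r, ('r, 'a) univ) dgfun \<Rightarrow> ('r, ('r, 'a) univ) dgfun" where
  "hpb_fst p q = mk_dgfun (hpb p q) (Dom p) ufst (\<lambda>s t i m. ufst m)"

definition hpb_snd :: "('r, ('r, 'a) univ) dgfun \<Rightarrow> ('r, ('r, 'a) univ) dgfun \<Rightarrow> ('r, ('r, 'a) univ) dgfun" where
  "hpb_snd p q = mk_dgfun (hpb p q) (Dom q) (\<lambda>s. ufst (usnd s)) (\<lambda>s t i m. ufst (usnd m))"

text \<open>Functoriality in maps of cospans. Since path categories are the homotopy pullbacks of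
  identities, it also compares these with other homotopy pullbacks.\<close>

definition hpb_map :: "('r, ('r, 'a) univ) dgfun \<Rightarrow> ('r, ('r, 'a) univ) dgfun \<Rightarrow>
    ('r, ('r, 'a) univ) dgfun \<Rightarrow> ('r, ('r, 'a) univ) dgfun \<Rightarrow> ('r, ('r, 'a) univ) dgfun \<Rightarrow>
    ('r, ('r, 'a) univ) dgfun \<Rightarrow> ('r, ('r, 'a) univ) dgfun \<Rightarrow> ('r, ('r, 'a) univ) dgfun" where
  "hpb_map p q p' q' \<alpha> \<beta> \<eta> = mk_dgfun (hpb p q) (hpb p' q')
     (\<lambda>s. UPair (ob \<alpha> (ufst s)) (UPair (ob \<beta> (ufst (usnd s)))
        (mor \<eta> (ob p (ufst s)) (ob q (ufst (usnd s))) 0 (usnd (usnd s)))))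
     (\<lambda>s t i m. UPair (mor \<alpha> (ufst s) (ufst t) i (ufst m))
        (UPair (mor \<beta> (ufst (usnd s)) (ufst (usnd t)) i (ufst (usnd m)))
          (mor \<eta> (ob p (ufst s)) (ob q (ufst (usnd t))) (i + 1) (usnd (usnd m)))))"

text \<open>Followed by \<open>hpb_snd\<close> it is \<open>p\<close>, followed by
  \<open>hpb_fst\<close> it is the identity: the factorization of \<open>p\<close> through its
  mapping path category.\<close>

definition hpb_const :: "('r, ('r, 'a) univ) dgfun \<Rightarrow> ('r, ('r, 'a) univ) dgfun" where
  "hpb_const p = mk_dgfun (Dom p) (hpb p (dg_id (Cod p)))
     (\<lambda>x. UPair x (UPair (ob p x) (Ident (Cod p) (ob p x))))
     (\<lambda>x y i a. UPair a (UPair (mor p x y i a) \<zero>\<^bsub>HomGr (Cod p) (ob p x) (ob p y) (i + 1)\<^esub>))"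

context cospan
begin

lemma hpb_fst_hom: "hpb_fst p q \<in> dg_hom R (hpb p q) U"
  unfolding hpb_fst_def
  by (rule mk_dgfun_dg_hom[OF dg_category_hpb p.D.dg_category_axioms])
    (auto elim!: hpb_ObjE triple_sumE simp: linear_map_proj)

lemma hpb_snd_hom: "hpb_snd p q \<in> dg_hom R (hpb p q) V"
  unfolding hpb_snd_def
  by (rule mk_dgfun_dg_hom[OF dg_category_hpb q.D.dg_category_axioms])
    (auto elim!: hpb_ObjE triple_sumE simp: linear_map_proj)

end

lemma dgf_hom: "F \<in> dg_hom R A B \<Longrightarrow> dgf R F"
  by (simp add: dgf_def dg_hom_def)

lemma cospanI: "p \<in> dg_hom R U Y \<Longrightarrow> q \<in> dg_hom R V Y \<Longrightarrow> cospan R p q"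
  by (simp add: cospan_def cospan_axioms_def dgf_hom dg_homD)

text \<open>The two equations \<open>eq\<close> say that \<alpha> and \<beta> lie over \<eta>; they
  identify the corner terms of the differential, so that \<eta> may be applied to the homotopy
  component.\<close>

lemma hpb_map_hom:
  assumes p: "p \<in> dg_hom R U Y" and q: "q \<in> dg_hom R V Y"
    and p': "p' \<in> dg_hom R U' Y'" and q': "q' \<in> dg_hom R V' Y'"
    and \<alpha>: "\<alpha> \<in> dg_hom R U U'" and \<beta>: "\<beta> \<in> dg_hom R V V'" and \<eta>: "\<eta> \<in> dg_hom R Y Y'"
    and eq: "p' \<circ>\<^sub>d \<alpha> = \<eta> \<circ>\<^sub>d p" "q' \<circ>\<^sub>d \<beta> = \<eta> \<circ>\<^sub>d q"
  shows "hpb_map p q p' q' \<alpha> \<beta> \<eta> \<in> dg_hom R (hpb p q) (hpb p' q')"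
proof -
  interpret c: cospan R p q using p q by (rule cospanI)
  interpret c': cospan R p' q' using p' q' by (rule cospanI)
  interpret a: dgf R \<alpha> using \<alpha> by (rule dgf_hom)
  interpret b: dgf R \<beta> using \<beta> by (rule dgf_hom)
  interpret e: dgf R \<eta> using \<eta> by (rule dgf_hom)
  note [simp] = dg_homD(2,3)[OF p] dg_homD(2,3)[OF q] dg_homD(2,3)[OF p'] dg_homD(2,3)[OF q']
    dg_homD(2,3)[OF \<alpha>] dg_homD(2,3)[OF \<beta>] dg_homD(2,3)[OF \<eta>]
  have [simp]: "ob p' (ob \<alpha> x) = ob \<eta> (ob p x)" if "x \<in> Obj U" for x
    using arg_cong[OF eq(1), of "\<lambda>F. ob F x"] that by simp
  have [simp]: "ob q' (ob \<beta> x) = ob \<eta> (ob q x)" if "x \<in> Obj V" for x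
    using arg_cong[OF eq(2), of "\<lambda>F. ob F x"] that by simp
  have mp [simp]: "mor p' (ob \<alpha> x) (ob \<alpha> y) i (mor \<alpha> x y i f) = mor \<eta> (ob p x) (ob p y) i (mor p x y i f)"
    if "x \<in> Obj U" "y \<in> Obj U" "f \<in> Mor U x y i" for x y i f
    using arg_cong[OF eq(1), of "\<lambda>F. mor F x y i f"] that by simp
  have mq [simp]: "mor q' (ob \<beta> x) (ob \<beta> y) i (mor \<beta> x y i f) = mor \<eta> (ob q x) (ob q y) i (mor q x y i f)"
    if "x \<in> Obj V" "y \<in> Obj V" "f \<in> Mor V x y i" for x y i f
    using arg_cong[OF eq(2), of "\<lambda>F. mor F x y i f"] that by simp
  note ob = a.ob_closed[simplified] b.ob_closed[simplified] e.ob_closed[simplified]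
    c.p.ob_closed[simplified] c.q.ob_closed[simplified]
  note mor = a.mor_mor[simplified] b.mor_mor[simplified] e.mor_mor[simplified]
    c.p.mor_mor[simplified] c.q.mor_mor[simplified]
  have Y: "dg_category R Y" using dg_homD(4)[OF \<eta>] .
  interpret Y: dg_category R Y by fact
  let ?o = "\<lambda>s. UPair (ob \<alpha> (ufst s)) (UPair (ob \<beta> (ufst (usnd s)))
      (mor \<eta> (ob p (ufst s)) (ob q (ufst (usnd s))) 0 (usnd (usnd s))))"
    and ?m = "\<lambda>s t i m. UPair (mor \<alpha> (ufst s) (ufst t) i (ufst m))
      (UPair (mor \<beta> (ufst (usnd s)) (ufst (usnd t)) i (ufst (usnd m)))
        (mor \<eta> (ob p (ufst s)) (ob q (ufst (usnd t))) (i + 1) (usnd (usnd m))))"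
  show ?thesis
    unfolding hpb_map_def
  proof (rule mk_dgfun_dg_hom[OF c.dg_category_hpb c'.dg_category_hpb])
    fix s assume s: "s \<in> Obj (hpb p q)"
    then obtain u v k where s: "s = UPair u (UPair v k)" "u \<in> Obj U" "v \<in> Obj V"
      "homotopy_invertible Y (ob p u) (ob q v) k" by (auto elim: hpb_ObjE)
    show "?o s \<in> Obj (hpb p' q')"
      using s ob e.mor_homotopy_invertible[of "ob p u" "ob q v" k] by simp
    show "?m s s 0 (Ident (hpb p q) s) = Ident (hpb p' q') (?o s)"
      using s ob a.mor_ident[of u] b.mor_ident[of v] e.mor_zero[of "ob p u" "ob q v" 1] by simp
    fix t assume t: "t \<in> Obj (hpb p q)"
    then obtain u' v' k' where t: "t = UPair u' (UPair v' k')" "u' \<in> Obj U" "v' \<in> Obj V"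
      "homotopy_invertible Y (ob p u') (ob q v') k'" by (auto elim: hpb_ObjE)
    have k: "k \<in> Mor Y (ob p u) (ob q v) 0" "k' \<in> Mor Y (ob p u') (ob q v') 0"
      using s(4) t(4) by (auto simp: homotopy_invertible_def cycles_def)
    fix i
    show "linear_map R (HomGr (hpb p q) s t i)
      (HomGr (hpb p' q') (?o s) (?o t) i) (?m s t i)"
      using linear_map_triple[OF linear_map_compose[OF linear_map_proj(1) a.mor_linear]
          linear_map_compose[OF linear_map_proj(2) b.mor_linear]
          linear_map_compose[OF linear_map_proj(3) e.mor_linear], of u u' v v' "ob p u" "ob q v'" i i "i + 1"] s t ob
      by simp
    fix m assume "m \<in> Mor (hpb p q) s t i"
    then obtain a b h where m: "m = UPair a (UPair b h)" "a \<in> Mor U u u' i" "b \<in> Mor V v v' i"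
      "h \<in> Mor Y (ob p u) (ob q v') (i + 1)" by (auto simp: s t elim!: triple_sumE)
    have parts: "Comp Y (ob p u) (ob q v) (ob q v') i 0 (mor q v v' i b) k \<in> Mor Y (ob p u) (ob q v') i"
      "Comp Y (ob p u) (ob p u') (ob q v') 0 i k' (mor p u u' i a) \<in> Mor Y (ob p u) (ob q v') i"
      "Dif (Hom Y (ob p u) (ob q v')) (i + 1) h \<in> Mor Y (ob p u) (ob q v') i"
      using m s t ob mor k by (auto intro!: Y.comp_closed Y.dif_closed)
    show "?m s t (i - 1) (Dif (Hom (hpb p q) s t) i m) =
      Dif (Hom (hpb p' q') (?o s) (?o t)) i (?m s t i m)"
      using parts m s t ob mor k
      by (simp add: a.mor_dif[simplified] b.mor_dif[simplified] e.mor_minus[simplified]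
        Y.mor_minus e.mor_comp[simplified] e.mor_dif[simplified])
  next
    fix s t r i j g f
    assume st: "s \<in> Obj (hpb p q)" "t \<in> Obj (hpb p q)" "r \<in> Obj (hpb p q)"
      and gf: "g \<in> Mor (hpb p q) t r i" "f \<in> Mor (hpb p q) s t j"
    obtain u v k where s: "s = UPair u (UPair v k)" "u \<in> Obj U" "v \<in> Obj V"
      using st(1) by (auto elim: hpb_ObjE)
    obtain u' v' k' where t: "t = UPair u' (UPair v' k')" "u' \<in> Obj U" "v' \<in> Obj V"
      using st(2) by (auto elim: hpb_ObjE)
    obtain u'' v'' k'' where r: "r = UPair u'' (UPair v'' k'')" "u'' \<in> Obj U" "v'' \<in> Obj V"
      using st(3) by (auto elim: hpb_ObjE)
    obtain a b h where f: "f = UPair a (UPair b h)" "a \<in> Mor U u u' j" "b \<in> Mor V v v' j"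
      "h \<in> Mor Y (ob p u) (ob q v') (j + 1)" using gf by (auto simp: s t elim!: triple_sumE)
    obtain a' b' h' where g: "g = UPair a' (UPair b' h')" "a' \<in> Mor U u' u'' i" "b' \<in> Mor V v' v'' i"
      "h' \<in> Mor Y (ob p u') (ob q v'') (i + 1)" using gf by (auto simp: t r elim!: triple_sumE)
    have parts: "Comp Y (ob p u) (ob p u') (ob q v'') (i + 1) j h' (mor p u u' j a) \<in> Mor Y (ob p u) (ob q v'') (i + j + 1)"
      "Comp Y (ob p u) (ob q v') (ob q v'') i (j + 1) (mor q v' v'' i b') h \<in> Mor Y (ob p u) (ob q v'') (i + j + 1)"
      using f g s t r ob mor by (auto intro!: Y.comp_closed)
    show "?m s r (i + j) (Comp (hpb p q) s t r i j g f) =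
      Comp (hpb p' q') (?o s) (?o t) (?o r) i j (?m t r i g) (?m s t j f)"
      using parts f g s t r ob mor
      by (simp add: a.mor_comp[simplified] b.mor_comp[simplified] e.mor_add[simplified] e.mor_inv[simplified]
        Y.mor_inv e.mor_comp[simplified])
  qed
qed

lemma hpb_const_hom:
  assumes p: "p \<in> dg_hom R U Y"
  shows "hpb_const p \<in> dg_hom R U (hpb p (dg_id Y))"
proof -
  note YC = dg_homD(5)[OF p]
  interpret c: cospan R p "dg_id Y" using p dg_id_hom[OF YC] by (rule cospanI)
  interpret Y: dg_category R Y by fact
  note [simp] = dg_homD(2,3)[OF p]
  note ob = c.p.ob_closed[simplified] and mor = c.p.mor_mor[simplified]
  show ?thesis
    unfolding hpb_const_def dg_homD(2,3)[OF p]
  proof (rule mk_dgfun_dg_hom[OF dg_homD(4)[OF p] c.dg_category_hpb])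
    fix x assume x: "x \<in> Obj U"
    show "UPair x (UPair (ob p x) (Ident Y (ob p x))) \<in> Obj (hpb p (dg_id Y))"
      using x ob by (simp add: Y.homotopy_invertible_ident)
    show "UPair (Ident U x) (UPair (mor p x x 0 (Ident U x)) \<zero>\<^bsub>HomGr Y (ob p x) (ob p x) (0 + 1)\<^esub>) =
      Ident (hpb p (dg_id Y)) (UPair x (UPair (ob p x) (Ident Y (ob p x))))"
      using x ob c.p.mor_ident[of x] by simp
    fix y i assume y: "y \<in> Obj U"
    have M: "Module.module R (HomGr Y (ob p x) (ob p y) (i + 1))" using x y ob by (simp add: Y.hom_module)
    show "linear_map R (HomGr U x y i) (HomGr (hpb p (dg_id Y)) (UPair x (UPair (ob p x) (Ident Y (ob p x))))
        (UPair y (UPair (ob p y) (Ident Y (ob p y)))) i)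
      (\<lambda>a. UPair a (UPair (mor p x y i a) \<zero>\<^bsub>HomGr Y (ob p x) (ob p y) (i + 1)\<^esub>))"
      using linear_map_triple[OF linear_map_id c.p.mor_linear linear_map_const_zero[OF M], of x y i] x y ob by simp
    fix a assume a: "a \<in> Mor U x y i"
    interpret N: abelian_group "HomGr Y (ob p x) (ob p y) i" using x y ob Y.hom_group by simp
    show "UPair (Dif (Hom U x y) i a) (UPair (mor p x y (i - 1) (Dif (Hom U x y) i a))
        \<zero>\<^bsub>HomGr Y (ob p x) (ob p y) (i - 1 + 1)\<^esub>) =
      Dif (Hom (hpb p (dg_id Y)) (UPair x (UPair (ob p x) (Ident Y (ob p x))))
        (UPair y (UPair (ob p y) (Ident Y (ob p y))))) i
       (UPair a (UPair (mor p x y i a) \<zero>\<^bsub>HomGr Y (ob p x) (ob p y) (i + 1)\<^esub>))"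
      using x y a ob mor Y.dif_zero[of "ob p x" "ob p y" "i + 1"]
      by (simp add: c.p.mor_dif[simplified] Y.ident_left Y.ident_right N.minus_zero_iff)
  next
    fix x y z i j g f assume o: "x \<in> Obj U" "y \<in> Obj U" "z \<in> Obj U" and g: "g \<in> Mor U y z i" and f: "f \<in> Mor U x y j"
    interpret N: abelian_group "HomGr Y (ob p x) (ob p z) (i + j + 1)" using o ob Y.hom_group by simp
    have 1: "Comp Y (ob p x) (ob p y) (ob p z) (i + 1) j \<zero>\<^bsub>HomGr Y (ob p y) (ob p z) (i + 1)\<^esub> (mor p x y j f) =
      \<zero>\<^bsub>HomGr Y (ob p x) (ob p z) (i + j + 1)\<^esub>"
      using Y.comp_zero_left[of "ob p x" "ob p y" "ob p z" "mor p x y j f" j "i + 1"] o ob mor f by (simp add: ac_simps)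
    have 2: "Comp Y (ob p x) (ob p y) (ob p z) i (j + 1) (mor p y z i g) \<zero>\<^bsub>HomGr Y (ob p x) (ob p y) (j + 1)\<^esub> =
      \<zero>\<^bsub>HomGr Y (ob p x) (ob p z) (i + j + 1)\<^esub>"
      using Y.comp_zero_right[of "ob p x" "ob p y" "ob p z" "mor p y z i g" i "j + 1"] o ob mor g
      by (simp add: add.assoc[symmetric])
    show "UPair (Comp U x y z i j g f) (UPair (mor p x z (i + j) (Comp U x y z i j g f))
        \<zero>\<^bsub>HomGr Y (ob p x) (ob p z) (i + j + 1)\<^esub>) =
      Comp (hpb p (dg_id Y)) (UPair x (UPair (ob p x) (Ident Y (ob p x))))
        (UPair y (UPair (ob p y) (Ident Y (ob p y)))) (UPair z (UPair (ob p z) (Ident Y (ob p z)))) i j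
       (UPair g (UPair (mor p y z i g) \<zero>\<^bsub>HomGr Y (ob p y) (ob p z) (i + 1)\<^esub>))
       (UPair f (UPair (mor p x y j f) \<zero>\<^bsub>HomGr Y (ob p x) (ob p y) (j + 1)\<^esub>))"
      using o g f ob mor 1 2 by (simp add: c.p.mor_comp[simplified])
  qed
qed

text \<open>The path object: its objects are homotopy equivalences in \<open>Y\<close>, its
  morphisms squares with a chosen filling.\<close>

abbreviation path_cat :: "('r, ('r, 'a) univ) dgcat \<Rightarrow> ('r, ('r, 'a) univ) dgcat" where
  "path_cat Y \<equiv> hpb (dg_id Y) (dg_id Y)"

text \<open>The way in which dg functors to a homotopy pullback arise: from \<open>f\<close>,
  \<open>g\<close> and a homotopy \<open>K\<close> from \<open>p f\<close> to \<open>q g\<close>, of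
  which only the third component carries information.\<close>

definition hpb_pair :: "('r, ('r, 'a) univ) dgfun \<Rightarrow> ('r, ('r, 'a) univ) dgfun \<Rightarrow>
    ('r, ('r, 'a) univ) dgfun \<Rightarrow> ('r, ('r, 'a) univ) dgfun \<Rightarrow> ('r, ('r, 'a) univ) dgfun \<Rightarrow>
    ('r, ('r, 'a) univ) dgfun" where
  "hpb_pair p q f g K = mk_dgfun (Dom K) (hpb p q)
     (\<lambda>x. UPair (ob f x) (UPair (ob g x) (usnd (usnd (ob K x)))))
     (\<lambda>x y i m. UPair (mor f x y i m) (UPair (mor g x y i m) (usnd (usnd (mor K x y i m)))))"

lemma hpb_pair_hom:
  assumes p: "p \<in> dg_hom R U Y" and q: "q \<in> dg_hom R V Y"
    and f: "f \<in> dg_hom R B U" and g: "g \<in> dg_hom R B V" and K: "K \<in> dg_hom R B (path_cat Y)"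
    and eq: "hpb_fst (dg_id Y) (dg_id Y) \<circ>\<^sub>d K = p \<circ>\<^sub>d f" "hpb_snd (dg_id Y) (dg_id Y) \<circ>\<^sub>d K = q \<circ>\<^sub>d g"
  shows "hpb_pair p q f g K \<in> dg_hom R B (hpb p q)"
proof -
  note YC = dg_homD(5)[OF p]
  interpret c: cospan R p q using p q by (rule cospanI)
  interpret c': cospan R "dg_id Y" "dg_id Y" using dg_id_hom[OF YC] dg_id_hom[OF YC] by (rule cospanI)
  interpret f: dgf R f using f by (rule dgf_hom)
  interpret g: dgf R g using g by (rule dgf_hom)
  interpret K: dgf R K using K by (rule dgf_hom)
  note [simp] = dg_homD(2,3)[OF p] dg_homD(2,3)[OF q] dg_homD(2,3)[OF f] dg_homD(2,3)[OF g] dg_homD(2,3)[OF K]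
  note ob = f.ob_closed[simplified] g.ob_closed[simplified]
    c.p.ob_closed[simplified] c.q.ob_closed[simplified]
  note mor = f.mor_mor[simplified] g.mor_mor[simplified]
    c.p.mor_mor[simplified] c.q.mor_mor[simplified]
  let ?pf = "\<lambda>x. ob p (ob f x)" and ?qg = "\<lambda>x. ob q (ob g x)"
  \<comment> \<open>The projection equations fix the first two components of \<open>K\<close>; what
    remains is an equivalence \<open>k\<close> for each object and a chain \<open>h\<close> for each
    morphism.\<close>
  have KO: "\<exists>k. ob K x = UPair (?pf x) (UPair (?qg x) k) \<and>
      homotopy_invertible Y (?pf x) (?qg x) k" if "x \<in> Obj B" for x
  proof -
    have o: "ob K x \<in> Obj (path_cat Y)" using K.ob_closed that by simp
    then obtain a b k where k: "ob K x = UPair a (UPair b k)" "homotopy_invertible Y a b k" "a \<in> Obj Y" "b \<in> Obj Y"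
      by (auto elim!: hpb_ObjE)
    show ?thesis
      using k o arg_cong[OF eq(1), of "\<lambda>F. ob F x"] arg_cong[OF eq(2), of "\<lambda>F. ob F x"] that
      by (auto simp: hpb_fst_def hpb_snd_def)
  qed
  define k where "k x = usnd (usnd (ob K x))" for x
  have k: "ob K x = UPair (?pf x) (UPair (?qg x) (k x))"
      "homotopy_invertible Y (?pf x) (?qg x) (k x)" if "x \<in> Obj B" for x
    using KO[OF that] by (auto simp: k_def)
  define h where "h x y i m = usnd (usnd (mor K x y i m))" for x y i m
  have h: "mor K x y i m = UPair (mor p (ob f x) (ob f y) i (mor f x y i m))
      (UPair (mor q (ob g x) (ob g y) i (mor g x y i m)) (h x y i m))"
    "h x y i m \<in> Mor Y (?pf x) (?qg y) (i + 1)"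
    if "x \<in> Obj B" "y \<in> Obj B" "m \<in> Mor B x y i" for x y i m
  proof -
    note xy = that
    have o: "mor K x y i m \<in> Mor (path_cat Y) (ob K x) (ob K y) i" using K.mor_mor that by simp
    have oc: "ob K x \<in> Obj (path_cat Y)" "ob K y \<in> Obj (path_cat Y)" using K.ob_closed that by auto
    obtain a b l where l: "mor K x y i m = UPair a (UPair b l)" "l \<in> Mor Y (?pf x) (?qg y) (i + 1)"
      using o xy ob by (auto simp: k elim!: triple_sumE)
    show "mor K x y i m = UPair (mor p (ob f x) (ob f y) i (mor f x y i m))
      (UPair (mor q (ob g x) (ob g y) i (mor g x y i m)) (h x y i m))"
      using l o oc arg_cong[OF eq(1), of "\<lambda>F. mor F x y i m"] arg_cong[OF eq(2), of "\<lambda>F. mor F x y i m"] that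
      by (simp add: hpb_fst_def hpb_snd_def h_def)
    show "h x y i m \<in> Mor Y (?pf x) (?qg y) (i + 1)" using l by (simp add: h_def)
  qed
  let ?o = "\<lambda>x. UPair (ob f x) (UPair (ob g x) (k x))"
    and ?m = "\<lambda>x y i m. UPair (mor f x y i m) (UPair (mor g x y i m) (h x y i m))"
  show ?thesis
    unfolding hpb_pair_def k_def[symmetric] h_def[symmetric] dg_homD(2)[OF K]
  proof (rule mk_dgfun_dg_hom[OF dg_homD(4)[OF f] c.dg_category_hpb])
    fix x assume x: "x \<in> Obj B"
    show "?o x \<in> Obj (hpb p q)" using x ob k by simp
    show "?m x x 0 (Ident B x) =
      Ident (hpb p q) (?o x)"
      using K.mor_ident[of x] h[OF x x, of "Ident B x" 0] x f.D.ident_closed[of x] ob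
      by (simp add: k f.mor_ident[simplified] g.mor_ident[simplified])
    fix y i assume y: "y \<in> Obj B"
    have "linear_map R (HomGr B x y i) (HomGr Y (?pf x) (?qg y) (i + 1)) (\<lambda>m. usnd (usnd (mor K x y i m)))"
    proof (rule linear_map_compose[OF _ linear_map_proj(3)])
      show "linear_map R (HomGr B x y i)
          (direct_sum_module (HomGr Y (?pf x) (?pf y) i) (direct_sum_module
            (HomGr Y (?qg x) (?qg y) i) (HomGr Y (?pf x) (?qg y) (i + 1))))
          (mor K x y i)"
        using K.mor_linear[of x y i] x y ob by (simp add: k)
    qed
    then have "linear_map R (HomGr B x y i) (HomGr Y (?pf x) (?qg y) (i + 1)) (h x y i)"
      by (simp add: h_def[abs_def])
    note linear_map_triple[OF f.mor_linear[simplified, OF x y] g.mor_linear[simplified, OF x y] this]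
    then show "linear_map R (HomGr B x y i) (HomGr (hpb p q) (?o x)
        (?o y) i)
      (?m x y i)"
      using x y by simp
    fix m assume m: "m \<in> Mor B x y i"
    have dm: "Dif (Hom B x y) i m \<in> Mor B x y (i - 1)" using x y m f.D.dif_closed by simp
    show "?m x y (i - 1) (Dif (Hom B x y) i m) =
      Dif (Hom (hpb p q) (?o x) (?o y)) i
        (?m x y i m)"
      using K.mor_dif[of x y m i] x y m h(1)[OF x y m] h(1)[OF x y dm] ob mor
      by (simp add: k f.mor_dif[simplified] g.mor_dif[simplified])
  next
    fix x y z i j n m assume o: "x \<in> Obj B" "y \<in> Obj B" "z \<in> Obj B" and n: "n \<in> Mor B y z i" and m: "m \<in> Mor B x y j"
    have nm: "Comp B x y z i j n m \<in> Mor B x z (i + j)" using o n m f.D.comp_closed by simp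
    show "?m x z (i + j) (Comp B x y z i j n m) =
      Comp (hpb p q) (?o x) (?o y)
        (?o z) i j
        (?m y z i n)
        (?m x y j m)"
      using K.mor_comp[of x y z n i m j] o n m h(1)[OF o(1,3) nm] h(1)[OF o(2,3) n] h(1)[OF o(1,2) m] ob mor
      by (simp add: k f.mor_comp[simplified] g.mor_comp[simplified])
  qed
qed

lemma hpb_fst_dg_hom:
  "p \<in> dg_hom R U Y \<Longrightarrow> q \<in> dg_hom R V Y \<Longrightarrow> hpb_fst p q \<in> dg_hom R (hpb p q) U"
  using cospan.hpb_fst_hom[OF cospanI] dg_homD(2) by metis

lemma hpb_snd_dg_hom:
  "p \<in> dg_hom R U Y \<Longrightarrow> q \<in> dg_hom R V Y \<Longrightarrow> hpb_snd p q \<in> dg_hom R (hpb p q) V"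
  using cospan.hpb_snd_hom[OF cospanI] dg_homD(2) by metis

lemma hpb_fst_simps:
  "Dom (hpb_fst p q) = hpb p q" "Cod (hpb_fst p q) = Dom p"
  "UPair u (UPair v e) \<in> Obj (hpb p q) \<Longrightarrow> ob (hpb_fst p q) (UPair u (UPair v e)) = u"
  "s \<in> Obj (hpb p q) \<Longrightarrow> t \<in> Obj (hpb p q) \<Longrightarrow> UPair a (UPair b h) \<in> Mor (hpb p q) s t i \<Longrightarrow>
   mor (hpb_fst p q) s t i (UPair a (UPair b h)) = a"
  by (simp_all add: hpb_fst_def)

lemma hpb_snd_simps:
  "Dom (hpb_snd p q) = hpb p q" "Cod (hpb_snd p q) = Dom q"
  "UPair u (UPair v e) \<in> Obj (hpb p q) \<Longrightarrow> ob (hpb_snd p q) (UPair u (UPair v e)) = v"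
  "s \<in> Obj (hpb p q) \<Longrightarrow> t \<in> Obj (hpb p q) \<Longrightarrow> UPair a (UPair b h) \<in> Mor (hpb p q) s t i \<Longrightarrow>
   mor (hpb_snd p q) s t i (UPair a (UPair b h)) = b"
  by (simp_all add: hpb_snd_def)

lemma hpb_map_proj:
  assumes p: "p \<in> dg_hom R U Y" and q: "q \<in> dg_hom R V Y"
    and p': "p' \<in> dg_hom R U' Y'" and q': "q' \<in> dg_hom R V' Y'"
    and \<alpha>: "\<alpha> \<in> dg_hom R U U'" and \<beta>: "\<beta> \<in> dg_hom R V V'" and \<eta>: "\<eta> \<in> dg_hom R Y Y'"
    and eq: "p' \<circ>\<^sub>d \<alpha> = \<eta> \<circ>\<^sub>d p" "q' \<circ>\<^sub>d \<beta> = \<eta> \<circ>\<^sub>d q"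
  shows "hpb_fst p' q' \<circ>\<^sub>d hpb_map p q p' q' \<alpha> \<beta> \<eta> = \<alpha> \<circ>\<^sub>d hpb_fst p q" (is "_ \<circ>\<^sub>d ?M = _")
    "hpb_snd p' q' \<circ>\<^sub>d hpb_map p q p' q' \<alpha> \<beta> \<eta> = \<beta> \<circ>\<^sub>d hpb_snd p q"
proof -
  have M: "?M \<in> dg_hom R (hpb p q) (hpb p' q')" by (rule hpb_map_hom) fact+
  interpret M: dgf R ?M using M by (rule dgf_hom)
  note [simp] = dg_homD(2,3)[OF M]
  have Mob: "ob ?M (UPair u (UPair v e)) = UPair (ob \<alpha> u) (UPair (ob \<beta> v) (mor \<eta> (ob p u) (ob q v) 0 e))"
    if "UPair u (UPair v e) \<in> Obj (hpb p q)" for u v e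
    using that by (simp add: hpb_map_def)
  have Mmor: "mor ?M (UPair u (UPair v e)) (UPair u' (UPair v' e')) i (UPair a (UPair b h)) =
      UPair (mor \<alpha> u u' i a) (UPair (mor \<beta> v v' i b) (mor \<eta> (ob p u) (ob q v') (i + 1) h))"
    if "UPair u (UPair v e) \<in> Obj (hpb p q)" "UPair u' (UPair v' e') \<in> Obj (hpb p q)"
      "UPair a (UPair b h) \<in> Mor (hpb p q) (UPair u (UPair v e)) (UPair u' (UPair v' e')) i"
    for u v e u' v' e' i a b h
    using that by (simp add: hpb_map_def)
  note [simp] = dg_homD(2,3)[OF p] dg_homD(2,3)[OF q] dg_homD(2,3)[OF p'] dg_homD(2,3)[OF q']
  note Mc = M.ob_closed[simplified] M.mor_mor[simplified]
  show "hpb_fst p' q' \<circ>\<^sub>d ?M = \<alpha> \<circ>\<^sub>d hpb_fst p q"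
  proof (rule dg_hom_ext[OF dg_comp_hom[OF M hpb_fst_dg_hom[OF p' q']] dg_comp_hom[OF hpb_fst_dg_hom[OF p q] \<alpha>]])
    fix s assume s: "s \<in> Obj (hpb p q)"
    then obtain u v e where s': "s = UPair u (UPair v e)" by (auto elim: hpb_ObjE)
    show "ob (hpb_fst p' q' \<circ>\<^sub>d ?M) s = ob (\<alpha> \<circ>\<^sub>d hpb_fst p q) s"
      using s Mc(1)[OF s] unfolding s' by (simp add: hpb_fst_simps Mob del: hpb_Obj)
    fix t i m assume t: "t \<in> Obj (hpb p q)" and m: "m \<in> Mor (hpb p q) s t i"
    obtain u' v' e' where t': "t = UPair u' (UPair v' e')" using t by (auto elim: hpb_ObjE)
    obtain a b h where m': "m = UPair a (UPair b h)" using m unfolding s' t' by (auto elim!: triple_sumE)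
    show "mor (hpb_fst p' q' \<circ>\<^sub>d ?M) s t i m = mor (\<alpha> \<circ>\<^sub>d hpb_fst p q) s t i m"
      using s t m Mc(1)[OF s] Mc(1)[OF t] Mc(2)[OF s t m] unfolding s' t' m'
      by (simp add: hpb_fst_simps Mob Mmor del: hpb_Obj hpb_HomGr)
  qed
  show "hpb_snd p' q' \<circ>\<^sub>d ?M = \<beta> \<circ>\<^sub>d hpb_snd p q"
  proof (rule dg_hom_ext[OF dg_comp_hom[OF M hpb_snd_dg_hom[OF p' q']] dg_comp_hom[OF hpb_snd_dg_hom[OF p q] \<beta>]])
    fix s assume s: "s \<in> Obj (hpb p q)"
    then obtain u v e where s': "s = UPair u (UPair v e)" by (auto elim: hpb_ObjE)
    show "ob (hpb_snd p' q' \<circ>\<^sub>d ?M) s = ob (\<beta> \<circ>\<^sub>d hpb_snd p q) s"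
      using s Mc(1)[OF s] unfolding s' by (simp add: hpb_snd_simps Mob del: hpb_Obj)
    fix t i m assume t: "t \<in> Obj (hpb p q)" and m: "m \<in> Mor (hpb p q) s t i"
    obtain u' v' e' where t': "t = UPair u' (UPair v' e')" using t by (auto elim: hpb_ObjE)
    obtain a b h where m': "m = UPair a (UPair b h)" using m unfolding s' t' by (auto elim!: triple_sumE)
    show "mor (hpb_snd p' q' \<circ>\<^sub>d ?M) s t i m = mor (\<beta> \<circ>\<^sub>d hpb_snd p q) s t i m"
      using s t m Mc(1)[OF s] Mc(1)[OF t] Mc(2)[OF s t m] unfolding s' t' m'
      by (simp add: hpb_snd_simps Mob Mmor del: hpb_Obj hpb_HomGr)
  qed
qed

lemma hpb_const_proj:
  assumes p: "p \<in> dg_hom R U Y"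
  shows "hpb_fst p (dg_id Y) \<circ>\<^sub>d hpb_const p = dg_id U" "hpb_snd p (dg_id Y) \<circ>\<^sub>d hpb_const p = p"
proof -
  note i = dg_id_hom[OF dg_homD(5)[OF p]] and C = hpb_const_hom[OF p]
  interpret C: dgf R "hpb_const p" using C by (rule dgf_hom)
  note [simp] = dg_homD(2,3)[OF p] dg_homD(2,3)[OF C]
  note Cc = C.ob_closed[simplified] C.mor_mor[simplified]
  have Cob: "ob (hpb_const p) x = UPair x (UPair (ob p x) (Ident Y (ob p x)))" if "x \<in> Obj U" for x
    using that by (simp add: hpb_const_def)
  have Cmor: "mor (hpb_const p) x y i m = UPair m (UPair (mor p x y i m) \<zero>\<^bsub>HomGr Y (ob p x) (ob p y) (i + 1)\<^esub>)"
    if "x \<in> Obj U" "y \<in> Obj U" "m \<in> Mor U x y i" for x y i m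
    using that by (simp add: hpb_const_def)
  show "hpb_fst p (dg_id Y) \<circ>\<^sub>d hpb_const p = dg_id U"
  proof (rule dg_hom_ext[OF dg_comp_hom[OF C hpb_fst_dg_hom[OF p i]] dg_id_hom[OF dg_homD(4)[OF p]]])
    fix x assume x: "x \<in> Obj U"
    show "ob (hpb_fst p (dg_id Y) \<circ>\<^sub>d hpb_const p) x = ob (dg_id U) x"
      using x Cc(1)[OF x] by (simp add: hpb_fst_simps Cob del: hpb_Obj)
    fix y i m assume y: "y \<in> Obj U" and m: "m \<in> Mor U x y i"
    show "mor (hpb_fst p (dg_id Y) \<circ>\<^sub>d hpb_const p) x y i m = mor (dg_id U) x y i m"
      using x y m Cc(1)[OF x] Cc(1)[OF y] Cc(2)[OF x y m] by (simp add: hpb_fst_simps Cob Cmor del: hpb_Obj hpb_HomGr)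
  qed
  show "hpb_snd p (dg_id Y) \<circ>\<^sub>d hpb_const p = p"
  proof (rule dg_hom_ext[OF dg_comp_hom[OF C hpb_snd_dg_hom[OF p i]] p])
    fix x assume x: "x \<in> Obj U"
    show "ob (hpb_snd p (dg_id Y) \<circ>\<^sub>d hpb_const p) x = ob p x"
      using x Cc(1)[OF x] by (simp add: hpb_snd_simps Cob del: hpb_Obj)
    fix y i m assume y: "y \<in> Obj U" and m: "m \<in> Mor U x y i"
    show "mor (hpb_snd p (dg_id Y) \<circ>\<^sub>d hpb_const p) x y i m = mor p x y i m"
      using x y m Cc(1)[OF x] Cc(1)[OF y] Cc(2)[OF x y m] by (simp add: hpb_snd_simps Cob Cmor del: hpb_Obj hpb_HomGr)
  qed
qed

lemma hpb_pair_proj: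
  assumes p: "p \<in> dg_hom R U Y" and q: "q \<in> dg_hom R V Y"
    and f: "f \<in> dg_hom R B U" and g: "g \<in> dg_hom R B V" and K: "K \<in> dg_hom R B (path_cat Y)"
    and eq: "hpb_fst (dg_id Y) (dg_id Y) \<circ>\<^sub>d K = p \<circ>\<^sub>d f" "hpb_snd (dg_id Y) (dg_id Y) \<circ>\<^sub>d K = q \<circ>\<^sub>d g"
  shows "hpb_fst p q \<circ>\<^sub>d hpb_pair p q f g K = f" (is "_ \<circ>\<^sub>d ?M = _") "hpb_snd p q \<circ>\<^sub>d hpb_pair p q f g K = g"
proof -
  have M: "?M \<in> dg_hom R B (hpb p q)" by (rule hpb_pair_hom) fact+
  interpret M: dgf R ?M using M by (rule dgf_hom)
  note [simp] = dg_homD(2,3)[OF M] dg_homD(2,3)[OF K]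
  note Mc = M.ob_closed[simplified] M.mor_mor[simplified]
  have Mob: "ob ?M x = UPair (ob f x) (UPair (ob g x) (usnd (usnd (ob K x))))" if "x \<in> Obj B" for x
    using that by (simp add: hpb_pair_def)
  have Mmor: "mor ?M x y i m = UPair (mor f x y i m) (UPair (mor g x y i m) (usnd (usnd (mor K x y i m))))"
    if "x \<in> Obj B" "y \<in> Obj B" "m \<in> Mor B x y i" for x y i m
    using that by (simp add: hpb_pair_def)
  show "hpb_fst p q \<circ>\<^sub>d ?M = f"
  proof (rule dg_hom_ext[OF dg_comp_hom[OF M hpb_fst_dg_hom[OF p q]] f])
    fix x assume x: "x \<in> Obj B"
    show "ob (hpb_fst p q \<circ>\<^sub>d ?M) x = ob f x"
      using x Mc(1)[OF x] by (simp add: hpb_fst_simps Mob del: hpb_Obj)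
    fix y i m assume y: "y \<in> Obj B" and m: "m \<in> Mor B x y i"
    show "mor (hpb_fst p q \<circ>\<^sub>d ?M) x y i m = mor f x y i m"
      using x y m Mc(1)[OF x] Mc(1)[OF y] Mc(2)[OF x y m] by (simp add: hpb_fst_simps Mob Mmor del: hpb_Obj hpb_HomGr)
  qed
  show "hpb_snd p q \<circ>\<^sub>d ?M = g"
  proof (rule dg_hom_ext[OF dg_comp_hom[OF M hpb_snd_dg_hom[OF p q]] g])
    fix x assume x: "x \<in> Obj B"
    show "ob (hpb_snd p q \<circ>\<^sub>d ?M) x = ob g x"
      using x Mc(1)[OF x] by (simp add: hpb_snd_simps Mob del: hpb_Obj)
    fix y i m assume y: "y \<in> Obj B" and m: "m \<in> Mor B x y i"
    show "mor (hpb_snd p q \<circ>\<^sub>d ?M) x y i m = mor g x y i m"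
      using x y m Mc(1)[OF x] Mc(1)[OF y] Mc(2)[OF x y m] by (simp add: hpb_snd_simps Mob Mmor del: hpb_Obj hpb_HomGr)
  qed
qed

section \<open>Surjective equivalences involving homotopy pullbacks\<close>

lemma surjective_equivalenceI:
  assumes "F \<in> dg_hom R A C"
    and "\<And>y. y \<in> Obj C \<Longrightarrow> \<exists>x\<in>Obj A. ob F x = y"
    and "\<And>x y i m n. x \<in> Obj A \<Longrightarrow> y \<in> Obj A \<Longrightarrow> m \<in> Mor A x y i \<Longrightarrow>
      Dif (Hom A x y) i m = \<zero>\<^bsub>HomGr A x y (i - 1)\<^esub> \<Longrightarrow> n \<in> Mor C (ob F x) (ob F y) (i + 1) \<Longrightarrow>
      Dif (Hom C (ob F x) (ob F y)) (i + 1) n = mor F x y i m \<Longrightarrow>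
      \<exists>l\<in>Mor A x y (i + 1). Dif (Hom A x y) (i + 1) l = m \<and> mor F x y (i + 1) l = n"
  shows "surjective_equivalence R F"
  unfolding surjective_equivalence_def acyclic_surjection_def
  using assms dg_homD(1-3)[OF assms(1)] by (simp add: cycles_def)

text \<open>Relative form, over a surjective equivalence \<open>p\<close>, of the fact that path categories are invariant.\<close>

lemma path_map_surjective_equivalence:
  assumes p: "p \<in> dg_hom R Z Y" and P: "surjective_equivalence R p"
  shows "surjective_equivalence R (hpb_map (dg_id Z) (dg_id Z) p p (dg_id Z) (dg_id Z) p)"
proof -
  note [simp] = dg_homD(2,3)[OF p]
  interpret P: surj_equiv R p using P by unfold_locales
  interpret Z: dg_category R Z using dg_homD(4)[OF p] .
  interpret Y: dg_category R Y using dg_homD(5)[OF p] .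
  note i = dg_id_hom[OF dg_homD(4)[OF p]]
  have M: "hpb_map (dg_id Z) (dg_id Z) p p (dg_id Z) (dg_id Z) p \<in> dg_hom R (path_cat Z) (hpb p p)" (is "?M \<in> _")
    by (rule hpb_map_hom[OF i i p p i i p]) simp_all
  show ?thesis
  proof (rule surjective_equivalenceI[OF M])
    fix y assume "y \<in> Obj (hpb p p)"
    then obtain u v e where y: "y = UPair u (UPair v e)" "u \<in> Obj Z" "v \<in> Obj Z"
      "homotopy_invertible Y (ob p u) (ob p v) e" by (auto elim: hpb_ObjE)
    obtain k where "homotopy_invertible Z u v k" "mor p u v 0 k = e"
      using P.lift_homotopy_invertible[of u v e] y by auto
    then show "\<exists>x\<in>Obj (path_cat Z). ob ?M x = y"
      using y by (intro bexI[of _ "UPair u (UPair v k)"]) (auto simp: hpb_map_def)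
  next
    fix s t i m n assume st: "s \<in> Obj (path_cat Z)" "t \<in> Obj (path_cat Z)"
      and m: "m \<in> Mor (path_cat Z) s t i"
      and dm: "Dif (Hom (path_cat Z) s t) i m = \<zero>\<^bsub>HomGr (path_cat Z) s t (i - 1)\<^esub>"
      and n: "n \<in> Mor (hpb p p) (ob ?M s) (ob ?M t) (i + 1)"
      and dn: "Dif (Hom (hpb p p) (ob ?M s) (ob ?M t)) (i + 1) n = mor ?M s t i m"
    obtain u v e where s: "s = UPair u (UPair v e)" "u \<in> Obj Z" "v \<in> Obj Z" "homotopy_invertible Z u v e"
      using st(1) by (auto elim!: hpb_ObjE)
    obtain u' v' e' where t: "t = UPair u' (UPair v' e')" "u' \<in> Obj Z" "v' \<in> Obj Z" "homotopy_invertible Z u' v' e'"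
      using st(2) by (auto elim!: hpb_ObjE)
    have e: "e \<in> cycles (Hom Z u v) 0" "e' \<in> cycles (Hom Z u' v') 0"
      using s(4) t(4) by (auto simp: homotopy_invertible_def)
    note ec = Z.cycle_closed[OF e(1)] Z.cycle_closed[OF e(2)]
    obtain a b h where m: "m = UPair a (UPair b h)" "a \<in> Mor Z u u' i" "b \<in> Mor Z v v' i" "h \<in> Mor Z u v' (i + 1)"
      using m by (auto simp: s t elim!: triple_sumE)
    have Mst: "ob ?M s = UPair u (UPair v (mor p u v 0 e))" "ob ?M t = UPair u' (UPair v' (mor p u' v' 0 e'))"
      using s t by (simp_all add: hpb_map_def)
    obtain a2 b2 k where n: "n = UPair a2 (UPair b2 k)" "a2 \<in> Mor Z u u' (i + 1)" "b2 \<in> Mor Z v v' (i + 1)"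
      "k \<in> Mor Y (ob p u) (ob p v') (i + 1 + 1)"
      using n by (auto simp: Mst elim!: triple_sumE)
    let ?pu = "ob p u"
      and ?pv = "ob p v"
      and ?pu' = "ob p u'"
      and ?pv' = "ob p v'"
      and ?s = "i + 1 + 1"
      and ?k = "i + 1"
    note o = s(2,3) t(2,3) P.ob_closed[simplified, OF s(2)] P.ob_closed[simplified, OF s(3)]
      P.ob_closed[simplified, OF t(2)] P.ob_closed[simplified, OF t(3)]
    let ?C = "HomGr Z u v'"
      and ?d = "Dif (Hom Z u v')"
      and ?ce = "Comp Z u v v'"
      and ?ec = "Comp Z u u' v' 0"
    have d: "Dif (Hom Z v v') i b = \<zero>\<^bsub>HomGr Z v v' (i - 1)\<^esub>" "Dif (Hom Z u u') i a = \<zero>\<^bsub>HomGr Z u u' (i - 1)\<^esub>"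
      "(?ce i 0 b e \<ominus>\<^bsub>?C i\<^esub> ?ec i e' a) \<ominus>\<^bsub>?C i\<^esub>
        ?d ?k h = \<zero>\<^bsub>?C i\<^esub>"
      using dm m o by (simp_all add: s(1) t(1))
    have mM: "mor ?M s t i m = UPair a (UPair b (mor p u v' ?k h))"
      using st m s t by (simp add: hpb_map_def)
    have D: "Dif (Hom Z u u') ?k a2 = a" "Dif (Hom Z v v') ?k b2 = b"
      "(Comp Y ?pu ?pv ?pv' ?k 0 (mor p v v' ?k b2) (mor p u v 0 e)
        \<ominus>\<^bsub>HomGr Y ?pu ?pv' ?k\<^esub>
        Comp Y ?pu ?pu' ?pv' 0 ?k (mor p u' v' 0 e') (mor p u u' ?k a2))
       \<ominus>\<^bsub>HomGr Y ?pu ?pv' ?k\<^esub> Dif (Hom Y ?pu ?pv') ?s k = mor p u v' ?k h"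
      using dn n unfolding Mst mM by simp_all
    let ?be = "?ce ?k 0 b2 e" and ?ea = "?ec ?k e' a2"
    have c: "?be \<in> Mor Z u v' ?k" "?ea \<in> Mor Z u v' ?k"
      using o ec n by (auto intro!: Z.comp_closed)
    let ?G = "?C ?k" and ?H = "HomGr Y ?pu ?pv' ?k"
    interpret G: abelian_group ?G using o Z.hom_group by simp
    interpret G': abelian_group "?C i" using o Z.hom_group by simp
    interpret H: abelian_group ?H using o Y.hom_group by simp
    \<comment> \<open>The first two components of a lift are forced to be \<open>a2\<close> and
      \<open>b2\<close>, and \<open>l\<close> is the boundary that its third component must have. It
      is a cycle because \<open>m\<close> is one, and \<open>k\<close> bounds its image.\<close>
    define l where "l = (?be \<ominus>\<^bsub>?G\<^esub> ?ea) \<ominus>\<^bsub>?G\<^esub> h"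
    have l: "l \<in> Mor Z u v' ?k" using c m by (simp add: l_def)
    have dbe: "?d ?k ?be = ?ce i 0 b e"
      using Z.dif_comp_cycle_right[OF o(1,2,4) e(1) n(3)] D by simp
    have dea: "?d ?k ?ea = ?ec i e' a"
      using Z.dif_comp_cycle_left[OF o(1,3,4) e(2) n(2)] D by simp
    have "?d ?k l = \<zero>\<^bsub>?C i\<^esub>"
      unfolding l_def using c m o d(3) by (simp add: Z.dif_minus dbe dea)
    then have lc: "l \<in> cycles (Hom Z u v') ?k" using l by (simp add: cycles_def)
    have pb: "mor p u v' ?k ?be =
        Comp Y ?pu ?pv ?pv' ?k 0 (mor p v v' ?k b2) (mor p u v 0 e)"
      "mor p u v' ?k ?ea =
        Comp Y ?pu ?pu' ?pv' 0 ?k (mor p u' v' 0 e') (mor p u u' ?k a2)"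
      using o n ec by (simp_all add: P.mor_comp[simplified])
    have dk: "Dif (Hom Y ?pu ?pv') ?s k \<in> carrier ?H"
      using n o by (auto intro!: Y.dif_closed)
    have pc: "mor p u v' ?k ?be \<in> carrier ?H" "mor p u v' ?k ?ea \<in> carrier ?H"
      using o c P.mor_mor by simp_all
    have "mor p u v' ?k l = (mor p u v' ?k ?be \<ominus>\<^bsub>?H\<^esub> mor p u v' ?k ?ea) \<ominus>\<^bsub>?H\<^esub> mor p u v' ?k h"
      unfolding l_def using c m o by (simp add: P.mor_minus[simplified])
    also have "\<dots> = Dif (Hom Y ?pu ?pv') ?s k"
      unfolding D(3)[symmetric] pb[symmetric] using pc dk by algebra
    finally obtain h2 where h2: "h2 \<in> Mor Z u v' ?s" "?d ?s h2 = l"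
      "mor p u v' ?s h2 = k"
      using P.lift_boundary[simplified, OF o(1,4) lc, of k "i + 1 + 1"] n by auto
    have "(?be \<ominus>\<^bsub>?G\<^esub> ?ea) \<ominus>\<^bsub>?G\<^esub> l = h" unfolding l_def using c m by algebra
    then show "\<exists>l\<in>Mor (path_cat Z) s t ?k. Dif (Hom (path_cat Z) s t) ?k l = m \<and> mor ?M s t ?k l = n"
      using st m s t n h2 D o
      by (intro bexI[of _ "UPair a2 (UPair b2 h2)"]) (simp_all add: hpb_map_def)
  qed
qed

text \<open>On objects this is (F2). On morphisms, (F1) provides lifts of \<open>\<beta>\<close> and
  \<open>k\<close> with errors in the kernel of \<open>p\<close>. Composition with the homotopy
  equivalence \<open>e\<close> is invertible up to homotopy on the kernel complexes as well, so the
  errors can be corrected inside the kernel. This keeps the image prescribed.\<close>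

lemma path_fibration_surjective_equivalence:
  assumes p: "p \<in> dg_hom R Z Y" and P: "fibration R p"
  shows "surjective_equivalence R (hpb_map (dg_id Z) (dg_id Z) p (dg_id Y) (dg_id Z) p p)"
proof -
  note [simp] = dg_homD(2,3)[OF p]
  interpret P: dgf R p using p by (rule dgf_hom)
  interpret Z: dg_category R Z using dg_homD(4)[OF p] .
  interpret Y: dg_category R Y using dg_homD(5)[OF p] .
  have surj: "\<exists>m\<in>Mor Z x y i. mor p x y i m = n"
    if "x \<in> Obj Z" "y \<in> Obj Z" "n \<in> Mor Y (ob p x) (ob p y) i" for x y i n
  proof -
    have "mor p x y i ` Mor Z x y i = Mor Y (ob p x) (ob p y) i"
      using P that unfolding fibration_def by simp
    then show ?thesis using that by (metis imageE)
  qed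
  note i = dg_id_hom[OF dg_homD(4)[OF p]] and iY = dg_id_hom[OF dg_homD(5)[OF p]]
  have M: "hpb_map (dg_id Z) (dg_id Z) p (dg_id Y) (dg_id Z) p p \<in> dg_hom R (path_cat Z) (hpb p (dg_id Y))" (is "?M \<in> _")
    by (rule hpb_map_hom[OF i i p iY i p p]) (simp_all add: dg_comp_id_left[OF p] dg_comp_id_right[OF p])
  show ?thesis
  proof (rule surjective_equivalenceI[OF M])
    fix y assume "y \<in> Obj (hpb p (dg_id Y))"
    then obtain u v e where y: "y = UPair u (UPair v e)" "u \<in> Obj Z" "v \<in> Obj Y"
      "homotopy_invertible Y (ob p u) v e" by (auto elim!: hpb_ObjE)
    obtain w k where "w \<in> Obj Z" "homotopy_invertible Z u w k" "ob p w = v" "mor p u w 0 k = e"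
      using P y unfolding fibration_def by (metis dg_homD(2,3)[OF p])
    then show "\<exists>x\<in>Obj (path_cat Z). ob ?M x = y"
      using y by (intro bexI[of _ "UPair u (UPair w k)"]) (auto simp: hpb_map_def)
  next
    fix s t i m n assume st: "s \<in> Obj (path_cat Z)" "t \<in> Obj (path_cat Z)"
      and m: "m \<in> Mor (path_cat Z) s t i"
      and dm: "Dif (Hom (path_cat Z) s t) i m = \<zero>\<^bsub>HomGr (path_cat Z) s t (i - 1)\<^esub>"
      and n: "n \<in> Mor (hpb p (dg_id Y)) (ob ?M s) (ob ?M t) (i + 1)"
      and dn: "Dif (Hom (hpb p (dg_id Y)) (ob ?M s) (ob ?M t)) (i + 1) n = mor ?M s t i m"
    obtain u v e where s: "s = UPair u (UPair v e)" "u \<in> Obj Z" "v \<in> Obj Z" "homotopy_invertible Z u v e"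
      using st(1) by (auto elim!: hpb_ObjE)
    obtain u' v' e' where t: "t = UPair u' (UPair v' e')" "u' \<in> Obj Z" "v' \<in> Obj Z" "homotopy_invertible Z u' v' e'"
      using st(2) by (auto elim!: hpb_ObjE)
    obtain f w w' where e: "e \<in> cycles (Hom Z u v) 0" and f: "f \<in> cycles (Hom Z v u) 0"
      and w': "w' \<in> Mor Z u u 1" "Comp Z u v u 0 0 f e \<ominus>\<^bsub>HomGr Z u u 0\<^esub> Ident Z u = Dif (Hom Z u u) 1 w'"
      and w: "w \<in> Mor Z v v 1" "Comp Z v u v 0 0 e f \<ominus>\<^bsub>HomGr Z v v 0\<^esub> Ident Z v = Dif (Hom Z v v) 1 w"
      using Z.homotopy_invertibleE[OF s(4,2,3)] by metis
    have e': "e' \<in> cycles (Hom Z u' v') 0" using t(4) by (auto simp: homotopy_invertible_def)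
    note ec = Z.cycle_closed[OF e] Z.cycle_closed[OF e'] Z.cycle_closed[OF f]
    obtain a b h where m: "m = UPair a (UPair b h)" "a \<in> Mor Z u u' i" "b \<in> Mor Z v v' i" "h \<in> Mor Z u v' (i + 1)"
      using m by (auto simp: s t elim!: triple_sumE)
    have Mst: "ob ?M s = UPair u (UPair (ob p v) (mor p u v 0 e))" "ob ?M t = UPair u' (UPair (ob p v') (mor p u' v' 0 e'))"
      using s t by (simp_all add: hpb_map_def)
    let ?pu = "ob p u"
      and ?pv = "ob p v"
      and ?pu' = "ob p u'"
      and ?pv' = "ob p v'"
      and ?s = "i + 1 + 1"
      and ?k = "i + 1"
    note o = s(2,3) t(2,3) P.ob_closed[simplified, OF s(2)] P.ob_closed[simplified, OF s(3)]
      P.ob_closed[simplified, OF t(2)] P.ob_closed[simplified, OF t(3)]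
    obtain a2 \<beta> k where n: "n = UPair a2 (UPair \<beta> k)" "a2 \<in> Mor Z u u' ?k"
      "\<beta> \<in> Mor Y ?pv ?pv' ?k" "k \<in> Mor Y ?pu ?pv' ?s"
      using n o by (auto simp: Mst elim!: triple_sumE)
    let ?YP = "HomGr Y ?pu ?pv'"
      and ?YQ = "HomGr Y ?pv ?pv'"
      and ?C = "HomGr Z u v'"
      and ?F = "HomGr Z v v'"
      and ?d = "Dif (Hom Z u v')"
      and ?dv = "Dif (Hom Z v v')"
      and ?ce = "Comp Z u v v'"
      and ?ec = "Comp Z u u' v' 0"
      and ?cf = "Comp Z v u v' ?k 0"
    have d: "?dv i b = \<zero>\<^bsub>?F (i - 1)\<^esub>"
      "(?ce i 0 b e \<ominus>\<^bsub>?C i\<^esub> ?ec i e' a) \<ominus>\<^bsub>?C i\<^esub>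
        ?d ?k h = \<zero>\<^bsub>?C i\<^esub>"
      using dm m o by (simp_all add: s(1) t(1))
    have mM: "mor ?M s t i m = UPair a (UPair (mor p v v' i b) (mor p u v' ?k h))"
      using st m s t by (simp add: hpb_map_def)
    have D: "Dif (Hom Z u u') ?k a2 = a" "Dif (Hom Y ?pv ?pv') ?k \<beta> = mor p v v' i b"
      "(Comp Y ?pu ?pv ?pv' ?k 0 \<beta> (mor p u v 0 e)
        \<ominus>\<^bsub>?YP ?k\<^esub>
        Comp Y ?pu ?pu' ?pv' 0 ?k (mor p u' v' 0 e') (mor p u u' ?k a2))
       \<ominus>\<^bsub>?YP ?k\<^esub> Dif (Hom Y ?pu ?pv') ?s k = mor p u v' ?k h"
      using dn n o unfolding Mst mM by simp_all
    \<comment> \<open>Arbitrary lifts by (F1), corrected below.\<close>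
    obtain b0 where b0: "b0 \<in> Mor Z v v' ?k" "mor p v v' ?k b0 = \<beta>" using surj o n by blast
    obtain h0 where h0: "h0 \<in> Mor Z u v' ?s" "mor p u v' ?s h0 = k" using surj o n by blast
    let ?G = "?C ?k" and ?B = "?F i"
    interpret G: abelian_group ?G using o Z.hom_group by simp
    interpret G': abelian_group "?C i" using o Z.hom_group by simp
    interpret B: abelian_group ?B using o Z.hom_group by simp
    interpret B': abelian_group "?F (i - 1)" using o Z.hom_group by simp
    interpret B1: abelian_group "?F ?k" using o Z.hom_group by simp
    interpret H: abelian_group "?YP ?k" using o Y.hom_group by simp
    let ?be = "?ce ?k 0 b0 e" and ?ea = "?ec ?k e' a2"
    have c: "?be \<in> carrier ?G" "?ea \<in> carrier ?G" "?d ?s h0 \<in> carrier ?G"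
      "?dv ?k b0 \<in> carrier ?B"
      using o ec n b0 h0 by (auto intro!: Z.comp_closed Z.dif_closed)
    \<comment> \<open>The errors of \<open>b0\<close> and \<open>h0\<close> in the second and third
      component. Both are killed by \<open>p\<close>, \<open>r\<close> is a cycle, and
      \<open>r e = d s'\<close>.\<close>
    define r where "r = b \<ominus>\<^bsub>?B\<^esub> ?dv ?k b0"
    define s' where "s' = h \<ominus>\<^bsub>?G\<^esub> ((?be \<ominus>\<^bsub>?G\<^esub> ?ea) \<ominus>\<^bsub>?G\<^esub> ?d ?s h0)"
    have rs: "r \<in> carrier ?B" "s' \<in> carrier ?G" using c m by (simp_all add: r_def s'_def)
    have r: "r \<in> cycles (Hom Z v v') i"
      using rs c m o b0 d by (simp add: cycles_def r_def Z.dif_minus Z.dif_dif)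
    have pr: "mor p v v' i r = \<zero>\<^bsub>?YQ i\<^esub>"
    proof -
      interpret abelian_group "?YQ i" using o Y.hom_group by simp
      show ?thesis using o c m b0 D(2) P.mor_mor[of v v' b i]
        by (simp add: r_def P.mor_minus[simplified] P.mor_dif[simplified])
    qed
    have ps: "mor p u v' ?k s' = \<zero>\<^bsub>?YP ?k\<^esub>"
      using o c m b0 h0 n ec D(3)[symmetric] P.mor_mor[of u v' h "i + 1"]
      by (simp add: s'_def P.mor_minus[simplified] P.mor_dif[simplified] P.mor_comp[simplified] Z.mor_minus)
    have dbe: "?d ?k ?be = ?ce i 0 (?dv ?k b0) e"
      using Z.dif_comp_cycle_right[OF o(1,2,4) e b0(1)] by simp
    have dea: "?d ?k ?ea = ?ec i e' a"
      using Z.dif_comp_cycle_left[OF o(1,3,4) e' n(2)] D by simp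
    have x: "?ce i 0 b e \<in> Mor Z u v' i" "?ec i e' a \<in> Mor Z u v' i"
      "?d ?k h \<in> Mor Z u v' i" "?ce i 0 (?dv ?k b0) e \<in> Mor Z u v' i"
      using o m ec c by (auto intro!: Z.comp_closed Z.dif_closed)
    have dh: "?d ?k h = ?ce i 0 b e \<ominus>\<^bsub>?C i\<^esub> ?ec i e' a"
      using d(2) G'.minus_zero_iff[of "?ce i 0 b e \<ominus>\<^bsub>?C i\<^esub> ?ec i e' a"] x by simp
    have "?d ?k s' = ?ce i 0 b e \<ominus>\<^bsub>?C i\<^esub> ?ec i e' a
      \<ominus>\<^bsub>?C i\<^esub> (?ce i 0 (?dv ?k b0) e \<ominus>\<^bsub>?C i\<^esub> ?ec i e' a
        \<ominus>\<^bsub>?C i\<^esub> \<zero>\<^bsub>?C i\<^esub>)"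
      using o m c h0(1) Z.dif_dif[OF o(1,4) h0(1), of "i + 1"]
      by (simp add: s'_def Z.dif_minus Z.mor_minus dh dbe dea)
    also have "\<dots> = ?ce i 0 b e \<ominus>\<^bsub>?C i\<^esub> ?ce i 0 (?dv ?k b0) e"
      using x by algebra
    also have "\<dots> = ?ce i 0 r e"
      using o ec m c by (simp add: r_def Z.comp_minus_left)
    finally have ds: "?ce i 0 r e = ?d ?k s'" by simp
    \<comment> \<open>As \<open>r e\<close> bounds, so does \<open>r\<close>. The bounding chain is
      composed of \<open>r\<close> and \<open>s'\<close>, so \<open>p\<close> kills it and it may be
      added to \<open>b0\<close> without changing the image \<open>\<beta>\<close>.\<close>
    define b1 where "b1 = ?cf s' f \<ominus>\<^bsub>?F ?k\<^esub>
      koszul (?F ?k) i (Comp Z v v v' i 1 r w)"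
    have rb: "r = ?dv ?k b1"
      unfolding b1_def by (rule Z.comp_precomp_boundary[OF o(1,2,4) e f w r rs(2) ds])
    have y: "?cf s' f \<in> Mor Z v v' ?k" "Comp Z v v v' i 1 r w \<in> Mor Z v v' ?k"
      using o rs ec w by (auto intro!: Z.comp_closed)
    have b1: "b1 \<in> Mor Z v v' ?k" using y by (simp add: b1_def)
    have pb1: "mor p v v' ?k b1 = \<zero>\<^bsub>?YQ ?k\<^esub>"
    proof -
      interpret abelian_group "?YQ ?k" using o Y.hom_group by simp
      have "mor p v v' ?k (?cf s' f) = \<zero>\<^bsub>?YQ ?k\<^esub>"
        using o rs ec ps Y.comp_zero_left[of "ob p v" "ob p u" "ob p v'" "mor p v u 0 f" 0 "i + 1"] P.mor_mor[of v u f 0]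
        by (simp add: P.mor_comp[simplified])
      moreover have "mor p v v' ?k (Comp Z v v v' i 1 r w) = \<zero>\<^bsub>?YQ ?k\<^esub>"
        using o rs w pr Y.comp_zero_left[of "ob p v" "ob p v" "ob p v'" "mor p v v 1 w" 1 i] P.mor_mor[of v v w 1]
        by (simp add: P.mor_comp[simplified])
      ultimately show ?thesis using y o by (simp add: b1_def P.mor_minus[simplified] P.mor_inv[simplified] Z.mor_inv)
    qed
    let ?b1e = "?ce ?k 0 b1 e"
    \<comment> \<open>The third error that is left after adding \<open>b1\<close>: now a cycle in
      the kernel of \<open>p\<close>.\<close>
    define t' where "t' = s' \<ominus>\<^bsub>?G\<^esub> ?b1e"
    have b1e: "?b1e \<in> carrier ?G" using o b1 ec by (auto intro!: Z.comp_closed)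
    have db1e: "?d ?k ?b1e = ?ce i 0 r e"
      using Z.dif_comp_cycle_right[OF o(1,2,4) e b1] by (simp flip: rb)
    have re: "?ce i 0 r e \<in> Mor Z u v' i" using o rs ec by (auto intro!: Z.comp_closed)
    have t': "t' \<in> cycles (Hom Z u v') ?k"
      using rs b1e o re by (simp add: cycles_def t'_def Z.dif_minus db1e flip: ds)
    have pt: "mor p u v' ?k t' = \<zero>\<^bsub>?YP ?k\<^esub>"
    proof -
      have "mor p u v' ?k ?b1e = \<zero>\<^bsub>?YP ?k\<^esub>"
        using o b1 ec pb1 Y.comp_zero_left[of "ob p u" "ob p v" "ob p v'" "mor p u v 0 e" 0 "i + 1"] P.mor_mor[of u v e 0]
        by (simp add: P.mor_comp[simplified])
      then show ?thesis using rs b1e o ps by (simp add: t'_def P.mor_minus[simplified])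
    qed
    note tc = Z.cycle_closed[OF t']
    \<comment> \<open>The remaining error factors through \<open>e\<close> up to the boundary of
      \<open>h1\<close>. Its factor \<open>?b2\<close> is a cycle, so adding it does not spoil the
      second component.\<close>
    let ?b2 = "?cf t' f"
    define h1 where "h1 = koszul (?C ?s) ?k (Comp Z u u v' ?k 1 t' w')"
    have b2: "?b2 \<in> cycles (Hom Z v v') ?k" using o t' f by (intro Z.comp_cycle) auto
    note b2c = Z.cycle_closed[OF b2]
    have tw: "Comp Z u u v' ?k 1 t' w' \<in> Mor Z u v' ?s" using o tc w' by (auto intro!: Z.comp_closed)
    then have h1: "h1 \<in> Mor Z u v' ?s" using o by (simp add: h1_def Z.mor_inv)
    have pb2: "mor p v v' ?k ?b2 = \<zero>\<^bsub>?YQ ?k\<^esub>"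
      using o tc ec pt Y.comp_zero_left[of "ob p v" "ob p u" "ob p v'" "mor p v u 0 f" 0 "i + 1"] P.mor_mor[of v u f 0]
      by (simp add: P.mor_comp[simplified])
    have ph1: "mor p u v' ?s h1 = \<zero>\<^bsub>?YP ?s\<^esub>"
    proof -
      interpret abelian_group "?YP ?s" using o Y.hom_group by simp
      have "mor p u v' ?s (Comp Z u u v' ?k 1 t' w') = \<zero>\<^bsub>?YP ?s\<^esub>"
        using o tc w' pt Y.comp_zero_left[of "ob p u" "ob p u" "ob p v'" "mor p u u 1 w'" 1 "i + 1"] P.mor_mor[of u u w' 1]
        by (simp add: P.mor_comp[simplified])
      moreover have "mor p u v' ?s h1 = koszul (?YP ?s) ?k
          (mor p u v' ?s (Comp Z u u v' ?k 1 t' w'))"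
        using P.mor_inv[of u v' _ "i + 1 + 1"] tw o by (simp add: h1_def)
      ultimately show ?thesis by (simp only: a_inv_zero if_cancel)
    qed
    have teq: "t' = ?ce ?k 0 ?b2 e \<ominus>\<^bsub>?G\<^esub> ?d ?s h1"
      unfolding h1_def by (rule Z.cycle_precomp[OF o(1,2,4) e f w' t'])
    let ?bb = "b0 \<oplus>\<^bsub>?F ?k\<^esub> b1 \<oplus>\<^bsub>?F ?k\<^esub> ?b2"
      and ?hh = "h0 \<oplus>\<^bsub>?C ?s\<^esub> h1"
    have bb: "?bb \<in> Mor Z v v' ?k" "?hh \<in> Mor Z u v' ?s"
      using b0 b1 b2c h0 h1 o by (simp_all add: Z.mor_add)
    have pbb: "mor p v v' ?k ?bb = \<beta>"
    proof -
      interpret abelian_group "?YQ ?k" using o Y.hom_group by simp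
      show ?thesis using o b0 b1 b2c n by (simp add: P.mor_add[simplified] Z.mor_add pb1 pb2)
    qed
    have phh: "mor p u v' ?s ?hh = k"
    proof -
      interpret abelian_group "?YP ?s" using o Y.hom_group by simp
      have "mor p u v' ?s ?hh = mor p u v' ?s h0 \<oplus>\<^bsub>?YP ?s\<^esub> mor p u v' ?s h1"
        using P.mor_add[of u v' h0 "i + 1 + 1" h1] h0 h1 o by simp
      then show ?thesis unfolding ph1 h0(2) r_zero[OF n(4)] .
    qed
    have db2: "?dv ?k ?b2 = \<zero>\<^bsub>?B\<^esub>" using b2 by (simp add: cycles_def)
    have "?dv ?k ?bb = ?dv ?k b0 \<oplus>\<^bsub>?B\<^esub> r \<oplus>\<^bsub>?B\<^esub> \<zero>\<^bsub>?B\<^esub>"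
      using o b0 b1 b2c by (simp add: Z.dif_add Z.mor_add db2 flip: rb)
    also have "\<dots> = b" unfolding r_def using c m by algebra
    finally have dbb: "?dv ?k ?bb = b" .
    have b2e: "?ce ?k 0 ?b2 e \<in> carrier ?G" using o b2c ec by (auto intro!: Z.comp_closed)
    have dh1: "?d ?s h1 \<in> carrier ?G" using h1 o by (auto intro!: Z.dif_closed)
    have "?d ?s ?hh = ?d ?s h0 \<oplus>\<^bsub>?G\<^esub> ?d ?s h1"
      using Z.dif_add[OF o(1,4) h0(1) h1] by (simp only: add_diff_cancel_right')
    moreover have "?ce ?k 0 ?bb e = ?be \<oplus>\<^bsub>?G\<^esub> ?b1e \<oplus>\<^bsub>?G\<^esub> ?ce ?k 0 ?b2 e"
      using o b0 b1 b2c ec by (simp add: Z.comp_add_left Z.mor_add)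
    ultimately have "(?ce ?k 0 ?bb e \<ominus>\<^bsub>?G\<^esub> ?ea) \<ominus>\<^bsub>?G\<^esub> ?d ?s ?hh =
      ((?be \<oplus>\<^bsub>?G\<^esub> ?b1e \<oplus>\<^bsub>?G\<^esub> ?ce ?k 0 ?b2 e) \<ominus>\<^bsub>?G\<^esub> ?ea) \<ominus>\<^bsub>?G\<^esub>
        (?d ?s h0 \<oplus>\<^bsub>?G\<^esub> ?d ?s h1)" by simp
    also have "\<dots> = ((?be \<ominus>\<^bsub>?G\<^esub> ?ea) \<ominus>\<^bsub>?G\<^esub> ?d ?s h0) \<oplus>\<^bsub>?G\<^esub> ?b1e \<oplus>\<^bsub>?G\<^esub>
        (?ce ?k 0 ?b2 e \<ominus>\<^bsub>?G\<^esub> ?d ?s h1)"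
      using c b1e b2e dh1 by algebra
    also have "\<dots> = ((?be \<ominus>\<^bsub>?G\<^esub> ?ea) \<ominus>\<^bsub>?G\<^esub> ?d ?s h0) \<oplus>\<^bsub>?G\<^esub> ?b1e \<oplus>\<^bsub>?G\<^esub> t'"
      by (simp only: teq[symmetric])
    also have "\<dots> = h" unfolding t'_def s'_def using c b1e m by algebra
    finally have dhh: "(?ce ?k 0 ?bb e \<ominus>\<^bsub>?G\<^esub> ?ea) \<ominus>\<^bsub>?G\<^esub> ?d ?s ?hh = h" .
    define bb where "bb = ?bb"
    define hh where "hh = ?hh"
    show "\<exists>l\<in>Mor (path_cat Z) s t ?k. Dif (Hom (path_cat Z) s t) ?k l = m \<and> mor ?M s t ?k l = n"
      using bb pbb phh dbb dhh st unfolding bb_def[symmetric] hh_def[symmetric]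
      using m s t n D o
      by (intro bexI[of _ "UPair a2 (UPair bb hh)"]) (simp_all add: hpb_map_def)
  qed
qed

text \<open>Objects lift by essential surjectivity. For morphisms, injectivity of \<open>p\<close>
  on homology bounds the first component \<open>a\<close>, and surjectivity one degree higher
  corrects the bounding chain so that a filling of the third component exists.\<close>

lemma hpb_snd_surjective_equivalence:
  assumes p: "p \<in> dg_hom R Z Y" and P: "quasi_equivalence R p"
  shows "surjective_equivalence R (hpb_snd p (dg_id Y))"
proof -
  note [simp] = dg_homD(2,3)[OF p]
  interpret P: quasi_equiv R p using P by unfold_locales
  interpret Z: dg_category R Z using dg_homD(4)[OF p] .
  interpret Y: dg_category R Y using dg_homD(5)[OF p] .
  note i = dg_id_hom[OF dg_homD(5)[OF p]]
  let ?M = "hpb_snd p (dg_id Y)" and ?X = "hpb p (dg_id Y)"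
  have M: "?M \<in> dg_hom R ?X Y" using hpb_snd_dg_hom[OF p i] .
  show ?thesis
  proof (rule surjective_equivalenceI[OF M])
    fix y assume y: "y \<in> Obj Y"
    then obtain u e where "u \<in> Obj Z" "homotopy_invertible Y (ob p u) y e"
      using P.essentially_surj[of y] by auto
    then show "\<exists>x\<in>Obj ?X. ob ?M x = y"
      using y by (intro bexI[of _ "UPair u (UPair y e)"]) (auto simp: hpb_snd_simps)
  next
    fix s t i m n assume st: "s \<in> Obj ?X" "t \<in> Obj ?X"
      and m: "m \<in> Mor ?X s t i" and dm: "Dif (Hom ?X s t) i m = \<zero>\<^bsub>HomGr ?X s t (i - 1)\<^esub>"
      and n: "n \<in> Mor Y (ob ?M s) (ob ?M t) (i + 1)"
      and dn: "Dif (Hom Y (ob ?M s) (ob ?M t)) (i + 1) n = mor ?M s t i m"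
    obtain u v e where s: "s = UPair u (UPair v e)" "u \<in> Obj Z" "v \<in> Obj Y" "homotopy_invertible Y (ob p u) v e"
      using st(1) by (auto elim!: hpb_ObjE)
    obtain u' v' e' where t: "t = UPair u' (UPair v' e')" "u' \<in> Obj Z" "v' \<in> Obj Y" "homotopy_invertible Y (ob p u') v' e'"
      using st(2) by (auto elim!: hpb_ObjE)
    note o = s(2,3) t(2,3) P.ob_closed[simplified, OF s(2)] P.ob_closed[simplified, OF t(2)]
    obtain f w w' where e': "e' \<in> cycles (Hom Y (ob p u') v') 0" and f: "f \<in> cycles (Hom Y v' (ob p u')) 0"
      and w': "w' \<in> Mor Y (ob p u') (ob p u') 1"
        "Comp Y (ob p u') v' (ob p u') 0 0 f e' \<ominus>\<^bsub>HomGr Y (ob p u') (ob p u') 0\<^esub> Ident Y (ob p u') = Dif (Hom Y (ob p u') (ob p u')) 1 w'"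
      and w: "w \<in> Mor Y v' v' 1" "Comp Y v' (ob p u') v' 0 0 e' f \<ominus>\<^bsub>HomGr Y v' v' 0\<^esub> Ident Y v' = Dif (Hom Y v' v') 1 w"
      using Y.homotopy_invertibleE[OF t(4) o(6,4)] by metis
    have e: "e \<in> cycles (Hom Y (ob p u) v) 0" using s(4) by (auto simp: homotopy_invertible_def)
    note ec = Y.cycle_closed[OF e] Y.cycle_closed[OF e'] Y.cycle_closed[OF f]
    have Mst: "ob ?M s = v" "ob ?M t = v'" using st s t by (simp_all add: hpb_snd_simps)
    obtain a b h where m': "m = UPair a (UPair b h)" "a \<in> Mor Z u u' i" "b \<in> Mor Y v v' i" "h \<in> Mor Y (ob p u) v' (i + 1)"
      using m o by (auto simp: s t elim!: triple_sumE)
    have mM: "mor ?M s t i m = b" using st m m' by (simp add: hpb_snd_simps)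
    have n: "n \<in> Mor Y v v' (i + 1)" "Dif (Hom Y v v') (i + 1) n = b" using n dn mM Mst by simp_all
    let ?H = "HomGr Y (ob p u) v' i" and ?G = "HomGr Y (ob p u) v' (i + 1)"
    let ?pu = "ob p u"
      and ?pu' = "ob p u'"
      and ?s = "i + 1 + 1"
      and ?k = "i + 1"
    let ?d = "Dif (Hom Y ?pu v')"
      and ?ec = "Comp Y ?pu ?pu' v' 0"
      and ?ce = "Comp Y ?pu v v'"
      and ?P = "HomGr Y ?pu ?pu'"
    interpret H: abelian_group ?H using o Y.hom_group by simp
    interpret G: abelian_group ?G using o Y.hom_group by simp
    interpret A: abelian_group "HomGr Z u u' i" using o Z.hom_group by simp
    let ?pa = "mor p u u' i a"
    have da: "Dif (Hom Z u u') i a = \<zero>\<^bsub>HomGr Z u u' (i - 1)\<^esub>"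
      "(?ce i 0 b e \<ominus>\<^bsub>?H\<^esub> ?ec i e' ?pa) \<ominus>\<^bsub>?H\<^esub>
        ?d ?k h = \<zero>\<^bsub>?H\<^esub>"
      using dm m' o by (simp_all add: s(1) t(1))
    have ac: "a \<in> cycles (Hom Z u u') i" using da m' by (simp add: cycles_def)
    have pa: "?pa \<in> cycles (Hom Y ?pu ?pu') i" using P.mor_cycle[of u u' a i] ac o by simp
    note pac = Y.cycle_closed[OF pa]
    let ?ne = "?ce ?k 0 n e"
    have ne: "?ne \<in> carrier ?G" using o n ec by (auto intro!: Y.comp_closed)
    have dne: "?d ?k ?ne = ?ce i 0 b e"
      using Y.dif_comp_cycle_right[OF o(5,2,4) e n(1)] n(2) by simp
    have x: "?ce i 0 b e \<in> carrier ?H" "?ec i e' ?pa \<in> carrier ?H"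
      "?d ?k h \<in> carrier ?H"
      using o m' ec pac by (auto intro!: Y.comp_closed Y.dif_closed)
    have dh: "?d ?k h = ?ce i 0 b e \<ominus>\<^bsub>?H\<^esub> ?ec i e' ?pa"
      using da(2) H.minus_zero_iff[of "?ce i 0 b e \<ominus>\<^bsub>?H\<^esub> ?ec i e' ?pa"] x by simp
    \<comment> \<open>Since \<open>m\<close> is a cycle and \<open>d n = b\<close>, the chain
      \<open>n e - h\<close> bounds \<open>e' p(a)\<close>. Cancelling \<open>e'\<close> shows that
      \<open>p(a)\<close> bounds, and then so does \<open>a\<close>.\<close>
    have "?d ?k (?ne \<ominus>\<^bsub>?G\<^esub> h) = ?ce i 0 b e \<ominus>\<^bsub>?H\<^esub>
        (?ce i 0 b e \<ominus>\<^bsub>?H\<^esub> ?ec i e' ?pa)"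
      using ne m' o by (simp add: Y.dif_minus dne dh)
    also have "\<dots> = ?ec i e' ?pa" using x by algebra
    finally have epa: "?ec i e' ?pa = ?d ?k (?ne \<ominus>\<^bsub>?G\<^esub> h)" by simp
    have nh: "?ne \<ominus>\<^bsub>?G\<^esub> h \<in> carrier ?G" using ne m' by simp
    have "Comp Y ?pu v' ?pu' 0 ?k f (?ne \<ominus>\<^bsub>?G\<^esub> h) \<ominus>\<^bsub>?P ?k\<^esub>
        Comp Y ?pu ?pu' ?pu' 1 i w' ?pa \<in> Mor Y ?pu ?pu' ?k"
      using o nh ec w' pac by (auto intro!: Y.comp_closed Y.mor_minus)
    then have "?pa \<in> boundaries (Hom Y ?pu ?pu') i"
      unfolding boundaries_def using Y.comp_postcomp_boundary[OF o(5,6,4) e' f w' pa nh epa] by (metis image_eqI)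
    then have "a \<in> boundaries (Hom Z u u') i" using P.reflects_boundary[of u u' a i] ac o by simp
    then obtain a0 where a0: "a0 \<in> Mor Z u u' ?k" "a = Dif (Hom Z u u') ?k a0" by (auto simp: boundaries_def)
    let ?pax = "mor p u u' ?k a0"
    have pa0: "?pax \<in> Mor Y ?pu ?pu' ?k" using P.mor_mor[of u u' a0 "i + 1"] a0 o by simp
    let ?epax = "?ec ?k e' ?pax"
    have epa0: "?epax \<in> carrier ?G" using o ec pa0 by (auto intro!: Y.comp_closed)
    have depa0: "?d ?k ?epax = ?ec i e' ?pa"
      using Y.dif_comp_cycle_left[OF o(5,6,4) e' pa0] P.mor_dif[of u u' a0 "i + 1" i] a0 o by simp
    \<comment> \<open>The boundary that a third component would need if \<open>a0\<close> were the
      first one. It is a cycle but need not bound.\<close>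
    define c where "c = (?ne \<ominus>\<^bsub>?G\<^esub> ?epax) \<ominus>\<^bsub>?G\<^esub> h"
    have cG: "c \<in> carrier ?G" using ne epa0 m' by (simp add: c_def)
    have "?d ?k c = \<zero>\<^bsub>?H\<^esub>"
      using ne epa0 m' o da(2) by (simp add: c_def Y.dif_minus Y.mor_minus dne depa0)
    then have c: "c \<in> cycles (Hom Y ?pu v') ?k" using cG by (simp add: cycles_def)
    \<comment> \<open>Up to boundaries \<open>c\<close> is \<open>e' z\<close>, and \<open>z\<close>
      is \<open>p(a1)\<close> for a cycle \<open>a1\<close>. Replacing \<open>a0\<close> by
      \<open>a0 + a1\<close> therefore makes the defect bound, with \<open>w1\<close> and
      \<open>w\<close> supplying the third component \<open>?h2\<close>.\<close>
    let ?z = "Comp Y ?pu v' ?pu' 0 ?k f c"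
    have z: "?z \<in> cycles (Hom Y ?pu ?pu') ?k" using o f c by (intro Y.comp_cycle) auto
    note zc = Y.cycle_closed[OF z]
    obtain a1 where a1: "a1 \<in> cycles (Hom Z u u') ?k"
      "homologous (Hom Y ?pu ?pu') ?k ?z (mor p u u' ?k a1)"
      using P.lift_cycle_homologous[of u u' ?z "i + 1"] z o by auto
    then obtain w1 where w1: "w1 \<in> Mor Y ?pu ?pu' ?s"
      "?z \<ominus>\<^bsub>?P ?k\<^esub> mor p u u' ?k a1 = Dif (Hom Y ?pu ?pu') ?s w1"
      by (auto simp: homologous_def)
    note a1c = Z.cycle_closed[OF a1(1)]
    let ?pay = "mor p u u' ?k a1"
    have pa1: "?pay \<in> Mor Y ?pu ?pu' ?k" using P.mor_mor[of u u' a1 "i + 1"] a1c o by simp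
    let ?epay = "?ec ?k e' ?pay" and ?ez = "?ec ?k e' ?z"
      and ?ew1 = "?ec ?s e' w1" and ?wc = "Comp Y ?pu v' v' 1 ?k w c"
    have y: "?epay \<in> carrier ?G" "?ez \<in> carrier ?G" "?ew1 \<in> Mor Y ?pu v' ?s" "?wc \<in> Mor Y ?pu v' ?s"
      using o ec pa1 zc w1 w cG by (auto intro!: Y.comp_closed)
    have dw: "?d ?s ?wc \<in> carrier ?G" using y o by (auto intro!: Y.dif_closed)
    have ceq: "c = ?ez \<ominus>\<^bsub>?G\<^esub> ?d ?s ?wc"
      by (rule Y.cycle_postcomp[OF o(5,6,4) e' f w c])
    have dew1: "?d ?s ?ew1 = ?ez \<ominus>\<^bsub>?G\<^esub> ?epay"
      using Y.dif_comp_cycle_left[OF o(5,6,4) e' w1(1)] Y.comp_minus_right[OF o(5,6,4) ec(2) zc pa1]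
      by (simp only: add_0_left add_diff_cancel_right' dvd_0_right if_True w1(2)[symmetric])
    let ?a2 = "a0 \<oplus>\<^bsub>HomGr Z u u' ?k\<^esub> a1" and ?h2 = "?ew1 \<ominus>\<^bsub>HomGr Y ?pu v' ?s\<^esub> ?wc"
    have a2: "?a2 \<in> Mor Z u u' ?k" using a0 a1c o by (simp add: Z.mor_add)
    have h2: "?h2 \<in> Mor Y ?pu v' ?s" using y o by (simp add: Y.mor_minus)
    have da2: "Dif (Hom Z u u') ?k ?a2 = a"
      using a0 a1(1) a1c o m' by (simp add: Z.dif_add cycles_def)
    have "?d ?s ?h2 = (?ez \<ominus>\<^bsub>?G\<^esub> ?epay) \<ominus>\<^bsub>?G\<^esub> ?d ?s ?wc"
      using Y.dif_minus[OF o(5,4) y(3,4)] dew1 by (simp only: add_diff_cancel_right')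
    moreover have "?ec ?k e' (mor p u u' ?k ?a2) = ?epax \<oplus>\<^bsub>?G\<^esub> ?epay"
      using o a0 a1c pa0 pa1 ec by (simp add: P.mor_add[simplified] Y.comp_add_right)
    ultimately have "(?ne \<ominus>\<^bsub>?G\<^esub> ?ec ?k e' (mor p u u' ?k ?a2)) \<ominus>\<^bsub>?G\<^esub>
        ?d ?s ?h2 =
      (?ne \<ominus>\<^bsub>?G\<^esub> (?epax \<oplus>\<^bsub>?G\<^esub> ?epay)) \<ominus>\<^bsub>?G\<^esub> ((?ez \<ominus>\<^bsub>?G\<^esub> ?epay) \<ominus>\<^bsub>?G\<^esub> ?d ?s ?wc)" by simp
    also have "\<dots> = (?ne \<ominus>\<^bsub>?G\<^esub> ?epax) \<ominus>\<^bsub>?G\<^esub> (?ez \<ominus>\<^bsub>?G\<^esub> ?d ?s ?wc)"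
      using ne epa0 y(1,2) dw by algebra
    also have "\<dots> = (?ne \<ominus>\<^bsub>?G\<^esub> ?epax) \<ominus>\<^bsub>?G\<^esub> c" by (simp only: ceq[symmetric])
    also have "\<dots> = h" unfolding c_def using ne epa0 m'(4) by algebra
    finally have dh2: "(?ne \<ominus>\<^bsub>?G\<^esub> ?ec ?k e' (mor p u u' ?k ?a2)) \<ominus>\<^bsub>?G\<^esub>
        ?d ?s ?h2 = h" .
    define a2 h2 where "a2 = ?a2" and "h2 = ?h2"
    have L: "UPair a2 (UPair n h2) \<in> Mor ?X s t ?k"
      using a2 h2 n o by (simp add: s(1) t(1) a2_def h2_def)
    moreover have "Dif (Hom ?X s t) ?k (UPair a2 (UPair n h2)) = m"
      using da2 dh2 n m' o unfolding a2_def[symmetric] h2_def[symmetric] by (simp add: s(1) t(1))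
    moreover have "mor ?M s t ?k (UPair a2 (UPair n h2)) = n"
      using st L by (simp add: hpb_snd_simps)
    ultimately show "\<exists>l\<in>Mor ?X s t ?k. Dif (Hom ?X s t) ?k l = m \<and> mor ?M s t ?k l = n" by blast
  qed
qed

lemma quasi_equivalence_id:
  assumes "dg_category R A" shows "quasi_equivalence R (dg_id A)"
proof -
  interpret A: dg_category R A by fact
  have "surjective_equivalence R (dg_id A)"
    by (rule surjective_equivalenceI[OF dg_id_hom[OF assms]]) (use A.dif_closed in auto)
  then show ?thesis using surj_equiv.equivalence[of R "dg_id A"] by (simp add: surj_equiv_def)
qed

section \<open>Homotopy classes of dg functors out of a cofibrant dg category\<close>

lemma dg_functorD:
  assumes "dg_functor R F" shows "dg_category R (Dom F)" "dg_category R (Cod F)"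
  using assms by (simp_all only: dg_functor_def)

definition homotopic :: "'r ring \<Rightarrow> ('r, ('r, 'a) univ) dgcat \<Rightarrow> ('r, ('r, 'a) univ) dgcat \<Rightarrow>
    ('r, ('r, 'a) univ) dgfun \<Rightarrow> ('r, ('r, 'a) univ) dgfun \<Rightarrow> bool" where
  "homotopic R B Y f g \<longleftrightarrow> (\<exists>K\<in>dg_hom R B (path_cat Y).
     hpb_fst (dg_id Y) (dg_id Y) \<circ>\<^sub>d K = f \<and> hpb_snd (dg_id Y) (dg_id Y) \<circ>\<^sub>d K = g)"

text \<open>Finite chains take the place of composite homotopies; lifting and invariance then have
  to be checked for single homotopies only.\<close>

abbreviation homotopies :: "'r ring \<Rightarrow> ('r, ('r, 'a) univ) dgcat \<Rightarrow> ('r, ('r, 'a) univ) dgcat \<Rightarrow>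
    ('r, ('r, 'a) univ) dgfun \<Rightarrow> ('r, ('r, 'a) univ) dgfun \<Rightarrow> bool" where
  "homotopies R B Y \<equiv> (homotopic R B Y)\<^sup>*\<^sup>*"

lemma path_cat_proj:
  assumes "dg_category R Y"
  shows "hpb_fst (dg_id Y) (dg_id Y) \<in> dg_hom R (path_cat Y) Y"
    "hpb_snd (dg_id Y) (dg_id Y) \<in> dg_hom R (path_cat Y) Y"
  using hpb_fst_dg_hom hpb_snd_dg_hom dg_id_hom[OF assms] by blast+

lemma homotopic_hom:
  assumes "dg_category R Y" "homotopic R B Y f g"
  shows "f \<in> dg_hom R B Y" "g \<in> dg_hom R B Y"
  using assms path_cat_proj dg_comp_hom unfolding homotopic_def by blast+

lemma homotopies_hom:
  assumes "dg_category R Y" "homotopies R B Y f g" "f \<in> dg_hom R B Y"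
  shows "g \<in> dg_hom R B Y"
  using assms(2,3) homotopic_hom(2)[OF assms(1)] by (induction) auto

lemma homotopic_refl:
  assumes "f \<in> dg_hom R B Y"
  shows "homotopic R B Y f f"
proof -
  note i = dg_id_hom[OF dg_homD(5)[OF assms]] and c = hpb_const_hom[OF dg_id_hom[OF dg_homD(5)[OF assms]]]
  show ?thesis unfolding homotopic_def
  proof (intro bexI[of _ "hpb_const (dg_id Y) \<circ>\<^sub>d f"] conjI)
    show "hpb_fst (dg_id Y) (dg_id Y) \<circ>\<^sub>d (hpb_const (dg_id Y) \<circ>\<^sub>d f) = f"
      using dg_comp_assoc[OF assms c hpb_fst_dg_hom[OF i i]] hpb_const_proj(1)[OF i] dg_comp_id_left[OF assms] by simp
    show "hpb_snd (dg_id Y) (dg_id Y) \<circ>\<^sub>d (hpb_const (dg_id Y) \<circ>\<^sub>d f) = f"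
      using dg_comp_assoc[OF assms c hpb_snd_dg_hom[OF i i]] hpb_const_proj(2)[OF i] dg_comp_id_left[OF assms] by simp
    show "hpb_const (dg_id Y) \<circ>\<^sub>d f \<in> dg_hom R B (path_cat Y)" by (rule dg_comp_hom[OF assms c])
  qed
qed

lemma homotopic_comp:
  assumes "homotopic R B Y f g" and u: "u \<in> dg_hom R Y Z"
  shows "homotopic R B Z (u \<circ>\<^sub>d f) (u \<circ>\<^sub>d g)"
proof -
  obtain K where K: "K \<in> dg_hom R B (path_cat Y)" "hpb_fst (dg_id Y) (dg_id Y) \<circ>\<^sub>d K = f"
    "hpb_snd (dg_id Y) (dg_id Y) \<circ>\<^sub>d K = g" using assms(1) by (auto simp: homotopic_def)
  note i = dg_id_hom[OF dg_homD(4)[OF u]] and j = dg_id_hom[OF dg_homD(5)[OF u]]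
  let ?M = "hpb_map (dg_id Y) (dg_id Y) (dg_id Z) (dg_id Z) u u u"
  have eq: "dg_id Z \<circ>\<^sub>d u = u \<circ>\<^sub>d dg_id Y" using dg_comp_id_left[OF u] dg_comp_id_right[OF u] by simp
  have M: "?M \<in> dg_hom R (path_cat Y) (path_cat Z)" by (rule hpb_map_hom[OF i i j j u u u eq eq])
  note P = hpb_map_proj[OF i i j j u u u eq eq]
  show ?thesis unfolding homotopic_def
  proof (intro bexI[of _ "?M \<circ>\<^sub>d K"] conjI)
    show "hpb_fst (dg_id Z) (dg_id Z) \<circ>\<^sub>d (?M \<circ>\<^sub>d K) = u \<circ>\<^sub>d f"
      using dg_comp_assoc[OF K(1) M hpb_fst_dg_hom[OF j j]] P(1)
        dg_comp_assoc[OF K(1) hpb_fst_dg_hom[OF i i] u] K(2) by simp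
    show "hpb_snd (dg_id Z) (dg_id Z) \<circ>\<^sub>d (?M \<circ>\<^sub>d K) = u \<circ>\<^sub>d g"
      using dg_comp_assoc[OF K(1) M hpb_snd_dg_hom[OF j j]] P(2)
        dg_comp_assoc[OF K(1) hpb_snd_dg_hom[OF i i] u] K(3) by simp
    show "?M \<circ>\<^sub>d K \<in> dg_hom R B (path_cat Z)" by (rule dg_comp_hom[OF K(1) M])
  qed
qed

lemma homotopies_comp:
  assumes "homotopies R B Y f g" and u: "u \<in> dg_hom R Y Z"
  shows "homotopies R B Z (u \<circ>\<^sub>d f) (u \<circ>\<^sub>d g)"
  using assms(1) by induction (auto dest: homotopic_comp[OF _ u])

section \<open>Homotopy classes out of \<open>B\<close> and quasi-equivalences\<close>

locale cofibrant_dg =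
  fixes R :: "'r ring" and B :: "('r, ('r, 'a) univ) dgcat"
  assumes cofibrant: "cofibrant R B"
begin

text \<open>\<open>f\<close>, \<open>g\<close> and the homotopy between their images form a dg
  functor to \<open>hpb p p\<close>. It lifts through the surjective equivalence from the path
  category of \<open>Z\<close>, and the lift is a homotopy with the same ends.\<close>

lemma homotopic_reflect:
  assumes p: "p \<in> dg_hom R Z Y" and P: "surjective_equivalence R p"
    and f: "f \<in> dg_hom R B Z" and g: "g \<in> dg_hom R B Z" and h: "homotopic R B Y (p \<circ>\<^sub>d f) (p \<circ>\<^sub>d g)"
  shows "homotopic R B Z f g"
proof -
  obtain K where K: "K \<in> dg_hom R B (path_cat Y)" "hpb_fst (dg_id Y) (dg_id Y) \<circ>\<^sub>d K = p \<circ>\<^sub>d f"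
    "hpb_snd (dg_id Y) (dg_id Y) \<circ>\<^sub>d K = p \<circ>\<^sub>d g" using h by (auto simp: homotopic_def)
  let ?H = "hpb_pair p p f g K"
  have H: "?H \<in> dg_hom R B (hpb p p)" by (rule hpb_pair_hom[OF p p f g K])
  note HP = hpb_pair_proj[OF p p f g K]
  let ?M = "hpb_map (dg_id Z) (dg_id Z) p p (dg_id Z) (dg_id Z) p"
  note i = dg_id_hom[OF dg_homD(4)[OF p]]
  have M: "?M \<in> dg_hom R (path_cat Z) (hpb p p)" by (rule hpb_map_hom[OF i i p p i i p HOL.refl HOL.refl])
  note MP = hpb_map_proj[OF i i p p i i p HOL.refl HOL.refl]
  obtain L where L: "L \<in> dg_hom R B (path_cat Z)" "?M \<circ>\<^sub>d L = ?H"
    using cofibrant_lift[OF cofibrant path_map_surjective_equivalence[OF p P], of ?H] H dg_homD(2,3)[OF M] by auto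
  have "hpb_fst (dg_id Z) (dg_id Z) \<circ>\<^sub>d L = f"
    using dg_comp_assoc[OF L(1) M hpb_fst_dg_hom[OF p p]] MP(1) HP(1) L(2)
      dg_comp_id_left[OF hpb_fst_dg_hom[OF i i]] by simp
  moreover have "hpb_snd (dg_id Z) (dg_id Z) \<circ>\<^sub>d L = g"
    using dg_comp_assoc[OF L(1) M hpb_snd_dg_hom[OF p p]] MP(2) HP(2) L(2)
      dg_comp_id_left[OF hpb_snd_dg_hom[OF i i]] by simp
  ultimately show ?thesis using L(1) unfolding homotopic_def by blast
qed

text \<open>\<open>f\<close> and the homotopy starting at \<open>p f\<close> form a dg functor to
  \<open>hpb p (dg_id Y)\<close>. Its lift to the path category of \<open>Z\<close> is a homotopy
  that starts at \<open>f\<close>; the other end is the required \<open>f'\<close>.\<close>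

lemma homotopy_lifting:
  assumes p: "p \<in> dg_hom R Z Y" and P: "fibration R p"
    and f: "f \<in> dg_hom R B Z" and h: "homotopic R B Y (p \<circ>\<^sub>d f) g"
  shows "\<exists>f'\<in>dg_hom R B Z. p \<circ>\<^sub>d f' = g"
proof -
  note i = dg_id_hom[OF dg_homD(4)[OF p]] and j = dg_id_hom[OF dg_homD(5)[OF p]]
  have g: "g \<in> dg_hom R B Y" using homotopic_hom[OF dg_homD(5)[OF p] h] by simp
  obtain K where K: "K \<in> dg_hom R B (path_cat Y)" "hpb_fst (dg_id Y) (dg_id Y) \<circ>\<^sub>d K = p \<circ>\<^sub>d f"
    "hpb_snd (dg_id Y) (dg_id Y) \<circ>\<^sub>d K = dg_id Y \<circ>\<^sub>d g"
    using h dg_comp_id_left[OF g] by (auto simp: homotopic_def)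
  let ?H = "hpb_pair p (dg_id Y) f g K"
  have H: "?H \<in> dg_hom R B (hpb p (dg_id Y))" by (rule hpb_pair_hom[OF p j f g K])
  note HP = hpb_pair_proj[OF p j f g K]
  let ?M = "hpb_map (dg_id Z) (dg_id Z) p (dg_id Y) (dg_id Z) p p"
  have eq: "dg_id Y \<circ>\<^sub>d p = p \<circ>\<^sub>d dg_id Z" using dg_comp_id_left[OF p] dg_comp_id_right[OF p] by simp
  have M: "?M \<in> dg_hom R (path_cat Z) (hpb p (dg_id Y))" by (rule hpb_map_hom[OF i i p j i p p HOL.refl eq])
  note MP = hpb_map_proj[OF i i p j i p p HOL.refl eq]
  obtain L where L: "L \<in> dg_hom R B (path_cat Z)" "?M \<circ>\<^sub>d L = ?H"
    using cofibrant_lift[OF cofibrant path_fibration_surjective_equivalence[OF p P], of ?H] H dg_homD(2,3)[OF M] by auto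
  have s: "hpb_snd (dg_id Z) (dg_id Z) \<circ>\<^sub>d L \<in> dg_hom R B Z" by (rule dg_comp_hom[OF L(1) hpb_snd_dg_hom[OF i i]])
  have "p \<circ>\<^sub>d (hpb_snd (dg_id Z) (dg_id Z) \<circ>\<^sub>d L) = g"
    using dg_comp_assoc[OF L(1) M hpb_snd_dg_hom[OF p j]] MP(2) HP(2) L(2)
      dg_comp_assoc[OF L(1) hpb_snd_dg_hom[OF i i] p] by simp
  then show ?thesis using s by blast
qed

lemma homotopies_lifting:
  assumes p: "p \<in> dg_hom R Z Y" and P: "fibration R p"
    and f: "f \<in> dg_hom R B Z" and h: "homotopies R B Y (p \<circ>\<^sub>d f) g"
  shows "\<exists>f'\<in>dg_hom R B Z. p \<circ>\<^sub>d f' = g"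
  using h by induction (use f homotopy_lifting[OF p P] in blast)+

text \<open>\<open>K\<close> and the constant homotopy at \<open>g\<close> both end at
  \<open>g\<close>, and the projection of the path category to its end is a surjective equivalence.
  Hence the two are homotopic as dg functors to the path category, and their starting points are
  \<open>g\<close> and \<open>f\<close>, in the required order.\<close>

lemma homotopic_sym:
  assumes Y: "dg_category R Y" and h: "homotopic R B Y f g"
  shows "homotopic R B Y g f"
proof -
  note i = dg_id_hom[OF Y]
  obtain K where K: "K \<in> dg_hom R B (path_cat Y)" "hpb_fst (dg_id Y) (dg_id Y) \<circ>\<^sub>d K = f"
    "hpb_snd (dg_id Y) (dg_id Y) \<circ>\<^sub>d K = g" using h by (auto simp: homotopic_def)
  note g = homotopic_hom(2)[OF Y h]
  let ?c = "hpb_const (dg_id Y) \<circ>\<^sub>d g"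
  have c: "?c \<in> dg_hom R B (path_cat Y)" by (rule dg_comp_hom[OF g hpb_const_hom[OF i]])
  have cp: "hpb_fst (dg_id Y) (dg_id Y) \<circ>\<^sub>d ?c = g" "hpb_snd (dg_id Y) (dg_id Y) \<circ>\<^sub>d ?c = g"
    using dg_comp_assoc[OF g hpb_const_hom[OF i] path_cat_proj(1)[OF Y]]
      dg_comp_assoc[OF g hpb_const_hom[OF i] path_cat_proj(2)[OF Y]]
      hpb_const_proj[OF i] dg_comp_id_left[OF g] by simp_all
  have "homotopic R B (path_cat Y) ?c K"
    by (rule homotopic_reflect[OF path_cat_proj(2)[OF Y]
        hpb_snd_surjective_equivalence[OF i quasi_equivalence_id[OF Y]] c K(1)])
      (simp add: cp K homotopic_refl[OF g])
  from homotopic_comp[OF this path_cat_proj(1)[OF Y]] show ?thesis by (simp add: cp K)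
qed

lemma homotopies_sym:
  assumes Y: "dg_category R Y" and h: "homotopies R B Y f g"
  shows "homotopies R B Y g f"
  using h by induction (auto intro: converse_rtranclp_into_rtranclp homotopic_sym[OF Y])

text \<open>The intermediate dg functors of the chain are lifted one after the other by cofibrancy
  of \<open>B\<close>, and each link is reflected separately.\<close>

lemma homotopies_reflect:
  assumes p: "p \<in> dg_hom R Z Y" and P: "surjective_equivalence R p"
    and f: "f \<in> dg_hom R B Z" and h: "homotopies R B Y (p \<circ>\<^sub>d f) k"
    and g: "g \<in> dg_hom R B Z" "p \<circ>\<^sub>d g = k"
  shows "homotopies R B Z f g"
  using h g
proof (induction arbitrary: g)
  case base
  then have "homotopic R B Y (p \<circ>\<^sub>d f) (p \<circ>\<^sub>d g)" using homotopic_refl[OF dg_comp_hom[OF f p]] by simp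
  then show ?case using homotopic_reflect[OF p P f] base by blast
next
  case (step k' k)
  have "k' \<in> dg_hom R B Y" using homotopic_hom[OF dg_homD(5)[OF p] step.hyps(2)] by simp
  then obtain g' where g': "g' \<in> dg_hom R B Z" "p \<circ>\<^sub>d g' = k'"
    using cofibrant_lift[OF cofibrant P, of k'] dg_homD(2,3)[OF p] by auto
  then have "homotopies R B Z f g'" using step.IH by blast
  moreover have "homotopic R B Z g' g" using homotopic_reflect[OF p P g'(1)] step g' by simp
  ultimately show ?case by simp
qed

text \<open>A lift of \<open>g\<close> along the surjective equivalence \<open>hpb_snd\<close>
  consists of some \<open>f\<close> together with a homotopy from \<open>p f\<close> to
  \<open>g\<close>.\<close>

lemma quasi_equivalence_surj:
  assumes p: "p \<in> dg_hom R Z Y" and P: "quasi_equivalence R p" and g: "g \<in> dg_hom R B Y"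
  shows "\<exists>f\<in>dg_hom R B Z. homotopies R B Y (p \<circ>\<^sub>d f) g"
proof -
  note i = dg_id_hom[OF dg_homD(5)[OF p]]
  obtain L where L: "L \<in> dg_hom R B (hpb p (dg_id Y))" "hpb_snd p (dg_id Y) \<circ>\<^sub>d L = g"
    using cofibrant_lift[OF cofibrant hpb_snd_surjective_equivalence[OF p P], of g] g
      dg_homD(2,3)[OF hpb_snd_dg_hom[OF p i]] by auto
  let ?M = "hpb_map p (dg_id Y) (dg_id Y) (dg_id Y) p (dg_id Y) (dg_id Y)"
  have M: "?M \<in> dg_hom R (hpb p (dg_id Y)) (path_cat Y)" by (rule hpb_map_hom[OF p i i i p i i HOL.refl HOL.refl])
  note MP = hpb_map_proj[OF p i i i p i i HOL.refl HOL.refl]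
  let ?f = "hpb_fst p (dg_id Y) \<circ>\<^sub>d L"
  have f: "?f \<in> dg_hom R B Z" by (rule dg_comp_hom[OF L(1) hpb_fst_dg_hom[OF p i]])
  have KL: "?M \<circ>\<^sub>d L \<in> dg_hom R B (path_cat Y)" by (rule dg_comp_hom[OF L(1) M])
  have "hpb_fst (dg_id Y) (dg_id Y) \<circ>\<^sub>d (?M \<circ>\<^sub>d L) = p \<circ>\<^sub>d ?f"
    using dg_comp_assoc[OF L(1) M hpb_fst_dg_hom[OF i i]] MP(1)
      dg_comp_assoc[OF L(1) hpb_fst_dg_hom[OF p i] p] by simp
  moreover have "hpb_snd (dg_id Y) (dg_id Y) \<circ>\<^sub>d (?M \<circ>\<^sub>d L) = g"
    using dg_comp_assoc[OF L(1) M hpb_snd_dg_hom[OF i i]] MP(2) L(2)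
      dg_comp_id_left[OF hpb_snd_dg_hom[OF p i]] by simp
  ultimately have "homotopic R B Y (p \<circ>\<^sub>d ?f) g" using KL unfolding homotopic_def by blast
  then show ?thesis using f by blast
qed

text \<open>\<open>p\<close> factors as \<open>hpb_const p\<close> followed by a surjective
  equivalence, which reflects chains of homotopies; the first projection then undoes
  \<open>hpb_const p\<close>.\<close>

lemma quasi_equivalence_inj:
  assumes p: "p \<in> dg_hom R Z Y" and P: "quasi_equivalence R p"
    and f: "f \<in> dg_hom R B Z" and g: "g \<in> dg_hom R B Z" and h: "homotopies R B Y (p \<circ>\<^sub>d f) (p \<circ>\<^sub>d g)"
  shows "homotopies R B Z f g"
proof -
  note i = dg_id_hom[OF dg_homD(5)[OF p]]
  note c = hpb_const_hom[OF p] and cp = hpb_const_proj[OF p]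
  have s: "hpb_snd p (dg_id Y) \<circ>\<^sub>d (hpb_const p \<circ>\<^sub>d k) = p \<circ>\<^sub>d k"
    "hpb_fst p (dg_id Y) \<circ>\<^sub>d (hpb_const p \<circ>\<^sub>d k) = k" if "k \<in> dg_hom R B Z" for k
    using dg_comp_assoc[OF that c hpb_snd_dg_hom[OF p i]] dg_comp_assoc[OF that c hpb_fst_dg_hom[OF p i]]
      cp dg_comp_id_left[OF that] by simp_all
  have "homotopies R B (hpb p (dg_id Y)) (hpb_const p \<circ>\<^sub>d f) (hpb_const p \<circ>\<^sub>d g)"
    by (rule homotopies_reflect[OF hpb_snd_dg_hom[OF p i] hpb_snd_surjective_equivalence[OF p P]
        dg_comp_hom[OF f c] _ dg_comp_hom[OF g c] HOL.refl]) (simp add: s f g h)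
  from homotopies_comp[OF this hpb_fst_dg_hom[OF p i]] show ?thesis by (simp add: s f g)
qed

text \<open>The action of a zigzag on homotopy classes of dg functors out of \<open>B\<close>.\<close>

primrec zigzag_rel :: "('r, ('r, 'a) univ) zstep list \<Rightarrow> ('r, ('r, 'a) univ) dgfun \<Rightarrow>
    ('r, ('r, 'a) univ) dgfun \<Rightarrow> bool" where
  "zigzag_rel [] f g \<longleftrightarrow> homotopies R B (Cod f) f g"
| "zigzag_rel (st # s) f g \<longleftrightarrow> (case st of
     Fwd p F q \<Rightarrow> zigzag_rel s (F \<circ>\<^sub>d f) g
   | Bwd q W p \<Rightarrow> \<exists>f'\<in>dg_hom R B (Dom q). homotopies R B (Dom p) (W \<circ>\<^sub>d f') f \<and> zigzag_rel s f' g)"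

section \<open>Invariance of the action of zigzags under the congruence\<close>

lemma over_homD:
  assumes "F \<in> over_hom R X p q"
  shows "F \<in> dg_hom R (Dom p) (Dom q)" "dg_functor R p" "Cod p = X" "dg_functor R q" "Cod q = X"
    "dg_category R (Dom p)" "dg_category R (Dom q)"
  using assms dg_functorD by (auto simp: over_hom_def)

lemma zigzag_append: "zigzag R X p s q \<Longrightarrow> zigzag R X q t r \<Longrightarrow> zigzag R X p (s @ t) r"
  by (induction rule: zigzag.induct) (auto intro: zigzag.intros)

lemma zigzag_rel_left:
  assumes "zigzag R X p s q" "f \<in> dg_hom R B (Dom p)" "homotopies R B (Dom p) f f'" "zigzag_rel s f g"
  shows "zigzag_rel s f' g"
  using assms
proof (induction arbitrary: f f' rule: zigzag.induct)
  case (zz_nil p)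
  have D: "dg_category R (Dom p)" using dg_homD(5)[OF zz_nil.prems(1)] .
  have f': "f' \<in> dg_hom R B (Dom p)" using homotopies_hom[OF D zz_nil.prems(2,1)] .
  have "homotopies R B (Dom p) f g" using zz_nil.prems(3) dg_homD(3)[OF zz_nil.prems(1)] by simp
  with homotopies_sym[OF D zz_nil.prems(2)] have "homotopies R B (Dom p) f' g" by (rule rtranclp_trans)
  then show ?case by (simp add: dg_homD(3)[OF f'])
next
  case (zz_fwd F p q s r)
  note F = over_homD[OF zz_fwd.hyps(1)]
  show ?case
    using zz_fwd.IH[OF dg_comp_hom[OF zz_fwd.prems(1) F(1)] homotopies_comp[OF zz_fwd.prems(2) F(1)]]
      zz_fwd.prems(3) by simp
next
  case (zz_bwd W q p s r)
  then obtain f0 where f0: "f0 \<in> dg_hom R B (Dom q)" "homotopies R B (Dom p) (W \<circ>\<^sub>d f0) f" "zigzag_rel s f0 g"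
    by auto
  with rtranclp_trans[OF f0(2) zz_bwd.prems(2)] show ?case by auto
qed

lemma zigzag_rel_append:
  assumes "zigzag R X p s q" "zigzag R X q t r" "f \<in> dg_hom R B (Dom p)"
  shows "zigzag_rel (s @ t) f h \<longleftrightarrow> (\<exists>g\<in>dg_hom R B (Dom q). zigzag_rel s f g \<and> zigzag_rel t g h)"
  using assms
proof (induction arbitrary: f rule: zigzag.induct)
  case (zz_nil p)
  have D: "dg_category R (Dom p)" using dg_functorD(1)[OF zz_nil.hyps(1)] .
  note f = zz_nil.prems(2)
  have c: "Cod f = Dom p" using dg_homD(3)[OF f] .
  show ?case
  proof
    assume "zigzag_rel ([] @ t) f h"
    then show "\<exists>g\<in>dg_hom R B (Dom p). zigzag_rel [] f g \<and> zigzag_rel t g h" using f by (auto simp: c)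
  next
    assume "\<exists>g\<in>dg_hom R B (Dom p). zigzag_rel [] f g \<and> zigzag_rel t g h"
    then obtain g where g: "g \<in> dg_hom R B (Dom p)" "homotopies R B (Dom p) f g" "zigzag_rel t g h" by (auto simp: c)
    show "zigzag_rel ([] @ t) f h"
      using zigzag_rel_left[OF zz_nil.prems(1) g(1) homotopies_sym[OF D g(2)] g(3)] by simp
  qed
next
  case (zz_fwd F p q s r)
  note F = over_homD[OF zz_fwd.hyps(1)]
  show ?case using zz_fwd.IH[OF zz_fwd.prems(1) dg_comp_hom[OF zz_fwd.prems(2) F(1)]] by simp
next
  case (zz_bwd W q p s r)
  then show ?case by auto
qed

text \<open>A class in the homotopy category is a set of lists of steps; this recovers that they are
  zigzags with the right ends.\<close>

lemma zz_equiv_zigzag: "zz_equiv R X p q s t \<Longrightarrow> zigzag R X p s q \<and> zigzag R X p t q"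
proof (induction rule: zz_equiv.induct)
  case (ident p)
  then have "dg_id (Dom p) \<in> over_hom R X p p"
    using dg_id_hom[of R "Dom p"] dg_comp_id_right[of p R "Dom p" X]
    by (auto simp: over_hom_def dg_hom_def dest: dg_functorD)
  then show ?case using ident by (auto intro: zigzag.intros)
next
  case (comp F p q G r)
  note F = over_homD[OF comp.hyps(1)] and G = over_homD[OF comp.hyps(2)]
  have "r \<circ>\<^sub>d (G \<circ>\<^sub>d F) = p"
    using comp dg_comp_assoc[OF F(1) G(1), of r X] G by (auto simp: over_hom_def dg_hom_def)
  then have "G \<circ>\<^sub>d F \<in> over_hom R X p r"
    using F G dg_comp_hom[OF F(1) G(1)] by (auto simp: over_hom_def)
  then show ?case using comp G by (auto intro: zigzag.intros)
next
  case (inv_right W p q)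
  then show ?case using over_homD[OF inv_right(1)] by (auto intro: zigzag.intros)
next
  case (inv_left W p q)
  then show ?case using over_homD[OF inv_left(1)] by (auto intro: zigzag.intros)
qed (auto intro: zigzag_append)

text \<open>The essential relations are those that invert a weak equivalence:
  \<open>inv_right\<close> is injectivity of \<open>W\<close> on homotopy classes,
  \<open>inv_left\<close> uses its surjectivity.\<close>

lemma zz_equiv_rel:
  assumes "zz_equiv R X p q s t" "f \<in> dg_hom R B (Dom p)" "g \<in> dg_hom R B (Dom q)"
  shows "zigzag_rel s f g \<longleftrightarrow> zigzag_rel t f g"
  using assms
proof (induction arbitrary: f g rule: zz_equiv.induct)
  case (append p q s s' r t t')
  note z = zz_equiv_zigzag[OF append.hyps(1)] zz_equiv_zigzag[OF append.hyps(2)]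
  show ?case
    using zigzag_rel_append[of X p s q t r f g] zigzag_rel_append[of X p s' q t' r f g] z append by auto
next
  case (ident p)
  then show ?case using dg_comp_id_left[OF ident.prems(1)] dg_homD(3)[OF ident.prems(1)] by simp
next
  case (comp F p q G r)
  note F = over_homD[OF comp.hyps(1)] and G = over_homD[OF comp.hyps(2)]
  show ?case using dg_comp_assoc[OF comp.prems(1) F(1) G(1)] by simp
next
  case (inv_right W p q)
  note W = over_homD[OF inv_right.hyps(1)]
  have c: "Cod k = Dom p" if "k \<in> dg_hom R B (Dom p)" for k using that dg_homD(3) by blast
  note f = inv_right.prems(1)
  show ?case
  proof
    assume "zigzag_rel [Fwd p W q, Bwd p W q] f g"
    then obtain f' where f': "f' \<in> dg_hom R B (Dom p)" "homotopies R B (Dom q) (W \<circ>\<^sub>d f') (W \<circ>\<^sub>d f)"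
      "homotopies R B (Dom p) f' g" by (auto simp: c)
    from quasi_equivalence_inj[OF W(1) inv_right.hyps(2) f'(1) f f'(2)]
    have "homotopies R B (Dom p) f f'" by (rule homotopies_sym[OF W(6)])
    from rtranclp_trans[OF this f'(3)] show "zigzag_rel [] f g" by (simp add: c[OF f])
  next
    assume "zigzag_rel [] f g"
    then show "zigzag_rel [Fwd p W q, Bwd p W q] f g" using f by (auto simp: c)
  qed
next
  case (inv_left W p q)
  note W = over_homD[OF inv_left.hyps(1)]
  note f = inv_left.prems(1)
  have c: "Cod (W \<circ>\<^sub>d k) = Dom q" for k using dg_homD(3)[OF W(1)] by simp
  have d: "Cod f = Dom q" using dg_homD(3)[OF f] .
  show ?case
  proof
    assume "zigzag_rel [Bwd p W q, Fwd p W q] f g"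
    then obtain f' where f': "homotopies R B (Dom q) (W \<circ>\<^sub>d f') f" "homotopies R B (Dom q) (W \<circ>\<^sub>d f') g"
      using dg_homD(3)[OF W(1)] by auto
    from rtranclp_trans[OF homotopies_sym[OF W(7) f'(1)] f'(2)] show "zigzag_rel [] f g" by (simp add: d)
  next
    assume "zigzag_rel [] f g"
    then have fg: "homotopies R B (Dom q) f g" by (simp add: d)
    obtain f' where f': "f' \<in> dg_hom R B (Dom p)" "homotopies R B (Dom q) (W \<circ>\<^sub>d f') f"
      using quasi_equivalence_surj[OF W(1) inv_left.hyps(2) f] by blast
    from f' rtranclp_trans[OF f'(2) fg] show "zigzag_rel [Bwd p W q, Fwd p W q] f g"
      using dg_homD(3)[OF W(1)] by auto
  qed
qed auto

text \<open>Both sides act on the identity of \<open>B\<close>. The left-hand side sends it to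
  \<open>F\<close>; the right-hand side passes through some \<open>f\<close> into the domain of
  \<open>r\<close> before \<open>I\<close> is applied.\<close>

lemma ho_factorization:
  assumes B: "Dom p = B" and F: "F \<in> over_hom R X p q" and h: "h \<in> ho_hom R X p r"
    and eq: "ho_of R X p q F = ho_comp R X p q (ho_of R X r q I) h"
  shows "\<exists>f\<in>dg_hom R B (Dom r). I \<in> over_hom R X r q \<and> homotopies R B (Dom q) (I \<circ>\<^sub>d f) F"
proof -
  note FD = over_homD[OF F]
  have zF: "zigzag R X p [Fwd p F q] q" using F FD by (auto intro: zigzag.intros)
  then have "[Fwd p F q] \<in> ho_of R X p q F" by (simp add: ho_of_def ho_class_def zz_equiv.refl)
  then obtain s t where s: "s \<in> h" and t: "t \<in> ho_of R X r q I" and st: "zz_equiv R X p q (s @ t) [Fwd p F q]"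
    unfolding eq by (auto simp: ho_comp_def ho_class_def)
  have "zz_equiv R X r q [Fwd r I q] t" using t by (simp add: ho_of_def ho_class_def)
  note t = this zz_equiv_zigzag[OF this]
  have zs: "zigzag R X p s r" using s h by (auto simp: ho_hom_def ho_class_def dest: zz_equiv_zigzag)
  \<comment> \<open>The class of \<open>I\<close> is inhabited by \<open>t\<close>, and
    \<open>t\<close> is congruent to the one-step list of \<open>I\<close>. That list is hence a
    zigzag, which says that \<open>I\<close> is a dg functor over \<open>X\<close>.\<close>
  have I: "I \<in> over_hom R X r q"
    using t(2) by (auto elim: zigzag.cases)
  have Fh: "F \<in> dg_hom R B (Dom q)" using FD B by simp
  have i: "dg_id B \<in> dg_hom R B (Dom p)" using B FD dg_id_hom by simp
  have "zigzag_rel [Fwd p F q] (dg_id B) F"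
    using Fh dg_comp_id_right[OF Fh] by simp
  then have "zigzag_rel (s @ t) (dg_id B) F" using zz_equiv_rel[OF st i Fh] by simp
  then obtain f where f: "f \<in> dg_hom R B (Dom r)" "zigzag_rel t f F"
    using zigzag_rel_append[OF zs _ i] t by blast
  then have "zigzag_rel [Fwd r I q] f F" using zz_equiv_rel[OF t(1) f(1) Fh] by simp
  then show ?thesis using f I dg_homD(3)[OF over_homD(1)[OF I]] by auto
qed

end

section \<open>Cell attachments and big Postnikov sections\<close>

lemma scalar_module_simps [simp]:
  "a \<in> carrier (scalar_module R) \<longleftrightarrow> (\<exists>r\<in>carrier R. a = Scal r)" "\<zero>\<^bsub>scalar_module R\<^esub> = Scal \<zero>\<^bsub>R\<^esub>"
  "a \<oplus>\<^bsub>scalar_module R\<^esub> b = Scal (unscal a \<oplus>\<^bsub>R\<^esub> unscal b)"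
  "r \<odot>\<^bsub>scalar_module R\<^esub> a = Scal (r \<otimes>\<^bsub>R\<^esub> unscal a)"
  by (auto simp: scalar_module_def)

text \<open>Where a morphism module is \<open>R\<close> rather than zero: degree 0 for
  endomorphisms, the degrees satisfying \<open>K\<close> for the arrow from \<open>a\<close> to
  \<open>b\<close>.\<close>

definition scalar_degree :: "('r, 'a) univ \<Rightarrow> ('r, 'a) univ \<Rightarrow> (int \<Rightarrow> bool) \<Rightarrow>
    ('r, 'a) univ \<Rightarrow> ('r, 'a) univ \<Rightarrow> int \<Rightarrow> bool" where
  "scalar_degree a b K x y i \<longleftrightarrow> (x = y \<and> i = 0) \<or> (x \<noteq> y \<and> x = a \<and> y = b \<and> K i)"

lemma arrow_HomGr:
  assumes "\<And>i. Gr K i = (if P i then scalar_module R else zero_module (scalar_module R))"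
  shows "HomGr (arrow_dgcat R a b K) x y i =
    (if scalar_degree a b P x y i then scalar_module R else zero_module (scalar_module R))"
  by (auto simp: arrow_dgcat_def sphere_complex_def zero_complex_def scalar_degree_def assms)

lemma C_cat_simps [simp]:
  "Obj (C_cat R m) = {Num 1, Num 2}" "Ident (C_cat R m) x = Scal \<one>\<^bsub>R\<^esub>"
  "HomGr (C_cat R m) x y i = (if scalar_degree (Num 1) (Num 2) (\<lambda>i. i = m) x y i then scalar_module R
     else zero_module (scalar_module R))"
  "Comp (C_cat R m) x y z i j g f = Scal (unscal g \<otimes>\<^bsub>R\<^esub> unscal f)"
  "Dif (Hom (C_cat R m) x y) i a = Scal \<zero>\<^bsub>R\<^esub>"
  unfolding C_cat_def
  by (simp_all add: arrow_HomGr[of _ "\<lambda>i. i = m"] sphere_complex_def)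
    (simp_all add: arrow_dgcat_def sphere_complex_def zero_complex_def)

lemma D_cat_simps [simp]:
  "Obj (D_cat R k) = {Num 3, Num 4}" "Ident (D_cat R k) x = Scal \<one>\<^bsub>R\<^esub>"
  "HomGr (D_cat R k) x y i = (if scalar_degree (Num 3) (Num 4) (\<lambda>i. i = k \<or> i = k - 1) x y i then scalar_module R
     else zero_module (scalar_module R))"
  "Comp (D_cat R k) x y z i j g f = Scal (unscal g \<otimes>\<^bsub>R\<^esub> unscal f)"
  "Dif (Hom (D_cat R k) x y) i a = (if x = Num 3 \<and> y = Num 4 \<and> i = k then a else Scal \<zero>\<^bsub>R\<^esub>)"
  unfolding D_cat_def
  by (simp_all add: arrow_HomGr[of _ "\<lambda>i. i = k \<or> i = k - 1"] disk_complex_def)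
    (simp_all add: arrow_dgcat_def sphere_complex_def zero_complex_def disk_complex_def)

lemma C_cat_mor:
  assumes "cring R"
  shows "a \<in> Mor (C_cat R m) x y i \<longleftrightarrow> (\<exists>r\<in>carrier R. a = Scal r \<and>
    (r = \<zero>\<^bsub>R\<^esub> \<or> scalar_degree (Num 1) (Num 2) (\<lambda>i. i = m) x y i))"
proof -
  interpret cring R by fact
  show ?thesis by (auto simp del: C_cat_simps(4,5))
qed

lemma D_cat_mor:
  assumes "cring R"
  shows "a \<in> Mor (D_cat R k) x y i \<longleftrightarrow> (\<exists>r\<in>carrier R. a = Scal r \<and>
    (r = \<zero>\<^bsub>R\<^esub> \<or> scalar_degree (Num 3) (Num 4) (\<lambda>i. i = k \<or> i = k - 1) x y i))"
proof -
  interpret cring R by fact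
  show ?thesis by (auto simp del: D_cat_simps(4,5))
qed

text \<open>The two assumptions are available as soon as there is a cell, because the inclusions
  into the coproducts of an attachment are dg functors.\<close>

lemma S_fun_hom:
  assumes C: "dg_category R (C_cat R m :: ('r, ('r, 'a) univ) dgcat)"
    and D: "dg_category R (D_cat R (m + 1) :: ('r, ('r, 'a) univ) dgcat)"
  shows "(S_fun R m :: ('r, ('r, 'a) univ) dgfun) \<in> dg_hom R (C_cat R m) (D_cat R (m + 1))" (is "?S \<in> _")
proof -
  interpret C: dg_category R "C_cat R m :: ('r, ('r, 'a) univ) dgcat" by fact
  interpret R: cring R using C.cring .
  show ?thesis unfolding S_fun_def
    by (rule mk_dgfun_dg_hom[OF C D])
      (auto simp: linear_map_def C_cat_mor[OF C.cring] scalar_degree_def)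
qed

context
  fixes R :: "'r ring" and m :: int and Y :: "('r, ('r, 'a) univ) dgcat"
  assumes D: "dg_category R (D_cat R (m + 1) :: ('r, ('r, 'a) univ) dgcat)" and Y: "dg_category R Y"
begin

interpretation D: dg_category R "D_cat R (m + 1) :: ('r, ('r, 'a) univ) dgcat" by (rule D)
interpretation Y: dg_category R Y by (rule Y)
interpretation R: cring R by (rule D.cring)

text \<open>\<open>D(m + 1)\<close> is free on one chain of degree \<open>m + 1\<close> between two
  objects, so \<open>c\<close> can be prescribed arbitrarily.\<close>

lemma D_cat_functor:
  assumes x: "x \<in> Obj Y" "y \<in> Obj Y" and c: "c \<in> Mor Y x y (m + 1)"
  shows "\<exists>H\<in>dg_hom R (D_cat R (m + 1)) Y. ob H (Num 3) = x \<and> ob H (Num 4) = y \<and>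
    mor H (Num 3) (Num 4) (m + 1) (Scal \<one>\<^bsub>R\<^esub>) = c"
proof -
  define ob0 where "ob0 z = (if z = Num 3 then x else y)" for z :: "('r, 'a) univ"
  \<comment> \<open>The images of the units of \<open>R\<close>: identities, \<open>c\<close>, and
    in degree \<open>m\<close> its boundary; zero wherever the source has no morphisms.\<close>
  define gen where "gen u v i = (if u = v then (if i = 0 then Ident Y (ob0 u) else \<zero>\<^bsub>HomGr Y (ob0 u) (ob0 v) i\<^esub>)
    else if u = Num 3 \<and> v = Num 4 \<and> i = m + 1 then c
    else if u = Num 3 \<and> v = Num 4 \<and> i = m then Dif (Hom Y x y) (m + 1) c
    else \<zero>\<^bsub>HomGr Y (ob0 u) (ob0 v) i\<^esub>)" for u v :: "('r, 'a) univ" and i :: int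
  have ob0: "ob0 u \<in> Obj Y" for u using x by (simp add: ob0_def)
  have gen: "gen u v i \<in> Mor Y (ob0 u) (ob0 v) i" for u v i
  proof -
    have "Dif (Hom Y x y) (m + 1) c \<in> Mor Y x y m" using x c by (intro Y.dif_closed) auto
    then show ?thesis using x c by (simp add: gen_def Y.mor_zero Y.ident_closed ob0_def)
  qed
  let ?G = "\<lambda>u v. HomGr Y (ob0 u) (ob0 v)"
  let ?D = "D_cat R (m + 1) :: ('r, ('r, 'a) univ) dgcat"
  let ?H = "mk_dgfun ?D Y ob0 (\<lambda>u v i a. unscal a \<odot>\<^bsub>?G u v i\<^esub> gen u v i)"
  have "?H \<in> dg_hom R ?D Y"
  proof (rule mk_dgfun_dg_hom[OF D Y])
    fix u v :: "('r, 'a) univ" and i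
    interpret M: Module.module R "?G u v i" using ob0 Y.hom_module by blast
    interpret M': Module.module R "?G u v (i - 1)" using ob0 Y.hom_module by blast
    show "linear_map R (HomGr ?D u v i) (?G u v i)
      (\<lambda>a. unscal a \<odot>\<^bsub>?G u v i\<^esub> gen u v i)"
    proof (rule linear_mapI)
      fix a b assume ab: "a \<in> Mor ?D u v i" "b \<in> Mor ?D u v i"
      then obtain r s where "r \<in> carrier R" "s \<in> carrier R" "a = Scal r" "b = Scal s"
        by (auto simp: D_cat_mor[OF D.cring] simp del: D_cat_simps)
      then show "unscal (a \<oplus>\<^bsub>HomGr ?D u v i\<^esub> b) \<odot>\<^bsub>?G u v i\<^esub> gen u v i =
        unscal a \<odot>\<^bsub>?G u v i\<^esub> gen u v i \<oplus>\<^bsub>?G u v i\<^esub>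
        unscal b \<odot>\<^bsub>?G u v i\<^esub> gen u v i"
        using gen by (simp add: M.smult_l_distr)
    next
      fix a assume a: "a \<in> Mor ?D u v i"
      then obtain r where r: "r \<in> carrier R" "a = Scal r"
        by (auto simp: D_cat_mor[OF D.cring] simp del: D_cat_simps)
      then show "unscal a \<odot>\<^bsub>?G u v i\<^esub> gen u v i \<in> Mor Y (ob0 u) (ob0 v) i" using gen by simp
      fix s assume "s \<in> carrier R"
      then show "unscal (s \<odot>\<^bsub>HomGr ?D u v i\<^esub> a) \<odot>\<^bsub>?G u v i\<^esub> gen u v i =
        s \<odot>\<^bsub>?G u v i\<^esub> (unscal a \<odot>\<^bsub>?G u v i\<^esub> gen u v i)"
        using gen r by (simp add: M.smult_assoc1)
    qed
    fix a assume uv: "u \<in> Obj ?D" "v \<in> Obj ?D" and a: "a \<in> Mor ?D u v i"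
    then obtain r where r: "r \<in> carrier R" "a = Scal r"
      and r0: "r = \<zero>\<^bsub>R\<^esub> \<or> scalar_degree (Num 3) (Num 4) (\<lambda>i. i = m + 1 \<or> i = m + 1 - 1) u v i"
      by (auto simp: D_cat_mor[OF D.cring] simp del: D_cat_simps)
    have "Dif (Hom Y (ob0 u) (ob0 v)) i (unscal a \<odot>\<^bsub>?G u v i\<^esub> gen u v i) =
      r \<odot>\<^bsub>?G u v (i - 1)\<^esub> Dif (Hom Y (ob0 u) (ob0 v)) i (gen u v i)"
      using linear_map_smult[OF Y.dif_linear[OF ob0 ob0] r(1) gen] r by simp
    moreover have "unscal (Dif (Hom ?D u v) i a) \<odot>\<^bsub>?G u v (i - 1)\<^esub> gen u v (i - 1) =
      r \<odot>\<^bsub>?G u v (i - 1)\<^esub> Dif (Hom Y (ob0 u) (ob0 v)) i (gen u v i)"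
    proof -
      have g: "gen u v (i - 1) \<in> Mor Y (ob0 u) (ob0 v) (i - 1)"
        "Dif (Hom Y (ob0 u) (ob0 v)) i (gen u v i) \<in> Mor Y (ob0 u) (ob0 v) (i - 1)"
        using gen by (auto intro!: Y.dif_closed ob0)
      consider "r = \<zero>\<^bsub>R\<^esub>" | "u = v" "i = 0" | "u = Num 3" "v = Num 4" "i = m + 1" | "u = Num 3" "v = Num 4" "i = m"
        using r0 by (auto simp: scalar_degree_def)
      then show ?thesis
      proof cases
        case 1
        then show ?thesis using g r by (simp add: M'.smult_l_null)
      next
        case 2
        then show ?thesis
          using g r M'.smult_l_null Y.dif_ident[OF ob0[of u]] M'.smult_r_null[OF r(1)] uv by (auto simp: gen_def)
      next
        case 3
        then show ?thesis using r by (simp add: gen_def ob0_def)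
      next
        case 4
        then show ?thesis
          using g r Y.dif_dif[OF x c, of m] M'.smult_r_null[OF r(1)] M'.smult_l_null by (simp add: gen_def ob0_def)
      qed
    qed
    ultimately show "unscal (Dif (Hom ?D u v) i a) \<odot>\<^bsub>?G u v (i - 1)\<^esub> gen u v (i - 1) =
      Dif (Hom Y (ob0 u) (ob0 v)) i (unscal a \<odot>\<^bsub>?G u v i\<^esub> gen u v i)" by simp
  next
    fix u v w :: "('r, 'a) univ" and i j g f
    assume uvw: "u \<in> Obj ?D" "v \<in> Obj ?D" "w \<in> Obj ?D"
      and g: "g \<in> Mor ?D v w i" and f: "f \<in> Mor ?D u v j"
    obtain r where r: "r \<in> carrier R" "g = Scal r"
      and r0: "r = \<zero>\<^bsub>R\<^esub> \<or> scalar_degree (Num 3) (Num 4) (\<lambda>i. i = m + 1 \<or> i = m + 1 - 1) v w i"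
      using g by (auto simp: D_cat_mor[OF D.cring] simp del: D_cat_simps)
    obtain s where s: "s \<in> carrier R" "f = Scal s"
      and s0: "s = \<zero>\<^bsub>R\<^esub> \<or> scalar_degree (Num 3) (Num 4) (\<lambda>i. i = m + 1 \<or> i = m + 1 - 1) u v j"
      using f by (auto simp: D_cat_mor[OF D.cring] simp del: D_cat_simps)
    interpret M: Module.module R "?G u w (i + j)" using ob0 Y.hom_module by blast
    interpret M1: Module.module R "?G v w i" using ob0 Y.hom_module by blast
    interpret M2: Module.module R "?G u v j" using ob0 Y.hom_module by blast
    have "Comp Y (ob0 u) (ob0 v) (ob0 w) i j (r \<odot>\<^bsub>?G v w i\<^esub> gen v w i) (s \<odot>\<^bsub>?G u v j\<^esub> gen u v j) =
      (r \<otimes>\<^bsub>R\<^esub> s) \<odot>\<^bsub>?G u w (i + j)\<^esub> Comp Y (ob0 u) (ob0 v) (ob0 w) i j (gen v w i) (gen u v j)"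
      using ob0 gen r s
      by (simp add: Y.comp_smult_left Y.comp_smult_right Y.comp_closed M.smult_assoc1[symmetric] R.m_comm[of s r])
    moreover have "(r \<otimes>\<^bsub>R\<^esub> s) \<odot>\<^bsub>?G u w (i + j)\<^esub> gen u w (i + j) =
      (r \<otimes>\<^bsub>R\<^esub> s) \<odot>\<^bsub>?G u w (i + j)\<^esub> Comp Y (ob0 u) (ob0 v) (ob0 w) i j (gen v w i) (gen u v j)"
    proof (cases "r = \<zero>\<^bsub>R\<^esub> \<or> s = \<zero>\<^bsub>R\<^esub>")
      case True
      moreover have "gen u w (i + j) \<in> Mor Y (ob0 u) (ob0 w) (i + j)"
        "Comp Y (ob0 u) (ob0 v) (ob0 w) i j (gen v w i) (gen u v j) \<in> Mor Y (ob0 u) (ob0 w) (i + j)"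
        using gen by (auto intro!: Y.comp_closed ob0)
      ultimately show ?thesis using r s by (auto simp: M.smult_l_null)
    next
      case False
      then have sd: "scalar_degree (Num 3) (Num 4) (\<lambda>i. i = m + 1 \<or> i = m + 1 - 1) v w i"
        "scalar_degree (Num 3) (Num 4) (\<lambda>i. i = m + 1 \<or> i = m + 1 - 1) u v j" using r0 s0 by auto
      \<comment> \<open>The arrow from 3 to 4 cannot be composed with itself, so one of the factors
        is a multiple of an identity.\<close>
      have "u = v \<and> j = 0 \<or> v = w \<and> i = 0" using sd by (auto simp: scalar_degree_def)
      then have "gen u w (i + j) = Comp Y (ob0 u) (ob0 v) (ob0 w) i j (gen v w i) (gen u v j)"
      proof (elim disjE conjE)
        assume "u = v" "j = 0"
        then show ?thesis using Y.ident_right[OF ob0 ob0 gen] by (simp add: gen_def[of v v])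
      next
        assume "v = w" "i = 0"
        then show ?thesis using Y.ident_left[OF ob0 ob0 gen] by (simp add: gen_def[of w w])
      qed
      then show ?thesis by simp
    qed
    ultimately show "unscal (Comp ?D u v w i j g f) \<odot>\<^bsub>?G u w (i + j)\<^esub> gen u w (i + j) =
      Comp Y (ob0 u) (ob0 v) (ob0 w) i j (unscal g \<odot>\<^bsub>?G v w i\<^esub> gen v w i)
        (unscal f \<odot>\<^bsub>?G u v j\<^esub> gen u v j)"
      by (simp add: r s)
  next
    fix u :: "('r, 'a) univ"
    interpret M: Module.module R "?G u u 0" using ob0 Y.hom_module by blast
    show "unscal (Ident ?D u) \<odot>\<^bsub>?G u u 0\<^esub> gen u u 0 = Ident Y (ob0 u)"
      using ob0 by (simp add: gen_def Y.ident_closed)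
  qed (use ob0 in auto)
  moreover have "Scal \<one>\<^bsub>R\<^esub> \<in> Mor ?D (Num 3) (Num 4) (m + 1)"
    by (simp add: scalar_degree_def)
  then have "mor ?H (Num 3) (Num 4) (m + 1) (Scal \<one>\<^bsub>R\<^esub>) = \<one>\<^bsub>R\<^esub> \<odot>\<^bsub>HomGr Y (ob0 (Num 3)) (ob0 (Num 4)) (m + 1)\<^esub> gen (Num 3) (Num 4) (m + 1)"
    by (intro HOL.trans[OF mk_dgfun_simps(4)]) simp_all
  moreover have "\<one>\<^bsub>R\<^esub> \<odot>\<^bsub>HomGr Y (ob0 (Num 3)) (ob0 (Num 4)) (m + 1)\<^esub> gen (Num 3) (Num 4) (m + 1) = c"
    using c Module.module.smult_one[OF Y.hom_module[OF x]] by (simp add: gen_def ob0_def)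
  ultimately show ?thesis by (intro bexI[of _ ?H]) (simp_all add: ob0_def)
qed

text \<open>The unit in degree \<open>m\<close> is the boundary of the unit in degree
  \<open>m + 1\<close>, so the value on the latter determines everything beyond the objects.\<close>

lemma D_cat_functor_eq:
  assumes F: "F \<in> dg_hom R (D_cat R (m + 1)) Y" and G: "G \<in> dg_hom R (D_cat R (m + 1)) Y"
    and ob: "ob F (Num 3) = ob G (Num 3)" "ob F (Num 4) = ob G (Num 4)"
    and gen: "mor F (Num 3) (Num 4) (m + 1) (Scal \<one>\<^bsub>R\<^esub>) = mor G (Num 3) (Num 4) (m + 1) (Scal \<one>\<^bsub>R\<^esub>)"
  shows "F = G"
proof (rule dg_hom_ext[OF F G])
  interpret F: dgf R F using F by (rule dgf_hom)
  interpret G: dgf R G using G by (rule dgf_hom)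
  note d = dg_homD(2,3)[OF F] dg_homD(2,3)[OF G]
  let ?D = "D_cat R (m + 1) :: ('r, ('r, 'a) univ) dgcat"
  have o: "Num 3 \<in> Obj ?D" "Num 4 \<in> Obj ?D" by simp_all
  fix u v i a assume uv: "u \<in> Obj ?D" "v \<in> Obj ?D" and a: "a \<in> Mor ?D u v i"
  have ob': "ob F u = ob G u" "ob F v = ob G v" using uv ob by auto
  obtain r where r: "r \<in> carrier R" "a = Scal r"
    and r0: "r = \<zero>\<^bsub>R\<^esub> \<or> scalar_degree (Num 3) (Num 4) (\<lambda>i. i = m + 1 \<or> i = m + 1 - 1) u v i"
    using a by (auto simp: D_cat_mor[OF D.cring] simp del: D_cat_simps)
  have one: "Scal \<one>\<^bsub>R\<^esub> \<in> Mor ?D (Num 3) (Num 4) (m + 1)"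
    "Scal r \<in> Mor ?D (Num 3) (Num 4) (m + 1)"
    and e: "Scal r = r \<odot>\<^bsub>HomGr ?D (Num 3) (Num 4) (m + 1)\<^esub> Scal \<one>\<^bsub>R\<^esub>"
    using r by (simp_all add: scalar_degree_def)
  have top: "mor F (Num 3) (Num 4) (m + 1) (Scal r) = mor G (Num 3) (Num 4) (m + 1) (Scal r)"
    unfolding e using F.mor_smult[unfolded d, OF o one(1) r(1)] G.mor_smult[unfolded d, OF o one(1) r(1)] gen ob by simp
  have bot: "mor F (Num 3) (Num 4) m (Scal r) = mor G (Num 3) (Num 4) m (Scal r)"
    using F.mor_dif[unfolded d, OF o one(2), of m] G.mor_dif[unfolded d, OF o one(2), of m] top ob by simp
  consider "r = \<zero>\<^bsub>R\<^esub>" | "u = v" "i = 0" | "u = Num 3" "v = Num 4" "i = m + 1" | "u = Num 3" "v = Num 4" "i = m"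
    using r0 by (auto simp: scalar_degree_def)
  then show "mor F u v i a = mor G u v i a"
  proof cases
    case 1
    then have "a = \<zero>\<^bsub>HomGr ?D u v i\<^esub>" using r by simp
    then show ?thesis using F.mor_zero[unfolded d, OF uv, of i] G.mor_zero[unfolded d, OF uv, of i] ob' by simp
  next
    case 2
    have id: "Ident ?D u \<in> Mor ?D u u 0" using D.ident_closed uv by blast
    have "a = r \<odot>\<^bsub>HomGr ?D u u 0\<^esub> Ident ?D u" using r by (simp add: scalar_degree_def)
    then show ?thesis
      using F.mor_smult[unfolded d, OF uv(1,1) id r(1)] G.mor_smult[unfolded d, OF uv(1,1) id r(1)]
        F.mor_ident[unfolded d, OF uv(1)] G.mor_ident[unfolded d, OF uv(1)] ob' 2 by simp
  qed (use r top bot in simp_all)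
qed (use ob in auto)

end

section \<open>Attaching cells: extension and uniqueness\<close>

lemma is_coproductD:
  assumes "is_coproduct R I C inc K"
  shows "dg_category R K" "\<And>c. c \<in> I \<Longrightarrow> inc c \<in> dg_hom R (C c) K"
    "\<And>Z F. dg_category R Z \<Longrightarrow> (\<And>c. c \<in> I \<Longrightarrow> F c \<in> dg_hom R (C c) Z) \<Longrightarrow>
       \<exists>H\<in>dg_hom R K Z. \<forall>c\<in>I. H \<circ>\<^sub>d inc c = F c"
proof -
  note c = assms[unfolded is_coproduct_def]
  show "dg_category R K" using c by (rule conjunct1)
  show "inc c \<in> dg_hom R (C c) K" if "c \<in> I" for c using c[THEN conjunct2, THEN conjunct1] that by (rule bspec)
  fix Z F assume "dg_category R Z" "\<And>c. c \<in> I \<Longrightarrow> F c \<in> dg_hom R (C c) Z"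
  then have "dg_category R Z \<and> (\<forall>c\<in>I. F c \<in> dg_hom R (C c) Z)" by simp
  with c[THEN conjunct2, THEN conjunct2] have "\<exists>!H. H \<in> dg_hom R K Z \<and> (\<forall>c\<in>I. H \<circ>\<^sub>d inc c = F c)"
    by (elim allE[of _ Z] allE[of _ F] impE)
  then show "\<exists>H\<in>dg_hom R K Z. \<forall>c\<in>I. H \<circ>\<^sub>d inc c = F c" by (auto dest: ex1_implies_ex)
qed

lemma ex1_eq: "\<exists>!x. P x \<Longrightarrow> P a \<Longrightarrow> P b \<Longrightarrow> a = b"
  by blast

lemma coproduct_eq:
  assumes "is_coproduct R I C inc K" "dg_category R Z" "H \<in> dg_hom R K Z" "H' \<in> dg_hom R K Z"
    and "\<And>c. c \<in> I \<Longrightarrow> H \<circ>\<^sub>d inc c = H' \<circ>\<^sub>d inc c"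
  shows "H = H'"
proof -
  note c = assms(1)[unfolded is_coproduct_def]
  have "dg_category R Z \<and> (\<forall>c\<in>I. H \<circ>\<^sub>d inc c \<in> dg_hom R (C c) Z)"
    using assms(2) dg_comp_hom[OF is_coproductD(2)[OF assms(1)] assms(3)] by simp
  with c[THEN conjunct2, THEN conjunct2]
  have "\<exists>!G. G \<in> dg_hom R K Z \<and> (\<forall>c\<in>I. G \<circ>\<^sub>d inc c = H \<circ>\<^sub>d inc c)"
    by (elim allE[of _ Z] allE[of _ "\<lambda>c. H \<circ>\<^sub>d inc c"] impE)
  then show ?thesis by (rule ex1_eq) (use assms(3-5) in auto)
qed

text \<open>The property of a target that makes every dg functor to it extend over the cells of
  \<open>P\<^sub>n(A)\<close>: images of the attaching cycles bound.\<close>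

definition fills_cycles :: "nat \<Rightarrow> ('r, 'u) dgcat \<Rightarrow> bool" where
  "fills_cycles n Y \<longleftrightarrow> (\<forall>x\<in>Obj Y. \<forall>y\<in>Obj Y. \<forall>m>int n. \<forall>z\<in>cycles (Hom Y x y) m.
     \<exists>c\<in>Mor Y x y (m + 1). Dif (Hom Y x y) (m + 1) c = z)"

lemma attaches_cellsE:
  assumes "attaches_cells R n st att" and st: "st \<in> dg_hom R A A'"
  obtains incK K incL L s t u where
    "is_coproduct R (cells R n A) (\<lambda>(m, T). C_cat R m) incK K"
    "is_coproduct R (cells R n A) (\<lambda>(m, T). D_cat R (m + 1)) incL L"
    "s \<in> dg_hom R K L" "t \<in> dg_hom R K A" "u \<in> dg_hom R L A'" "u \<circ>\<^sub>d s = st \<circ>\<^sub>d t"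
    "\<forall>(m, T)\<in>cells R n A. s \<circ>\<^sub>d incK (m, T) = incL (m, T) \<circ>\<^sub>d S_fun R m"
    "\<forall>(m, T)\<in>cells R n A. t \<circ>\<^sub>d incK (m, T) = T"
    "\<forall>c\<in>cells R n A. att c = u \<circ>\<^sub>d incL c"
    "\<forall>Z a b. a \<in> dg_hom R L Z \<longrightarrow> b \<in> dg_hom R A Z \<longrightarrow> a \<circ>\<^sub>d s = b \<circ>\<^sub>d t \<longrightarrow>
       (\<exists>!H. H \<in> dg_hom R A' Z \<and> H \<circ>\<^sub>d u = a \<and> H \<circ>\<^sub>d st = b)"
proof -
  note d = dg_homD[OF st]
  obtain K L incK incL s t u where *: "is_coproduct R (cells R n A) (\<lambda>(m, T). C_cat R m) incK K"
    "is_coproduct R (cells R n A) (\<lambda>(m, T). D_cat R (m + 1)) incL L" "s \<in> dg_hom R K L"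
    "\<forall>(m, T)\<in>cells R n A. s \<circ>\<^sub>d incK (m, T) = incL (m, T) \<circ>\<^sub>d S_fun R m" "t \<in> dg_hom R K A"
    "\<forall>(m, T)\<in>cells R n A. t \<circ>\<^sub>d incK (m, T) = T" and p: "is_pushout R s t u st"
    and a: "\<forall>c\<in>cells R n A. att c = u \<circ>\<^sub>d incL c"
    using assms(1) unfolding attaches_cells_def d(2) by blast
  have sL: "Cod s = L" "Cod t = A" using *(3,5) dg_homD(3) by blast+
  have u: "u \<in> dg_hom R L A'" "u \<circ>\<^sub>d s = st \<circ>\<^sub>d t" using p[unfolded is_pushout_def, folded d(3)] d(3) sL
    unfolding dg_hom_def by (elim conjE; simp)+
  have un: "\<exists>!H. H \<in> dg_hom R A' Z \<and> H \<circ>\<^sub>d u = a \<and> H \<circ>\<^sub>d st = b"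
    if "a \<in> dg_hom R L Z" "b \<in> dg_hom R A Z" "a \<circ>\<^sub>d s = b \<circ>\<^sub>d t" for Z a b
  proof -
    have "\<forall>Z a b. a \<in> dg_hom R (Cod s) Z \<and> b \<in> dg_hom R (Cod t) Z \<and> a \<circ>\<^sub>d s = b \<circ>\<^sub>d t \<longrightarrow>
        (\<exists>!H. H \<in> dg_hom R (Cod st) Z \<and> H \<circ>\<^sub>d u = a \<and> H \<circ>\<^sub>d st = b)"
      using p unfolding is_pushout_def by (elim conjE)
    then show ?thesis unfolding sL d(3) using that
      by (elim allE[of _ Z] allE[of _ a] allE[of _ b] impE) simp_all
  qed
  show ?thesis
    by (rule that[OF *(1,2,3,5) u *(4,6) a]) (intro allI impI, rule un)
qed

lemma cell_boundary:
  assumes "(m, T) \<in> cells R n (A :: ('r, ('r, 'a) univ) dgcat)"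
  shows "T \<in> dg_hom R (C_cat R m) A" "int n < m" "Scal \<one>\<^bsub>R\<^esub> \<in> cycles (Hom (C_cat R m) (Num 1) (Num 2)) m"
    "mor T (Num 1) (Num 2) m (Scal \<one>\<^bsub>R\<^esub>) \<in> cycles (Hom A (ob T (Num 1)) (ob T (Num 2))) m"
    "ob T (Num 1) \<in> Obj A" "ob T (Num 2) \<in> Obj A"
proof -
  show T: "T \<in> dg_hom R (C_cat R m) A" and "int n < m" using assms by (auto simp: cells_def)
  interpret T: dgf R T using T by (rule dgf_hom)
  interpret R: cring R by (rule T.D.cring)
  show o: "Scal \<one>\<^bsub>R\<^esub> \<in> cycles (Hom (C_cat R m) (Num 1) (Num 2)) m"
    by (auto simp: cycles_def scalar_degree_def)
  show "mor T (Num 1) (Num 2) m (Scal \<one>\<^bsub>R\<^esub>) \<in> cycles (Hom A (ob T (Num 1)) (ob T (Num 2))) m"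
    using T.mor_cycle[unfolded dg_homD(2,3)[OF T], OF _ _ o] by simp
  show "ob T (Num 1) \<in> Obj A" "ob T (Num 2) \<in> Obj A"
    using T.ob_closed[unfolded dg_homD(2,3)[OF T]] by auto
qed

lemma S_fun_simps [simp]:
  "Dom (S_fun R m) = C_cat R m" "Cod (S_fun R m) = D_cat R (m + 1)"
  "ob (S_fun R m) (Num (Suc 0)) = Num 3" "ob (S_fun R m) (Num 2) = Num 4"
  by (simp_all add: S_fun_def)

lemma C_cat_functor_eq:
  assumes F: "F \<in> dg_hom R (C_cat R m) Y" and G: "G \<in> dg_hom R (C_cat R m) Y"
    and ob: "ob F (Num 1) = ob G (Num 1)" "ob F (Num 2) = ob G (Num 2)"
    and gen: "mor F (Num 1) (Num 2) m (Scal \<one>\<^bsub>R\<^esub>) = mor G (Num 1) (Num 2) m (Scal \<one>\<^bsub>R\<^esub>)"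
  shows "F = G"
proof (rule dg_hom_ext[OF F G])
  interpret F: dgf R F using F by (rule dgf_hom)
  interpret G: dgf R G using G by (rule dgf_hom)
  interpret R: cring R by (rule F.D.cring)
  note d = dg_homD(2,3)[OF F] dg_homD(2,3)[OF G]
  let ?C = "C_cat R m :: ('a, ('a, 'b) univ) dgcat"
  have o: "Num 1 \<in> Obj ?C" "Num 2 \<in> Obj ?C" by simp_all
  fix u v i a assume uv: "u \<in> Obj ?C" "v \<in> Obj ?C" and a: "a \<in> Mor ?C u v i"
  have ob': "ob F u = ob G u" "ob F v = ob G v" using uv ob by auto
  obtain r where r: "r \<in> carrier R" "a = Scal r"
    and r0: "r = \<zero>\<^bsub>R\<^esub> \<or> scalar_degree (Num 1) (Num 2) (\<lambda>i. i = m) u v i"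
    using a by (auto simp: C_cat_mor[OF F.D.cring] simp del: C_cat_simps)
  consider "r = \<zero>\<^bsub>R\<^esub>" | "u = v" "i = 0" | "u = Num 1" "v = Num 2" "i = m"
    using r0 by (auto simp: scalar_degree_def)
  then show "mor F u v i a = mor G u v i a"
  proof cases
    case 1
    then have "a = \<zero>\<^bsub>HomGr ?C u v i\<^esub>" using r by simp
    then show ?thesis using F.mor_zero[unfolded d, OF uv, of i] G.mor_zero[unfolded d, OF uv, of i] ob' by simp
  next
    case 2
    have id: "Ident ?C u \<in> Mor ?C u u 0" using F.D.ident_closed[unfolded d] uv by blast
    have "a = r \<odot>\<^bsub>HomGr ?C u u 0\<^esub> Ident ?C u" using r by (simp add: scalar_degree_def)
    then show ?thesis
      using F.mor_smult[unfolded d, OF uv(1,1) id r(1)] G.mor_smult[unfolded d, OF uv(1,1) id r(1)]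
        F.mor_ident[unfolded d, OF uv(1)] G.mor_ident[unfolded d, OF uv(1)] ob' 2 by simp
  next
    case 3
    have one: "Scal \<one>\<^bsub>R\<^esub> \<in> Mor ?C (Num 1) (Num 2) m" and e: "Scal r = r \<odot>\<^bsub>HomGr ?C (Num 1) (Num 2) m\<^esub> Scal \<one>\<^bsub>R\<^esub>"
      using r by (simp_all add: scalar_degree_def)
    show ?thesis unfolding 3 r(2) e
      using F.mor_smult[unfolded d, OF o one r(1)] G.mor_smult[unfolded d, OF o one r(1)] gen ob by simp
  qed
qed (use ob in auto)

text \<open>The attaching cycle of a cell \<open>(m, T)\<close> has degree \<open>m > n\<close>, so
  its image in \<open>Y\<close> bounds, and a bounding chain is a dg functor on
  \<open>D(m + 1)\<close>. The coproduct collects these and the pushout glues them to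
  \<open>G\<close>.\<close>

lemma attach_extend:
  fixes R :: "'r ring" and G :: "('r, ('r, 'a) univ) dgfun"
  assumes att: "attaches_cells R n st att" and st: "st \<in> dg_hom R A A'"
    and G: "G \<in> dg_hom R A Y" and Y: "fills_cycles n Y"
  shows "\<exists>G'\<in>dg_hom R A' Y. G' \<circ>\<^sub>d st = G"
proof -
  obtain K L incK incL s t u where
    K: "is_coproduct R (cells R n A) (\<lambda>(m, T). C_cat R m) incK K" and
    L: "is_coproduct R (cells R n A) (\<lambda>(m, T). D_cat R (m + 1)) incL L" and
    s: "s \<in> dg_hom R K L" and t: "t \<in> dg_hom R K A" and u: "u \<in> dg_hom R L A'" "u \<circ>\<^sub>d s = st \<circ>\<^sub>d t" and
    sK: "\<forall>(m, T)\<in>cells R n A. s \<circ>\<^sub>d incK (m, T) = incL (m, T) \<circ>\<^sub>d S_fun R m" and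
    tK: "\<forall>(m, T)\<in>cells R n A. t \<circ>\<^sub>d incK (m, T) = T" and
    attc: "\<forall>c\<in>cells R n A. att c = u \<circ>\<^sub>d incL c" and
    un: "\<forall>Z a b. a \<in> dg_hom R L Z \<longrightarrow> b \<in> dg_hom R A Z \<longrightarrow> a \<circ>\<^sub>d s = b \<circ>\<^sub>d t \<longrightarrow>
       (\<exists>!H. H \<in> dg_hom R A' Z \<and> H \<circ>\<^sub>d u = a \<and> H \<circ>\<^sub>d st = b)"
    by (rule attaches_cellsE[OF att st])
  note sK = bspec[OF sK, unfolded split_paired_all, simplified] and tK = bspec[OF tK, unfolded split_paired_all, simplified]
    and attc = bspec[OF attc] and un = un[rule_format]
  note YC = dg_homD(5)[OF G]
  interpret G: dgf R G using G by (rule dgf_hom)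
  interpret R: cring R by (rule G.D.cring)
  have inc: "incK (m, T) \<in> dg_hom R (C_cat R m) K" "incL (m, T) \<in> dg_hom R (D_cat R (m + 1)) L"
    if "(m, T) \<in> cells R n A" for m T
    using is_coproductD(2)[OF K that] is_coproductD(2)[OF L that] by auto
  have ex: "\<exists>H\<in>dg_hom R (D_cat R (m + 1)) Y. H \<circ>\<^sub>d S_fun R m = G \<circ>\<^sub>d T" if c: "(m, T) \<in> cells R n A" for m T
  proof -
    note T = cell_boundary[OF c]
    note DC = dg_homD(4)[OF inc(1)[OF c]] and DD = dg_homD(4)[OF inc(2)[OF c]]
    have GT: "G \<circ>\<^sub>d T \<in> dg_hom R (C_cat R m) Y" by (rule dg_comp_hom[OF T(1) G])
    interpret GT: dgf R "G \<circ>\<^sub>d T" using GT by (rule dgf_hom)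
    let ?x = "ob (G \<circ>\<^sub>d T) (Num 1)" and ?y = "ob (G \<circ>\<^sub>d T) (Num 2)"
    have o: "?x \<in> Obj Y" "?y \<in> Obj Y" using GT.ob_closed[unfolded dg_homD(2,3)[OF GT]] by auto
    have "mor (G \<circ>\<^sub>d T) (Num 1) (Num 2) m (Scal \<one>\<^bsub>R\<^esub>) \<in> cycles (Hom Y ?x ?y) m"
      using GT.mor_cycle[unfolded dg_homD(2,3)[OF GT], OF _ _ T(3)] by simp
    then obtain c where c: "c \<in> Mor Y ?x ?y (m + 1)"
      "Dif (Hom Y ?x ?y) (m + 1) c = mor (G \<circ>\<^sub>d T) (Num 1) (Num 2) m (Scal \<one>\<^bsub>R\<^esub>)"
      using Y o T(2) unfolding fills_cycles_def by blast
    obtain H where H: "H \<in> dg_hom R (D_cat R (m + 1)) Y" "ob H (Num 3) = ?x" "ob H (Num 4) = ?y"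
      "mor H (Num 3) (Num 4) (m + 1) (Scal \<one>\<^bsub>R\<^esub>) = c" using D_cat_functor[OF DD YC o c(1)] by blast
    interpret H: dgf R H using H(1) by (rule dgf_hom)
    note S = S_fun_hom[OF DC DD]
    have top: "Scal \<one>\<^bsub>R\<^esub> \<in> Mor (D_cat R (m + 1)) (Num 3) (Num 4) (m + 1)" by (simp add: scalar_degree_def)
    have one: "Scal \<one>\<^bsub>R\<^esub> \<in> Mor (C_cat R m) (Num 1) (Num 2) m" by (simp add: scalar_degree_def)
    have "mor (S_fun R m :: ('r, ('r, 'a) univ) dgfun) (Num 1) (Num 2) m (Scal \<one>\<^bsub>R\<^esub>) = Scal \<one>\<^bsub>R\<^esub>"
      unfolding S_fun_def by (rule mk_dgfun_simps(4)) (use one in simp_all)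
    moreover have "mor (H \<circ>\<^sub>d S_fun R m) (Num 1) (Num 2) m (Scal \<one>\<^bsub>R\<^esub>) =
        mor H (ob (S_fun R m) (Num 1)) (ob (S_fun R m) (Num 2)) m (mor (S_fun R m) (Num 1) (Num 2) m (Scal \<one>\<^bsub>R\<^esub>))"
      by (rule dg_comp_simps(4)) (use one in simp_all)
    ultimately have "mor (H \<circ>\<^sub>d S_fun R m) (Num 1) (Num 2) m (Scal \<one>\<^bsub>R\<^esub>) = mor H (Num 3) (Num 4) m (Scal \<one>\<^bsub>R\<^esub>)"
      by simp
    also have "\<dots> = mor (G \<circ>\<^sub>d T) (Num 1) (Num 2) m (Scal \<one>\<^bsub>R\<^esub>)"
      using H.mor_dif[unfolded dg_homD(2,3)[OF H(1)], OF _ _ top, of m] H c by simp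
    finally have "H \<circ>\<^sub>d S_fun R m = G \<circ>\<^sub>d T"
      by (intro C_cat_functor_eq[OF dg_comp_hom[OF S H(1)] GT]) (simp_all add: H)
    then show ?thesis using H(1) by blast
  qed
  \<comment> \<open>A filling is chosen for each cell at once, as the universal property of the
    coproduct asks for a whole family.\<close>
  define h where "h = (\<lambda>(m, T). SOME H. H \<in> dg_hom R (D_cat R (m + 1)) Y \<and> H \<circ>\<^sub>d S_fun R m = G \<circ>\<^sub>d T)"
  have h: "h (m, T) \<in> dg_hom R (D_cat R (m + 1)) Y" "h (m, T) \<circ>\<^sub>d S_fun R m = G \<circ>\<^sub>d T"
    if "(m, T) \<in> cells R n A" for m T
    using someI_ex[of "\<lambda>H. H \<in> dg_hom R (D_cat R (m + 1)) Y \<and> H \<circ>\<^sub>d S_fun R m = G \<circ>\<^sub>d T"] ex[OF that]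
    by (auto simp: h_def)
  have "\<exists>a\<in>dg_hom R L Y. \<forall>c\<in>cells R n A. a \<circ>\<^sub>d incL c = h c"
    by (rule is_coproductD(3)[OF L YC]) (use h in auto)
  then obtain a where a: "a \<in> dg_hom R L Y" "\<And>c. c \<in> cells R n A \<Longrightarrow> a \<circ>\<^sub>d incL c = h c" by blast
  \<comment> \<open>Gluing requires agreement on the coproduct of the spheres, which is tested on
    each summand.\<close>
  have "a \<circ>\<^sub>d s = G \<circ>\<^sub>d t"
  proof (rule coproduct_eq[OF K YC dg_comp_hom[OF s a(1)] dg_comp_hom[OF t G]])
    fix c assume "c \<in> cells R n A"
    then obtain m T where c: "c = (m, T)" "(m, T) \<in> cells R n A" by (cases c) auto
    note S = S_fun_hom[OF dg_homD(4)[OF inc(1)[OF c(2)]] dg_homD(4)[OF inc(2)[OF c(2)]]]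
    have "a \<circ>\<^sub>d s \<circ>\<^sub>d incK (m, T) = a \<circ>\<^sub>d incL (m, T) \<circ>\<^sub>d S_fun R m"
      using dg_comp_assoc[OF inc(1)[OF c(2)] s a(1)] dg_comp_assoc[OF S inc(2)[OF c(2)] a(1)] sK[OF c(2)] by simp
    also have "\<dots> = G \<circ>\<^sub>d T" using a(2)[OF c(2)] h(2)[OF c(2)] by simp
    also have "\<dots> = G \<circ>\<^sub>d t \<circ>\<^sub>d incK (m, T)"
      using dg_comp_assoc[OF inc(1)[OF c(2)] t G] tK[OF c(2)] by simp
    finally show "a \<circ>\<^sub>d s \<circ>\<^sub>d incK c = G \<circ>\<^sub>d t \<circ>\<^sub>d incK c" by (simp add: c(1))
  qed
  from un[OF a(1) G this] show ?thesis by blast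
qed

lemma attach_hom:
  fixes R :: "'r ring" and st :: "('r, ('r, 'a) univ) dgfun"
  assumes att: "attaches_cells R n st att" and st: "st \<in> dg_hom R A A'" and c: "(m, T) \<in> cells R n A"
  shows "att (m, T) \<in> dg_hom R (D_cat R (m + 1)) A'" "att (m, T) \<circ>\<^sub>d S_fun R m = st \<circ>\<^sub>d T"
    "(S_fun R m :: ('r, ('r, 'a) univ) dgfun) \<in> dg_hom R (C_cat R m) (D_cat R (m + 1))"
proof -
  obtain K L incK incL s t u where
    K: "is_coproduct R (cells R n A) (\<lambda>(m, T). C_cat R m) incK K" and
    L: "is_coproduct R (cells R n A) (\<lambda>(m, T). D_cat R (m + 1)) incL L" and
    s: "s \<in> dg_hom R K L" and t: "t \<in> dg_hom R K A" and u: "u \<in> dg_hom R L A'" "u \<circ>\<^sub>d s = st \<circ>\<^sub>d t" and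
    sK: "\<forall>(m, T)\<in>cells R n A. s \<circ>\<^sub>d incK (m, T) = incL (m, T) \<circ>\<^sub>d S_fun R m" and
    tK: "\<forall>(m, T)\<in>cells R n A. t \<circ>\<^sub>d incK (m, T) = T" and
    attc: "\<forall>c\<in>cells R n A. att c = u \<circ>\<^sub>d incL c" and
    un: "\<forall>Z a b. a \<in> dg_hom R L Z \<longrightarrow> b \<in> dg_hom R A Z \<longrightarrow> a \<circ>\<^sub>d s = b \<circ>\<^sub>d t \<longrightarrow>
       (\<exists>!H. H \<in> dg_hom R A' Z \<and> H \<circ>\<^sub>d u = a \<and> H \<circ>\<^sub>d st = b)"
    by (rule attaches_cellsE[OF att st])
  note sK = bspec[OF sK, unfolded split_paired_all, simplified] and tK = bspec[OF tK, unfolded split_paired_all, simplified]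
    and attc = bspec[OF attc] and un = un[rule_format]
  have inc: "incK (m, T) \<in> dg_hom R (C_cat R m) K" "incL (m, T) \<in> dg_hom R (D_cat R (m + 1)) L"
    using is_coproductD(2)[OF K c] is_coproductD(2)[OF L c] by auto
  show "att (m, T) \<in> dg_hom R (D_cat R (m + 1)) A'"
    unfolding attc[OF c] by (rule dg_comp_hom[OF inc(2) u(1)])
  show S: "(S_fun R m :: ('r, ('r, 'a) univ) dgfun) \<in> dg_hom R (C_cat R m) (D_cat R (m + 1))"
    by (rule S_fun_hom[OF dg_homD(4)[OF inc(1)] dg_homD(4)[OF inc(2)]])
  show "att (m, T) \<circ>\<^sub>d S_fun R m = st \<circ>\<^sub>d T"
    unfolding attc[OF c]
    using dg_comp_assoc[OF S inc(2) u(1)] dg_comp_assoc[OF inc(1) s u(1)]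
      dg_comp_assoc[OF inc(1) t st] sK[OF c] tK[OF c] u(2) by simp
qed

text \<open>By the pushout it suffices to compare on \<open>A\<close> and on each
  \<open>D(m + 1)\<close>. There the objects agree because they are attached to \<open>A\<close>, so
  the value on the top unit decides.\<close>

lemma attach_eq:
  assumes att: "attaches_cells R n st att" and st: "st \<in> dg_hom R A A'"
    and F: "F \<in> dg_hom R A' Y" and G: "G \<in> dg_hom R A' Y" and FG: "F \<circ>\<^sub>d st = G \<circ>\<^sub>d st"
    and cells: "\<And>m T. (m, T) \<in> cells R n A \<Longrightarrow>
      mor (F \<circ>\<^sub>d att (m, T)) (Num 3) (Num 4) (m + 1) (Scal \<one>\<^bsub>R\<^esub>) =
      mor (G \<circ>\<^sub>d att (m, T)) (Num 3) (Num 4) (m + 1) (Scal \<one>\<^bsub>R\<^esub>)"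
  shows "F = G"
proof -
  obtain K L incK incL s t u where
    K: "is_coproduct R (cells R n A) (\<lambda>(m, T). C_cat R m) incK K" and
    L: "is_coproduct R (cells R n A) (\<lambda>(m, T). D_cat R (m + 1)) incL L" and
    s: "s \<in> dg_hom R K L" and t: "t \<in> dg_hom R K A" and u: "u \<in> dg_hom R L A'" "u \<circ>\<^sub>d s = st \<circ>\<^sub>d t" and
    sK: "\<forall>(m, T)\<in>cells R n A. s \<circ>\<^sub>d incK (m, T) = incL (m, T) \<circ>\<^sub>d S_fun R m" and
    tK: "\<forall>(m, T)\<in>cells R n A. t \<circ>\<^sub>d incK (m, T) = T" and
    attc: "\<forall>c\<in>cells R n A. att c = u \<circ>\<^sub>d incL c" and
    un: "\<forall>Z a b. a \<in> dg_hom R L Z \<longrightarrow> b \<in> dg_hom R A Z \<longrightarrow> a \<circ>\<^sub>d s = b \<circ>\<^sub>d t \<longrightarrow>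
       (\<exists>!H. H \<in> dg_hom R A' Z \<and> H \<circ>\<^sub>d u = a \<and> H \<circ>\<^sub>d st = b)"
    by (rule attaches_cellsE[OF att st])
  note sK = bspec[OF sK, unfolded split_paired_all, simplified] and tK = bspec[OF tK, unfolded split_paired_all, simplified]
    and attc = bspec[OF attc] and un = un[rule_format]
  note YC = dg_homD(5)[OF F]
  have "F \<circ>\<^sub>d u = G \<circ>\<^sub>d u"
  proof (rule coproduct_eq[OF L YC dg_comp_hom[OF u(1) F] dg_comp_hom[OF u(1) G]])
    fix c assume "c \<in> cells R n A"
    then obtain m T where c: "c = (m, T)" "(m, T) \<in> cells R n A" by (cases c) auto
    note T = cell_boundary[OF c(2)] and H = attach_hom[OF att st c(2)]
    have inc: "incL (m, T) \<in> dg_hom R (D_cat R (m + 1)) L" using is_coproductD(2)[OF L c(2)] by auto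
    have FS: "F \<circ>\<^sub>d att (m, T) \<circ>\<^sub>d S_fun R m = G \<circ>\<^sub>d att (m, T) \<circ>\<^sub>d S_fun R m"
      using dg_comp_assoc[OF H(3,1) F] dg_comp_assoc[OF H(3,1) G] H(2)
        dg_comp_assoc[OF T(1) st F] dg_comp_assoc[OF T(1) st G] FG by simp
    have "F \<circ>\<^sub>d att (m, T) = G \<circ>\<^sub>d att (m, T)"
      by (rule D_cat_functor_eq[OF dg_homD(4)[OF H(1)] YC dg_comp_hom[OF H(1) F] dg_comp_hom[OF H(1) G] _ _ cells[OF c(2)]])
        (use arg_cong[OF FS, of "\<lambda>H. ob H (Num 1)"] arg_cong[OF FS, of "\<lambda>H. ob H (Num 2)"] in simp_all)
    then show "F \<circ>\<^sub>d u \<circ>\<^sub>d incL c = G \<circ>\<^sub>d u \<circ>\<^sub>d incL c"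
      unfolding c(1) attc[OF c(2)]
      using dg_comp_assoc[OF inc u(1) F] dg_comp_assoc[OF inc u(1) G] by simp
  qed
  then have u_eq: "G \<circ>\<^sub>d u = F \<circ>\<^sub>d u" by simp
  have "F \<circ>\<^sub>d u \<circ>\<^sub>d s = F \<circ>\<^sub>d st \<circ>\<^sub>d t"
    using dg_comp_assoc[OF s u(1) F] dg_comp_assoc[OF t st F] u(2) by simp
  from un[OF dg_comp_hom[OF u(1) F] dg_comp_hom[OF st F] this] show ?thesis
    by (rule ex1_eq) (simp_all add: F G FG u_eq)
qed

section \<open>Dg functors out of the colimit of the tower\<close>

context
  fixes R :: "'r ring" and n :: nat and A :: "('r, ('r, 'a) univ) dgcat" and t :: "('r, 'a) postnikov_tower"
  assumes tower: "big_postnikov R n A t"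
begin

lemma tower_base: "Stage t 0 = A"
  using tower by (simp add: big_postnikov_def)

lemma tower_map: "StageMap t i \<in> dg_hom R (Stage t i) (Stage t (Suc i))"
  and tower_attach: "attaches_cells R n (StageMap t i) (Attach t i)"
  using tower by (auto simp: big_postnikov_def)

lemma tower_colimit: "is_sequential_colimit R (Stage t) (StageMap t) (Leg t) (Colim t)"
  using tower by (simp add: big_postnikov_def)

lemma tower_leg: "Leg t i \<in> dg_hom R (Stage t i) (Colim t)"
  and tower_leg_Suc: "Leg t (Suc i) \<circ>\<^sub>d StageMap t i = Leg t i"
  using tower_colimit unfolding is_sequential_colimit_def by (elim conjE; simp)+

lemma tower_colimit_un:
  assumes "\<And>i. F i \<in> dg_hom R (Stage t i) Z" "\<And>i. F (Suc i) \<circ>\<^sub>d StageMap t i = F i"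
  shows "\<exists>!H. H \<in> dg_hom R (Colim t) Z \<and> (\<forall>i. H \<circ>\<^sub>d Leg t i = F i)"
proof -
  have "\<forall>Z F. (\<forall>i. F i \<in> dg_hom R (Stage t i) Z) \<and> (\<forall>i. F (Suc i) \<circ>\<^sub>d StageMap t i = F i) \<longrightarrow>
      (\<exists>!H. H \<in> dg_hom R (Colim t) Z \<and> (\<forall>i. H \<circ>\<^sub>d Leg t i = F i))"
    using tower_colimit unfolding is_sequential_colimit_def by (elim conjE)
  then show ?thesis using assms by (elim allE[of _ Z] allE[of _ F] impE) simp_all
qed

text \<open>An extension from one stage to the next involves choices, so the extensions are selected
  successively and compatibly before the colimit combines them.\<close>

lemma tower_extend:
  assumes G: "G \<in> dg_hom R A Y" and Y: "fills_cycles n Y"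
  shows "\<exists>H\<in>dg_hom R (Colim t) Y. H \<circ>\<^sub>d Leg t 0 = G"
proof -
  have "\<exists>F. \<forall>i. (F i \<in> dg_hom R (Stage t i) Y \<and> (i = 0 \<longrightarrow> F i = G)) \<and> F (Suc i) \<circ>\<^sub>d StageMap t i = F i"
  proof (rule dependent_nat_choice)
    show "\<exists>F. F \<in> dg_hom R (Stage t 0) Y \<and> (0 = 0 \<longrightarrow> F = G)" using G by (simp add: tower_base)
    fix F i assume "F \<in> dg_hom R (Stage t i) Y \<and> (i = 0 \<longrightarrow> F = G)"
    then show "\<exists>F'. (F' \<in> dg_hom R (Stage t (Suc i)) Y \<and> (Suc i = 0 \<longrightarrow> F' = G)) \<and> F' \<circ>\<^sub>d StageMap t i = F"
      using attach_extend[OF tower_attach tower_map _ Y, of F] by auto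
  qed
  then obtain F where F: "\<And>i. F i \<in> dg_hom R (Stage t i) Y" "F 0 = G" "\<And>i. F (Suc i) \<circ>\<^sub>d StageMap t i = F i"
    by blast
  from tower_colimit_un[OF F(1,3)] F(2) show ?thesis by (auto dest!: ex1_implies_ex)
qed

text \<open>Induction along the stages. The premise on cells may use the equality on the stage
  below, without which the two bounding chains need not lie in the same module.\<close>

lemma tower_eq:
  assumes F: "F \<in> dg_hom R (Colim t) Y" and G: "G \<in> dg_hom R (Colim t) Y"
    and base: "F \<circ>\<^sub>d Leg t 0 = G \<circ>\<^sub>d Leg t 0"
    and cells: "\<And>i m T. (m, T) \<in> cells R n (Stage t i) \<Longrightarrow> F \<circ>\<^sub>d Leg t i = G \<circ>\<^sub>d Leg t i \<Longrightarrow>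
      bounding_chain_value R t F i (m, T) = bounding_chain_value R t G i (m, T)"
  shows "F = G"
proof -
  have eq: "F \<circ>\<^sub>d Leg t i = G \<circ>\<^sub>d Leg t i" for i
  proof (induction i)
    case 0
    show ?case by (rule base)
  next
    case (Suc i)
    note L = tower_leg[of "Suc i"]
    show ?case
    proof (rule attach_eq[OF tower_attach tower_map dg_comp_hom[OF L F] dg_comp_hom[OF L G]])
      show "F \<circ>\<^sub>d Leg t (Suc i) \<circ>\<^sub>d StageMap t i = G \<circ>\<^sub>d Leg t (Suc i) \<circ>\<^sub>d StageMap t i"
        using dg_comp_assoc[OF tower_map L F] dg_comp_assoc[OF tower_map L G] Suc by (simp add: tower_leg_Suc)
      fix m T assume c: "(m, T) \<in> cells R n (Stage t i)"
      note a = attach_hom(1)[OF tower_attach tower_map c]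
      show "mor (F \<circ>\<^sub>d Leg t (Suc i) \<circ>\<^sub>d Attach t i (m, T)) (Num 3) (Num 4) (m + 1) (Scal \<one>\<^bsub>R\<^esub>) =
        mor (G \<circ>\<^sub>d Leg t (Suc i) \<circ>\<^sub>d Attach t i (m, T)) (Num 3) (Num 4) (m + 1) (Scal \<one>\<^bsub>R\<^esub>)"
        using cells[OF c Suc] dg_comp_assoc[OF a L F] dg_comp_assoc[OF a L G]
        by (simp add: bounding_chain_value_def cell_map_def)
    qed
  qed
  have "(F \<circ>\<^sub>d Leg t (Suc i)) \<circ>\<^sub>d StageMap t i = F \<circ>\<^sub>d Leg t i" for i
    using dg_comp_assoc[OF tower_map tower_leg[of "Suc i"] F] by (simp add: tower_leg_Suc)
  from tower_colimit_un[OF dg_comp_hom[OF tower_leg F] this] show ?thesis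
    by (rule ex1_eq) (simp_all add: F G eq)
qed

text \<open>All of this is read off from the square that attaches the cell: restricted along
  \<open>S_fun\<close>, the cell map is \<open>T\<close> followed by the leg. In particular the
  chain bounds the image of the attaching cycle.\<close>

lemma bounding_chain:
  assumes c: "(m, T) \<in> cells R n (Stage t i)" and F: "F \<in> dg_hom R (Colim t) Y"
  shows "ob (F \<circ>\<^sub>d cell_map t i (m, T)) (Num 3) = ob (F \<circ>\<^sub>d Leg t i) (ob T (Num 1))" (is "?o3 = ?x")
    "ob (F \<circ>\<^sub>d cell_map t i (m, T)) (Num 4) = ob (F \<circ>\<^sub>d Leg t i) (ob T (Num 2))" (is "?o4 = ?y")
    "bounding_chain_value R t F i (m, T) \<in> Mor Y (ob (F \<circ>\<^sub>d Leg t i) (ob T (Num 1))) (ob (F \<circ>\<^sub>d Leg t i) (ob T (Num 2))) (m + 1)"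
    "Dif (Hom Y (ob (F \<circ>\<^sub>d Leg t i) (ob T (Num 1))) (ob (F \<circ>\<^sub>d Leg t i) (ob T (Num 2)))) (m + 1) (bounding_chain_value R t F i (m, T)) =
      mor (F \<circ>\<^sub>d Leg t i) (ob T (Num 1)) (ob T (Num 2)) m (mor T (Num 1) (Num 2) m (Scal \<one>\<^bsub>R\<^esub>))"
    "ob (F \<circ>\<^sub>d Leg t i) (ob T (Num 1)) \<in> Obj Y" "ob (F \<circ>\<^sub>d Leg t i) (ob T (Num 2)) \<in> Obj Y"
proof -
  note T = cell_boundary[OF c] and a = attach_hom[OF tower_attach tower_map c]
  note cm = dg_comp_hom[OF a(1) tower_leg[of "Suc i"], folded cell_map_def]
  note Fc = dg_comp_hom[OF cm F]
  have "cell_map t i (m, T) \<circ>\<^sub>d S_fun R m = Leg t i \<circ>\<^sub>d T"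
    unfolding cell_map_def
    using dg_comp_assoc[OF a(3,1) tower_leg[of "Suc i"]] a(2) dg_comp_assoc[OF T(1) tower_map tower_leg[of "Suc i"]]
    by (simp add: tower_leg_Suc)
  then have S: "F \<circ>\<^sub>d cell_map t i (m, T) \<circ>\<^sub>d S_fun R m = F \<circ>\<^sub>d Leg t i \<circ>\<^sub>d T"
    using dg_comp_assoc[OF a(3) cm F] dg_comp_assoc[OF T(1) tower_leg[of i] F] by simp
  have DT: "Dom T = C_cat R m" using dg_homD(2)[OF T(1)] .
  show o: "?o3 = ?x" "?o4 = ?y"
    using arg_cong[OF S, of "\<lambda>H. ob H (Num 1)"] arg_cong[OF S, of "\<lambda>H. ob H (Num 2)"]
    using dg_comp_simps(3)[of "Num 1" T "F \<circ>\<^sub>d Leg t i"] dg_comp_simps(3)[of "Num 2" T "F \<circ>\<^sub>d Leg t i"] DT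
    by simp_all
  interpret Fc: dgf R "F \<circ>\<^sub>d cell_map t i (m, T)" using Fc by (rule dgf_hom)
  interpret R: cring R by (rule Fc.D.cring)
  let ?D = "D_cat R (m + 1) :: ('r, ('r, 'a) univ) dgcat" and ?C = "C_cat R m :: ('r, ('r, 'a) univ) dgcat"
  have top: "Scal \<one>\<^bsub>R\<^esub> \<in> Mor ?D (Num 3) (Num 4) (m + 1)" by (simp add: scalar_degree_def)
  have one: "Scal \<one>\<^bsub>R\<^esub> \<in> Mor ?C (Num 1) (Num 2) m" by (simp add: scalar_degree_def)
  note d = dg_homD(2,3)[OF Fc]
  have b: "bounding_chain_value R t F i (m, T) = mor (F \<circ>\<^sub>d cell_map t i (m, T)) (Num 3) (Num 4) (m + 1) (Scal \<one>\<^bsub>R\<^esub>)"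
    by (simp add: bounding_chain_value_def)
  show "bounding_chain_value R t F i (m, T) \<in> Mor Y ?x ?y (m + 1)"
    unfolding b o[symmetric] using Fc.mor_mor[unfolded d, OF _ _ top] by simp
  have Sm: "mor (S_fun R m :: ('r, ('r, 'a) univ) dgfun) (Num 1) (Num 2) m (Scal \<one>\<^bsub>R\<^esub>) = Scal \<one>\<^bsub>R\<^esub>"
    unfolding S_fun_def by (rule mk_dgfun_simps(4)) (use one in simp_all)
  have 1: "mor (F \<circ>\<^sub>d cell_map t i (m, T) \<circ>\<^sub>d S_fun R m) (Num 1) (Num 2) m (Scal \<one>\<^bsub>R\<^esub>) =
      mor (F \<circ>\<^sub>d cell_map t i (m, T)) (ob (S_fun R m) (Num 1)) (ob (S_fun R m) (Num 2)) m (mor (S_fun R m) (Num 1) (Num 2) m (Scal \<one>\<^bsub>R\<^esub>))"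
    by (rule dg_comp_simps(4)) (use one in simp_all)
  have 2: "mor (F \<circ>\<^sub>d Leg t i \<circ>\<^sub>d T) (Num 1) (Num 2) m (Scal \<one>\<^bsub>R\<^esub>) =
      mor (F \<circ>\<^sub>d Leg t i) (ob T (Num 1)) (ob T (Num 2)) m (mor T (Num 1) (Num 2) m (Scal \<one>\<^bsub>R\<^esub>))"
    by (rule dg_comp_simps(4)) (use one DT in simp_all)
  have "Dif (Hom Y ?o3 ?o4) (m + 1) (bounding_chain_value R t F i (m, T)) =
    mor (F \<circ>\<^sub>d cell_map t i (m, T)) (Num 3) (Num 4) m (Scal \<one>\<^bsub>R\<^esub>)"
    unfolding b using Fc.mor_dif[unfolded d, OF _ _ top, of m] by simp
  also have "\<dots> = mor (F \<circ>\<^sub>d Leg t i \<circ>\<^sub>d T) (Num 1) (Num 2) m (Scal \<one>\<^bsub>R\<^esub>)"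
    using 1 Sm by (simp add: S)
  finally show "Dif (Hom Y ?x ?y) (m + 1) (bounding_chain_value R t F i (m, T)) =
      mor (F \<circ>\<^sub>d Leg t i) (ob T (Num 1)) (ob T (Num 2)) m (mor T (Num 1) (Num 2) m (Scal \<one>\<^bsub>R\<^esub>))"
    unfolding o 2 .
  show "?x \<in> Obj Y" "?y \<in> Obj Y" unfolding o[symmetric] using Fc.ob_closed[unfolded d] by auto
qed

lemma from_base_hom: "from_base t i \<in> dg_hom R A (Stage t i)" "Leg t i \<circ>\<^sub>d from_base t i = Leg t 0"
proof (induction i)
  case 0
  show "from_base t 0 \<in> dg_hom R A (Stage t 0)" "Leg t 0 \<circ>\<^sub>d from_base t 0 = Leg t 0"
    using dg_homD(4)[OF tower_map[of 0]] dg_comp_id_right[OF tower_leg[of 0]] dg_id_hom by (simp_all add: tower_base)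
next
  case (Suc i)
  show "from_base t (Suc i) \<in> dg_hom R A (Stage t (Suc i))"
    using dg_comp_hom[OF Suc(1) tower_map] by simp
  show "Leg t (Suc i) \<circ>\<^sub>d from_base t (Suc i) = Leg t 0"
    using dg_comp_assoc[OF Suc(1) tower_map tower_leg[of "Suc i"]] Suc(2) by (simp add: tower_leg_Suc)
qed

end

section \<open>The coskeleton\<close>

text \<open>
  \<open>cosk N A\<close> agrees with \<open>A\<close> up to degree \<open>N\<close> and has the \<open>N\<close>-cycles of \<open>A\<close> in degree \<open>N + 1\<close>, with
  their inclusion as differential; cycles of degree at least \<open>N\<close> bound uniquely in it.
\<close>

definition cosk_complex :: "int \<Rightarrow> ('r, 'u) complex \<Rightarrow> ('r, 'u) complex" where
  "cosk_complex N M =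
     \<lparr>Gr = (\<lambda>i. if i \<le> N then Gr M i
                else if i = N + 1 then (Gr M N)\<lparr>carrier := cycles M N\<rparr>
                else zero_module (Gr M i)),
      Dif = (\<lambda>i x. if i \<le> N then Dif M i x else if i = N + 1 then x
                else if i = N + 2 then \<zero>\<^bsub>Gr M N\<^esub> else \<zero>\<^bsub>Gr M (i - 1)\<^esub>)\<rparr>"

text \<open>The canonical map to the coskeleton: a chain of degree \<open>N + 1\<close> is recorded
  by the cycle that it fills.\<close>

definition cosk_map :: "int \<Rightarrow> ('r, 'u) complex \<Rightarrow> int \<Rightarrow> 'u \<Rightarrow> 'u" where
  "cosk_map N M i x = (if i \<le> N then x else if i = N + 1 then Dif M i x else \<zero>\<^bsub>Gr M i\<^esub>)"

text \<open>A morphism of degree \<open>N + 1\<close> is a cycle of degree \<open>N\<close>. Degree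
  0 acts on it by composition in \<open>A\<close>, while morphisms of lower degree whose composite
  has degree \<open>N + 1\<close> compose to the boundary of that composite.\<close>

definition cosk :: "int \<Rightarrow> ('r, 'u) dgcat \<Rightarrow> ('r, 'u) dgcat" where
  "cosk N A =
     \<lparr>Obj = Obj A,
      Hom = (\<lambda>x y. cosk_complex N (Hom A x y)),
      Comp = (\<lambda>x y z i j g f.
        if i = N + 1 \<and> j = 0 then Comp A x y z N 0 g f
        else if i = 0 \<and> j = N + 1 then Comp A x y z 0 N g f
        else if i \<le> N \<and> j \<le> N then cosk_map N (Hom A x z) (i + j) (Comp A x y z i j g f)
        else \<zero>\<^bsub>Gr (cosk_complex N (Hom A x z)) (i + j)\<^esub>),
      Ident = Ident A\<rparr>"

lemma cosk_simps [simp]: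
  "Obj (cosk N A) = Obj A" "Hom (cosk N A) x y = cosk_complex N (Hom A x y)" "Ident (cosk N A) = Ident A"
  by (simp_all add: cosk_def)

lemma cosk_Gr:
  "i \<le> N \<Longrightarrow> Gr (cosk_complex N M) i = Gr M i"
  "i = N + 1 \<Longrightarrow> Gr (cosk_complex N M) i = (Gr M N)\<lparr>carrier := cycles M N\<rparr>"
  "i > N + 1 \<Longrightarrow> Gr (cosk_complex N M) i = zero_module (Gr M i)"
  by (simp_all add: cosk_complex_def)

lemma cosk_Dif:
  "i \<le> N \<Longrightarrow> Dif (cosk_complex N M) i x = Dif M i x"
  "i = N + 1 \<Longrightarrow> Dif (cosk_complex N M) i x = x"
  "i > N + 1 \<Longrightarrow> Dif (cosk_complex N M) i x = \<zero>\<^bsub>Gr (cosk_complex N M) (i - 1)\<^esub>"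
  by (auto simp: cosk_complex_def)

lemma cosk_Comp:
  "Comp (cosk N A) x y z (N + 1) 0 g f = Comp A x y z N 0 g f"
  "0 < N \<Longrightarrow> Comp (cosk N A) x y z 0 (N + 1) g f = Comp A x y z 0 N g f"
  "i \<le> N \<Longrightarrow> j \<le> N \<Longrightarrow>
   Comp (cosk N A) x y z i j g f = cosk_map N (Hom A x z) (i + j) (Comp A x y z i j g f)"
  "i \<ge> N + 1 \<or> j \<ge> N + 1 \<Longrightarrow> \<not> (i = N + 1 \<and> j = 0) \<Longrightarrow> \<not> (i = 0 \<and> j = N + 1) \<Longrightarrow>
   Comp (cosk N A) x y z i j g f = \<zero>\<^bsub>Gr (cosk_complex N (Hom A x z)) (i + j)\<^esub>"
  by (auto simp: cosk_def)

lemma cosk_map_simps [simp]: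
  "i \<le> N \<Longrightarrow> cosk_map N M i x = x"
  "i = N + 1 \<Longrightarrow> cosk_map N M i x = Dif M i x"
  "i > N + 1 \<Longrightarrow> cosk_map N M i x = \<zero>\<^bsub>Gr M i\<^esub>"
  by (simp_all add: cosk_map_def)

lemma module_cycles:
  assumes M: "chain_complex R M"
  shows "Module.module R ((Gr M i)\<lparr>carrier := cycles M i\<rparr>)"
proof -
  interpret Mi: Module.module R "Gr M i" by (rule complex_module[OF M])
  interpret Mp: Module.module R "Gr M (i - 1)" by (rule complex_module[OF M])
  note l = complex_linear[OF M, of i]
  show ?thesis
    by (rule module_subset[OF Mi.module_axioms])
      (auto simp: cycles_def linear_map_add[OF l] linear_map_smult[OF l] Mp.smult_r_null
        linear_map_inv[OF Mi.module_axioms Mp.module_axioms l] linear_map_zero[OF Mi.module_axioms Mp.module_axioms l])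
qed

text \<open>An additive inverse is described relative to the carrier, so passing to the cycles
  requires comparing the two inverses.\<close>

lemma inv_carrier_update:
  assumes M: "abelian_group M" and N: "abelian_group (M\<lparr>carrier := S\<rparr>)" and S: "S \<subseteq> carrier M" "x \<in> S"
  shows "\<ominus>\<^bsub>M\<lparr>carrier := S\<rparr>\<^esub> x = \<ominus>\<^bsub>M\<^esub> x"
proof -
  interpret M: abelian_group M by fact
  interpret N: abelian_group "M\<lparr>carrier := S\<rparr>" by fact
  have "\<ominus>\<^bsub>M\<lparr>carrier := S\<rparr>\<^esub> x \<in> S" using N.a_inv_closed S by simp
  moreover have "\<ominus>\<^bsub>M\<lparr>carrier := S\<rparr>\<^esub> x \<oplus>\<^bsub>M\<^esub> x = \<zero>\<^bsub>M\<^esub>" using N.l_neg[of x] S by simp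
  ultimately show ?thesis using M.minus_equality S by (metis subsetD)
qed

context
  fixes R :: "'r ring" and M :: "('r, 'u) complex" and N :: int
  assumes M: "chain_complex R M"
begin

lemma cosk_module: "Module.module R (Gr (cosk_complex N M) i)"
  by (simp add: cosk_complex_def complex_module[OF M] module_cycles[OF M] module_zero_module)

lemma cosk_dif_linear: "linear_map R (Gr (cosk_complex N M) i) (Gr (cosk_complex N M) (i - 1)) (Dif (cosk_complex N M) i)"
proof -
  consider "i \<le> N" | "i = N + 1" | "i > N + 1" by linarith
  then show ?thesis
  proof cases
    case 1
    then have "Dif (cosk_complex N M) i = Dif M i" by (intro ext) (simp add: cosk_Dif)
    then show ?thesis using 1 complex_linear[OF M, of i] by (simp add: cosk_Gr)
  next
    case 2
    then show ?thesis by (simp add: cosk_Gr cosk_Dif linear_map_def cycles_def Pi_iff)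
  next
    case 3
    have "Dif (cosk_complex N M) i = (\<lambda>x. \<zero>\<^bsub>Gr (cosk_complex N M) (i - 1)\<^esub>)"
      using 3 by (intro ext) (simp add: cosk_Dif)
    then show ?thesis by (simp add: linear_map_const_zero cosk_module)
  qed
qed

lemma chain_complex_cosk: "chain_complex R (cosk_complex N M)"
proof (rule chain_complexI)
  fix i x assume x: "x \<in> carrier (Gr (cosk_complex N M) i)"
  consider "i \<le> N" | "i = N + 1" | "i > N + 1" by linarith
  then show "Dif (cosk_complex N M) (i - 1) (Dif (cosk_complex N M) i x) = \<zero>\<^bsub>Gr (cosk_complex N M) (i - 2)\<^esub>"
  proof cases
    case 1
    then show ?thesis using x complex_dif_dif[OF M, of x i] by (simp add: cosk_Gr cosk_Dif)
  next
    case 2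
    then show ?thesis using x by (simp add: cosk_Gr cosk_Dif cycles_def)
  next
    case 3
    then show ?thesis
      using linear_map_zero[OF cosk_module cosk_module cosk_dif_linear, of "i - 1"] by (simp add: cosk_Dif)
  qed
qed (fact cosk_module cosk_dif_linear)+

lemma cosk_map_linear: "linear_map R (Gr M i) (Gr (cosk_complex N M) i) (cosk_map N M i)"
proof -
  consider "i \<le> N" | "i = N + 1" | "i > N + 1" by linarith
  then show ?thesis
  proof cases
    case 1
    then show ?thesis by (simp add: cosk_Gr linear_map_def)
  next
    case 2
    note l = complex_linear[OF M, of i]
    have "Dif M i x \<in> cycles M N" if "x \<in> carrier (Gr M i)" for x
      using 2 that complex_dif_dif[OF M that, of "N" "N - 1"] linear_map_closed[OF l that]
      by (simp add: cycles_def)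
    then show ?thesis using 2 linear_map_add[OF l] linear_map_smult[OF l]
      by (simp add: cosk_Gr linear_map_def Pi_iff)
  next
    case 3
    have "linear_map R (Gr M i) (Gr (cosk_complex N M) i) (\<lambda>x. \<zero>\<^bsub>Gr (cosk_complex N M) i\<^esub>)"
      by (rule linear_map_const_zero[OF cosk_module])
    moreover have "cosk_map N M i = (\<lambda>x. \<zero>\<^bsub>Gr (cosk_complex N M) i\<^esub>)"
      using 3 by (intro ext) (simp add: cosk_Gr)
    ultimately show ?thesis by simp
  qed
qed

lemma cosk_map_dif:
  assumes x: "x \<in> carrier (Gr M i)"
  shows "cosk_map N M (i - 1) (Dif M i x) = Dif (cosk_complex N M) i (cosk_map N M i x)"
proof -
  consider "i \<le> N" | "i = N + 1" | "i = N + 2" | "i > N + 2" by linarith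
  then show ?thesis
  proof cases
    case 1
    then show ?thesis by (simp add: cosk_Dif(1))
  next
    case 2
    then show ?thesis by (simp add: cosk_Dif(2))
  next
    case 3
    then have "i - 1 = N + 1" by simp
    \<comment> \<open>The value lies in degree \<open>N + 1\<close> of the coskeleton, whose zero is
      that of \<open>Gr M N\<close>.\<close>
    have "Dif (cosk_complex N M) i y = \<zero>\<^bsub>Gr M N\<^esub>" for y
      using 3 by (simp add: cosk_complex_def)
    moreover have "Dif M (N + 1) (Dif M i x) = \<zero>\<^bsub>Gr M N\<^esub>"
      by (rule complex_dif_dif[OF M x]) (use 3 in simp_all)
    ultimately show ?thesis by (simp add: \<open>i - 1 = N + 1\<close>)
  next
    case 4
    then have "Dif (cosk_complex N M) i y = \<zero>\<^bsub>Gr M (i - 1)\<^esub>" for y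
      by (simp add: cosk_complex_def)
    moreover have "cosk_map N M (i - 1) y = \<zero>\<^bsub>Gr M (i - 1)\<^esub>" for y
      using 4 by (simp add: cosk_map_def)
    ultimately show ?thesis by simp
  qed
qed

end

section \<open>The coskeleton of a positively graded dg category\<close>

lemma linear_map_restrict_codomain:
  "linear_map R M N f \<Longrightarrow> (\<And>x. x \<in> carrier M \<Longrightarrow> f x \<in> S) \<Longrightarrow> linear_map R M (N\<lparr>carrier := S\<rparr>) f"
  by (auto simp: linear_map_def)

lemma linear_map_restrict_domain:
  "linear_map R M N f \<Longrightarrow> S \<subseteq> carrier M \<Longrightarrow> linear_map R (M\<lparr>carrier := S\<rparr>) N f"
  by (simp add: linear_map_def Pi_iff subset_iff)

text \<open>Positivity makes every morphism of degree 0 a cycle, so that degree 0 acts on the cycles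
  placed in degree \<open>N + 1\<close>; \<open>0 < N\<close> keeps degree 0 of the coskeleton equal
  to that of \<open>A\<close>.\<close>

locale positive_dg = dg_category +
  fixes N :: int
  assumes pos: "positively_graded A" and N: "0 < N"
begin

abbreviation "Z \<equiv> cosk N A"

lemma neg_zero: "x \<in> Obj A \<Longrightarrow> y \<in> Obj A \<Longrightarrow> f \<in> Mor A x y i \<Longrightarrow> i < 0 \<Longrightarrow> f = \<zero>\<^bsub>HomGr A x y i\<^esub>"
  using pos by (auto simp: positively_graded_def)

lemma degree0_cycle: "x \<in> Obj A \<Longrightarrow> y \<in> Obj A \<Longrightarrow> f \<in> Mor A x y 0 \<Longrightarrow> f \<in> cycles (Hom A x y) 0"
  using neg_zero[OF _ _ dif_closed[of x y f 0 "-1"]] by (simp add: cycles_def)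

lemma cosk_mor:
  "i \<le> N \<Longrightarrow> f \<in> Mor Z x y i \<longleftrightarrow> f \<in> Mor A x y i"
  "f \<in> Mor Z x y (N + 1) \<longleftrightarrow> f \<in> cycles (Hom A x y) N"
  "i > N + 1 \<Longrightarrow> f \<in> Mor Z x y i \<longleftrightarrow> f = \<zero>\<^bsub>HomGr Z x y i\<^esub>"
  by (simp_all add: cosk_Gr)

lemma cosk_low: "f \<in> Mor Z x y i \<Longrightarrow> i \<le> N \<Longrightarrow> f \<in> Mor A x y i"
  by (simp add: cosk_Gr(1))

lemma cosk_low0: "f \<in> Mor Z x y i \<Longrightarrow> i = 0 \<Longrightarrow> f \<in> Mor A x y 0"
  using N cosk_low by auto

lemma cosk_top: "f \<in> Mor Z x y i \<Longrightarrow> i = N + 1 \<Longrightarrow> f \<in> cycles (Hom A x y) N"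
  by (simp add: cosk_Gr(2))

text \<open>There are no nonzero morphisms outside the degrees 0 to \<open>N + 1\<close>, which
  confines every identity below to finitely many patterns of degrees.\<close>

lemma cosk_trivial:
  assumes "x \<in> Obj A" "y \<in> Obj A" "f \<in> Mor Z x y i" "g \<in> Mor Z x y i" "i < 0 \<or> i > N + 1"
  shows "f = g"
proof (cases "i < 0")
  case True
  then have "f \<in> Mor A x y i" "g \<in> Mor A x y i" using assms N by (simp_all add: cosk_Gr)
  then show ?thesis using neg_zero[OF assms(1,2) _ True] by metis
next
  case False
  then show ?thesis using assms by (simp add: cosk_Gr)
qed

lemma cosk_hom_module: "x \<in> Obj A \<Longrightarrow> y \<in> Obj A \<Longrightarrow> Module.module R (HomGr Z x y i)"
  using cosk_module[OF hom_complex] by simp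

lemma cosk_neg: "x \<in> Obj A \<Longrightarrow> y \<in> Obj A \<Longrightarrow> f \<in> Mor Z x y i \<Longrightarrow> i < 0 \<Longrightarrow> f = \<zero>\<^bsub>HomGr Z x y i\<^esub>"
  using cosk_trivial[of x y f i] abelian_groupE(2)[OF module_abelian_group[OF cosk_hom_module]] by blast

lemma cosk_map_lin: "x \<in> Obj A \<Longrightarrow> y \<in> Obj A \<Longrightarrow>
    linear_map R (HomGr A x y i) (HomGr Z x y i) (cosk_map N (Hom A x y) i)"
  using cosk_map_linear[OF hom_complex] by simp

lemma cosk_comp_linear_right:
  assumes o: "x \<in> Obj A" "y \<in> Obj A" "z \<in> Obj A" and g: "g \<in> Mor Z y z i"
  shows "linear_map R (HomGr Z x y j) (HomGr Z x z (i + j)) (\<lambda>f. Comp Z x y z i j g f)"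
proof -
  consider "i = N + 1" "j = 0" | "i = 0" "j = N + 1" | "i \<le> N" "j \<le> N"
    | "i \<ge> N + 1 \<or> j \<ge> N + 1" "\<not> (i = N + 1 \<and> j = 0)" "\<not> (i = 0 \<and> j = N + 1)" by linarith
  then show ?thesis
  proof cases
    case 1
    then have g': "g \<in> cycles (Hom A y z) N" using g cosk_mor(2) by simp
    have "linear_map R (HomGr A x y 0) ((HomGr A x z N)\<lparr>carrier := cycles (Hom A x z) N\<rparr>) (Comp A x y z N 0 g)"
      using comp_linear_right[OF o cycle_closed[OF g'], of 0] comp_cycle[OF o g' degree0_cycle]
      by (intro linear_map_restrict_codomain) (auto simp: o)
    then show ?thesis using 1 N by (simp add: cosk_Gr cosk_Comp)
  next
    case 2
    then have g': "g \<in> cycles (Hom A y z) 0" using g cosk_mor(1)[of 0] N o degree0_cycle by simp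
    have "linear_map R ((HomGr A x y N)\<lparr>carrier := cycles (Hom A x y) N\<rparr>)
        ((HomGr A x z N)\<lparr>carrier := cycles (Hom A x z) N\<rparr>) (Comp A x y z 0 N g)"
      using comp_linear_right[OF o cycle_closed[OF g'], of N] comp_cycle[OF o g']
      by (intro linear_map_restrict_codomain linear_map_restrict_domain) (auto simp: cycles_def)
    then show ?thesis using 2 N by (simp add: cosk_Gr cosk_Comp)
  next
    case 3
    then have "g \<in> Mor A y z i" using g cosk_mor(1) by simp
    from linear_map_compose[OF comp_linear_right[OF o this, of j] cosk_map_lin[OF o(1,3)]]
    show ?thesis using 3 by (simp add: cosk_Gr(1) cosk_Comp)
  next
    case 4
    then show ?thesis
      using linear_map_const_zero[OF cosk_hom_module[OF o(1,3)]] by (simp add: cosk_Comp)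
  qed
qed

lemma cosk_comp_linear_left:
  assumes o: "x \<in> Obj A" "y \<in> Obj A" "z \<in> Obj A" and f: "f \<in> Mor Z x y j"
  shows "linear_map R (HomGr Z y z i) (HomGr Z x z (i + j)) (\<lambda>g. Comp Z x y z i j g f)"
proof -
  consider "i = N + 1" "j = 0" | "i = 0" "j = N + 1" | "i \<le> N" "j \<le> N"
    | "i \<ge> N + 1 \<or> j \<ge> N + 1" "\<not> (i = N + 1 \<and> j = 0)" "\<not> (i = 0 \<and> j = N + 1)" by linarith
  then show ?thesis
  proof cases
    case 1
    then have f': "f \<in> cycles (Hom A x y) 0" using f cosk_mor(1)[of 0] N o degree0_cycle by simp
    have "linear_map R ((HomGr A y z N)\<lparr>carrier := cycles (Hom A y z) N\<rparr>)
        ((HomGr A x z N)\<lparr>carrier := cycles (Hom A x z) N\<rparr>) (\<lambda>g. Comp A x y z N 0 g f)"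
      using comp_linear_left[OF o cycle_closed[OF f'], of N] comp_cycle[OF o _ f']
      by (intro linear_map_restrict_codomain linear_map_restrict_domain) (auto simp: cycles_def)
    then show ?thesis using 1 N by (simp add: cosk_Gr cosk_Comp)
  next
    case 2
    then have f': "f \<in> cycles (Hom A x y) N" using f cosk_mor(2) by simp
    have "linear_map R (HomGr A y z 0) ((HomGr A x z N)\<lparr>carrier := cycles (Hom A x z) N\<rparr>) (\<lambda>g. Comp A x y z 0 N g f)"
      using comp_linear_left[OF o cycle_closed[OF f'], of 0] comp_cycle[OF o degree0_cycle f']
      by (intro linear_map_restrict_codomain) (auto simp: o)
    then show ?thesis using 2 N by (simp add: cosk_Gr cosk_Comp)
  next
    case 3
    then have "f \<in> Mor A x y j" using f cosk_mor(1) by simp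
    from linear_map_compose[OF comp_linear_left[OF o this, of i] cosk_map_lin[OF o(1,3)]]
    show ?thesis using 3 by (simp add: cosk_Gr(1) cosk_Comp)
  next
    case 4
    then show ?thesis
      using linear_map_const_zero[OF cosk_hom_module[OF o(1,3)]] by (simp add: cosk_Comp)
  qed
qed

lemma cosk_comp_closed:
  assumes "x \<in> Obj A" "y \<in> Obj A" "z \<in> Obj A" "g \<in> Mor Z y z i" "f \<in> Mor Z x y j" "k = i + j"
  shows "Comp Z x y z i j g f \<in> Mor Z x z k"
  using linear_map_closed[OF cosk_comp_linear_right[OF assms(1-4)] assms(5)] assms(6) by simp

lemma cosk_comp_zero_right:
  assumes o: "x \<in> Obj A" "y \<in> Obj A" "z \<in> Obj A" and "g \<in> Mor Z y z i" "k = i + j"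
  shows "Comp Z x y z i j g \<zero>\<^bsub>HomGr Z x y j\<^esub> = \<zero>\<^bsub>HomGr Z x z k\<^esub>"
  using linear_map_zero[OF cosk_hom_module[OF o(1,2)] cosk_hom_module[OF o(1,3)] cosk_comp_linear_right[OF assms(1-4)]] assms(5)
  by simp

lemma cosk_comp_zero_left:
  assumes o: "x \<in> Obj A" "y \<in> Obj A" "z \<in> Obj A" and "f \<in> Mor Z x y j" "k = i + j"
  shows "Comp Z x y z i j \<zero>\<^bsub>HomGr Z y z i\<^esub> f = \<zero>\<^bsub>HomGr Z x z k\<^esub>"
  using linear_map_zero[OF cosk_hom_module[OF o(2,3)] cosk_hom_module[OF o(1,3)] cosk_comp_linear_left[OF assms(1-4)]] assms(5)
  by simp

text \<open>If the total degree is at most \<open>N\<close>, this is associativity in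
  \<open>A\<close>. A factor of degree \<open>N + 1\<close> forces the others to have degree 0 and
  is composed as a cycle. When degrees at most \<open>N\<close> add up to \<open>N + 1\<close>, both
  sides are the boundary of the triple composite in \<open>A\<close>.\<close>

lemma cosk_assoc:
  assumes o: "w \<in> Obj A" "x \<in> Obj A" "y \<in> Obj A" "z \<in> Obj A"
    and h: "h \<in> Mor Z y z i" and g: "g \<in> Mor Z x y j" and f: "f \<in> Mor Z w x k"
  shows "Comp Z w y z i (j + k) h (Comp Z w x y j k g f) = Comp Z w x z (i + j) k (Comp Z x y z i j h g) f"
    (is "?L = ?R")
proof -
  have gf: "Comp Z w x y j k g f \<in> Mor Z w y (j + k)" using o g f by (intro cosk_comp_closed) auto
  have hg: "Comp Z x y z i j h g \<in> Mor Z x z (i + j)" using o g h by (intro cosk_comp_closed) auto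
  have LR: "?L \<in> Mor Z w z (i + j + k)" "?R \<in> Mor Z w z (i + j + k)"
    by (rule cosk_comp_closed[OF o(1,3,4) h gf]; simp) (rule cosk_comp_closed[OF o(1,2,4) hg f]; simp)
  consider "i + j + k > N + 1 \<or> i + j + k < 0" | "i < 0" | "j < 0" | "k < 0"
    | "i \<ge> 0" "j \<ge> 0" "k \<ge> 0" "i + j + k \<le> N + 1" by linarith
  then show ?thesis
  proof cases
    case 1
    then show ?thesis using cosk_trivial[OF o(1,4) LR] by blast
  next
    case 2
    then have z: "h = \<zero>\<^bsub>HomGr Z y z i\<^esub>" using cosk_neg o h by blast
    have hg0: "Comp Z x y z i j h g = \<zero>\<^bsub>HomGr Z x z (i + j)\<^esub>"
      unfolding z by (rule cosk_comp_zero_left[OF o(2,3,4) g]) simp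
    have "?L = \<zero>\<^bsub>HomGr Z w z (i + j + k)\<^esub>"
      unfolding z by (rule cosk_comp_zero_left[OF o(1,3,4) gf]) simp
    moreover have "?R = \<zero>\<^bsub>HomGr Z w z (i + j + k)\<^esub>"
      unfolding hg0 by (rule cosk_comp_zero_left[OF o(1,2,4) f]) simp
    ultimately show ?thesis by simp
  next
    case 3
    then have z: "g = \<zero>\<^bsub>HomGr Z x y j\<^esub>" using cosk_neg o g by blast
    have gf0: "Comp Z w x y j k g f = \<zero>\<^bsub>HomGr Z w y (j + k)\<^esub>"
      unfolding z by (rule cosk_comp_zero_left[OF o(1,2,3) f]) simp
    have hg0: "Comp Z x y z i j h g = \<zero>\<^bsub>HomGr Z x z (i + j)\<^esub>"
      unfolding z by (rule cosk_comp_zero_right[OF o(2,3,4) h]) simp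
    have "?L = \<zero>\<^bsub>HomGr Z w z (i + j + k)\<^esub>"
      unfolding gf0 by (rule cosk_comp_zero_right[OF o(1,3,4) h]) simp
    moreover have "?R = \<zero>\<^bsub>HomGr Z w z (i + j + k)\<^esub>"
      unfolding hg0 by (rule cosk_comp_zero_left[OF o(1,2,4) f]) simp
    ultimately show ?thesis by simp
  next
    case 4
    then have z: "f = \<zero>\<^bsub>HomGr Z w x k\<^esub>" using cosk_neg o f by blast
    have gf0: "Comp Z w x y j k g f = \<zero>\<^bsub>HomGr Z w y (j + k)\<^esub>"
      unfolding z by (rule cosk_comp_zero_right[OF o(1,2,3) g]) simp
    have "?L = \<zero>\<^bsub>HomGr Z w z (i + j + k)\<^esub>"
      unfolding gf0 by (rule cosk_comp_zero_right[OF o(1,3,4) h]) simp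
    moreover have "?R = \<zero>\<^bsub>HomGr Z w z (i + j + k)\<^esub>"
      unfolding z by (rule cosk_comp_zero_right[OF o(1,2,4) hg]) simp
    ultimately show ?thesis by simp
  next
    case 5
    note c5 = 5
    have "i = N + 1 \<Longrightarrow> j = 0 \<and> k = 0" "j = N + 1 \<Longrightarrow> i = 0 \<and> k = 0" "k = N + 1 \<Longrightarrow> i = 0 \<and> j = 0"
      "i \<noteq> N + 1 \<Longrightarrow> i \<le> N" "j \<noteq> N + 1 \<Longrightarrow> j \<le> N" "k \<noteq> N + 1 \<Longrightarrow> k \<le> N"
      "i + j + k \<noteq> N + 1 \<Longrightarrow> i + j + k \<le> N"
      using c5 by auto
    then consider "i = N + 1" "j = 0" "k = 0" | "i = 0" "j = N + 1" "k = 0" | "i = 0" "j = 0" "k = N + 1"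
      | "i \<le> N" "j \<le> N" "k \<le> N" "i + j + k \<le> N" | "i \<le> N" "j \<le> N" "k \<le> N" "i + j + k = N + 1"
      by blast
    then show ?thesis
    proof cases
      case 1
      note m = cycle_closed[OF cosk_top[OF h 1(1)]] cosk_low0[OF g 1(2)] cosk_low0[OF f 1(3)]
      show ?thesis using comp_assoc[OF o m] 1 N by (simp add: cosk_Comp)
    next
      case 2
      note m = cosk_low0[OF h 2(1)] cycle_closed[OF cosk_top[OF g 2(2)]] cosk_low0[OF f 2(3)]
      show ?thesis using comp_assoc[OF o m] 2 N by (simp add: cosk_Comp)
    next
      case 3
      note m = cosk_low0[OF h 3(1)] cosk_low0[OF g 3(2)] cycle_closed[OF cosk_top[OF f 3(3)]]
      show ?thesis using comp_assoc[OF o m] 3 N by (simp add: cosk_Comp)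
    next
      case 4
      note m = cosk_low[OF h 4(1)] cosk_low[OF g 4(2)] cosk_low[OF f 4(3)]
      show ?thesis using comp_assoc[OF o m] 4 c5 by (simp add: cosk_Comp)
    next
      case 5
      note m = cosk_low[OF h 5(1)] cosk_low[OF g 5(2)] cosk_low[OF f 5(3)]
      have gfA: "Comp A w x y j k g f \<in> Mor A w y (j + k)" and hgA: "Comp A x y z i j h g \<in> Mor A x z (i + j)"
        using o m by (auto intro!: comp_closed)
      \<comment> \<open>For \<open>i = 0\<close> the inner composite has degree \<open>N + 1\<close>
        and is already a boundary; \<open>h\<close> is then a cycle, so composing with it commutes
        with \<open>d\<close>.\<close>
      have L: "?L = Dif (Hom A w z) (N + 1) (Comp A w y z i (j + k) h (Comp A w x y j k g f))"
      proof (cases "i = 0")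
        case True
        then have jk: "j + k = N + 1" using 5 by simp
        have hc: "h \<in> cycles (Hom A y z) 0" using m True o degree0_cycle by simp
        show ?thesis
          using dif_comp_cycle_left[OF o(1,3,4) hc gfA] 5 jk True N by (simp add: cosk_Comp)
      next
        case False
        then have "j + k \<le> N" using 5 c5 by simp
        then show ?thesis using 5 by (simp add: cosk_Comp add.assoc[symmetric])
      qed
      have R: "?R = Dif (Hom A w z) (N + 1) (Comp A w x z (i + j) k (Comp A x y z i j h g) f)"
      proof (cases "k = 0")
        case True
        then have ij: "i + j = N + 1" using 5 by simp
        have fc: "f \<in> cycles (Hom A w x) 0" using m True o degree0_cycle by simp
        show ?thesis
          using dif_comp_cycle_right[OF o(1,2,4) fc hgA] 5 ij True N by (simp add: cosk_Comp)
      next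
        case False
        then have "i + j \<le> N" using 5 c5 by simp
        then show ?thesis using 5 by (simp add: cosk_Comp)
      qed
      show ?thesis unfolding L R using comp_assoc[OF o m] by simp
    qed
  qed
qed

lemma chain_complex_Z: "x \<in> Obj A \<Longrightarrow> y \<in> Obj A \<Longrightarrow> chain_complex R (Hom Z x y)"
  using chain_complex_cosk[OF hom_complex] by simp

lemma cosk_dif_closed: "x \<in> Obj A \<Longrightarrow> y \<in> Obj A \<Longrightarrow> f \<in> Mor Z x y i \<Longrightarrow> k = i - 1 \<Longrightarrow> Dif (Hom Z x y) i f \<in> Mor Z x y k"
  using linear_map_closed[OF complex_linear[OF chain_complex_Z]] by blast

lemma cosk_dif_zero: "x \<in> Obj A \<Longrightarrow> y \<in> Obj A \<Longrightarrow> k = i - 1 \<Longrightarrow> Dif (Hom Z x y) i \<zero>\<^bsub>HomGr Z x y i\<^esub> = \<zero>\<^bsub>HomGr Z x y k\<^esub>"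
  using linear_map_zero[OF cosk_hom_module cosk_hom_module complex_linear[OF chain_complex_Z]] by blast

text \<open>Up to total degree \<open>N + 1\<close> this is the rule of \<open>A\<close>, except
  that a factor of degree \<open>N + 1\<close> is its own differential. In total degree
  \<open>N + 2\<close> the left-hand side is zero, and the two summands on the right must
  cancel.\<close>

lemma cosk_leibniz:
  assumes o: "x \<in> Obj A" "y \<in> Obj A" "z \<in> Obj A"
    and g: "g \<in> Mor Z y z i" and f: "f \<in> Mor Z x y j"
  shows "Dif (Hom Z x z) (i + j) (Comp Z x y z i j g f) =
    Comp Z x y z (i - 1) j (Dif (Hom Z y z) i g) f \<oplus>\<^bsub>HomGr Z x z (i + j - 1)\<^esub>
    koszul (HomGr Z x z (i + j - 1)) i (Comp Z x y z i (j - 1) g (Dif (Hom Z x y) j f))"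
    (is "?L = ?P \<oplus>\<^bsub>?M\<^esub> koszul ?M i ?Q")
proof -
  let ?d = "\<lambda>x y. Dif (Hom A x y)" and ?e = "\<lambda>x y. Dif (Hom Z x y)"
  interpret M: abelian_group ?M by (rule module_abelian_group[OF cosk_hom_module[OF o(1,3)]])
  interpret M': abelian_group "Gr (cosk_complex N (Hom A x z)) (i + j - 1)" using M.abelian_group_axioms by simp
  have gf: "Comp Z x y z i j g f \<in> Mor Z x z (i + j)" using o g f by (intro cosk_comp_closed) auto
  have dg: "?e y z i g \<in> Mor Z y z (i - 1)" and df: "?e x y j f \<in> Mor Z x y (j - 1)"
    by (rule cosk_dif_closed[OF o(2,3) g]; simp) (rule cosk_dif_closed[OF o(1,2) f]; simp)
  have L: "?L \<in> carrier ?M" by (rule cosk_dif_closed[OF o(1,3) gf]) simp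
  have P: "?P \<in> carrier ?M" by (rule cosk_comp_closed[OF o dg f]) simp
  have Q: "?Q \<in> carrier ?M" by (rule cosk_comp_closed[OF o g df]) simp
  have PQ: "?P \<oplus>\<^bsub>?M\<^esub> koszul ?M i ?Q \<in> carrier ?M" using P Q by simp
  have zero: "u = \<zero>\<^bsub>HomGr Z a b k\<^esub>" if "u \<in> Mor Z a b k" "k < 0 \<or> k > N + 1" "a \<in> Obj A" "b \<in> Obj A" for u a b k
    using cosk_trivial[OF that(3,4,1) _ that(2)] abelian_groupE(2)[OF module_abelian_group[OF cosk_hom_module[OF that(3,4)]]] .
  consider "i + j - 1 > N + 1 \<or> i + j - 1 < 0" | "i < 0 \<or> i > N + 1" | "j < 0 \<or> j > N + 1"
    | "i \<ge> 0" "j \<ge> 0" "i \<le> N + 1" "j \<le> N + 1" "i + j \<le> N + 2" by linarith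
  then show ?thesis
  proof cases
    case 1
    then show ?thesis using cosk_trivial[OF o(1,3) L PQ] by blast
  next
    case 2
    from zero[OF g this o(2,3)] have z: "g = \<zero>\<^bsub>HomGr Z y z i\<^esub>" .
    then have "?e y z i g = ?e y z i \<zero>\<^bsub>HomGr Z y z i\<^esub>" by (rule arg_cong)
    also have "\<dots> = \<zero>\<^bsub>HomGr Z y z (i - 1)\<^esub>" by (rule cosk_dif_zero[OF o(2,3)]) simp
    finally have dz: "?e y z i g = \<zero>\<^bsub>HomGr Z y z (i - 1)\<^esub>" .
    note z = z dz
    have "?L = \<zero>\<^bsub>?M\<^esub>"
      unfolding z(1) cosk_comp_zero_left[OF o f HOL.refl] by (rule cosk_dif_zero[OF o(1,3)]) simp
    moreover have "?P = \<zero>\<^bsub>?M\<^esub>" unfolding z(2) by (rule cosk_comp_zero_left[OF o f]) simp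
    moreover have "?Q = \<zero>\<^bsub>?M\<^esub>" unfolding z(1) by (rule cosk_comp_zero_left[OF o df]) simp
    ultimately show ?thesis by simp
  next
    case 3
    from zero[OF f this o(1,2)] have z: "f = \<zero>\<^bsub>HomGr Z x y j\<^esub>" .
    then have "?e x y j f = ?e x y j \<zero>\<^bsub>HomGr Z x y j\<^esub>" by (rule arg_cong)
    also have "\<dots> = \<zero>\<^bsub>HomGr Z x y (j - 1)\<^esub>" by (rule cosk_dif_zero[OF o(1,2)]) simp
    finally have dz: "?e x y j f = \<zero>\<^bsub>HomGr Z x y (j - 1)\<^esub>" .
    note z = z dz
    have "?L = \<zero>\<^bsub>?M\<^esub>"
      unfolding z(1) cosk_comp_zero_right[OF o g HOL.refl] by (rule cosk_dif_zero[OF o(1,3)]) simp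
    moreover have "?P = \<zero>\<^bsub>?M\<^esub>" unfolding z(1) by (rule cosk_comp_zero_right[OF o dg]) simp
    moreover have "?Q = \<zero>\<^bsub>?M\<^esub>" unfolding z(2) by (rule cosk_comp_zero_right[OF o g]) simp
    ultimately show ?thesis by simp
  next
    case 4
    note c4 = 4
    have Q0: "?Q = \<zero>\<^bsub>?M\<^esub>" if "j = 0"
    proof -
      have "?e x y j f = \<zero>\<^bsub>HomGr Z x y (j - 1)\<^esub>" using cosk_neg[OF o(1,2) df] that by simp
      then have "?Q = Comp Z x y z i (j - 1) g \<zero>\<^bsub>HomGr Z x y (j - 1)\<^esub>" by (rule arg_cong)
      also have "\<dots> = \<zero>\<^bsub>?M\<^esub>" by (rule cosk_comp_zero_right[OF o g]) simp
      finally show ?thesis .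
    qed
    have P0: "?P = \<zero>\<^bsub>?M\<^esub>" if "i = 0"
    proof -
      have "?e y z i g = \<zero>\<^bsub>HomGr Z y z (i - 1)\<^esub>" using cosk_neg[OF o(2,3) dg] that by simp
      then have "?P = Comp Z x y z (i - 1) j \<zero>\<^bsub>HomGr Z y z (i - 1)\<^esub> f" by (rule arg_cong)
      also have "\<dots> = \<zero>\<^bsub>?M\<^esub>" by (rule cosk_comp_zero_left[OF o f]) simp
      finally show ?thesis .
    qed
    have "i = N + 1 \<Longrightarrow> j = 0 \<or> j = 1" "j = N + 1 \<Longrightarrow> i = 0 \<or> i = 1"
      "i \<noteq> N + 1 \<Longrightarrow> i \<le> N" "j \<noteq> N + 1 \<Longrightarrow> j \<le> N"
      "i + j \<noteq> N + 1 \<Longrightarrow> i + j \<noteq> N + 2 \<Longrightarrow> i + j \<le> N"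
      using c4 by auto
    then consider "i = N + 1" "j = 0" | "i = N + 1" "j = 1" | "i = 0" "j = N + 1" | "i = 1" "j = N + 1"
      | "i \<le> N" "j \<le> N" "i + j \<le> N" | "i \<le> N" "j \<le> N" "i + j = N + 1" | "i \<le> N" "j \<le> N" "i + j = N + 2"
      by blast
    then show ?thesis
    proof cases
      case 1
      have e: "?L = ?P" using 1 N by (simp add: cosk_Comp cosk_Dif)
      show ?thesis unfolding e Q0[OF 1(2)] M.a_inv_zero if_cancel M.r_zero[OF P] by (rule HOL.refl)
    next
      case 2
      have gc: "g \<in> cycles (Hom A y z) N" by (rule cosk_top[OF g 2(1)])
      have fm: "f \<in> Mor A x y 1" using cosk_low[OF f] 2(2) N by simp
      have "?L = \<zero>\<^bsub>?M\<^esub>" using 2 N cosk_Dif(3)[of N "N + 1 + 1"] by (simp add: cosk_Comp(4) add.commute[of 2])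
      moreover have MN: "?M = (HomGr A x z N)\<lparr>carrier := cycles (Hom A x z) N\<rparr>" using 2 N by (simp add: cosk_Gr)
      have p: "?P = ?d x z (N + 1) (Comp A x y z N 1 g f)" using 2 N by (simp add: cosk_Comp cosk_Dif)
      moreover have q: "?Q = Comp A x y z N 0 g (?d x y 1 f)" using 2 N by (simp add: cosk_Comp cosk_Dif)
      \<comment> \<open>In \<open>A\<close> the boundary of \<open>g f\<close> carries the sign of
        the degree \<open>N\<close> of the cycle \<open>g\<close>, whereas the rule in
        \<open>Z\<close> uses its degree \<open>N + 1\<close> there. The opposite parities give the
        cancellation.\<close>
      have pq: "?P = koszul ?M N ?Q"
      proof -
        have "?P = koszul (HomGr A x z N) N ?Q"
          unfolding p q using dif_comp_cycle_left[OF o gc fm] by simp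
        moreover have "\<ominus>\<^bsub>?M\<^esub> ?Q = \<ominus>\<^bsub>HomGr A x z N\<^esub> ?Q"
          unfolding MN
        proof (rule inv_carrier_update[OF hom_group[OF o(1,3)]])
          show "abelian_group ((HomGr A x z N)\<lparr>carrier := cycles (Hom A x z) N\<rparr>)" using M.abelian_group_axioms MN by simp
          show "?Q \<in> cycles (Hom A x z) N" using Q MN by simp
        qed (auto simp: cycles_def)
        ultimately show ?thesis by simp
      qed
      moreover have "?P \<oplus>\<^bsub>?M\<^esub> koszul ?M i ?Q = \<zero>\<^bsub>?M\<^esub>"
      proof (cases "even i")
        case True
        then have "?P = \<ominus>\<^bsub>?M\<^esub> ?Q" using pq 2(1) by (simp only: even_plus_one_iff if_False)
        then show ?thesis using True M.l_neg[OF Q] by (simp only: if_True)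
      next
        case False
        then have "?P = ?Q" using pq 2(1) by (simp only: even_plus_one_iff if_True not_not)
        then show ?thesis using False M.r_neg[OF Q] by (simp only: if_False)
      qed
      ultimately show ?thesis by (simp only:)
    next
      case 3
      have e: "?L = ?Q" using 3 N by (simp add: cosk_Comp cosk_Dif)
      have k: "koszul ?M i ?Q = ?Q" using 3 by simp
      show ?thesis unfolding k e P0[OF 3(1)] M.l_zero[OF Q] by (rule HOL.refl)
    next
      case 4
      have fc: "f \<in> cycles (Hom A x y) N" by (rule cosk_top[OF f 4(2)])
      have gm: "g \<in> Mor A y z 1" using cosk_low[OF g] 4(1) N by simp
      have "?L = \<zero>\<^bsub>?M\<^esub>" using 4 N cosk_Dif(3)[of N "N + 1 + 1"] by (simp add: cosk_Comp(4) add.commute[of 2])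
      moreover have p: "?P = Comp A x y z 0 N (?d y z 1 g) f" using 4 N by (simp add: cosk_Comp cosk_Dif)
      moreover have q: "?Q = ?d x z (N + 1) (Comp A x y z 1 N g f)"
        using 4 N by (simp add: cosk_Comp cosk_Dif add.commute)
      \<comment> \<open>Here \<open>f\<close> is a cycle on the right, so
        \<open>d (g f) = (d g) f\<close> without a sign, and the odd degree of \<open>g\<close>
        makes the terms cancel.\<close>
      have e: "?P = ?Q"
        unfolding p q using dif_comp_cycle_right[OF o fc gm] by (simp add: add.commute)
      have k: "koszul ?M i ?Q = \<ominus>\<^bsub>?M\<^esub> ?Q" using 4(1) by simp
      have "?P \<oplus>\<^bsub>?M\<^esub> koszul ?M i ?Q = \<zero>\<^bsub>?M\<^esub>" unfolding k e by (rule M.r_neg[OF Q])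
      ultimately show ?thesis by (simp only:)
    next
      case 5
      note m = cosk_low[OF g 5(1)] cosk_low[OF f 5(2)]
      show ?thesis using leibniz[OF o m] 5 by (simp add: cosk_Comp(3) cosk_Dif(1) cosk_Gr(1))
    next
      case 6
      note m = cosk_low[OF g 6(1)] cosk_low[OF f 6(2)]
      show ?thesis using leibniz[OF o m] 6 by (simp add: cosk_Comp(3) cosk_Dif(1,2) cosk_Gr(1))
    next
      case 7
      note m = cosk_low[OF g 7(1)] cosk_low[OF f 7(2)]
      have MN: "?M = (HomGr A x z N)\<lparr>carrier := cycles (Hom A x z) N\<rparr>" using 7 N by (simp add: cosk_Gr)
      interpret MA: abelian_group "HomGr A x z N" using o hom_group by blast
      have s: "i - 1 + j = N + 1" "i + (j - 1) = N + 1" using 7 by auto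
      have dgA: "?d y z i g \<in> Mor A y z (i - 1)" and dfA: "?d x y j f \<in> Mor A x y (j - 1)"
        using m o by (auto intro: dif_closed)
      let ?p = "Comp A x y z (i - 1) j (?d y z i g) f" and ?q = "Comp A x y z i (j - 1) g (?d x y j f)"
      have pqm: "?p \<in> Mor A x z (N + 1)" "?q \<in> Mor A x z (N + 1)"
        using o m dgA dfA s by (auto intro!: comp_closed)
      have L0: "?L = \<zero>\<^bsub>?M\<^esub>" using 7 N cosk_Dif(3)[of N "N + 1 + 1"] by (simp add: cosk_Comp(3) add.commute[of 2])
      have "?P = cosk_map N (Hom A x z) (i - 1 + j) ?p" using 7 by (simp only: cosk_Comp(3) cosk_simps(2) cosk_Dif(1))
      then have p: "?P = ?d x z (N + 1) ?p" unfolding s(1) by simp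
      have "?Q = cosk_map N (Hom A x z) (i + (j - 1)) ?q" using 7 by (simp only: cosk_Comp(3) cosk_simps(2) cosk_Dif(1))
      then have q: "?Q = ?d x z (N + 1) ?q" unfolding s(2) by simp
      have gfA: "Comp A x y z i j g f \<in> Mor A x z (N + 2)" using o m 7 by (auto intro!: comp_closed)
      \<comment> \<open>Both terms are boundaries of composites in \<open>A\<close>, and their
        signed sum is \<open>d d (g f) = 0\<close> by the Leibniz rule of \<open>A\<close>.\<close>
      have "?d x z (N + 1) (?d x z (N + 2) (Comp A x y z i j g f)) = \<zero>\<^bsub>HomGr A x z N\<^esub>"
        using dif_dif[OF o(1,3) gfA, of "N + 1"] by simp
      moreover have "?d x z (N + 2) (Comp A x y z i j g f) =
          ?p \<oplus>\<^bsub>HomGr A x z (N + 1)\<^esub> koszul (HomGr A x z (N + 1)) i ?q"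
      proof -
        have e: "N + 2 - 1 = N + 1" by simp
        show ?thesis using leibniz[OF o m] unfolding 7(3) e .
      qed
      ultimately have "?d x z (N + 1) ?p \<oplus>\<^bsub>HomGr A x z N\<^esub> koszul (HomGr A x z N) i (?d x z (N + 1) ?q) =
          \<zero>\<^bsub>HomGr A x z N\<^esub>"
        using dif_add[OF o(1,3), of _ "N + 1"] dif_inv[OF o(1,3), of _ "N + 1"] pqm mor_inv[OF o(1,3)] by (auto split: if_splits)
      moreover have "\<ominus>\<^bsub>?M\<^esub> ?Q = \<ominus>\<^bsub>HomGr A x z N\<^esub> ?Q"
        unfolding MN
      proof (rule inv_carrier_update[OF hom_group[OF o(1,3)]])
        show "abelian_group ((HomGr A x z N)\<lparr>carrier := cycles (Hom A x z) N\<rparr>)" using M.abelian_group_axioms MN by simp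
        show "?Q \<in> cycles (Hom A x z) N" using Q MN by simp
      qed (auto simp: cycles_def)
      ultimately have "?P \<oplus>\<^bsub>HomGr A x z N\<^esub> koszul ?M i ?Q = \<zero>\<^bsub>HomGr A x z N\<^esub>"
        unfolding p q by (simp split: if_splits)
      then show ?thesis unfolding L0 unfolding MN by simp
    qed
  qed
qed

lemma dg_category_cosk: "dg_category R Z"
proof (rule dg_category.intro)
  fix x assume "x \<in> Obj Z"
  then show "Ident Z x \<in> cycles (Hom Z x x) 0"
    using ident_cycle[of x] N by (simp add: cycles_def cosk_Gr(1) cosk_Dif(1))
  fix y f j assume o: "x \<in> Obj Z" "y \<in> Obj Z" and f: "f \<in> Mor Z x y j"
  consider "j \<le> N" | "j = N + 1" | "j > N + 1" by linarith
  then have "Comp Z x y y 0 j (Ident Z y) f = f \<and> Comp Z x x y j 0 f (Ident Z x) = f"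
  proof cases
    case 1
    then show ?thesis using o f N by (simp add: cosk_Comp(3) cosk_Gr(1) ident_left ident_right)
  next
    case 2
    then have "f \<in> Mor A x y N" using f cosk_mor(2) cycle_closed by simp
    then show ?thesis using 2 o N by (simp add: cosk_Comp(1,2) ident_left ident_right)
  next
    case 3
    have oA: "x \<in> Obj A" "y \<in> Obj A" using o by simp_all
    have i: "Ident A u \<in> Mor Z u u 0" if "u \<in> Obj A" for u using that ident_closed N by (simp add: cosk_Gr(1))
    have "Comp Z x y y 0 j (Ident A y) f \<in> Mor Z x y j" "Comp Z x x y j 0 f (Ident A x) \<in> Mor Z x y j"
      by (rule cosk_comp_closed[OF oA(1,2,2) i[OF oA(2)] f]; simp) (rule cosk_comp_closed[OF oA(1,1,2) f i[OF oA(1)]]; simp)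
    then show ?thesis using 3 by (intro conjI cosk_trivial[OF oA _ f]) auto
  qed
  then show "Comp Z x y y 0 j (Ident Z y) f = f" "Comp Z x x y j 0 f (Ident Z x) = f" by auto
next
  show "cring R" by (rule cring)
next
  fix x y assume "x \<in> Obj Z" "y \<in> Obj Z"
  then show "chain_complex R (Hom Z x y)" using chain_complex_Z by simp
qed (use cosk_comp_linear_right cosk_comp_linear_left cosk_assoc cosk_leibniz in \<open>simp_all only: cosk_simps(1)\<close>)

definition cosk_proj :: "('a, 'b) dgfun" where
  "cosk_proj = mk_dgfun A Z (\<lambda>x. x) (\<lambda>x y i f. cosk_map N (Hom A x y) i f)"

lemma cosk_proj_hom: "cosk_proj \<in> dg_hom R A Z"
  unfolding cosk_proj_def
proof (rule mk_dgfun_dg_hom[OF dg_category_axioms dg_category_cosk])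
  fix x assume "x \<in> Obj A"
  then show "x \<in> Obj Z" "cosk_map N (Hom A x x) 0 (Ident A x) = Ident Z x" using N by simp_all
next
  fix x y i assume o: "x \<in> Obj A" "y \<in> Obj A"
  then show "linear_map R (HomGr A x y i) (HomGr Z x y i) (cosk_map N (Hom A x y) i)" by (rule cosk_map_lin)
  fix f assume "f \<in> Mor A x y i"
  then show "cosk_map N (Hom A x y) (i - 1) (Dif (Hom A x y) i f) = Dif (Hom Z x y) i (cosk_map N (Hom A x y) i f)"
    using cosk_map_dif[OF hom_complex[OF o]] by simp
next
  fix x y z i j g f assume o: "x \<in> Obj A" "y \<in> Obj A" "z \<in> Obj A" and g: "g \<in> Mor A y z i" and f: "f \<in> Mor A x y j"
  let ?L = "cosk_map N (Hom A x z) (i + j) (Comp A x y z i j g f)"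
    and ?R = "Comp Z x y z i j (cosk_map N (Hom A y z) i g) (cosk_map N (Hom A x y) j f)"
  have gf: "Comp A x y z i j g f \<in> Mor A x z (i + j)" using o g f by (intro comp_closed) auto
  have m: "cosk_map N (Hom A y z) i g \<in> Mor Z y z i" "cosk_map N (Hom A x y) j f \<in> Mor Z x y j"
    using linear_map_closed[OF cosk_map_lin] o g f by auto
  have L: "?L \<in> Mor Z x z (i + j)" using linear_map_closed[OF cosk_map_lin] o gf by blast
  have R: "?R \<in> Mor Z x z (i + j)" by (rule cosk_comp_closed[OF o m]) simp
  consider "i + j < 0 \<or> i + j > N + 1" | "i < 0" | "j < 0" | "i \<le> N" "j \<le> N"
    | "i = N + 1" "j = 0" | "i = 0" "j = N + 1"
    using N by (cases "i + j < 0 \<or> i + j > N + 1 \<or> i < 0 \<or> j < 0 \<or> (i \<le> N \<and> j \<le> N)") auto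
  then show "?L = ?R"
  proof cases
    case 1
    then show ?thesis using cosk_trivial[OF o(1,3) L R] by blast
  next
    case 2
    then have z: "g = \<zero>\<^bsub>HomGr A y z i\<^esub>" "cosk_map N (Hom A y z) i g = \<zero>\<^bsub>HomGr Z y z i\<^esub>"
      using neg_zero[OF o(2,3) g] cosk_neg[OF o(2,3) m(1)] by auto
    have "?R = \<zero>\<^bsub>HomGr Z x z (i + j)\<^esub>" unfolding z(2) by (rule cosk_comp_zero_left[OF o m(2)]) simp
    moreover have "?L = \<zero>\<^bsub>HomGr Z x z (i + j)\<^esub>"
      unfolding z(1) comp_zero_left[OF o f]
      by (rule linear_map_zero[OF hom_module cosk_hom_module cosk_map_lin]) (rule o)+
    ultimately show ?thesis by simp
  next
    case 3
    then have z: "f = \<zero>\<^bsub>HomGr A x y j\<^esub>" "cosk_map N (Hom A x y) j f = \<zero>\<^bsub>HomGr Z x y j\<^esub>"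
      using neg_zero[OF o(1,2) f] cosk_neg[OF o(1,2) m(2)] by auto
    have "?R = \<zero>\<^bsub>HomGr Z x z (i + j)\<^esub>" unfolding z(2) by (rule cosk_comp_zero_right[OF o m(1)]) simp
    moreover have "?L = \<zero>\<^bsub>HomGr Z x z (i + j)\<^esub>"
      unfolding z(1) comp_zero_right[OF o g]
      by (rule linear_map_zero[OF hom_module cosk_hom_module cosk_map_lin]) (rule o)+
    ultimately show ?thesis by simp
  next
    case 4
    then show ?thesis by (simp add: cosk_Comp(3))
  next
    \<comment> \<open>\<open>d (g f) = (d g) f\<close>, since \<open>f\<close> has degree 0 and is
      therefore a cycle.\<close>
    case 5
    then show ?thesis
      using dif_comp_cycle_right[OF o degree0_cycle[OF o(1,2)] g] f N by (simp add: cosk_Comp(1))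
  next
    case 6
    then show ?thesis
      using dif_comp_cycle_left[OF o degree0_cycle[OF o(2,3)] f] g N by (simp add: cosk_Comp(2))
  qed
qed

end

section \<open>Small Postnikov sections\<close>

text \<open>The axioms are equations between values of operations, so they pass along surjections
  that commute with all the operations. For small sections this avoids arguing with chosen
  representatives in every axiom.\<close>

lemma quotient_dg_category:
  assumes A: "dg_category R A" and obj: "Obj A' = Obj A"
    and lin: "\<And>x y i. x \<in> Obj A \<Longrightarrow> y \<in> Obj A \<Longrightarrow> linear_map R (HomGr A x y i) (HomGr A' x y i) (\<pi> x y i)"
    and surj: "\<And>x y i. x \<in> Obj A \<Longrightarrow> y \<in> Obj A \<Longrightarrow> \<pi> x y i ` Mor A x y i = Mor A' x y i"
    and zero: "\<And>x y i. x \<in> Obj A \<Longrightarrow> y \<in> Obj A \<Longrightarrow> \<pi> x y i \<zero>\<^bsub>HomGr A x y i\<^esub> = \<zero>\<^bsub>HomGr A' x y i\<^esub>"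
    and dif: "\<And>x y i f. x \<in> Obj A \<Longrightarrow> y \<in> Obj A \<Longrightarrow> f \<in> Mor A x y i \<Longrightarrow>
      \<pi> x y (i - 1) (Dif (Hom A x y) i f) = Dif (Hom A' x y) i (\<pi> x y i f)"
    and id: "\<And>x. x \<in> Obj A \<Longrightarrow> \<pi> x x 0 (Ident A x) = Ident A' x"
    and comp: "\<And>x y z i j g f. x \<in> Obj A \<Longrightarrow> y \<in> Obj A \<Longrightarrow> z \<in> Obj A \<Longrightarrow> g \<in> Mor A y z i \<Longrightarrow> f \<in> Mor A x y j \<Longrightarrow>
      \<pi> x z (i + j) (Comp A x y z i j g f) = Comp A' x y z i j (\<pi> y z i g) (\<pi> x y j f)"
  shows "dg_category R A'" "mk_dgfun A A' (\<lambda>x. x) \<pi> \<in> dg_hom R A A'"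
proof -
  interpret A: dg_category R A by fact
  have ex: "\<exists>h\<in>Mor A x y i. f = \<pi> x y i h" if "x \<in> Obj A" "y \<in> Obj A" "f \<in> Mor A' x y i" for x y i f
    using surj[OF that(1,2)] that(3) by blast
  have cl: "\<pi> x y i f \<in> Mor A' x y i" if "x \<in> Obj A" "y \<in> Obj A" "f \<in> Mor A x y i" for x y i f
    using linear_map_closed[OF lin] that by blast
  note add = linear_map_add[OF lin, symmetric] and smult = linear_map_smult[OF lin, symmetric]
  have mod: "Module.module R (HomGr A' x y i)" if "x \<in> Obj A" "y \<in> Obj A" for x y i
    by (rule module_transport[OF A.hom_module lin surj zero]) (fact that)+
  have inv: "\<pi> x y i (\<ominus>\<^bsub>HomGr A x y i\<^esub> f) = \<ominus>\<^bsub>HomGr A' x y i\<^esub> \<pi> x y i f"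
    if "x \<in> Obj A" "y \<in> Obj A" "f \<in> Mor A x y i" for x y i f
    by (rule linear_map_inv[OF A.hom_module mod lin]) (fact that)+
  let ?d = "\<lambda>x y. Dif (Hom A x y)" and ?e = "\<lambda>x y. Dif (Hom A' x y)"
  show A': "dg_category R A'"
  proof (rule dg_category.intro)
    show "cring R" by (rule A.cring)
    fix x y assume "x \<in> Obj A'" "y \<in> Obj A'"
    then have o: "x \<in> Obj A" "y \<in> Obj A" by (simp_all add: obj)
    show "chain_complex R (Hom A' x y)"
    proof (rule chain_complexI)
      fix i
      show "Module.module R (HomGr A' x y i)" by (rule mod[OF o])
      show "linear_map R (HomGr A' x y i) (HomGr A' x y (i - 1)) (?e x y i)"
      proof (rule linear_mapI)
        fix f assume "f \<in> Mor A' x y i"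
        then obtain h where h: "h \<in> Mor A x y i" "f = \<pi> x y i h" using ex o by blast
        have dh: "?d x y i h \<in> Mor A x y (i - 1)" using o h by (intro A.dif_closed) auto
        show "?e x y i f \<in> Mor A' x y (i - 1)" using h o dh cl by (simp flip: dif)
        { fix g assume "g \<in> Mor A' x y i"
          then obtain k where k: "k \<in> Mor A x y i" "g = \<pi> x y i k" using ex o by blast
          have dk: "?d x y i k \<in> Mor A x y (i - 1)" using o k by (intro A.dif_closed) auto
          have "?e x y i (f \<oplus>\<^bsub>HomGr A' x y i\<^esub> g) = \<pi> x y (i - 1) (?d x y i (h \<oplus>\<^bsub>HomGr A x y i\<^esub> k))"
            using h k o by (simp add: add dif A.mor_add)
          also have "\<dots> = ?e x y i f \<oplus>\<^bsub>HomGr A' x y (i - 1)\<^esub> ?e x y i g"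
            using h k o dh dk by (simp add: A.dif_add add flip: dif)
          finally show "?e x y i (f \<oplus>\<^bsub>HomGr A' x y i\<^esub> g) =
            ?e x y i f \<oplus>\<^bsub>HomGr A' x y (i - 1)\<^esub> ?e x y i g" . }
        { fix r assume r: "r \<in> carrier R"
          have "?e x y i (r \<odot>\<^bsub>HomGr A' x y i\<^esub> f) = \<pi> x y (i - 1) (?d x y i (r \<odot>\<^bsub>HomGr A x y i\<^esub> h))"
            using h o r by (simp add: smult dif A.mor_smult)
          also have "\<dots> = r \<odot>\<^bsub>HomGr A' x y (i - 1)\<^esub> ?e x y i f"
            using h o r dh linear_map_smult[OF A.dif_linear[OF o]] by (simp add: smult flip: dif)
          finally show "?e x y i (r \<odot>\<^bsub>HomGr A' x y i\<^esub> f) = r \<odot>\<^bsub>HomGr A' x y (i - 1)\<^esub> ?e x y i f" . }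
      qed
      fix f assume "f \<in> Mor A' x y i"
      then obtain h where h: "h \<in> Mor A x y i" "f = \<pi> x y i h" using ex o by blast
      have dh: "?d x y i h \<in> Mor A x y (i - 1)" using o h by (intro A.dif_closed) auto
      have "?e x y (i - 1) (?e x y i f) = \<pi> x y (i - 1 - 1) (?d x y (i - 1) (?d x y i h))"
        unfolding h(2) dif[OF o h(1), symmetric] by (rule dif[OF o dh, symmetric])
      also have "\<dots> = \<zero>\<^bsub>HomGr A' x y (i - 2)\<^esub>" using o h A.dif_dif[OF o h(1), of "i - 1"] zero[OF o, of "i - 2"] by simp
      finally show "?e x y (i - 1) (?e x y i f) = \<zero>\<^bsub>HomGr A' x y (i - 2)\<^esub>" .
    qed
    fix f j assume "f \<in> Mor A' x y j"
    then obtain h where h: "h \<in> Mor A x y j" "f = \<pi> x y j h" using ex o by blast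
    show "Comp A' x y y 0 j (Ident A' y) f = f"
      using comp[OF o(1,2,2) A.ident_closed[OF o(2)] h(1)] h o by (simp add: id A.ident_left)
    show "Comp A' x x y j 0 f (Ident A' x) = f"
      using comp[OF o(1,1,2) h(1) A.ident_closed[OF o(1)]] h o by (simp add: id A.ident_right)
  next
    fix x assume "x \<in> Obj A'"
    then have o: "x \<in> Obj A" by (simp add: obj)
    show "Ident A' x \<in> cycles (Hom A' x x) 0"
      using dif[OF o o A.ident_closed[OF o]] zero[OF o o, of "-1"] cl[OF o o A.ident_closed[OF o]]
      by (simp add: cycles_def id[OF o] A.dif_ident[OF o])
  next
    fix x y z assume "x \<in> Obj A'" "y \<in> Obj A'" "z \<in> Obj A'"
    then have o: "x \<in> Obj A" "y \<in> Obj A" "z \<in> Obj A" by (simp_all add: obj)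
    { fix g i j assume "g \<in> Mor A' y z i"
      then obtain k where k: "k \<in> Mor A y z i" "g = \<pi> y z i k" using ex o by blast
      show "linear_map R (HomGr A' x y j) (HomGr A' x z (i + j)) (\<lambda>f. Comp A' x y z i j g f)"
      proof (rule linear_mapI)
        fix f assume "f \<in> Mor A' x y j"
        then obtain h where h: "h \<in> Mor A x y j" "f = \<pi> x y j h" using ex o by blast
        have c: "Comp A x y z i j k h \<in> Mor A x z (i + j)" using o k h by (intro A.comp_closed) auto
        show "Comp A' x y z i j g f \<in> Mor A' x z (i + j)" using h k o c cl by (simp flip: comp)
        { fix f' assume "f' \<in> Mor A' x y j"
          then obtain h' where h': "h' \<in> Mor A x y j" "f' = \<pi> x y j h'" using ex o by blast
          have c': "Comp A x y z i j k h' \<in> Mor A x z (i + j)" using o k h' by (intro A.comp_closed) auto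
          show "Comp A' x y z i j g (f \<oplus>\<^bsub>HomGr A' x y j\<^esub> f') =
            Comp A' x y z i j g f \<oplus>\<^bsub>HomGr A' x z (i + j)\<^esub> Comp A' x y z i j g f'"
            using h h' k o c c' by (simp add: add A.mor_add A.comp_add_right flip: comp) }
        { fix r assume "r \<in> carrier R"
          then show "Comp A' x y z i j g (r \<odot>\<^bsub>HomGr A' x y j\<^esub> f) = r \<odot>\<^bsub>HomGr A' x z (i + j)\<^esub> Comp A' x y z i j g f"
            using h k o c by (simp add: smult A.mor_smult A.comp_smult_right flip: comp) }
      qed }
    { fix f i j assume "f \<in> Mor A' x y j"
      then obtain h where h: "h \<in> Mor A x y j" "f = \<pi> x y j h" using ex o by blast
      show "linear_map R (HomGr A' y z i) (HomGr A' x z (i + j)) (\<lambda>g. Comp A' x y z i j g f)"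
      proof (rule linear_mapI)
        fix g assume "g \<in> Mor A' y z i"
        then obtain k where k: "k \<in> Mor A y z i" "g = \<pi> y z i k" using ex o by blast
        have c: "Comp A x y z i j k h \<in> Mor A x z (i + j)" using o k h by (intro A.comp_closed) auto
        show "Comp A' x y z i j g f \<in> Mor A' x z (i + j)" using h k o c cl by (simp flip: comp)
        { fix g' assume "g' \<in> Mor A' y z i"
          then obtain k' where k': "k' \<in> Mor A y z i" "g' = \<pi> y z i k'" using ex o by blast
          have c': "Comp A x y z i j k' h \<in> Mor A x z (i + j)" using o k' h by (intro A.comp_closed) auto
          show "Comp A' x y z i j (g \<oplus>\<^bsub>HomGr A' y z i\<^esub> g') f =
            Comp A' x y z i j g f \<oplus>\<^bsub>HomGr A' x z (i + j)\<^esub> Comp A' x y z i j g' f"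
            using h k k' o c c' by (simp add: add A.mor_add A.comp_add_left flip: comp) }
        { fix r assume "r \<in> carrier R"
          then show "Comp A' x y z i j (r \<odot>\<^bsub>HomGr A' y z i\<^esub> g) f = r \<odot>\<^bsub>HomGr A' x z (i + j)\<^esub> Comp A' x y z i j g f"
            using h k o c by (simp add: smult A.mor_smult A.comp_smult_left flip: comp) }
      qed }
    fix g i f j assume "g \<in> Mor A' y z i" "f \<in> Mor A' x y j"
    then obtain k h where k: "k \<in> Mor A y z i" "g = \<pi> y z i k" and h: "h \<in> Mor A x y j" "f = \<pi> x y j h"
      using ex o by metis
    have d: "?d y z i k \<in> Mor A y z (i - 1)" "?d x y j h \<in> Mor A x y (j - 1)"
      using o k h by (auto intro!: A.dif_closed)
    have c: "Comp A x y z i j k h \<in> Mor A x z (i + j)"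
      "Comp A x y z (i - 1) j (?d y z i k) h \<in> Mor A x z (i + j - 1)"
      "Comp A x y z i (j - 1) k (?d x y j h) \<in> Mor A x z (i + j - 1)"
      using o k h d by (auto intro!: A.comp_closed)
    have c2: "\<pi> x z (i + j - 1) (Comp A x y z (i - 1) j (?d y z i k) h) =
        Comp A' x y z (i - 1) j (\<pi> y z (i - 1) (?d y z i k)) (\<pi> x y j h)"
      "\<pi> x z (i + j - 1) (Comp A x y z i (j - 1) k (?d x y j h)) =
        Comp A' x y z i (j - 1) (\<pi> y z i k) (\<pi> x y (j - 1) (?d x y j h))"
      using comp[OF o d(1) h(1)] comp[OF o k(1) d(2)] by (simp_all add: algebra_simps)
    have "?e x z (i + j) (Comp A' x y z i j g f) =
      \<pi> x z (i + j - 1) (?d x z (i + j) (Comp A x y z i j k h))"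
      unfolding k(2) h(2) comp[OF o k(1) h(1), symmetric] by (rule dif[OF o(1,3) c(1), symmetric])
    also have "\<dots> = \<pi> x z (i + j - 1) (Comp A x y z (i - 1) j (?d y z i k) h) \<oplus>\<^bsub>HomGr A' x z (i + j - 1)\<^esub>
      koszul (HomGr A' x z (i + j - 1)) i (\<pi> x z (i + j - 1) (Comp A x y z i (j - 1) k (?d x y j h)))"
      using A.leibniz[OF o k(1) h(1)] c o A.mor_inv by (simp add: linear_map_add[OF lin] inv)
    also have "\<dots> = Comp A' x y z (i - 1) j (?e y z i g) f \<oplus>\<^bsub>HomGr A' x z (i + j - 1)\<^esub>
      koszul (HomGr A' x z (i + j - 1)) i (Comp A' x y z i (j - 1) g (?e x y j f))"
      using k h o by (simp add: c2 flip: dif)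
    finally show "?e x z (i + j) (Comp A' x y z i j g f) =
      Comp A' x y z (i - 1) j (?e y z i g) f \<oplus>\<^bsub>HomGr A' x z (i + j - 1)\<^esub>
      koszul (HomGr A' x z (i + j - 1)) i (Comp A' x y z i (j - 1) g (?e x y j f))" .
  next
    fix w x y z h i g j f k
    assume "w \<in> Obj A'" "x \<in> Obj A'" "y \<in> Obj A'" "z \<in> Obj A'"
      and hgf: "h \<in> Mor A' y z i" "g \<in> Mor A' x y j" "f \<in> Mor A' w x k"
    then have o: "w \<in> Obj A" "x \<in> Obj A" "y \<in> Obj A" "z \<in> Obj A" by (simp_all add: obj)
    obtain h0 where h: "h0 \<in> Mor A y z i" "h = \<pi> y z i h0" using ex o hgf by blast
    obtain g0 where g: "g0 \<in> Mor A x y j" "g = \<pi> x y j g0" using ex o hgf by blast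
    obtain f0 where f: "f0 \<in> Mor A w x k" "f = \<pi> w x k f0" using ex o hgf by blast
    have c: "Comp A w x y j k g0 f0 \<in> Mor A w y (j + k)" "Comp A x y z i j h0 g0 \<in> Mor A x z (i + j)"
      using o h g f by (auto intro!: A.comp_closed)
    have "Comp A' w y z i (j + k) h (Comp A' w x y j k g f) =
        \<pi> w z (i + (j + k)) (Comp A w y z i (j + k) h0 (Comp A w x y j k g0 f0))"
      unfolding h(2) g(2) f(2) comp[OF o(1,2,3) g(1) f(1), symmetric] by (rule comp[OF o(1,3,4) h(1) c(1), symmetric])
    also have "\<dots> = \<pi> w z (i + j + k) (Comp A w x z (i + j) k (Comp A x y z i j h0 g0) f0)"
      using A.comp_assoc[OF o h(1) g(1) f(1)] by (simp add: add.assoc)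
    also have "\<dots> = Comp A' w x z (i + j) k (Comp A' x y z i j h g) f"
      unfolding h(2) g(2) f(2) comp[OF o(2,3,4) h(1) g(1), symmetric] by (rule comp[OF o(1,2,4) c(2) f(1)])
    finally show "Comp A' w y z i (j + k) h (Comp A' w x y j k g f) = Comp A' w x z (i + j) k (Comp A' x y z i j h g) f" .
  qed
  show "mk_dgfun A A' (\<lambda>x. x) \<pi> \<in> dg_hom R A A'"
    by (rule mk_dgfun_dg_hom[OF A A']) (simp_all add: obj lin dif id comp)
qed

section \<open>Truncation above and its compatibility with composition\<close>

lemma trunc_le_simps:
  "i < int n \<Longrightarrow> Gr (trunc_le n M) i = Gr M i"
  "i = int n \<Longrightarrow> Gr (trunc_le n M) i = quot_module (Gr M i) (boundaries M i)"
  "i > int n \<Longrightarrow> Gr (trunc_le n M) i = zero_module (Gr M i)"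
  "Dif (trunc_le n M) i x = trunc_le_map n M (i - 1) (Dif M i x)"
  by (simp_all add: trunc_le_def)

lemma trunc_le_map_simps:
  "i < int n \<Longrightarrow> trunc_le_map n M i x = x" "i = int n \<Longrightarrow> trunc_le_map n M i x = hclass M i x"
  "i > int n \<Longrightarrow> trunc_le_map n M i x = \<zero>\<^bsub>Gr M i\<^esub>"
  by (simp_all add: trunc_le_map_def)

lemma quot_module_simps:
  "carrier (quot_module (Gr M i) (boundaries M i)) = hclass M i ` carrier (Gr M i)"
  "\<zero>\<^bsub>quot_module (Gr M i) (boundaries M i)\<^esub> = hclass M i \<zero>\<^bsub>Gr M i\<^esub>"
  "x \<oplus>\<^bsub>quot_module (Gr M i) (boundaries M i)\<^esub> y = hclass M i (x \<oplus>\<^bsub>Gr M i\<^esub> y)"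
  "r \<odot>\<^bsub>quot_module (Gr M i) (boundaries M i)\<^esub> x = hclass M i (r \<odot>\<^bsub>Gr M i\<^esub> x)"
  by (simp_all add: quot_module_def hclass_def)

context
  fixes R :: "'r ring" and M :: "('r, 'u) complex" and i :: int
  assumes M: "chain_complex R M"
begin

interpretation Mi: Module.module R "Gr M i" by (rule complex_module[OF M])

lemma hclass_add:
  assumes "x \<in> carrier (Gr M i)" "y \<in> carrier (Gr M i)"
  shows "hclass M i (hclass M i x \<oplus>\<^bsub>Gr M i\<^esub> hclass M i y) = hclass M i (x \<oplus>\<^bsub>Gr M i\<^esub> y)"
proof -
  note h = hclass_homologous[OF M assms(1)] and k = hclass_homologous[OF M assms(2)]
  have "(hclass M i x \<ominus>\<^bsub>Gr M i\<^esub> x) \<oplus>\<^bsub>Gr M i\<^esub> (hclass M i y \<ominus>\<^bsub>Gr M i\<^esub> y) \<in> boundaries M i"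
    using h k by (intro boundaries_add[OF M]) (simp_all add: homologous_boundaries[OF M])
  also have "(hclass M i x \<ominus>\<^bsub>Gr M i\<^esub> x) \<oplus>\<^bsub>Gr M i\<^esub> (hclass M i y \<ominus>\<^bsub>Gr M i\<^esub> y) =
      (hclass M i x \<oplus>\<^bsub>Gr M i\<^esub> hclass M i y) \<ominus>\<^bsub>Gr M i\<^esub> (x \<oplus>\<^bsub>Gr M i\<^esub> y)"
    using assms h(1) k(1) by algebra
  finally show ?thesis using assms h(1) k(1) by (simp add: hclass_eq_iff[OF M] homologous_boundaries[OF M])
qed

lemma hclass_smult:
  assumes "r \<in> carrier R" "x \<in> carrier (Gr M i)"
  shows "hclass M i (r \<odot>\<^bsub>Gr M i\<^esub> hclass M i x) = hclass M i (r \<odot>\<^bsub>Gr M i\<^esub> x)"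
proof -
  note h = hclass_homologous[OF M assms(2)]
  have "r \<odot>\<^bsub>Gr M i\<^esub> (hclass M i x \<ominus>\<^bsub>Gr M i\<^esub> x) \<in> boundaries M i"
    using h assms by (intro boundaries_smult[OF M]) (simp_all add: homologous_boundaries[OF M])
  also have "r \<odot>\<^bsub>Gr M i\<^esub> (hclass M i x \<ominus>\<^bsub>Gr M i\<^esub> x) = r \<odot>\<^bsub>Gr M i\<^esub> hclass M i x \<ominus>\<^bsub>Gr M i\<^esub> r \<odot>\<^bsub>Gr M i\<^esub> x"
    using assms h(1) by (simp add: a_minus_def Mi.smult_r_distr Mi.smult_r_minus)
  finally show ?thesis using assms h(1) by (simp add: hclass_eq_iff[OF M] homologous_boundaries[OF M])
qed

lemma trunc_le_map_closed: "x \<in> carrier (Gr M i) \<Longrightarrow> trunc_le_map n M i x \<in> carrier (Gr M i)"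
  using hclass_homologous(1)[OF M, of x i] Mi.zero_closed by (auto simp: trunc_le_map_def)

lemma trunc_le_map_linear: "linear_map R (Gr M i) (Gr (trunc_le n M) i) (trunc_le_map n M i)"
proof -
  consider "i < int n" | (eq) "i = int n" | "i > int n" by linarith
  then show ?thesis
  proof cases
    case eq
    show ?thesis
      by (rule linear_mapI) (simp_all only: trunc_le_simps(2)[OF eq] trunc_le_map_simps(2)[OF eq]
        quot_module_simps hclass_add hclass_smult imageI)
  qed (simp_all add: trunc_le_simps trunc_le_map_simps linear_map_def Pi_def zero_module_def Mi.smult_r_null)
qed

lemma trunc_le_map_surj: "trunc_le_map n M i ` carrier (Gr M i) = carrier (Gr (trunc_le n M) i)"
proof -
  consider "i < int n" | "i = int n" | "i > int n" by linarith
  then show ?thesis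
    by cases (auto simp: trunc_le_def trunc_le_map_def quot_module_simps image_iff)
qed

lemma trunc_le_map_zero: "trunc_le_map n M i \<zero>\<^bsub>Gr M i\<^esub> = \<zero>\<^bsub>Gr (trunc_le n M) i\<^esub>"
  by (simp add: trunc_le_def trunc_le_map_def quot_module_simps)

lemma trunc_le_map_homologous:
  assumes "x \<in> carrier (Gr M i)" "i \<le> int n"
  shows "homologous M i (trunc_le_map n M i x) x"
  using assms hclass_homologous(2)[OF M, of x i] homologous_refl[OF M] by (auto simp: trunc_le_map_def)

lemma homologous_dif:
  assumes "x \<in> carrier (Gr M i)" "y \<in> carrier (Gr M i)" "homologous M i x y"
  shows "Dif M i x = Dif M i y"
proof -
  interpret Mp: Module.module R "Gr M (i - 1)" by (rule complex_module[OF M])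
  note l = complex_linear[OF M, of i]
  have "x \<ominus>\<^bsub>Gr M i\<^esub> y \<in> cycles M i" using assms boundaries_cycles[OF M] by (auto simp: homologous_boundaries[OF M])
  then show ?thesis
    using linear_map_minus[OF Mi.module_axioms Mp.module_axioms l assms(1,2)] Mp.minus_zero_iff
      linear_map_closed[OF l] assms(1,2) by (simp add: cycles_def)
qed

lemma trunc_le_map_dif:
  assumes x: "x \<in> carrier (Gr M i)"
  shows "trunc_le_map n M (i - 1) (Dif M i x) = Dif (trunc_le n M) i (trunc_le_map n M i x)"
proof -
  consider "i \<le> int n" | "i = int n + 1" | "i > int n + 1" by linarith
  then show ?thesis
  proof cases
    case 1
    then show ?thesis
      using homologous_dif[OF trunc_le_map_closed[OF x] x trunc_le_map_homologous[OF x 1]]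
      by (simp add: trunc_le_simps(4))
  next
    case 2
    interpret Mp: Module.module R "Gr M (i - 1)" by (rule complex_module[OF M])
    have e: "i - 1 = int n" using 2 by simp
    \<comment> \<open>The truncation kills \<open>x\<close>, so its boundary must become zero in
      degree \<open>n\<close>; it does, because that degree is the quotient by the
      boundaries.\<close>
    have b: "Dif M i x \<in> boundaries M (i - 1)" using x by (simp add: boundaries_def)
    have "hclass M (i - 1) (Dif M i x) = hclass M (i - 1) \<zero>\<^bsub>Gr M (i - 1)\<^esub>"
      using hclass_boundary_iff[OF M linear_map_closed[OF complex_linear[OF M] x]] b by simp
    moreover have "Dif M i \<zero>\<^bsub>Gr M i\<^esub> = \<zero>\<^bsub>Gr M (i - 1)\<^esub>"
      by (rule linear_map_zero[OF Mi.module_axioms Mp.module_axioms complex_linear[OF M]])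
    moreover have "trunc_le_map n M i x = \<zero>\<^bsub>Gr M i\<^esub>" using 2 by (simp add: trunc_le_map_simps(3))
    ultimately show ?thesis by (simp only: trunc_le_simps(4) trunc_le_map_simps(2)[OF e])
  next
    case 3
    then show ?thesis by (simp add: trunc_le_simps(4) trunc_le_map_simps(3))
  qed
qed

lemma trunc_le_map_trunc: "trunc_le_map n M i (trunc_le_map (Suc n) M i x) = trunc_le_map n M i x"
  by (simp add: trunc_le_map_def)

end

lemma small_postnikov_simps [simp]:
  "Obj (small_postnikov n A) = Obj A" "Hom (small_postnikov n A) x y = trunc_le n (Hom A x y)"
  "Comp (small_postnikov n A) x y z i j g f = trunc_le_map n (Hom A x z) (i + j) (Comp A x y z i j g f)"
  "Ident (small_postnikov n A) x = trunc_le_map n (Hom A x x) 0 (Ident A x)"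
  by (simp_all add: small_postnikov_def)

context positive_dg
begin

text \<open>Only total degree \<open>n\<close> is delicate. A factor of degree \<open>n\<close> is
  then composed with one of degree 0, which is a cycle, so changing the former by a boundary changes
  the composite by a boundary.\<close>

lemma trunc_le_map_comp:
  assumes o: "x \<in> Obj A" "y \<in> Obj A" "z \<in> Obj A" and g: "g \<in> Mor A y z i" and f: "f \<in> Mor A x y j"
  shows "trunc_le_map n (Hom A x z) (i + j) (Comp A x y z i j g f) =
    trunc_le_map n (Hom A x z) (i + j) (Comp A x y z i j (trunc_le_map n (Hom A y z) i g) (trunc_le_map n (Hom A x y) j f))"
    (is "_ = trunc_le_map n _ _ (Comp A x y z i j ?g ?f)")
proof -
  note C = hom_complex[OF o(1,3)] and Cg = hom_complex[OF o(2,3)] and Cf = hom_complex[OF o(1,2)]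
  have g': "?g \<in> Mor A y z i" by (rule trunc_le_map_closed[OF Cg g])
  have f': "?f \<in> Mor A x y j" by (rule trunc_le_map_closed[OF Cf f])
  consider "i + j > int n" | "i < 0" | "j < 0" | "i \<ge> 0" "j \<ge> 0" "i + j < int n" | "i \<ge> 0" "j \<ge> 0" "i + j = int n" by linarith
  then show ?thesis
  proof cases
    case 1
    then show ?thesis by (simp add: trunc_le_map_simps(3))
  next
    case 2
    have "g = \<zero>\<^bsub>HomGr A y z i\<^esub>" "?g = \<zero>\<^bsub>HomGr A y z i\<^esub>" by (rule neg_zero[OF o(2,3) g 2]; fail | rule neg_zero[OF o(2,3) _ 2], fact)+
    then show ?thesis using comp_zero_left[OF o f, of i] comp_zero_left[OF o f', of i] by simp
  next
    case 3
    have "f = \<zero>\<^bsub>HomGr A x y j\<^esub>" "?f = \<zero>\<^bsub>HomGr A x y j\<^esub>" by (rule neg_zero[OF o(1,2) _ 3], fact)+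
    then show ?thesis using comp_zero_right[OF o g, of j] comp_zero_right[OF o g', of j] by simp
  next
    case 4
    then show ?thesis by (simp add: trunc_le_map_simps(1))
  next
    case 5
    have gf: "Comp A x y z i j g f \<in> Mor A x z (int n)" "Comp A x y z i j ?g ?f \<in> Mor A x z (int n)"
      "Comp A x y z i j ?g f \<in> Mor A x z (int n)"
      using o f g f' g' 5 by (auto intro!: comp_closed)
    have hg: "homologous (Hom A y z) i ?g g" by (rule trunc_le_map_homologous[OF Cg g]) (use 5 in simp)
    have hf: "homologous (Hom A x y) j ?f f" by (rule trunc_le_map_homologous[OF Cf f]) (use 5 in simp)
    have "homologous (Hom A x z) (int n) (Comp A x y z i j ?g f) (Comp A x y z i j g f)"
    proof (cases "i < int n")
      case True
      then show ?thesis using homologous_refl[OF C gf(1)] by (simp add: trunc_le_map_simps(1))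
    next
      case False
      then have "j = 0" using 5 by simp
      then have "f \<in> cycles (Hom A x y) j" using degree0_cycle[OF o(1,2)] f by simp
      then have "Comp A x y z i j (?g \<ominus>\<^bsub>HomGr A y z i\<^esub> g) f \<in> boundaries (Hom A x z) (int n)"
        using o hg 5 by (intro comp_boundary_left) (auto simp: homologous_boundaries[OF Cg])
      then show ?thesis using comp_minus_left[OF o f g' g] 5 by (simp add: homologous_boundaries[OF C])
    qed
    moreover have "homologous (Hom A x z) (int n) (Comp A x y z i j ?g ?f) (Comp A x y z i j ?g f)"
    proof (cases "j < int n")
      case True
      then show ?thesis using homologous_refl[OF C gf(3)] by (simp add: trunc_le_map_simps(1)[of j])
    next
      case False
      then have "i = 0" using 5 by simp
      then have "?g \<in> cycles (Hom A y z) i" using degree0_cycle[OF o(2,3)] g' by simp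
      then have "Comp A x y z i j ?g (?f \<ominus>\<^bsub>HomGr A x y j\<^esub> f) \<in> boundaries (Hom A x z) (int n)"
        using o hf 5 by (intro comp_boundary_right) (auto simp: homologous_boundaries[OF Cf])
      then show ?thesis using comp_minus_right[OF o g' f' f] 5 by (simp add: homologous_boundaries[OF C])
    qed
    ultimately have "homologous (Hom A x z) (int n) (Comp A x y z i j ?g ?f) (Comp A x y z i j g f)"
      using homologous_trans[OF C gf(2,3,1)] by blast
    then show ?thesis
      unfolding 5(3) trunc_le_map_simps(2)[OF HOL.refl] using hclass_eq_iff[OF C gf(2,1)] by simp
  qed
qed

lemma small_postnikov:
  "dg_category R (small_postnikov n A)" "postnikov_proj n A \<in> dg_hom R A (small_postnikov n A)"
proof -
  show "dg_category R (small_postnikov n A)"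
    by (rule quotient_dg_category(1)[OF dg_category_axioms, of _ "\<lambda>x y i. trunc_le_map n (Hom A x y) i"])
      (use trunc_le_map_linear[OF hom_complex] trunc_le_map_surj[OF hom_complex] trunc_le_map_zero[OF hom_complex]
        trunc_le_map_dif[OF hom_complex] trunc_le_map_comp in simp_all)
  show "postnikov_proj n A \<in> dg_hom R A (small_postnikov n A)"
    unfolding postnikov_proj_def
    by (rule quotient_dg_category(2)[OF dg_category_axioms, of _ "\<lambda>x y i. trunc_le_map n (Hom A x y) i"])
      (use trunc_le_map_linear[OF hom_complex] trunc_le_map_surj[OF hom_complex] trunc_le_map_zero[OF hom_complex]
        trunc_le_map_dif[OF hom_complex] trunc_le_map_comp in simp_all)
qed

end

section \<open>Lifting through one Postnikov stage\<close>

text \<open>Fullness and the condition on kernels make \<open>F\<close> reflect homologies in degree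
  0. Since degree 0 consists of cycles, arbitrary preimages of a homotopy equivalence and of its
  inverse are again inverse to each other up to homotopy, which gives (F2).\<close>

lemma fibrationI:
  assumes F: "F \<in> dg_hom R C D"
    and ob: "\<And>y. y \<in> Obj D \<Longrightarrow> \<exists>x\<in>Obj C. ob F x = y"
    and full: "\<And>x y i. x \<in> Obj C \<Longrightarrow> y \<in> Obj C \<Longrightarrow> Mor D (ob F x) (ob F y) i \<subseteq> mor F x y i ` Mor C x y i"
    and cycles: "\<And>x y. x \<in> Obj C \<Longrightarrow> y \<in> Obj C \<Longrightarrow> Mor C x y 0 \<subseteq> cycles (Hom C x y) 0"
    and ker: "\<And>x y f. x \<in> Obj C \<Longrightarrow> y \<in> Obj C \<Longrightarrow> f \<in> Mor C x y 0 \<Longrightarrow>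
      mor F x y 0 f = \<zero>\<^bsub>HomGr D (ob F x) (ob F y) 0\<^esub> \<Longrightarrow> f \<in> boundaries (Hom C x y) 0"
  shows "fibration R F"
proof -
  note FD = dg_homD[OF F]
  interpret F: dgf R F by standard (rule FD)
  interpret C: dg_category R C by (rule FD)
  interpret D: dg_category R D by (rule FD)
  note FF = F.mor_minus[unfolded FD(2,3)] F.mor_dif[unfolded FD(2,3)] F.mor_comp[unfolded FD(2,3)]
    F.mor_ident[unfolded FD(2,3)] F.mor_mor[unfolded FD(2,3)] F.ob_closed[unfolded FD(2,3)]
  have reflect: "homologous (Hom C x y) 0 f g"
    if o: "x \<in> Obj C" "y \<in> Obj C" and f: "f \<in> Mor C x y 0" and g: "g \<in> Mor C x y 0"
      and h: "homologous (Hom D (ob F x) (ob F y)) 0 (mor F x y 0 f) (mor F x y 0 g)" for x y f g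
  proof -
    note oF = FF(6)[OF o(1)] FF(6)[OF o(2)]
    interpret Cm: abelian_group "HomGr C x y 0" by (rule C.hom_group[OF o])
    let ?D = "HomGr D (ob F x) (ob F y) 0" and ?C = "HomGr C x y 0"
    interpret Dm: abelian_group "?D" by (rule D.hom_group[OF oF])
    obtain w where w: "w \<in> Mor D (ob F x) (ob F y) 1"
      "mor F x y 0 f \<ominus>\<^bsub>?D\<^esub> mor F x y 0 g = Dif (Hom D (ob F x) (ob F y)) 1 w"
      using h by (auto simp: homologous_def)
    \<comment> \<open>Subtracting the boundary of a preimage of \<open>w\<close> moves
      \<open>f - g\<close> into the kernel, where it bounds by assumption.\<close>
    obtain c where c: "c \<in> Mor C x y 1" "w = mor F x y 1 c" using full[OF o] w(1) by blast
    let ?d = "Dif (Hom C x y) 1 c"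
    have d: "?d \<in> Mor C x y 0" by (rule C.dif_closed[OF o c(1)]) simp
    have fg: "f \<ominus>\<^bsub>?C\<^esub> g \<in> Mor C x y 0" using f g by simp
    have Fd: "mor F x y 0 ?d = Dif (Hom D (ob F x) (ob F y)) 1 w" using FF(2)[OF o c(1)] c(2) by simp
    have "mor F x y 0 (f \<ominus>\<^bsub>?C\<^esub> g \<ominus>\<^bsub>?C\<^esub> ?d) =
        \<zero>\<^bsub>?D\<^esub>"
      unfolding FF(1)[OF o fg d] FF(1)[OF o f g] w(2) Fd
      using FF(5)[OF o d] Fd by (simp add: Dm.r_neg a_minus_def)
    then have "f \<ominus>\<^bsub>?C\<^esub> g \<ominus>\<^bsub>?C\<^esub> ?d \<in> boundaries (Hom C x y) 0"
      using fg d by (intro ker o) simp_all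
    moreover have "?d \<in> boundaries (Hom C x y) 0" using c(1) by (simp add: boundaries_def)
    ultimately have "f \<ominus>\<^bsub>?C\<^esub> g \<ominus>\<^bsub>?C\<^esub> ?d \<oplus>\<^bsub>?C\<^esub> ?d \<in> boundaries (Hom C x y) 0"
      by (rule boundaries_add[OF C.hom_complex[OF o]])
    also have "f \<ominus>\<^bsub>?C\<^esub> g \<ominus>\<^bsub>?C\<^esub> ?d \<oplus>\<^bsub>?C\<^esub> ?d = f \<ominus>\<^bsub>?C\<^esub> g"
      using fg d by (simp add: a_minus_def Cm.a_assoc Cm.l_neg)
    finally show ?thesis by (simp add: homologous_boundaries[OF C.hom_complex[OF o]])
  qed
  show ?thesis unfolding fibration_def FD(2,3)
  proof (intro conjI ballI allI impI)
    show "dg_functor R F" by (rule FD)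
    fix x y i assume "x \<in> Obj C" "y \<in> Obj C"
    then show "mor F x y i ` Mor C x y i = Mor D (ob F x) (ob F y) i" using full FF(5) by blast
  next
    fix a b v assume a: "a \<in> Obj C" and b: "b \<in> Obj D" and v: "homotopy_invertible D (ob F a) b v"
    obtain c where c: "c \<in> Obj C" "ob F c = b" using ob[OF b] by blast
    note oF = FF(6)[OF a] FF(6)[OF c(1)]
    obtain v' where vc: "v \<in> cycles (Hom D (ob F a) (ob F c)) 0" and v': "v' \<in> cycles (Hom D (ob F c) (ob F a)) 0"
      "homologous (Hom D (ob F a) (ob F a)) 0 (Comp D (ob F a) (ob F c) (ob F a) 0 0 v' v) (Ident D (ob F a))"
      "homologous (Hom D (ob F c) (ob F c)) 0 (Comp D (ob F c) (ob F a) (ob F c) 0 0 v v') (Ident D (ob F c))"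
      using v D.homotopy_invertible_iff[OF oF] c(2) by auto
    obtain u where u: "u \<in> Mor C a c 0" "mor F a c 0 u = v" using full[OF a c(1)] D.cycle_closed[OF vc] by blast
    obtain u' where u': "u' \<in> Mor C c a 0" "mor F c a 0 u' = v'" using full[OF c(1) a] D.cycle_closed[OF v'(1)] by blast
    have "homologous (Hom C a a) 0 (Comp C a c a 0 0 u' u) (Ident C a)"
    proof (rule reflect[OF a a])
      show "homologous (Hom D (ob F a) (ob F a)) 0 (mor F a a 0 (Comp C a c a 0 0 u' u)) (mor F a a 0 (Ident C a))"
        using FF(3)[OF a c(1) a u'(1) u(1)] FF(4)[OF a] v'(2) u(2) u'(2) by simp
      show "Comp C a c a 0 0 u' u \<in> Mor C a a 0" by (rule C.comp_closed[OF a c(1) a u'(1) u(1)]) simp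
    qed (rule C.ident_closed[OF a])
    moreover have "homologous (Hom C c c) 0 (Comp C c a c 0 0 u u') (Ident C c)"
    proof (rule reflect[OF c(1) c(1)])
      show "homologous (Hom D (ob F c) (ob F c)) 0 (mor F c c 0 (Comp C c a c 0 0 u u')) (mor F c c 0 (Ident C c))"
        using FF(3)[OF c(1) a c(1) u(1) u'(1)] FF(4)[OF c(1)] v'(3) u(2) u'(2) by simp
      show "Comp C c a c 0 0 u u' \<in> Mor C c c 0" by (rule C.comp_closed[OF c(1) a c(1) u(1) u'(1)]) simp
    qed (rule C.ident_closed[OF c(1)])
    ultimately have "homotopy_invertible C a c u"
      using C.homotopy_invertible_iff[OF a c(1)] cycles[OF a c(1)] cycles[OF c(1) a] u(1) u'(1) by blast
    then show "\<exists>c\<in>Obj C. \<exists>u. ob F c = b \<and> homotopy_invertible C a c u \<and> mor F a c 0 u = v"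
      using c u(2) by blast
  qed
qed

section \<open>Homology modules and the square zero extension\<close>

lemma homology_simps:
  "\<zero>\<^bsub>homology M i\<^esub> = hclass M i \<zero>\<^bsub>Gr M i\<^esub>" "x \<oplus>\<^bsub>homology M i\<^esub> y = hclass M i (x \<oplus>\<^bsub>Gr M i\<^esub> y)"
  "r \<odot>\<^bsub>homology M i\<^esub> x = hclass M i (r \<odot>\<^bsub>Gr M i\<^esub> x)"
proof -
  have "quot_class (Gr M i\<lparr>carrier := S\<rparr>) = quot_class (Gr M i)" for S
    by (intro ext) (simp add: quot_class_def a_r_coset_def r_coset_def)
  then show "\<zero>\<^bsub>homology M i\<^esub> = hclass M i \<zero>\<^bsub>Gr M i\<^esub>" "x \<oplus>\<^bsub>homology M i\<^esub> y = hclass M i (x \<oplus>\<^bsub>Gr M i\<^esub> y)"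
    "r \<odot>\<^bsub>homology M i\<^esub> x = hclass M i (r \<odot>\<^bsub>Gr M i\<^esub> x)"
    by (simp_all add: homology_def quot_module_def hclass_def)
qed

lemma homology_linear:
  assumes M: "chain_complex R M"
  shows "linear_map R ((Gr M i)\<lparr>carrier := cycles M i\<rparr>) (homology M i) (hclass M i)"
  by (rule linear_mapI)
    (auto simp: homology_simps homology_carrier[OF M] cycles_def hclass_add[OF M] hclass_smult[OF M])

lemma module_homology:
  assumes M: "chain_complex R M" shows "Module.module R (homology M i)"
  by (rule module_transport[OF module_cycles[OF M] homology_linear[OF M]])
    (simp_all add: homology_simps homology_carrier[OF M])

lemma trunc_le_map_eq_homologous:
  assumes M: "chain_complex R M" and x: "x \<in> carrier (Gr M i)" "y \<in> carrier (Gr M i)" and i: "i \<le> int n"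
    and eq: "trunc_le_map n M i x = trunc_le_map n M i y"
  shows "homologous M i x y"
proof (cases "i = int n")
  case True
  show ?thesis using eq unfolding trunc_le_map_simps(2)[OF True] by (simp only: hclass_eq_iff[OF M x])
next
  case False
  then have "x = y" using i eq by (simp add: trunc_le_map_simps(1))
  then show ?thesis using homologous_refl[OF M x(1)] by simp
qed

lemma kinv_simps:
  "Obj (kinv_target n A) = Obj A"
  "HomGr (kinv_target n A) x y i = direct_sum_module (Gr (trunc_le n (Hom A x y)) i)
     (if i = int n + 2 then homology (Hom A x y) (int n + 1) else zero_module (homology (Hom A x y) (int n + 1)))"
  "Dif (Hom (kinv_target n A) x y) i p =
     UPair (Dif (trunc_le n (Hom A x y)) i (ufst p)) \<zero>\<^bsub>homology (Hom A x y) (int n + 1)\<^esub>"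
  "Comp (kinv_target n A) x y z i j p q =
     UPair (trunc_le_map n (Hom A x z) (i + j) (Comp A x y z i j (ufst p) (ufst q)))
       ((if i = 0 \<and> j = int n + 2 then hclass (Hom A x z) (int n + 1) (Comp A x y z 0 (int n + 1) (ufst p) (usnd q))
         else \<zero>\<^bsub>homology (Hom A x z) (int n + 1)\<^esub>) \<oplus>\<^bsub>homology (Hom A x z) (int n + 1)\<^esub>
        (if i = int n + 2 \<and> j = 0 then hclass (Hom A x z) (int n + 1) (Comp A x y z (int n + 1) 0 (usnd p) (ufst q))
         else \<zero>\<^bsub>homology (Hom A x z) (int n + 1)\<^esub>))"
  "Ident (kinv_target n A) x = UPair (trunc_le_map n (Hom A x x) 0 (Ident A x)) \<zero>\<^bsub>homology (Hom A x x) (int n + 1)\<^esub>"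
  by (simp_all add: square_zero_extension_def direct_sum_complex_def homology_bimodule_def Let_def)

lemma kinv_incl_simps [simp]:
  "Dom (kinv_incl n A) = small_postnikov n A" "Cod (kinv_incl n A) = kinv_target n A"
  "x \<in> Obj A \<Longrightarrow> ob (kinv_incl n A) x = x"
  "x \<in> Obj A \<Longrightarrow> y \<in> Obj A \<Longrightarrow> f \<in> Mor (small_postnikov n A) x y i \<Longrightarrow>
    mor (kinv_incl n A) x y i f = UPair f \<zero>\<^bsub>homology (Hom A x y) (int n + 1)\<^esub>"
  by (simp_all add: sqz_incl_def homology_bimodule_def Let_def)

lemma sqz_proj_hom:
  assumes "dg_category R D" "dg_category R (D \<ltimes> N)"
  shows "sqz_proj D N \<in> dg_hom R (D \<ltimes> N) D"
  unfolding sqz_proj_def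
  by (rule mk_dgfun_dg_hom[OF assms(2,1)])
    (simp_all add: square_zero_extension_def direct_sum_complex_def linear_map_ufst)

lemma kinv_proj_simps [simp]:
  "Dom (kinv_proj n A) = kinv_target n A" "Cod (kinv_proj n A) = small_postnikov n A"
  "x \<in> Obj A \<Longrightarrow> ob (kinv_proj n A) x = x"
  "x \<in> Obj A \<Longrightarrow> y \<in> Obj A \<Longrightarrow> p \<in> Mor (kinv_target n A) x y i \<Longrightarrow> mor (kinv_proj n A) x y i p = ufst p"
  by (simp_all add: sqz_proj_def kinv_simps(1))

text \<open>The coskeleton is formed at level \<open>n + 1\<close>, so that its top degree
  \<open>n + 2\<close> consists of the \<open>(n + 1)\<close>-cycles of \<open>A\<close>: the degree
  in which \<open>E\<close> carries the homology \<open>H\<^sub>n\<^sub>+\<^sub>1(A)\<close>. The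
  assumption \<open>target\<close> will come from \<gamma>, which is a dg functor to
  \<open>E\<close>.\<close>

locale postnikov_stage = positive_dg R A "int n + 1"
  for R :: "'r ring" and A :: "('r, ('r, 'a) univ) dgcat" and n +
  assumes target: "dg_category R (kinv_target n A)"
begin

abbreviation "X \<equiv> small_postnikov n A"
abbreviation "E \<equiv> kinv_target n A"
abbreviation "hzero x y \<equiv> \<zero>\<^bsub>homology (Hom A x y) (int n + 1)\<^esub>"

sublocale E: dg_category R E by (rule target)
sublocale X: dg_category R X by (rule small_postnikov)

text \<open>The fibration \<kappa> on morphisms: truncation below, and in degree
  \<open>n + 2\<close> the homology class of the cycle.\<close>

definition kinv_value where
  "kinv_value x y i f = UPair (trunc_le_map n (Hom A x y) i f)
     (if i = int n + 2 then hclass (Hom A x y) (int n + 1) f else hzero x y)"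

definition kinv_cosk where
  "kinv_cosk = mk_dgfun Z E (\<lambda>x. x) kinv_value"

lemma hzero_add:
  assumes o: "x \<in> Obj A" "y \<in> Obj A"
  shows "v \<in> carrier (homology (Hom A x y) (int n + 1)) \<Longrightarrow>
      hzero x y \<oplus>\<^bsub>homology (Hom A x y) (int n + 1)\<^esub> v = v"
    "v \<in> carrier (homology (Hom A x y) (int n + 1)) \<Longrightarrow>
      v \<oplus>\<^bsub>homology (Hom A x y) (int n + 1)\<^esub> hzero x y = v"
    "hzero x y \<in> carrier (homology (Hom A x y) (int n + 1))"
proof -
  interpret H: abelian_group "homology (Hom A x y) (int n + 1)"
    by (rule module_abelian_group[OF module_homology[OF hom_complex[OF o]]])
  show "v \<in> carrier (homology (Hom A x y) (int n + 1)) \<Longrightarrow>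
      hzero x y \<oplus>\<^bsub>homology (Hom A x y) (int n + 1)\<^esub> v = v"
    "v \<in> carrier (homology (Hom A x y) (int n + 1)) \<Longrightarrow>
      v \<oplus>\<^bsub>homology (Hom A x y) (int n + 1)\<^esub> hzero x y = v"
    "hzero x y \<in> carrier (homology (Hom A x y) (int n + 1))"
    by simp_all
qed

text \<open>\<open>E\<close> is concentrated in the degrees 0 to \<open>n\<close> and
  \<open>n + 2\<close>; the gap at \<open>n + 1\<close> separates the section from the
  bimodule.\<close>

lemma target_trivial:
  assumes o: "x \<in> Obj A" "y \<in> Obj A" and pq: "p \<in> Mor E x y k" "q \<in> Mor E x y k"
    and k: "k < 0 \<or> k = int n + 1 \<or> k > int n + 2"
  shows "p = q"
proof -
  have "a = b" if "a \<in> Mor X x y k" "b \<in> Mor X x y k" for a b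
    using k
  proof (cases "k < 0")
    case True
    then have "a \<in> Mor A x y k" "b \<in> Mor A x y k" using that by (simp_all add: trunc_le_simps(1))
    then show ?thesis using neg_zero[OF o _ True] by metis
  qed (use that in \<open>auto simp: trunc_le_simps(3)\<close>)
  then show ?thesis using pq k by (auto simp: kinv_simps(2) elim!: direct_sum_moduleE)
qed

lemma kinv_value_linear:
  assumes o: "x \<in> Obj A" "y \<in> Obj A"
  shows "linear_map R (HomGr Z x y i) (HomGr E x y i) (kinv_value x y i)"
proof -
  note C = hom_complex[OF o]
  have "linear_map R (HomGr Z x y i) (HomGr X x y i) (trunc_le_map n (Hom A x y) i)"
  proof (cases "i \<le> int n + 1")
    case True
    then show ?thesis using trunc_le_map_linear[OF C, of i n] by (simp add: cosk_Gr(1))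
  next
    case False
    have "trunc_le_map n (Hom A x y) i = (\<lambda>f. \<zero>\<^bsub>HomGr X x y i\<^esub>)"
      using False by (intro ext) (simp add: trunc_le_map_simps(3) trunc_le_simps(3))
    then show ?thesis using linear_map_const_zero[OF X.hom_module[of x y i]] o by simp
  qed
  moreover have "linear_map R (HomGr Z x y i)
      (if i = int n + 2 then homology (Hom A x y) (int n + 1) else zero_module (homology (Hom A x y) (int n + 1)))
      (\<lambda>f. if i = int n + 2 then hclass (Hom A x y) (int n + 1) f else hzero x y)"
    using homology_linear[OF C, of "int n + 1"] linear_map_const_zero[OF module_zero_module[OF module_homology[OF C]]]
    by (auto simp: cosk_Gr(2))
  ultimately show ?thesis unfolding kinv_simps(2) kinv_value_def
    by (simp only: small_postnikov_simps(2)) (rule linear_map_pair)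
qed

lemmas kinv_value_closed = linear_map_closed[OF kinv_value_linear]

lemma kinv_value_zero: "x \<in> Obj A \<Longrightarrow> y \<in> Obj A \<Longrightarrow> kinv_value x y i \<zero>\<^bsub>HomGr Z x y i\<^esub> = \<zero>\<^bsub>HomGr E x y i\<^esub>"
  by (rule linear_map_zero[OF cosk_hom_module E.hom_module kinv_value_linear]) (simp_all add: kinv_simps(1))

text \<open>Leaving degree \<open>n + 2\<close>, where \<open>Z\<close> and \<open>E\<close> differ
  most, the differential ends in the gap of \<open>E\<close> at degree \<open>n + 1\<close>.\<close>

lemma kinv_value_dif:
  assumes o: "x \<in> Obj A" "y \<in> Obj A" and f: "f \<in> Mor Z x y i"
  shows "kinv_value x y (i - 1) (Dif (Hom Z x y) i f) = Dif (Hom E x y) i (kinv_value x y i f)" (is "?L = ?R")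
proof -
  have oE: "x \<in> Obj E" "y \<in> Obj E" using o by (simp_all add: kinv_simps(1))
  have L: "?L \<in> Mor E x y (i - 1)" by (rule kinv_value_closed[OF o cosk_dif_closed[OF o f HOL.refl]])
  have R: "?R \<in> Mor E x y (i - 1)" by (rule E.dif_closed[OF oE kinv_value_closed[OF o f] HOL.refl])
  consider "i - 1 < 0 \<or> i - 1 = int n + 1 \<or> i - 1 > int n + 2" | "i \<le> int n + 1" | "i = int n + 3" by linarith
  then show ?thesis
  proof cases
    case 1
    show ?thesis by (rule target_trivial[OF o L R 1])
  next
    case 2
    then show ?thesis
      using trunc_le_map_dif[OF hom_complex[OF o] cosk_low[OF f 2]] unfolding kinv_value_def kinv_simps(3)
      by (simp add: cosk_Dif(1))
  next
    case 3
    then have z: "f = \<zero>\<^bsub>HomGr Z x y i\<^esub>" using f cosk_mor(3)[of i f x y] by simp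
    have "?L = \<zero>\<^bsub>HomGr E x y (i - 1)\<^esub>" unfolding z cosk_dif_zero[OF o HOL.refl] by (rule kinv_value_zero[OF o])
    moreover have "?R = \<zero>\<^bsub>HomGr E x y (i - 1)\<^esub>"
      unfolding z kinv_value_zero[OF o]
      by (rule linear_map_zero[OF E.hom_module E.hom_module E.dif_linear]) (rule oE)+
    ultimately show ?thesis by simp
  qed
qed

text \<open>Besides truncation only total degree \<open>n + 2\<close> counts. Either a cycle meets a
  morphism of degree 0, which is the bimodule action, or both degrees are positive and the class of
  the composite vanishes.\<close>

lemma kinv_value_comp:
  assumes o: "x \<in> Obj A" "y \<in> Obj A" "z \<in> Obj A" and g: "g \<in> Mor Z y z i" and f: "f \<in> Mor Z x y j"
  shows "kinv_value x z (i + j) (Comp Z x y z i j g f) =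
    Comp E x y z i j (kinv_value y z i g) (kinv_value x y j f)" (is "?L = ?R")
proof -
  have oE: "x \<in> Obj E" "y \<in> Obj E" "z \<in> Obj E" using o by (simp_all add: kinv_simps(1))
  note kg = kinv_value_closed[OF o(2,3) g] and kf = kinv_value_closed[OF o(1,2) f] and C = hom_complex[OF o(1,3)]
  have L: "?L \<in> Mor E x z (i + j)" by (rule kinv_value_closed[OF o(1,3) cosk_comp_closed[OF o g f HOL.refl]])
  have R: "?R \<in> Mor E x z (i + j)" by (rule E.comp_closed[OF oE kg kf HOL.refl])
  consider "i + j < 0 \<or> i + j = int n + 1 \<or> i + j > int n + 2" | "i < 0" | "j < 0"
    | "i \<ge> 0" "j \<ge> 0" "i + j \<le> int n" | "i \<ge> 0" "j \<ge> 0" "i + j = int n + 2" by linarith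
  then show ?thesis
  proof cases
    case 1
    show ?thesis by (rule target_trivial[OF o(1,3) L R 1])
  next
    case 2
    note z = cosk_neg[OF o(2,3) g 2]
    show ?thesis unfolding z cosk_comp_zero_left[OF o f HOL.refl] kinv_value_zero[OF o(1,3)] kinv_value_zero[OF o(2,3)]
      by (rule E.comp_zero_left[OF oE kf, symmetric])
  next
    case 3
    note z = cosk_neg[OF o(1,2) f 3]
    show ?thesis unfolding z cosk_comp_zero_right[OF o g HOL.refl] kinv_value_zero[OF o(1,3)] kinv_value_zero[OF o(1,2)]
      by (rule E.comp_zero_right[OF oE kg, symmetric])
  next
    case 4
    then have ij: "i \<le> int n + 1" "j \<le> int n + 1" "i + j \<le> int n + 1" "i \<noteq> int n + 2" "j \<noteq> int n + 2" "i + j \<noteq> int n + 2" by auto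
    note m = cosk_low[OF g ij(1)] cosk_low[OF f ij(2)]
    show ?thesis using ij trunc_le_map_comp[OF o m] hzero_add(1)[OF o(1,3) hzero_add(3)[OF o(1,3)]]
      unfolding kinv_value_def kinv_simps(4) by (simp add: cosk_Comp(3))
  next
    case 5
    let ?k = "int n + 1"
    have tr: "trunc_le_map n (Hom A x z) (i + j) a = \<zero>\<^bsub>HomGr A x z (i + j)\<^esub>" for a
      using 5 by (simp add: trunc_le_map_simps(3))
    consider "i = 0" "j = int n + 2" | "i = int n + 2" "j = 0" | "i > 0" "j > 0" using 5 by linarith
    then show ?thesis
    proof cases
      case 1
      have fc: "f \<in> cycles (Hom A x y) ?k" by (rule cosk_top[OF f]) (use 1 in simp)
      have gc: "g \<in> cycles (Hom A y z) 0" by (rule degree0_cycle[OF o(2,3) cosk_low0[OF g 1(1)]])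
      \<comment> \<open>\<open>E\<close> composes representatives of classes, \<open>Z\<close> the
        morphisms themselves. The factors are homologous cycles, so the composites have the same
        class.\<close>
      let ?g = "trunc_le_map n (Hom A y z) 0 g" and ?f = "hclass (Hom A x y) ?k f"
      have g': "homologous (Hom A y z) 0 ?g g" "?g \<in> cycles (Hom A y z) 0"
        using trunc_le_map_homologous[OF hom_complex[OF o(2,3)] cycle_closed[OF gc]]
          degree0_cycle[OF o(2,3) trunc_le_map_closed[OF hom_complex[OF o(2,3)] cycle_closed[OF gc]]] by simp_all
      have f': "homologous (Hom A x y) ?k ?f f" "?f \<in> cycles (Hom A x y) ?k"
        using hclass_homologous(2)[OF hom_complex[OF o(1,2)] cycle_closed[OF fc]] hclass_cycle[OF hom_complex[OF o(1,2)] fc]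
        by simp_all
      have c: "Comp A x y z 0 ?k g f \<in> cycles (Hom A x z) ?k" "Comp A x y z 0 ?k ?g ?f \<in> cycles (Hom A x z) ?k"
        using comp_cycle[OF o gc fc] comp_cycle[OF o g'(2) f'(2)] by simp_all
      have "homologous (Hom A x z) ?k (Comp A x y z 0 ?k ?g ?f) (Comp A x y z 0 ?k g f)"
        by (rule comp_homologous[OF o g'(2) gc g'(1) f'(2) fc f'(1)]) simp
      then have e: "hclass (Hom A x z) ?k (Comp A x y z 0 ?k g f) = hclass (Hom A x z) ?k (Comp A x y z 0 ?k ?g ?f)"
        using hclass_eq_iff[OF C cycle_closed[OF c(2)] cycle_closed[OF c(1)]] by simp
      have "hclass (Hom A x z) ?k (Comp A x y z 0 ?k ?g ?f) \<in> carrier (homology (Hom A x z) ?k)"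
        using c(2) by (simp add: homology_carrier[OF C])
      note h = hzero_add(2)[OF o(1,3) this]
      have zc: "Comp Z x y z 0 (int n + 2) g f = Comp A x y z 0 ?k g f"
        using cosk_Comp(2)[of ?k A x y z g f] by (simp add: add.commute)
      show ?thesis unfolding kinv_value_def kinv_simps(4) tr using 1 h e zc by simp
    next
      case 2
      have gc: "g \<in> cycles (Hom A y z) ?k" by (rule cosk_top[OF g]) (use 2 in simp)
      have fc: "f \<in> cycles (Hom A x y) 0" by (rule degree0_cycle[OF o(1,2) cosk_low0[OF f 2(2)]])
      let ?f = "trunc_le_map n (Hom A x y) 0 f" and ?g = "hclass (Hom A y z) ?k g"
      have f': "homologous (Hom A x y) 0 ?f f" "?f \<in> cycles (Hom A x y) 0"
        using trunc_le_map_homologous[OF hom_complex[OF o(1,2)] cycle_closed[OF fc]]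
          degree0_cycle[OF o(1,2) trunc_le_map_closed[OF hom_complex[OF o(1,2)] cycle_closed[OF fc]]] by simp_all
      have g': "homologous (Hom A y z) ?k ?g g" "?g \<in> cycles (Hom A y z) ?k"
        using hclass_homologous(2)[OF hom_complex[OF o(2,3)] cycle_closed[OF gc]] hclass_cycle[OF hom_complex[OF o(2,3)] gc]
        by simp_all
      have c: "Comp A x y z ?k 0 g f \<in> cycles (Hom A x z) ?k" "Comp A x y z ?k 0 ?g ?f \<in> cycles (Hom A x z) ?k"
        using comp_cycle[OF o gc fc] comp_cycle[OF o g'(2) f'(2)] by simp_all
      have "homologous (Hom A x z) ?k (Comp A x y z ?k 0 ?g ?f) (Comp A x y z ?k 0 g f)"
        by (rule comp_homologous[OF o g'(2) gc g'(1) f'(2) fc f'(1)]) simp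
      then have e: "hclass (Hom A x z) ?k (Comp A x y z ?k 0 g f) = hclass (Hom A x z) ?k (Comp A x y z ?k 0 ?g ?f)"
        using hclass_eq_iff[OF C cycle_closed[OF c(2)] cycle_closed[OF c(1)]] by simp
      have "hclass (Hom A x z) ?k (Comp A x y z ?k 0 ?g ?f) \<in> carrier (homology (Hom A x z) ?k)"
        using c(2) by (simp add: homology_carrier[OF C])
      note h = hzero_add(1)[OF o(1,3) this]
      have zc: "Comp Z x y z (int n + 2) 0 g f = Comp A x y z ?k 0 g f"
        using cosk_Comp(1)[of ?k A x y z g f] by (simp add: add.commute)
      show ?thesis unfolding kinv_value_def kinv_simps(4) tr using 2 h e zc by simp
    next
      case 3
      then have ij: "i \<le> ?k" "j \<le> ?k" "i \<noteq> 0" "j \<noteq> 0" "i + j = ?k + 1" using 5 by auto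
      note m = cosk_low[OF g ij(1)] cosk_low[OF f ij(2)]
      have gf: "Comp A x y z i j g f \<in> Mor A x z (?k + 1)" by (rule comp_closed[OF o m]) (use 5 in simp)
      \<comment> \<open>In \<open>Z\<close> the composite is a boundary of \<open>A\<close>, whose
        class is zero; in \<open>E\<close> morphisms of positive degree act by zero.\<close>
      then have b: "Dif (Hom A x z) (?k + 1) (Comp A x y z i j g f) \<in> boundaries (Hom A x z) ?k"
        by (simp add: boundaries_def)
      have "hclass (Hom A x z) ?k (Dif (Hom A x z) (?k + 1) (Comp A x y z i j g f)) = hzero x z"
        unfolding homology_simps(1)
        using hclass_boundary_iff[OF C] b boundaries_subset[OF C, of ?k] by blast
      moreover have "Comp Z x y z i j g f = Dif (Hom A x z) (?k + 1) (Comp A x y z i j g f)"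
        using cosk_Comp(3)[OF ij(1,2)] unfolding ij(5) by simp
      moreover have "i + j = int n + 2" using 5 by simp
      ultimately show ?thesis using hzero_add(1)[OF o(1,3) hzero_add(3)[OF o(1,3)]] ij(3,4)
        unfolding kinv_value_def kinv_simps(4) tr by simp
    qed
  qed
qed

lemma kinv_cosk_hom: "kinv_cosk \<in> dg_hom R Z E"
  unfolding kinv_cosk_def
proof (rule mk_dgfun_dg_hom[OF dg_category_cosk target])
  fix x assume "x \<in> Obj Z"
  then show "x \<in> Obj E" "kinv_value x x 0 (Ident Z x) = Ident E x" by (simp_all add: kinv_simps kinv_value_def)
qed (use kinv_value_linear kinv_value_dif kinv_value_comp in \<open>simp_all only: cosk_simps(1)\<close>)

lemma kinv_cosk_simps [simp]:
  "Dom kinv_cosk = Z" "Cod kinv_cosk = E" "x \<in> Obj A \<Longrightarrow> ob kinv_cosk x = x"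
  "x \<in> Obj A \<Longrightarrow> y \<in> Obj A \<Longrightarrow> f \<in> Mor Z x y i \<Longrightarrow> mor kinv_cosk x y i f = kinv_value x y i f"
  by (simp_all add: kinv_cosk_def)

text \<open>Truncation is onto up to degree \<open>n\<close>, and in degree \<open>n + 2\<close>
  cycles map onto homology. In degree 0 the kernel consists of boundaries of \<open>A\<close>, which
  are boundaries in \<open>Z\<close> too.\<close>

lemma kinv_cosk_fibration: "fibration R kinv_cosk"
proof (rule fibrationI[OF kinv_cosk_hom])
  fix y assume "y \<in> Obj E"
  then show "\<exists>x\<in>Obj Z. ob kinv_cosk x = y" by (simp add: kinv_simps(1))
next
  fix x y i assume "x \<in> Obj Z" "y \<in> Obj Z"
  then have o: "x \<in> Obj A" "y \<in> Obj A" by simp_all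
  note C = hom_complex[OF o]
  have "p \<in> kinv_value x y i ` Mor Z x y i" if p: "p \<in> Mor E x y i" for p
  proof -
    obtain a v where av: "p = UPair a v" "a \<in> Mor X x y i"
      "v \<in> carrier (if i = int n + 2 then homology (Hom A x y) (int n + 1) else zero_module (homology (Hom A x y) (int n + 1)))"
      using p unfolding kinv_simps(2) small_postnikov_simps(2) by (rule direct_sum_moduleE)
    consider "i \<le> int n + 1" | "i = int n + 2" | "i > int n + 2" by linarith
    then show ?thesis
    proof cases
      case 1
      obtain a0 where "a0 \<in> Mor A x y i" "a = trunc_le_map n (Hom A x y) i a0"
        using av(2) trunc_le_map_surj[OF C, of n i] by auto
      then show ?thesis using av 1 by (intro image_eqI[of _ _ a0]) (simp_all add: kinv_value_def cosk_Gr(1))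
    next
      case 2
      then obtain z where z: "z \<in> cycles (Hom A x y) (int n + 1)" "v = hclass (Hom A x y) (int n + 1) z"
        using av(3) homology_carrier[OF C, of "int n + 1"] by auto
      have "a = \<zero>\<^bsub>HomGr A x y i\<^esub>" using av(2) 2 by (simp add: trunc_le_simps(3))
      then show ?thesis using av z 2 cosk_mor(2)[of z x y]
        by (intro image_eqI[of _ _ z]) (simp_all add: kinv_value_def trunc_le_map_simps(3) add.commute)
    next
      case 3
      have z: "\<zero>\<^bsub>HomGr Z x y i\<^esub> \<in> Mor Z x y i"
        using abelian_groupE(2)[OF module_abelian_group[OF cosk_hom_module[OF o]]] .
      have "p = kinv_value x y i \<zero>\<^bsub>HomGr Z x y i\<^esub>"
        by (rule target_trivial[OF o p kinv_value_closed[OF o z]]) (use 3 in simp)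
      then show ?thesis using z by (rule image_eqI)
    qed
  qed
  then show "Mor E (ob kinv_cosk x) (ob kinv_cosk y) i \<subseteq> mor kinv_cosk x y i ` Mor Z x y i"
    using o by auto
next
  fix x y assume "x \<in> Obj Z" "y \<in> Obj Z"
  then have o: "x \<in> Obj A" "y \<in> Obj A" by simp_all
  show "Mor Z x y 0 \<subseteq> cycles (Hom Z x y) 0"
    using degree0_cycle[OF o] N by (auto simp: cycles_def cosk_Gr(1) cosk_Dif(1))
  fix f assume f: "f \<in> Mor Z x y 0" and z: "mor kinv_cosk x y 0 f = \<zero>\<^bsub>HomGr E (ob kinv_cosk x) (ob kinv_cosk y) 0\<^esub>"
  note C = hom_complex[OF o]
  have f0: "f \<in> Mor A x y 0" using cosk_low0[OF f] by simp
  have "trunc_le_map n (Hom A x y) 0 f = \<zero>\<^bsub>HomGr X x y 0\<^esub>"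
    using z o f by (simp add: kinv_simps(2) kinv_value_def)
  then have "homologous (Hom A x y) 0 f \<zero>\<^bsub>HomGr A x y 0\<^esub>"
    using trunc_le_map_zero[OF C, of n 0] f0 mor_zero[OF o] by (intro trunc_le_map_eq_homologous[OF C, of _ _ _ n]) simp_all
  then have "f \<in> boundaries (Hom A x y) 0"
    using hclass_eq_iff[OF C f0 mor_zero[OF o]] hclass_boundary_iff[OF C f0] by simp
  then show "f \<in> boundaries (Hom Z x y) 0" by (simp add: boundaries_def cosk_Gr(1) cosk_Dif(1))
qed

text \<open>A cycle of degree \<open>n + 1\<close> is its own filling in degree
  \<open>n + 2\<close>. The differential there is an inclusion, so cycles of degree
  \<open>n + 2\<close> are zero, and above there is nothing.\<close>

lemma cosk_fills_cycles: "fills_cycles n Z"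
  unfolding fills_cycles_def
proof (intro ballI allI impI)
  fix x y m z assume "x \<in> Obj Z" "y \<in> Obj Z" and m: "int n < m" and z: "z \<in> cycles (Hom Z x y) m"
  then have o: "x \<in> Obj A" "y \<in> Obj A" by simp_all
  consider "m = int n + 1" | "m = int n + 2" | "m > int n + 2" using m by linarith
  then have "z \<in> cycles (Hom A x y) (int n + 1) \<and> m = int n + 1 \<or> z = \<zero>\<^bsub>HomGr Z x y m\<^esub>"
  proof cases
    case 1
    then show ?thesis using z by (simp add: cycles_def cosk_Gr(1) cosk_Dif(1))
  next
    case 2
    then show ?thesis using z by (simp add: cycles_def cosk_Gr(1,2) cosk_Dif(2) add.commute)
  next
    case 3
    then show ?thesis using z by (simp add: cycles_def cosk_Gr(3))
  qed
  then show "\<exists>c\<in>Mor Z x y (m + 1). Dif (Hom Z x y) (m + 1) c = z"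
  proof
    assume "z \<in> cycles (Hom A x y) (int n + 1) \<and> m = int n + 1"
    then show ?thesis by (intro bexI[of _ z]) (simp_all add: cosk_Gr(2) cosk_Dif(2))
  next
    assume "z = \<zero>\<^bsub>HomGr Z x y m\<^esub>"
    then show ?thesis using cosk_dif_zero[OF o, of m "m + 1"]
        abelian_groupE(2)[OF module_abelian_group[OF cosk_hom_module[OF o, of "m + 1"]]]
      by (intro bexI[of _ "\<zero>\<^bsub>HomGr Z x y (m + 1)\<^esub>"]) simp_all
  qed
qed

text \<open>A chain of degree \<open>n + 2\<close> of \<open>A\<close> enters \<open>Z\<close> as
  its boundary, which has class zero; this matches the zero bimodule part on the other side.\<close>

lemma kinv_cosk_proj:
  assumes incl: "kinv_incl n A \<circ>\<^sub>d postnikov_proj n A \<in> dg_hom R A E"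
  shows "kinv_cosk \<circ>\<^sub>d cosk_proj = kinv_incl n A \<circ>\<^sub>d postnikov_proj n A"
proof (rule dg_hom_ext[OF dg_comp_hom[OF cosk_proj_hom kinv_cosk_hom] incl])
  fix x assume "x \<in> Obj A"
  then show "ob (kinv_cosk \<circ>\<^sub>d cosk_proj) x = ob (kinv_incl n A \<circ>\<^sub>d postnikov_proj n A) x"
    by (simp add: cosk_proj_def postnikov_proj_def)
  fix y i f assume "y \<in> Obj A" and f: "f \<in> Mor A x y i"
  with \<open>x \<in> Obj A\<close> have o: "x \<in> Obj A" "y \<in> Obj A" by simp_all
  note C = hom_complex[OF o]
  have "cosk_map (int n + 1) (Hom A x y) i f \<in> Mor Z x y i"
    using linear_map_closed[OF cosk_map_linear[OF C] f] by simp
  then have l: "mor (kinv_cosk \<circ>\<^sub>d cosk_proj) x y i f = kinv_value x y i (cosk_map (int n + 1) (Hom A x y) i f)"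
    using o f by (simp add: cosk_proj_def)
  have "trunc_le_map n (Hom A x y) i f \<in> Mor X x y i"
    using linear_map_closed[OF trunc_le_map_linear[OF C] f] by simp
  then have r: "mor (kinv_incl n A \<circ>\<^sub>d postnikov_proj n A) x y i f = UPair (trunc_le_map n (Hom A x y) i f) (hzero x y)"
    using o f by (simp add: postnikov_proj_def)
  consider "i \<le> int n + 1" | "i = int n + 2" | "i > int n + 2" by linarith
  then show "mor (kinv_cosk \<circ>\<^sub>d cosk_proj) x y i f = mor (kinv_incl n A \<circ>\<^sub>d postnikov_proj n A) x y i f"
    unfolding l r
  proof cases
    case 1
    then show "kinv_value x y i (cosk_map (int n + 1) (Hom A x y) i f) = UPair (trunc_le_map n (Hom A x y) i f) (hzero x y)"
      by (simp add: kinv_value_def)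
  next
    case 2
    then have b: "Dif (Hom A x y) i f \<in> boundaries (Hom A x y) (int n + 1)"
      using f by (simp add: boundaries_def add.commute)
    then have "hclass (Hom A x y) (int n + 1) (Dif (Hom A x y) i f) = hzero x y"
      unfolding homology_simps(1) using hclass_boundary_iff[OF C] boundaries_subset[OF C] by blast
    then show "kinv_value x y i (cosk_map (int n + 1) (Hom A x y) i f) = UPair (trunc_le_map n (Hom A x y) i f) (hzero x y)"
      using 2 by (simp add: kinv_value_def trunc_le_map_simps(3))
  next
    case 3
    then show "kinv_value x y i (cosk_map (int n + 1) (Hom A x y) i f) = UPair (trunc_le_map n (Hom A x y) i f) (hzero x y)"
      by (simp add: kinv_value_def trunc_le_map_simps(3))
  qed
qed

end

text \<open>\<open>P\<close> is the identity on objects and onto on morphisms, so every condition on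
  the induced dg functor is checked on preimages, where it is a condition on
  \<open>G\<close>.\<close>

lemma dg_hom_factor:
  assumes P: "P \<in> dg_hom R A A'" and G: "G \<in> dg_hom R A C"
    and obj: "Obj A' = Obj A" "\<And>x. x \<in> Obj A \<Longrightarrow> ob P x = x"
    and surj: "\<And>x y i. x \<in> Obj A \<Longrightarrow> y \<in> Obj A \<Longrightarrow> mor P x y i ` Mor A x y i = Mor A' x y i"
    and s: "\<And>x y i f. x \<in> Obj A \<Longrightarrow> y \<in> Obj A \<Longrightarrow> f \<in> Mor A x y i \<Longrightarrow> s x y i (mor P x y i f) = mor G x y i f"
  shows "mk_dgfun A' C (ob G) s \<in> dg_hom R A' C"
proof (rule mk_dgfun_dg_hom[OF dg_homD(5)[OF P] dg_homD(5)[OF G]], unfold obj(1))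
  note PD = dg_homD[OF P] and GD = dg_homD[OF G]
  interpret A: dg_category R A by (rule PD)
  interpret P: dgf R P by standard (rule PD)
  interpret G: dgf R G by standard (rule GD)
  note PP = P.mor_add[unfolded PD(2,3)] P.mor_smult[unfolded PD(2,3)] P.mor_dif[unfolded PD(2,3)]
    P.mor_comp[unfolded PD(2,3)] P.mor_ident[unfolded PD(2,3)]
  note GG = G.mor_add[unfolded GD(2,3)] G.mor_smult[unfolded GD(2,3)] G.mor_dif[unfolded GD(2,3)]
    G.mor_comp[unfolded GD(2,3)] G.mor_ident[unfolded GD(2,3)] G.mor_mor[unfolded GD(2,3)] G.ob_closed[unfolded GD(2,3)]
  { fix x assume o: "x \<in> Obj A"
    show "ob G x \<in> Obj C" by (rule GG(7)[OF o])
    show "s x x 0 (Ident A' x) = Ident C (ob G x)"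
      using s[OF o o A.ident_closed[OF o]] PP(5)[OF o] GG(5)[OF o] obj(2)[OF o] by simp }
  { fix x y i assume o: "x \<in> Obj A" "y \<in> Obj A"
    note op = obj(2)[OF o(1)] obj(2)[OF o(2)]
    show "linear_map R (HomGr A' x y i) (HomGr C (ob G x) (ob G y) i) (s x y i)"
    proof (rule linear_mapI)
      fix f assume "f \<in> Mor A' x y i"
      then obtain h where h: "h \<in> Mor A x y i" "f = mor P x y i h" using surj[OF o] by blast
      show "s x y i f \<in> Mor C (ob G x) (ob G y) i" unfolding h(2) s[OF o h(1)] by (rule GG(6)[OF o h(1)])
      { fix g assume "g \<in> Mor A' x y i"
        then obtain k where k: "k \<in> Mor A x y i" "g = mor P x y i k" using surj[OF o] by blast
        show "s x y i (f \<oplus>\<^bsub>HomGr A' x y i\<^esub> g) = s x y i f \<oplus>\<^bsub>HomGr C (ob G x) (ob G y) i\<^esub> s x y i g"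
          using s[OF o A.mor_add[OF o h(1) k(1)]] s[OF o h(1)] s[OF o k(1)] PP(1)[OF o h(1) k(1)] GG(1)[OF o h(1) k(1)] h k op
          by simp }
      { fix r assume r: "r \<in> carrier R"
        show "s x y i (r \<odot>\<^bsub>HomGr A' x y i\<^esub> f) = r \<odot>\<^bsub>HomGr C (ob G x) (ob G y) i\<^esub> s x y i f"
          using s[OF o A.mor_smult[OF o h(1) r]] s[OF o h(1)] PP(2)[OF o h(1) r] GG(2)[OF o h(1) r] h op by simp }
    qed
    fix f assume "f \<in> Mor A' x y i"
    then obtain h where h: "h \<in> Mor A x y i" "f = mor P x y i h" using surj[OF o] by blast
    show "s x y (i - 1) (Dif (Hom A' x y) i f) = Dif (Hom C (ob G x) (ob G y)) i (s x y i f)"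
      using s[OF o A.dif_closed[OF o h(1) HOL.refl]] s[OF o h(1)] PP(3)[OF o h(1)] GG(3)[OF o h(1)] h op by simp }
  fix x y z i j g f assume o: "x \<in> Obj A" "y \<in> Obj A" "z \<in> Obj A" and gf: "g \<in> Mor A' y z i" "f \<in> Mor A' x y j"
  obtain k where k: "k \<in> Mor A y z i" "g = mor P y z i k" using surj[OF o(2,3)] gf(1) by blast
  obtain h where h: "h \<in> Mor A x y j" "f = mor P x y j h" using surj[OF o(1,2)] gf(2) by blast
  show "s x z (i + j) (Comp A' x y z i j g f) =
    Comp C (ob G x) (ob G y) (ob G z) i j (s y z i g) (s x y j f)"
    using s[OF o(1,3) A.comp_closed[OF o k(1) h(1) HOL.refl]] s[OF o(1,2) h(1)] s[OF o(2,3) k(1)]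
      PP(4)[OF o k(1) h(1)] GG(4)[OF o k(1) h(1)] h k obj(2)[OF o(1)] obj(2)[OF o(2)] obj(2)[OF o(3)] by simp
qed

section \<open>The projections between small Postnikov sections\<close>

lemma postnikov_proj_simps [simp]:
  "Dom (postnikov_proj n A) = A" "Cod (postnikov_proj n A) = small_postnikov n A"
  "x \<in> Obj A \<Longrightarrow> ob (postnikov_proj n A) x = x"
  "x \<in> Obj A \<Longrightarrow> y \<in> Obj A \<Longrightarrow> f \<in> Mor A x y i \<Longrightarrow> mor (postnikov_proj n A) x y i f = trunc_le_map n (Hom A x y) i f"
  by (simp_all add: postnikov_proj_def)

lemma postnikov_step_simps [simp]:
  "Dom (postnikov_step n A) = small_postnikov (Suc n) A" "Cod (postnikov_step n A) = small_postnikov n A"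
  "x \<in> Obj A \<Longrightarrow> ob (postnikov_step n A) x = x"
  "x \<in> Obj A \<Longrightarrow> y \<in> Obj A \<Longrightarrow> f \<in> Mor (small_postnikov (Suc n) A) x y i \<Longrightarrow>
    mor (postnikov_step n A) x y i f = trunc_le_map n (Hom A x y) i f"
  by (simp_all add: postnikov_step_def)

context positive_dg
begin

lemma postnikov_proj_surj: "x \<in> Obj A \<Longrightarrow> y \<in> Obj A \<Longrightarrow>
    mor (postnikov_proj n A) x y i ` Mor A x y i = Mor (small_postnikov n A) x y i"
  using trunc_le_map_surj[OF hom_complex, of x y n i] by simp

lemma postnikov_step_hom: "postnikov_step n A \<in> dg_hom R (small_postnikov (Suc n) A) (small_postnikov n A)"
proof -
  have "mk_dgfun (small_postnikov (Suc n) A) (small_postnikov n A) (ob (postnikov_proj n A))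
      (\<lambda>x y i f. trunc_le_map n (Hom A x y) i f) \<in> dg_hom R (small_postnikov (Suc n) A) (small_postnikov n A)"
    by (rule dg_hom_factor[OF small_postnikov(2) small_postnikov(2) _ _ postnikov_proj_surj])
      (use trunc_le_map_trunc[OF hom_complex] in simp_all)
  moreover have "mk_dgfun (small_postnikov (Suc n) A) (small_postnikov n A) (ob (postnikov_proj n A))
      (\<lambda>x y i f. trunc_le_map n (Hom A x y) i f) = postnikov_step n A"
    unfolding postnikov_step_def by (rule mk_dgfun_cong) simp_all
  ultimately show ?thesis by simp
qed

text \<open>The kernel in degree 0 consists of boundaries of \<open>A\<close>. They remain
  boundaries at level \<open>n + 1\<close>, because the class of the bounding chain in degree 1
  survives there.\<close>

lemma postnikov_step_fibration: "fibration R (postnikov_step n A)"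
proof (rule fibrationI[OF postnikov_step_hom])
  fix y assume "y \<in> Obj (small_postnikov n A)"
  then show "\<exists>x\<in>Obj (small_postnikov (Suc n) A). ob (postnikov_step n A) x = y" by simp
next
  fix x y i assume "x \<in> Obj (small_postnikov (Suc n) A)" "y \<in> Obj (small_postnikov (Suc n) A)"
  then have o: "x \<in> Obj A" "y \<in> Obj A" by simp_all
  note C = hom_complex[OF o]
  show "Mor (small_postnikov n A) (ob (postnikov_step n A) x) (ob (postnikov_step n A) y) i \<subseteq>
      mor (postnikov_step n A) x y i ` Mor (small_postnikov (Suc n) A) x y i"
  proof
    fix a assume "a \<in> Mor (small_postnikov n A) (ob (postnikov_step n A) x) (ob (postnikov_step n A) y) i"
    then obtain a0 where a0: "a0 \<in> Mor A x y i" "a = trunc_le_map n (Hom A x y) i a0"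
      using o trunc_le_map_surj[OF C, of n i] by auto
    have "trunc_le_map (Suc n) (Hom A x y) i a0 \<in> Mor (small_postnikov (Suc n) A) x y i"
      using linear_map_closed[OF trunc_le_map_linear[OF C] a0(1)] by simp
    then show "a \<in> mor (postnikov_step n A) x y i ` Mor (small_postnikov (Suc n) A) x y i"
      using o a0 trunc_le_map_trunc[OF C] by (intro image_eqI[of _ _ "trunc_le_map (Suc n) (Hom A x y) i a0"]) simp_all
  qed
next
  fix x y assume "x \<in> Obj (small_postnikov (Suc n) A)" "y \<in> Obj (small_postnikov (Suc n) A)"
  then have o: "x \<in> Obj A" "y \<in> Obj A" by simp_all
  note C = hom_complex[OF o]
  have Gr0: "HomGr (small_postnikov (Suc n) A) x y 0 = HomGr A x y 0" by (simp add: trunc_le_simps(1))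
  show "Mor (small_postnikov (Suc n) A) x y 0 \<subseteq> cycles (Hom (small_postnikov (Suc n) A) x y) 0"
    using degree0_cycle[OF o] by (auto simp: cycles_def trunc_le_simps trunc_le_map_simps)
  fix f assume "f \<in> Mor (small_postnikov (Suc n) A) x y 0"
    and z: "mor (postnikov_step n A) x y 0 f = \<zero>\<^bsub>HomGr (small_postnikov n A) (ob (postnikov_step n A) x) (ob (postnikov_step n A) y) 0\<^esub>"
  then have f0: "f \<in> Mor A x y 0" by (simp only: Gr0)
  have "trunc_le_map n (Hom A x y) 0 f = \<zero>\<^bsub>HomGr (small_postnikov n A) x y 0\<^esub>"
    using z o f0 by (simp add: Gr0[simplified])
  then have "homologous (Hom A x y) 0 f \<zero>\<^bsub>HomGr A x y 0\<^esub>"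
    using trunc_le_map_zero[OF C, of n 0] f0 mor_zero[OF o] by (intro trunc_le_map_eq_homologous[OF C, of _ _ _ n]) simp_all
  then have "f \<in> boundaries (Hom A x y) 0"
    using hclass_eq_iff[OF C f0 mor_zero[OF o]] hclass_boundary_iff[OF C f0] by simp
  then obtain c where c: "c \<in> Mor A x y 1" "f = Dif (Hom A x y) 1 c" by (auto simp: boundaries_def)
  have "trunc_le_map (Suc n) (Hom A x y) 0 f = Dif (trunc_le (Suc n) (Hom A x y)) 1 (trunc_le_map (Suc n) (Hom A x y) 1 c)"
    using trunc_le_map_dif[OF C c(1), of "Suc n"] c(2) by simp
  then have "f = Dif (trunc_le (Suc n) (Hom A x y)) 1 (trunc_le_map (Suc n) (Hom A x y) 1 c)" by (simp add: trunc_le_map_simps(1))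
  then show "f \<in> boundaries (Hom (small_postnikov (Suc n) A) x y) 0"
    using linear_map_closed[OF trunc_le_map_linear[OF C] c(1)] by (simp add: boundaries_def)
qed

end

lemma bounding_chain_comp:
  fixes R :: "'r ring" and A :: "('r, ('r, 'a) univ) dgcat"
  assumes tower: "big_postnikov R n A t" and c: "(m, T) \<in> cells R n (Stage t i)"
    and F: "F \<in> dg_hom R (Colim t) Y" and H: "H \<in> dg_hom R Y Y'"
  shows "bounding_chain_value R t (H \<circ>\<^sub>d F) i (m, T) =
    mor H (ob (F \<circ>\<^sub>d Leg t i) (ob T (Num 1))) (ob (F \<circ>\<^sub>d Leg t i) (ob T (Num 2))) (m + 1)
      (bounding_chain_value R t F i (m, T))"
proof -
  note a = attach_hom[OF tower_attach[OF tower] tower_map[OF tower] c]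
  note cm = dg_comp_hom[OF a(1) tower_leg[OF tower, of "Suc i"], folded cell_map_def]
  note Fc = dg_comp_hom[OF cm F]
  interpret Fc: dgf R "F \<circ>\<^sub>d cell_map t i (m, T)" using Fc by (rule dgf_hom)
  interpret R: cring R by (rule Fc.D.cring)
  have top: "Scal \<one>\<^bsub>R\<^esub> \<in> Mor (D_cat R (m + 1) :: ('r, ('r, 'a) univ) dgcat) (Num 3) (Num 4) (m + 1)"
    by (simp add: scalar_degree_def)
  have "mor (H \<circ>\<^sub>d (F \<circ>\<^sub>d cell_map t i (m, T))) (Num 3) (Num 4) (m + 1) (Scal \<one>\<^bsub>R\<^esub>) =
    mor H (ob (F \<circ>\<^sub>d cell_map t i (m, T)) (Num 3)) (ob (F \<circ>\<^sub>d cell_map t i (m, T)) (Num 4)) (m + 1)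
      (mor (F \<circ>\<^sub>d cell_map t i (m, T)) (Num 3) (Num 4) (m + 1) (Scal \<one>\<^bsub>R\<^esub>))"
    by (rule dg_comp_simps(4)) (use top dg_homD(2)[OF Fc] in simp_all)
  then show ?thesis
    using dg_comp_assoc[OF cm F H] bounding_chain(1,2)[OF tower c F] by (simp add: bounding_chain_value_def)
qed

section \<open>The factorization of \<gamma> and the lift to the next section\<close>

context postnikov_stage
begin

text \<open>The two dg functors agree on \<open>A\<close> by \<open>kinv_cosk_proj\<close>. Bounding
  chains for \<open>m > n + 1\<close> land in degrees above \<open>n + 2\<close>, where
  \<open>E\<close> is zero. For \<open>m = n + 1\<close> the chain is sent by
  \<open>\<Gamma>\<close> to the cycle \<open>z\<close> itself and by \<kappa> to its class, as
  \<gamma> prescribes.\<close>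

lemma gamma_factor:
  assumes tower: "big_postnikov R n A t" and gamma: "is_gamma R n A t \<gamma>"
  shows "\<exists>\<Gamma>\<in>dg_hom R (Colim t) Z. kinv_cosk \<circ>\<^sub>d \<Gamma> = \<gamma>"
proof -
  have g: "\<gamma> \<in> dg_hom R (Colim t) E" "\<gamma> \<circ>\<^sub>d Leg t 0 = kinv_incl n A \<circ>\<^sub>d postnikov_proj n A"
    and g1: "\<And>i m T. (m, T) \<in> cells R n (Stage t i) \<Longrightarrow> m = int n + 1 \<Longrightarrow>
        \<exists>a\<in>Obj A. \<exists>b\<in>Obj A. \<exists>z\<in>cycles (Hom A a b) (int n + 1).
           ob (from_base t i) a = ob T (Num 1) \<and> ob (from_base t i) b = ob T (Num 2) \<and>
           mor (from_base t i) a b (int n + 1) z = mor T (Num 1) (Num 2) m (Scal \<one>\<^bsub>R\<^esub>) \<and>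
           bounding_chain_value R t \<gamma> i (m, T) =
             UPair \<zero>\<^bsub>HomGr (small_postnikov n A) a b (int n + 2)\<^esub> (hclass (Hom A a b) (int n + 1) z)"
    using gamma unfolding is_gamma_def by blast+
  note L0 = tower_leg[OF tower, of 0, unfolded tower_base[OF tower]]
  obtain \<Gamma> where \<Gamma>: "\<Gamma> \<in> dg_hom R (Colim t) Z" "\<Gamma> \<circ>\<^sub>d Leg t 0 = cosk_proj"
    using tower_extend[OF tower cosk_proj_hom cosk_fills_cycles] by blast
  note K = dg_comp_hom[OF \<Gamma>(1) kinv_cosk_hom]
  have "kinv_cosk \<circ>\<^sub>d \<Gamma> = \<gamma>"
  proof (rule tower_eq[OF tower K g(1)])
    show "kinv_cosk \<circ>\<^sub>d \<Gamma> \<circ>\<^sub>d Leg t 0 = \<gamma> \<circ>\<^sub>d Leg t 0"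
      using dg_comp_assoc[OF L0 \<Gamma>(1) kinv_cosk_hom] \<Gamma>(2) g(2) kinv_cosk_proj dg_comp_hom[OF L0 g(1)] by simp
    fix i m T assume c: "(m, T) \<in> cells R n (Stage t i)" and IH: "kinv_cosk \<circ>\<^sub>d \<Gamma> \<circ>\<^sub>d Leg t i = \<gamma> \<circ>\<^sub>d Leg t i"
    note bk = bounding_chain[OF tower c K, unfolded IH] and bg = bounding_chain[OF tower c g(1)]
      and b\<Gamma> = bounding_chain[OF tower c \<Gamma>(1)]
    show "bounding_chain_value R t (kinv_cosk \<circ>\<^sub>d \<Gamma>) i (m, T) = bounding_chain_value R t \<gamma> i (m, T)"
    proof (cases "m = int n + 1")
      case False
      then have m: "m > int n + 1" using cell_boundary(2)[OF c] by simp
      show ?thesis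
        by (rule target_trivial[OF bk(5,6)[unfolded kinv_simps(1)] bk(3) bg(3)]) (use m in simp)
    next
      case True
      obtain a b z where o: "a \<in> Obj A" "b \<in> Obj A" and z: "z \<in> cycles (Hom A a b) (int n + 1)"
        and T: "ob (from_base t i) a = ob T (Num 1)" "ob (from_base t i) b = ob T (Num 2)"
          "mor (from_base t i) a b (int n + 1) z = mor T (Num 1) (Num 2) m (Scal \<one>\<^bsub>R\<^esub>)"
        and v: "bounding_chain_value R t \<gamma> i (m, T) =
             UPair \<zero>\<^bsub>HomGr (small_postnikov n A) a b (int n + 2)\<^esub> (hclass (Hom A a b) (int n + 1) z)"
        using g1[OF c True] by blast
      note fb = from_base_hom[OF tower, of i]
      note GL = dg_comp_hom[OF tower_leg[OF tower, of i] \<Gamma>(1)]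
      have "\<Gamma> \<circ>\<^sub>d Leg t i \<circ>\<^sub>d from_base t i = cosk_proj"
        using dg_comp_assoc[OF fb(1) tower_leg[OF tower, of i] \<Gamma>(1)] fb(2) \<Gamma>(2) by simp
      note cp = arg_cong[OF this, of ob] arg_cong[OF this, of mor]
      have u: "ob (\<Gamma> \<circ>\<^sub>d Leg t i) (ob T (Num 1)) = a" "ob (\<Gamma> \<circ>\<^sub>d Leg t i) (ob T (Num 2)) = b"
        using fun_cong[OF cp(1), of a] fun_cong[OF cp(1), of b] o dg_homD(2)[OF fb(1)]
          dg_comp_simps(3)[of _ "from_base t i" "\<Gamma> \<circ>\<^sub>d Leg t i"]
        unfolding T(1,2)[symmetric] cosk_proj_def by simp_all
      have zA: "z \<in> Mor A a b (int n + 1)" by (rule cycle_closed[OF z])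
      have "mor (\<Gamma> \<circ>\<^sub>d Leg t i \<circ>\<^sub>d from_base t i) a b (int n + 1) z =
          mor (\<Gamma> \<circ>\<^sub>d Leg t i) (ob T (Num 1)) (ob T (Num 2)) (int n + 1) (mor (from_base t i) a b (int n + 1) z)"
        unfolding T(1,2)[symmetric] by (rule dg_comp_simps(4)) (use o zA dg_homD(2)[OF fb(1)] in simp_all)
      moreover have "mor cosk_proj a b (int n + 1) z = z" using o zA by (simp add: cosk_proj_def)
      ultimately have "mor (\<Gamma> \<circ>\<^sub>d Leg t i) (ob T (Num 1)) (ob T (Num 2)) m (mor T (Num 1) (Num 2) m (Scal \<one>\<^bsub>R\<^esub>)) = z"
        unfolding cp(2) by (simp only: True T(3)[unfolded True, symmetric])
      \<comment> \<open>Out of degree \<open>n + 2\<close> the differential of \<open>Z\<close> is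
        the inclusion of cycles, so a bounding chain is determined by its boundary.\<close>
      then have "Dif (Hom Z a b) (m + 1) (bounding_chain_value R t \<Gamma> i (m, T)) = z"
        using b\<Gamma>(4) unfolding u by simp
      then have "bounding_chain_value R t \<Gamma> i (m, T) = z" using True by (simp add: cosk_Dif(2))
      then have "bounding_chain_value R t (kinv_cosk \<circ>\<^sub>d \<Gamma>) i (m, T) = mor kinv_cosk a b (m + 1) z"
        using bounding_chain_comp[OF tower c \<Gamma>(1) kinv_cosk_hom] unfolding u by simp
      also have "\<dots> = kinv_value a b (m + 1) z"
        using o z True by (intro kinv_cosk_simps(4)) (simp_all add: cosk_Gr(2))
      also have "\<dots> = bounding_chain_value R t \<gamma> i (m, T)"
        unfolding v kinv_value_def using True by (simp add: trunc_le_map_simps(3) trunc_le_simps(3) add.commute)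
      finally show ?thesis .
    qed
  qed
  then show ?thesis using \<Gamma>(1) by blast
qed

text \<open>Bounding chains have degree above \<open>n\<close>, where the small section is zero, so
  only the values on \<open>A\<close> have to be compared.\<close>

lemma proj_gamma:
  assumes tower: "big_postnikov R n A t" and M: "is_M R n A t M" and gamma: "is_gamma R n A t \<gamma>"
  shows "kinv_proj n A \<circ>\<^sub>d \<gamma> = M"
proof -
  have g: "\<gamma> \<in> dg_hom R (Colim t) E" "\<gamma> \<circ>\<^sub>d Leg t 0 = kinv_incl n A \<circ>\<^sub>d postnikov_proj n A"
    using gamma unfolding is_gamma_def by blast+
  have m: "M \<in> dg_hom R (Colim t) X" "M \<circ>\<^sub>d Leg t 0 = postnikov_proj n A" using M unfolding is_M_def by blast+
  note L0 = tower_leg[OF tower, of 0, unfolded tower_base[OF tower]]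
  note p = sqz_proj_hom[OF small_postnikov(1) target]
  note pg = dg_comp_hom[OF g(1) p]
  note gL = dg_comp_hom[OF L0 g(1), unfolded g(2)]
  show ?thesis
  proof (rule tower_eq[OF tower pg m(1)])
    have "kinv_proj n A \<circ>\<^sub>d (kinv_incl n A \<circ>\<^sub>d postnikov_proj n A) = postnikov_proj n A"
    proof (rule dg_hom_ext[OF dg_comp_hom[OF gL p] small_postnikov(2)])
      fix x y i f assume o: "x \<in> Obj A" "y \<in> Obj A" and f: "f \<in> Mor A x y i"
      have X: "trunc_le_map n (Hom A x y) i f \<in> Mor X x y i"
        using linear_map_closed[OF trunc_le_map_linear[OF hom_complex[OF o]] f] by simp
      interpret gL: dgf R "kinv_incl n A \<circ>\<^sub>d postnikov_proj n A" using gL by (rule dgf_hom)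
      have v: "mor (kinv_incl n A \<circ>\<^sub>d postnikov_proj n A) x y i f = UPair (trunc_le_map n (Hom A x y) i f) (hzero x y)"
        using o f X by simp
      have "mor (kinv_incl n A \<circ>\<^sub>d postnikov_proj n A) x y i f \<in> Mor E x y i"
        using gL.mor_mor[of x y f i] o f by (simp del: dg_comp_simps(4))
      then show "mor (kinv_proj n A \<circ>\<^sub>d (kinv_incl n A \<circ>\<^sub>d postnikov_proj n A)) x y i f = mor (postnikov_proj n A) x y i f"
        using o f v X by simp
    qed simp
    then show "kinv_proj n A \<circ>\<^sub>d \<gamma> \<circ>\<^sub>d Leg t 0 = M \<circ>\<^sub>d Leg t 0"
      using dg_comp_assoc[OF L0 g(1) p] g(2) m(2) by simp
    fix i k T assume c: "(k, T) \<in> cells R n (Stage t i)" and IH: "kinv_proj n A \<circ>\<^sub>d \<gamma> \<circ>\<^sub>d Leg t i = M \<circ>\<^sub>d Leg t i"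
    have k: "k + 1 > int n" using cell_boundary(2)[OF c] by simp
    show "bounding_chain_value R t (kinv_proj n A \<circ>\<^sub>d \<gamma>) i (k, T) = bounding_chain_value R t M i (k, T)"
      using bounding_chain(3)[OF tower c pg, unfolded IH] bounding_chain(3)[OF tower c m(1)] k
      by (simp add: trunc_le_simps(3))
  qed
qed

text \<open>The lift truncates the values of \<open>g\<close>, so it kills all degrees above
  \<open>n + 1\<close>. This respects the differential exactly because the cycles that
  \<open>g\<close> takes as values in degree \<open>n + 2\<close> are boundaries of
  \<open>A\<close>.\<close>

lemma lift_from_cosk:
  assumes g: "g \<in> dg_hom R B Z" and f: "f \<in> dg_hom R B X" and eq: "kinv_cosk \<circ>\<^sub>d g = kinv_incl n A \<circ>\<^sub>d f"
  shows "\<exists>L\<in>dg_hom R B (small_postnikov (Suc n) A). postnikov_step n A \<circ>\<^sub>d L = f"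
proof -
  note gD = dg_homD[OF g] and fD = dg_homD[OF f]
  interpret B: dg_category R B by (rule gD)
  interpret g: dgf R g using g by (rule dgf_hom)
  interpret f: dgf R f using f by (rule dgf_hom)
  let ?P = "small_postnikov (Suc n) A"
  interpret P: dg_category R ?P by (rule small_postnikov)
  note gg = g.mor_linear[unfolded gD(2,3)] g.mor_dif[unfolded gD(2,3)]
    g.mor_comp[unfolded gD(2,3)] g.mor_ident[unfolded gD(2,3)] g.mor_mor[unfolded gD(2,3)]
  have ob: "ob g x \<in> Obj A" "ob g x = ob f x" if "x \<in> Obj B" for x
  proof -
    show o: "ob g x \<in> Obj A" using g.ob_closed[unfolded gD(2,3)] that by simp
    have "ob f x \<in> Obj A" using f.ob_closed[unfolded fD(2,3)] that by simp
    then show "ob g x = ob f x" using arg_cong[OF eq, of "\<lambda>H. ob H x"] that o gD(2) fD(2) by simp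
  qed
  have val: "kinv_value (ob g x) (ob g y) i (mor g x y i b) = UPair (mor f x y i b) (hzero (ob g x) (ob g y))"
    if o: "x \<in> Obj B" "y \<in> Obj B" and b: "b \<in> Mor B x y i" for x y i b
  proof -
    have fb: "mor f x y i b \<in> Mor X (ob g x) (ob g y) i"
      using f.mor_mor[unfolded fD(2,3), OF o b] ob(2)[OF o(1)] ob(2)[OF o(2)] by simp
    have "mor (kinv_cosk \<circ>\<^sub>d g) x y i b = mor (kinv_incl n A \<circ>\<^sub>d f) x y i b" by (simp only: eq)
    then show ?thesis
      using o b gD(2) fD(2) ob(1)[OF o(1)] ob(1)[OF o(2)] ob(2)[OF o(1), symmetric] ob(2)[OF o(2), symmetric] fb gg(5)[OF o b]
      by (simp del: small_postnikov_simps cosk_simps(2))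
  qed
  let ?A = "\<lambda>x y. Hom A (ob g x) (ob g y)"
  let ?G = "\<lambda>x y. HomGr ?P (ob g x) (ob g y)"
  let ?v = "\<lambda>x y i b. trunc_le_map (Suc n) (?A x y) i (mor g x y i b)"
  have lin: "linear_map R (HomGr B x y i) (?G x y i) (?v x y i)" if o: "x \<in> Obj B" "y \<in> Obj B" for x y i
  proof (cases "i \<le> int n + 1")
    case True
    show ?thesis
      using linear_map_compose[OF gg(1)[OF o, of i, unfolded cosk_simps(2) cosk_Gr(1)[OF True]]
        trunc_le_map_linear[OF hom_complex[OF ob(1)[OF o(1)] ob(1)[OF o(2)]]]] by simp
  next
    case False
    then have "?v x y i = (\<lambda>b. \<zero>\<^bsub>?G x y i\<^esub>)"
      by (intro ext) (simp add: trunc_le_map_simps(3) trunc_le_simps(3))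
    then show ?thesis using linear_map_const_zero[OF P.hom_module[of "ob g x" "ob g y" i]] ob(1)[OF o(1)] ob(1)[OF o(2)] by simp
  qed
  note v = linear_map_closed[OF lin]
  have trivial: "p = q" if "p \<in> Mor ?P x y k" "q \<in> Mor ?P x y k" "k > int n + 1" for p q x y k
    using that by (simp add: trunc_le_simps(3))
  have v0: "?v x y i b = \<zero>\<^bsub>?G x y i\<^esub>" if "x \<in> Obj B" "y \<in> Obj B" "b \<in> Mor B x y i" "i < 0" for x y i b
  proof -
    note o = ob(1)[OF that(1)] ob(1)[OF that(2)]
    have "?v x y i b \<in> Mor A (ob g x) (ob g y) i" using v[OF that(1-3)] that(4) by (simp add: trunc_le_simps(1))
    then show ?thesis using neg_zero[OF o _ that(4)] that(4) by (simp add: trunc_le_simps(1))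
  qed
  define L where "L = mk_dgfun B ?P (ob g) ?v"
  have L: "L \<in> dg_hom R B ?P" unfolding L_def
  proof (rule mk_dgfun_dg_hom[OF gD(4) small_postnikov(1) _ lin])
    fix x assume o: "x \<in> Obj B"
    then show "ob g x \<in> Obj ?P" using ob(1) by simp
    show "?v x x 0 (Ident B x) = Ident ?P (ob g x)" using gg(4)[OF o] by simp
  next
    fix x y i b assume o: "x \<in> Obj B" "y \<in> Obj B" and b: "b \<in> Mor B x y i"
    note oA = ob(1)[OF o(1)] ob(1)[OF o(2)]
    note C = hom_complex[OF oA]
    have db: "Dif (Hom B x y) i b \<in> Mor B x y (i - 1)" by (rule B.dif_closed[OF o b HOL.refl])
    consider "i \<le> int n + 1" | "i = int n + 2" | "i > int n + 2" by linarith
    then show "?v x y (i - 1) (Dif (Hom B x y) i b) = Dif (Hom ?P (ob g x) (ob g y)) i (?v x y i b)"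
    proof cases
      case 1
      have "mor g x y i b \<in> Mor A (ob g x) (ob g y) i" using cosk_low[OF gg(5)[OF o b] 1] .
      then show ?thesis using trunc_le_map_dif[OF C, of _ i "Suc n"] gg(2)[OF o b] 1 by (simp add: cosk_Dif(1))
    next
      case 2
      \<comment> \<open>The critical degree. The differential of \<open>b\<close> goes to the cycle
        \<open>g b\<close>, which must vanish in the top degree \<open>n + 1\<close> of the new
        section; its class there is the bimodule component of \<kappa> applied to
        \<open>g b\<close>, and that is zero by \<open>val\<close>.\<close>
      have gb: "mor g x y i b \<in> cycles (?A x y) (int n + 1)"
        by (rule cosk_top[OF gg(5)[OF o b]]) (use 2 in simp)
      have e: "i - 1 = int (Suc n)" using 2 by simp
      have "mor g x y (i - 1) (Dif (Hom B x y) i b) = mor g x y i b" using gg(2)[OF o b] 2 by (simp add: cosk_Dif(2))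
      then have "?v x y (i - 1) (Dif (Hom B x y) i b) = hclass (?A x y) (i - 1) (mor g x y i b)"
        by (simp only: trunc_le_map_simps(2)[OF e])
      also have "\<dots> = hclass (?A x y) (int n + 1) (mor g x y i b)" using 2 by (simp add: add.commute)
      also have "\<dots> = hzero (ob g x) (ob g y)" using val[OF o b] 2 by (simp add: kinv_value_def)
      also have "\<dots> = \<zero>\<^bsub>?G x y (i - 1)\<^esub>"
        using 2 by (simp add: homology_simps(1) trunc_le_simps(2) quot_module_simps add.commute)
      also have "\<dots> = Dif (Hom ?P (ob g x) (ob g y)) i \<zero>\<^bsub>?G x y i\<^esub>"
        by (rule linear_map_zero[OF P.hom_module P.hom_module P.dif_linear, symmetric]) (use oA in simp_all)
      also have "\<zero>\<^bsub>?G x y i\<^esub> = ?v x y i b"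
        using 2 by (simp add: trunc_le_map_simps(3) trunc_le_simps(3))
      finally show ?thesis .
    next
      case 3
      have "Dif (Hom ?P (ob g x) (ob g y)) i (?v x y i b) \<in> Mor ?P (ob g x) (ob g y) (i - 1)"
        by (rule P.dif_closed[OF _ _ v[OF o b] HOL.refl]) (use oA in simp_all)
      then show ?thesis by (rule trivial[OF v[OF o db]]) (use 3 in simp)
    qed
  next
    fix x y z i j c b assume o: "x \<in> Obj B" "y \<in> Obj B" "z \<in> Obj B" and c: "c \<in> Mor B y z i" and b: "b \<in> Mor B x y j"
    note oA = ob(1)[OF o(1)] ob(1)[OF o(2)] ob(1)[OF o(3)]
    have oP: "ob g x \<in> Obj ?P" "ob g y \<in> Obj ?P" "ob g z \<in> Obj ?P" using oA by simp_all
    note gc = gg(5)[OF o(2,3) c] and gb = gg(5)[OF o(1,2) b]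
    have cb: "Comp B x y z i j c b \<in> Mor B x z (i + j)" by (rule B.comp_closed[OF o c b HOL.refl])
    consider "i + j > int n + 1" | "i < 0" "i + j \<le> int n + 1" | "j < 0" "i + j \<le> int n + 1" | "i + j \<le> int n + 1" "i \<le> int n + 1" "j \<le> int n + 1" by linarith
    then show "?v x z (i + j) (Comp B x y z i j c b) =
        Comp ?P (ob g x) (ob g y) (ob g z) i j (?v y z i c) (?v x y j b)"
    proof cases
      case 1
      show ?thesis
        by (rule trivial[OF v[OF o(1,3) cb] P.comp_closed[OF oP v[OF o(2,3) c] v[OF o(1,2) b] HOL.refl] 1])
    next
      case 2
      have "mor g x z (i + j) (Comp B x y z i j c b) = \<zero>\<^bsub>HomGr Z (ob g x) (ob g z) (i + j)\<^esub>"
        unfolding gg(3)[OF o c b HOL.refl] cosk_neg[OF oA(2,3) gc 2(1)] by (rule cosk_comp_zero_left[OF oA gb HOL.refl])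
      also have "\<dots> = \<zero>\<^bsub>HomGr A (ob g x) (ob g z) (i + j)\<^esub>" using 2(2) by (simp add: cosk_Gr(1))
      finally have "?v x z (i + j) (Comp B x y z i j c b) = \<zero>\<^bsub>?G x z (i + j)\<^esub>"
        using trunc_le_map_zero[OF hom_complex[OF oA(1,3)], of "Suc n" "i + j"] by simp
      then show ?thesis unfolding v0[OF o(2,3) c 2(1)]
        using P.comp_zero_left[OF oP v[OF o(1,2) b], of i] by simp
    next
      case 3
      have "mor g x z (i + j) (Comp B x y z i j c b) = \<zero>\<^bsub>HomGr Z (ob g x) (ob g z) (i + j)\<^esub>"
        unfolding gg(3)[OF o c b HOL.refl] cosk_neg[OF oA(1,2) gb 3(1)] by (rule cosk_comp_zero_right[OF oA gc HOL.refl])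
      also have "\<dots> = \<zero>\<^bsub>HomGr A (ob g x) (ob g z) (i + j)\<^esub>" using 3(2) by (simp add: cosk_Gr(1))
      finally have "?v x z (i + j) (Comp B x y z i j c b) = \<zero>\<^bsub>?G x z (i + j)\<^esub>"
        using trunc_le_map_zero[OF hom_complex[OF oA(1,3)], of "Suc n" "i + j"] by simp
      then show ?thesis unfolding v0[OF o(1,2) b 3(1)]
        using P.comp_zero_right[OF oP v[OF o(2,3) c], of j] by simp
    next
      case 4
      note m = cosk_low[OF gc 4(2)] cosk_low[OF gb 4(3)]
      show ?thesis using gg(3)[OF o c b] trunc_le_map_comp[OF oA m, of "Suc n"] 4 by (simp add: cosk_Comp(3))
    qed
  qed
  have "postnikov_step n A \<circ>\<^sub>d L = f"
  proof (rule dg_hom_ext[OF dg_comp_hom[OF L postnikov_step_hom] f])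
    fix x assume o: "x \<in> Obj B"
    show "ob (postnikov_step n A \<circ>\<^sub>d L) x = ob f x" using ob[OF o] o by (simp add: L_def)
  next
    fix x y i b assume o: "x \<in> Obj B" "y \<in> Obj B" and b: "b \<in> Mor B x y i"
    have "mor (postnikov_step n A \<circ>\<^sub>d L) x y i b = trunc_le_map n (?A x y) i (?v x y i b)"
      using o b v[OF o b] ob(1)[OF o(1)] ob(1)[OF o(2)] by (simp add: L_def)
    also have "\<dots> = trunc_le_map n (?A x y) i (mor g x y i b)"
      by (rule trunc_le_map_trunc[OF hom_complex]) (use ob(1)[OF o(1)] ob(1)[OF o(2)] in simp_all)
    also have "\<dots> = mor f x y i b" using val[OF o b] by (simp add: kinv_value_def)
    finally show "mor (postnikov_step n A \<circ>\<^sub>d L) x y i b = mor f x y i b" .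
  qed
  then show ?thesis using L by blast
qed

end

lemma stage_lift:
  fixes R :: "'r ring" and A B :: "('r, ('r, 'a) univ) dgcat"
  assumes A: "dg_category R A" and pos: "positively_graded A" and B: "cofibrant R B"
    and F: "F \<in> dg_hom R B (small_postnikov n A)" and vanish: "obstruction_vanishes R n A F"
  shows "\<exists>L\<in>dg_hom R B (small_postnikov (Suc n) A). postnikov_step n A \<circ>\<^sub>d L = F"
proof -
  note FD = dg_homD[OF F]
  obtain t M \<gamma> G where tower: "big_postnikov R n A t" and M: "is_M R n A t M" and gamma: "is_gamma R n A t \<gamma>"
    and G: "G \<in> dg_hom R B (Colim t)" "M \<circ>\<^sub>d G = F"
    and cl: "class_vanishes R n A F (obstruction_class R n A M \<gamma> G)"
    using vanish FD(2) unfolding obstruction_vanishes_def by blast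
  have \<gamma>: "\<gamma> \<in> dg_hom R (Colim t) (kinv_target n A)" using gamma unfolding is_gamma_def by blast
  interpret postnikov_stage R A n
    by (intro postnikov_stage.intro positive_dg.intro A positive_dg_axioms.intro postnikov_stage_axioms.intro pos dg_homD(5)[OF \<gamma>])
      simp
  interpret cofibrant_dg R B by standard (rule B)
  note p = sqz_proj_hom[OF small_postnikov(1) target]
  note \<gamma>G = dg_comp_hom[OF G(1) \<gamma>]
  \<comment> \<open>This places \<open>\<gamma> G\<close> over \<open>X\<close> with source
    \<open>F\<close>, the form in which a zigzag can act on it.\<close>
  have pF: "kinv_proj n A \<circ>\<^sub>d (\<gamma> \<circ>\<^sub>d G) = F"
    using dg_comp_assoc[OF G(1) \<gamma> p] proj_gamma[OF tower M gamma] G(2) by simp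
  have over: "\<gamma> \<circ>\<^sub>d G \<in> over_hom R X F (kinv_proj n A)"
    unfolding over_hom_def using FD p pF \<gamma>G dg_homD(1)[OF p] by simp
  obtain h where h: "h \<in> ho_hom R X F (dg_id X)"
    "ho_of R X F (kinv_proj n A) (\<gamma> \<circ>\<^sub>d G) = ho_comp R X F (kinv_proj n A) (ho_of R X (dg_id X) (kinv_proj n A) (kinv_incl n A)) h"
    using cl unfolding class_vanishes_def obstruction_class_def G(2) Let_def by blast
  \<comment> \<open>The factor \<open>h\<close> is merely a class of zigzags, so it yields an actual
    \<open>f\<close> only after acting on the identity of \<open>B\<close>.\<close>
  obtain f where f: "f \<in> dg_hom R B (Dom (dg_id X))" and I: "kinv_incl n A \<in> over_hom R X (dg_id X) (kinv_proj n A)"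
    and hf: "homotopies R B (Dom (kinv_proj n A)) (kinv_incl n A \<circ>\<^sub>d f) (\<gamma> \<circ>\<^sub>d G)"
    using ho_factorization[OF FD(2) over h] by blast
  have f: "f \<in> dg_hom R B X" using f by simp
  have hf: "homotopies R B E (kinv_incl n A \<circ>\<^sub>d f) (\<gamma> \<circ>\<^sub>d G)" using hf by simp
  have incl: "kinv_incl n A \<in> dg_hom R X E" "kinv_proj n A \<circ>\<^sub>d kinv_incl n A = dg_id X"
    using I by (simp_all add: over_hom_def)
  have pf: "kinv_proj n A \<circ>\<^sub>d (kinv_incl n A \<circ>\<^sub>d f) = f"
    using dg_comp_assoc[OF f incl(1) p] incl(2) dg_comp_id_left[OF f] by simp
  obtain \<Gamma> where \<Gamma>: "\<Gamma> \<in> dg_hom R (Colim t) Z" "kinv_cosk \<circ>\<^sub>d \<Gamma> = \<gamma>"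
    using gamma_factor[OF tower gamma] by blast
  have "homotopies R B E (kinv_cosk \<circ>\<^sub>d (\<Gamma> \<circ>\<^sub>d G)) (kinv_incl n A \<circ>\<^sub>d f)"
    using homotopies_sym[OF target hf] dg_comp_assoc[OF G(1) \<Gamma>(1) kinv_cosk_hom] \<Gamma>(2) by simp
  then obtain g where g: "g \<in> dg_hom R B Z" "kinv_cosk \<circ>\<^sub>d g = kinv_incl n A \<circ>\<^sub>d f"
    using homotopies_lifting[OF kinv_cosk_hom kinv_cosk_fibration dg_comp_hom[OF G(1) \<Gamma>(1)]] by blast
  obtain L where L: "L \<in> dg_hom R B (small_postnikov (Suc n) A)" "postnikov_step n A \<circ>\<^sub>d L = f"
    using lift_from_cosk[OF g(1) f g(2)] by blast
  have "homotopies R B X f F" using homotopies_comp[OF hf p] pf pF by simp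
  then have "homotopies R B X (postnikov_step n A \<circ>\<^sub>d L) F" using L(2) by simp
  then show ?thesis by (rule homotopies_lifting[OF postnikov_step_hom postnikov_step_fibration L(1)])
qed

section \<open>The limit of the lifts\<close>

text \<open>Truncation at level \<open>n\<close> is the identity in degrees below \<open>n\<close>,
  so in degree \<open>i\<close> the values of \<open>F n\<close> agree for all \<open>n > i\<close>,
  and each condition on the limit is one on a sufficiently late \<open>F n\<close>.\<close>

lemma postnikov_limit:
  fixes R :: "'r ring" and A B :: "('r, ('r, 'a) univ) dgcat"
  assumes A: "dg_category R A" and pos: "positively_graded A"
    and F: "\<And>n. F n \<in> dg_hom R B (small_postnikov n A)" "\<And>n. postnikov_step n A \<circ>\<^sub>d F (Suc n) = F n"
  shows "\<exists>L\<in>dg_hom R B A. postnikov_proj 0 A \<circ>\<^sub>d L = F 0"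
proof -
  interpret positive_dg R A 1 by (intro positive_dg.intro A positive_dg_axioms.intro pos) simp
  note FD = dg_homD[OF F(1)]
  interpret B: dg_category R B by (rule FD(4))
  have dgf: "dgf R (F n)" for n using F(1) by (rule dgf_hom)
  note FF = dgf.ob_closed[OF dgf, unfolded FD(2,3)] dgf.mor_mor[OF dgf, unfolded FD(2,3)]
    dgf.mor_linear[OF dgf, unfolded FD(2,3)] dgf.mor_dif[OF dgf, unfolded FD(2,3)]
    dgf.mor_ident[OF dgf, unfolded FD(2,3)] dgf.mor_comp[OF dgf, unfolded FD(2,3)]
  let ?o = "ob (F 0)"
  have oA: "ob (F n) x \<in> Obj A" if "x \<in> Obj B" for n x using FF(1)[OF that] by simp
  have ob: "ob (F n) x = ?o x" if "x \<in> Obj B" for n x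
  proof (induction n)
    case (Suc n)
    have "ob (postnikov_step n A \<circ>\<^sub>d F (Suc n)) x = ob (F n) x" by (simp only: F(2))
    then show ?case using that oA[OF that] Suc FD(2) by simp
  qed simp
  have trunc: "trunc_le_map n (Hom A (?o x) (?o y)) i (mor (F (Suc n)) x y i b) = mor (F n) x y i b"
    if o: "x \<in> Obj B" "y \<in> Obj B" and b: "b \<in> Mor B x y i" for n x y i b
  proof -
    have "mor (F (Suc n)) x y i b \<in> Mor (small_postnikov (Suc n) A) (?o x) (?o y) i"
      using FF(2)[OF o b, of "Suc n"] unfolding ob[OF o(1), of "Suc n"] ob[OF o(2), of "Suc n"] .
    moreover have "mor (postnikov_step n A \<circ>\<^sub>d F (Suc n)) x y i b = mor (F n) x y i b" by (simp only: F(2))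
    ultimately show ?thesis
      using o b oA[OF o(1), of 0] oA[OF o(2), of 0] ob[OF o(1), of "Suc n"] ob[OF o(2), of "Suc n"] FD(2)
      by (simp del: small_postnikov_simps)
  qed
  \<comment> \<open>\<open>nat (i + 1)\<close> is the first level above degree \<open>i\<close>; at
    level \<open>i\<close> itself the value would still be a class. Negative degrees use level
    0.\<close>
  define c where "c x y i b = mor (F (nat (i + 1))) x y i b" for x y i b
  have c: "mor (F n) x y i b = c x y i b"
    if o: "x \<in> Obj B" "y \<in> Obj B" and b: "b \<in> Mor B x y i" and n: "i < int n" for n x y i b
  proof -
    have "nat (i + 1) \<le> n" using n by simp
    then show ?thesis unfolding c_def
    proof (induction rule: dec_induct)
      case (step m)
      then have "i < int m" by simp
      then show ?case using step.IH trunc[OF o b, of m]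
        by (simp add: trunc_le_map_simps(1))
    qed simp
  qed
  define L where "L = mk_dgfun B A ?o c"
  have L: "L \<in> dg_hom R B A" unfolding L_def
  proof (rule mk_dgfun_dg_hom[OF FD(4) A])
    fix x assume o: "x \<in> Obj B"
    show "?o x \<in> Obj A" by (rule oA[OF o])
    show "c x x 0 (Ident B x) = Ident A (?o x)"
      using FF(5)[OF o, of 1] ob[OF o, of 1] c[OF o o B.ident_closed[OF o], of 1] by (simp add: trunc_le_map_simps(1))
  next
    fix x y i assume o: "x \<in> Obj B" "y \<in> Obj B"
    define n where "n = nat (i + 1)"
    have n: "i < int n" by (simp add: n_def)
    have "linear_map R (HomGr B x y i) (HomGr A (?o x) (?o y) i) (mor (F n) x y i)"
      using FF(3)[OF o, of i n] ob[OF o(1), of n] ob[OF o(2), of n] by (simp add: trunc_le_simps(1)[OF n])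
    moreover have "c x y i = mor (F n) x y i" by (intro ext) (simp add: c_def n_def)
    ultimately show "linear_map R (HomGr B x y i) (HomGr A (?o x) (?o y) i) (c x y i)" by simp
    fix b assume b: "b \<in> Mor B x y i"
    have db: "Dif (Hom B x y) i b \<in> Mor B x y (i - 1)" by (rule B.dif_closed[OF o b HOL.refl])
    show "c x y (i - 1) (Dif (Hom B x y) i b) = Dif (Hom A (?o x) (?o y)) i (c x y i b)"
      using FF(4)[OF o b HOL.refl, of n] c[OF o b n] c[OF o db, of n] ob[OF o(1), of n] ob[OF o(2), of n] n
      by (simp add: trunc_le_simps(4) trunc_le_map_simps(1))
  next
    fix x y z i j d b assume o: "x \<in> Obj B" "y \<in> Obj B" "z \<in> Obj B" and d: "d \<in> Mor B y z i" and b: "b \<in> Mor B x y j"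
    \<comment> \<open>A common level above \<open>i\<close>, \<open>j\<close> and
      \<open>i + j\<close>, where composition is that of \<open>A\<close>.\<close>
    define n where "n = nat (\<bar>i\<bar> + \<bar>j\<bar> + 1)"
    have n: "i < int n" "j < int n" "i + j < int n" unfolding n_def by linarith+
    have db: "Comp B x y z i j d b \<in> Mor B x z (i + j)" by (rule B.comp_closed[OF o d b HOL.refl])
    show "c x z (i + j) (Comp B x y z i j d b) = Comp A (?o x) (?o y) (?o z) i j (c y z i d) (c x y j b)"
      using FF(6)[OF o d b HOL.refl, of n] c[OF o(1,3) db n(3)] c[OF o(2,3) d n(1)] c[OF o(1,2) b n(2)]
        ob[OF o(1), of n] ob[OF o(2), of n] ob[OF o(3), of n] n(3)
      by (simp add: trunc_le_map_simps(1))
  qed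
  have "postnikov_proj 0 A \<circ>\<^sub>d L = F 0"
  proof (rule dg_hom_ext[OF dg_comp_hom[OF L small_postnikov(2)] F(1)])
    fix x assume "x \<in> Obj B"
    then show "ob (postnikov_proj 0 A \<circ>\<^sub>d L) x = ob (F 0) x" using oA by (simp add: L_def)
  next
    fix x y i b assume o: "x \<in> Obj B" "y \<in> Obj B" and b: "b \<in> Mor B x y i"
    note oo = oA[OF o(1), of 0] oA[OF o(2), of 0]
    have cb: "c x y i b \<in> Mor A (?o x) (?o y) i"
      using dgf.mor_mor[OF dgf_hom[OF L], unfolded dg_homD(2,3)[OF L], OF o b] o b by (simp add: L_def)
    have "mor (postnikov_proj 0 A \<circ>\<^sub>d L) x y i b = trunc_le_map 0 (Hom A (?o x) (?o y)) i (c x y i b)"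
      using o b oo cb by (simp add: L_def)
    also have "\<dots> = mor (F 0) x y i b"
    proof -
      consider "i < 0" | "i = 0" | "i > 0" by linarith
      then show ?thesis
      proof cases
        case 1
        then show ?thesis using c[OF o b, of 0] by (simp add: trunc_le_map_simps(1))
      next
        case 2
        \<comment> \<open>In degree 0 the limit takes its value from \<open>F 1\<close>, and
          \<open>F 0\<close> is the class of that value.\<close>
        then show ?thesis using c[OF o b, of 1] trunc[OF o b, of 0] by simp
      next
        case 3
        then show ?thesis using FF(2)[OF o b, of 0] by (simp add: trunc_le_map_simps(3) trunc_le_simps(3))
      qed
    qed
    finally show "mor (postnikov_proj 0 A \<circ>\<^sub>d L) x y i b = mor (F 0) x y i b" .
  qed
  then show ?thesis using L by blast
qed

section \<open>Truncation below and the conclusion\<close>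

lemma tau_ge0_simps [simp]:
  "Obj (tau_ge0 A) = Obj A" "Hom (tau_ge0 A) x y = trunc_ge0 (Hom A x y)"
  "Comp (tau_ge0 A) = Comp A" "Ident (tau_ge0 A) = Ident A"
  by (simp_all add: tau_ge0_def)

lemma tau_ge0_incl_hom:
  assumes A: "dg_category R A" and A': "dg_category R (tau_ge0 A)"
  shows "tau_ge0_incl A \<in> dg_hom R (tau_ge0 A) A"
proof -
  interpret dg_category R A by fact
  show ?thesis unfolding tau_ge0_incl_def
    by (rule mk_dgfun_dg_hom[OF A' A])
      (auto simp: trunc_ge0_def linear_map_def cycles_def zero_module_def mor_zero)
qed

lemma positively_graded_positive_model: "positively_graded (positive_model A)"
  by (simp add: positive_model_def) (simp add: positively_graded_def trunc_ge0_def)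

theorem theorem1p4:
  fixes R :: "'r ring"
    and A B :: "('r, ('r, 'a) univ) dgcat"
    and F0 :: "('r, ('r, 'a) univ) dgfun"
    and F :: "nat \<Rightarrow> ('r, ('r, 'a) univ) dgfun"
    and N :: enat
  assumes "cring R"
    and "dg_category R A"
    and conn: "homologically_connective A"
    and "dg_category R B"
    and cof: "cofibrant R B"
    and F0: "F0 \<in> dg_hom R B (small_postnikov 0 (positive_model A))"
    and process: "lifting_process R (positive_model A) B F0 N F"
    and vanish: "\<forall>n. enat n < N \<longrightarrow> obstruction_vanishes R n (positive_model A) (F n)"
  shows "\<exists>L. is_lift R A B F0 L"
proof -
  let ?A = "positive_model A"
  have N0: "0 < N" and F_0: "F 0 = F0" and F: "\<And>n. enat n < N \<Longrightarrow> F n \<in> dg_hom R B (small_postnikov n ?A)"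
    and step: "\<And>n. enat (Suc n) < N \<Longrightarrow> postnikov_step n ?A \<circ>\<^sub>d F (Suc n) = F n"
    and stop: "\<And>n. N = enat (Suc n) \<Longrightarrow>
        \<not> (\<exists>L\<in>dg_hom R B (small_postnikov (Suc n) ?A). postnikov_step n ?A \<circ>\<^sub>d L = F n)"
    using process unfolding lifting_process_def by blast+
  have "obstruction_vanishes R 0 ?A (F 0)" using vanish N0 by (simp add: zero_enat_def)
  then obtain t where t: "big_postnikov R 0 ?A t" unfolding obstruction_vanishes_def by blast
  \<comment> \<open>The tower of stage 0 starts at \<open>?A\<close>, and its first structure map is
    a dg functor. This gives the axioms for \<open>?A\<close> also when it is a truncation.\<close>
  have A': "dg_category R ?A" using dg_homD(4)[OF tower_map[OF t, of 0]] tower_base[OF t] by simp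
  note lift = stage_lift[OF A' positively_graded_positive_model cof F]
  \<comment> \<open>A finite process would have a last stage, to which the vanishing of its
    obstruction class would supply a further lift.\<close>
  have "N = \<infinity>"
  proof (cases N)
    case (enat k)
    then obtain m where m: "N = enat (Suc m)" using N0 by (cases k) (auto simp: zero_enat_def)
    then have "enat m < N" by simp
    then show ?thesis using lift[of m] vanish stop[OF m] by blast
  qed
  then obtain L where L: "L \<in> dg_hom R B ?A" "postnikov_proj 0 ?A \<circ>\<^sub>d L = F0"
    using postnikov_limit[OF A' positively_graded_positive_model F step] F_0 by auto
  show ?thesis
  proof (cases "positively_graded A")
    case True
    then show ?thesis using L by (auto simp: is_lift_def positive_model_def)
  next
    case False
    then have e: "?A = tau_ge0 A" by (simp add: positive_model_def)
    have "tau_ge0_incl A \<in> dg_hom R (tau_ge0 A) A" using tau_ge0_incl_hom assms(2) A' e by simp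
    then have "tau_ge0_incl A \<circ>\<^sub>d L \<in> dg_hom R B A" using dg_comp_hom L(1) e by simp
    then show ?thesis using False L e by (auto simp: is_lift_def)
  qed
qed

end
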